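(* Let $(\mathcal C,\mathbb E,\mathfrak s)$ be a $2$-Calabi-Yau extriangulated category with enough projectives and enough injectives and with a cluster tilting object, and let $\mathcal I$ be a rigid subcategory of $\mathcal C$ such that $\mathrm{Proj}(\mathcal C)\subseteq\mathcal I$. Let ${}^{\perp_{\mathbb E}}\mathcal I/\mathcal I=\bigoplus_{j\in J}A_j$ be the complete decomposition of the triangulated category ${}^{\perp_{\mathbb E}}\mathcal I/\mathcal I$ (all $A_j$ indecomposable triangulated categories). Then: 1. All cotorsion pairs in $\mathcal C$ with core $\mathcal I$ are obtained as preimages under the quotient functor $\pi:{}^{\perp_{\mathbb E}}\mathcal I\to{}^{\perp_{\mathbb E}}\mathcal I/\mathcal I$ of the pairs $\left(\bigoplus_{j\in L}A_j,\bigoplus_{j\in J-L}A_j\right)$, where $L$ is a subset of $J$. There are $2^{\mathrm{ns}({}^{\perp_{\mathbb E}}\mathcal I/\mathcal I)}$ cotorsion pairs with core $\mathcal I$, where $\mathrm{ns}({}^{\perp_{\mathbb E}}\mathcal I/\mathcal I)$ is the number of indecomposable direct summands in this decomposition. 2. $(\mathcal X,\mathcal Y)$ is a cotorsion pair with core $\mathcal I$ if and only if so is $(\mathcal Y,\mathcal X)$.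
   Context: Conventions: all additive categories are Krull-Schmidt; a subcategory is a full subcategory closed under isomorphisms, finite direct sums and direct summands; $\mathrm{add}\,M$ is the subcategory of direct summands of finite direct sums of copies of $M$. Extriangulated category: a triple $(\mathcal C,\mathbb E,\mathfrak s)$ with $\mathcal C$ additive, $\mathbb E:\mathcal C^{\mathrm{op}}\times\mathcal C\to\mathrm{Ab}$ a biadditive functor, and $\mathfrak s$ assigning to each $\delta\in\mathbb E(C,A)$ an equivalence class $\mathfrak s(\delta)=[A\xrightarrow{x}B\xrightarrow{y}C]$ of sequences (equivalence: an isomorphism of middle terms compatible with the identities of the ends). One says $A\to B\to C$ realizes $\delta$ and calls $A\to B\to C\overset{\delta}{\dashrightarrow}$ an $\mathbb E$-triangle. Write $a_*\delta=\mathbb E(C,a)(\delta)$, $c^*\delta=\mathbb E(c,A)(\delta)$; a morphism $\delta\to\delta'$ with $\delta'\in\mathbb E(C',A')$ is a pair $(a:A\to A',c:C\to C')$ with $a_*\delta=c^*\delta'$. Axioms: every morphism $(a,c):\delta\to\delta'$ is realized by some $b$ with $bx=x'a$, $y'b=cy$; $\mathfrak s(0)$ is the split sequence and $\mathfrak s(\delta\oplus\delta')=\mathfrak s(\delta)\oplus\mathfrak s(\delta')$; (ET3) if $bx=x'a$ there is $c$ with $cy=y'b$ and $(a,c):\delta\to\delta'$ a morphism, and dually (ET3)$^{\rm op}$; (ET4) if $A\xrightarrow{f}B\xrightarrow{f'}D$ realizes $\delta$ and $B\xrightarrow{g}C\xrightarrow{g'}F$ realizes $\delta'$, there are an object $E$,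 morphisms $h':C\to E$, $d:D\to E$, $e:E\to F$ with $h'g=df'$, $eh'=g'$, and $\delta''\in\mathbb E(E,A)$ realized by $A\xrightarrow{gf}C\xrightarrow{h'}E$, such that $D\xrightarrow{d}E\xrightarrow{e}F$ realizes $f'_*\delta'$, $d^*\delta''=\delta$, $f_*\delta''=e^*\delta'$; and dually (ET4)$^{\rm op}$. $P$ is projective if every morphism $P\to C$ lifts along $y$ for every $\mathbb E$-triangle $A\to B\xrightarrow{y}C\dashrightarrow$; injectives are dual. $\mathrm{Proj}(\mathcal C)$ is the subcategory of projectives. Enough projectives: every $C$ has an $\mathbb E$-triangle $A\to P\to C\dashrightarrow$ with $P$ projective; enough injectives dually. $2$-Calabi-Yau: $\mathcal C$ is $k$-linear over a field $k$, all $\mathrm{Hom}(A,B)$ and $\mathbb E(A,B)$ are finite dimensional, and there is a bifunctorial isomorphism $\mathbb E(A,B)\simeq\mathrm{Hom}_k(\mathbb E(B,A),k)$. A subcategory $\mathcal R$ is rigid if $\mathbb E(\mathcal R,\mathcal R)=0$; it is cluster tilting if it is functorially finite and $M\in\mathcal R\iff\mathbb E(M,\mathcal R)=0\iff\mathbb E(\mathcal R,M)=0$. $T$ is a cluster tilting object if $\mathrm{add}\,T$ is cluster tilting. A cotorsion pair $(\mathcal X,\mathcal Y)$ is a pair of subcategories with $\mathbb E(\mathcal X,\mathcal Y)=0$ such that every $C$ admits $\mathbb E$-triangles $Y\to X\to C\dashrightarrow$ and $C\to Y'\to X'\dashrightarrow$ with $X,X'\in\mathcal X$, $Y,Y'\in\mathcal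 Y$; its core is $\mathcal X\cap\mathcal Y$. ${}^{\perp_{\mathbb E}}\mathcal I=\{M\mid\mathbb E(M,\mathcal I)=0\}$. The quotient ${}^{\perp_{\mathbb E}}\mathcal I/\mathcal I$ (morphisms modulo those factoring through $\mathcal I$) is a triangulated category: the shift $A\langle1\rangle$ is defined by an $\mathbb E$-triangle $A\xrightarrow{a}I_A\xrightarrow{b}A\langle1\rangle\dashrightarrow$ with $a$ a left and $b$ a right $\mathcal I$-approximation, and triangles are the complexes isomorphic to $A\xrightarrow{\overline f}B\xrightarrow{\overline g}C\xrightarrow{\overline h}A\langle1\rangle$ coming from $\mathbb E$-triangles $A\xrightarrow fB\xrightarrow gC\dashrightarrow$ in ${}^{\perp_{\mathbb E}}\mathcal I$ with all morphisms $A\to\mathcal I$ factoring through $f$, where $(1_A,*,h)$ is a morphism of $\mathbb E$-triangles to $A\to I_A\to A\langle1\rangle\dashrightarrow$. A decomposition $\bigoplus_{j\in J} A_j$ of a triangulated category means triangulated subcategories $A_j$ with no nonzero morphisms between different ones such that every object is a finite direct sum of objects of the $A_j$; a triangulated category is indecomposable if it is nonzero and not a direct sum of two nonzero triangulated subcategories. *)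

theory Defs
  imports "HOL-Algebra.AbelCoset" "Jordan_Normal_Form.Missing_VectorSpace"
begin

section \<open>Additive categories\<close>

text \<open>
  Hom-sets are records of type \<^typ>\<open>('k, 'm) module\<close>: only the additive group is used in the notion
  of an additive category, the scalar multiplication only for \<open>k\<close>-linear categories, and the
  ring multiplication never. Everything is relative to the set \<open>Obj C\<close> of objects.
\<close>

record ('o, 'm, 'k) cat =
  Obj :: "'o set"
  Hom :: "'o \<Rightarrow> 'o \<Rightarrow> ('k, 'm) module"
  Dom :: "'m \<Rightarrow> 'o"
  Cod :: "'m \<Rightarrow> 'o"
  Comp :: "'m \<Rightarrow> 'm \<Rightarrow> 'm" (infixl \<open>\<bullet>\<index>\<close> 75)
  Ident :: "'o \<Rightarrow> 'm"

abbreviation mor :: "('o, 'm, 'k, 'z) cat_scheme \<Rightarrow> 'o \<Rightarrow> 'o \<Rightarrow> 'm set" where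
  "mor C A B \<equiv> carrier (Hom C A B)"

locale preadditive_category =
  fixes C :: "('o, 'm, 'k, 'z) cat_scheme" (structure)
  assumes dom_cod: "\<lbrakk>A \<in> Obj C; B \<in> Obj C; f \<in> mor C A B\<rbrakk> \<Longrightarrow> Dom C f = A \<and> Cod C f = B"
    and ident_mor: "A \<in> Obj C \<Longrightarrow> Ident C A \<in> mor C A A"
    and comp_mor: "\<lbrakk>A \<in> Obj C; B \<in> Obj C; D \<in> Obj C; f \<in> mor C A B; g \<in> mor C B D\<rbrakk>
      \<Longrightarrow> g \<bullet> f \<in> mor C A D"
    and comp_assoc: "\<lbrakk>A \<in> Obj C; B \<in> Obj C; D \<in> Obj C; E \<in> Obj C;
        f \<in> mor C A B; g \<in> mor C B D; h \<in> mor C D E\<rbrakk> \<Longrightarrow> h \<bullet> (g \<bullet> f) = (h \<bullet> g) \<bullet> f"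
    and comp_ident: "\<lbrakk>A \<in> Obj C; B \<in> Obj C; f \<in> mor C A B\<rbrakk>
      \<Longrightarrow> f \<bullet> Ident C A = f \<and> Ident C B \<bullet> f = f"
    and hom_group: "\<lbrakk>A \<in> Obj C; B \<in> Obj C\<rbrakk> \<Longrightarrow> abelian_group (Hom C A B)"
    and comp_add_right: "\<lbrakk>A \<in> Obj C; B \<in> Obj C; D \<in> Obj C;
        f \<in> mor C A B; f' \<in> mor C A B; g \<in> mor C B D\<rbrakk>
      \<Longrightarrow> g \<bullet> (f \<oplus>\<^bsub>Hom C A B\<^esub> f') = g \<bullet> f \<oplus>\<^bsub>Hom C A D\<^esub> g \<bullet> f'"
    and comp_add_left: "\<lbrakk>A \<in> Obj C; B \<in> Obj C; D \<in> Obj C;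
        f \<in> mor C A B; g \<in> mor C B D; g' \<in> mor C B D\<rbrakk>
      \<Longrightarrow> (g \<oplus>\<^bsub>Hom C B D\<^esub> g') \<bullet> f = g \<bullet> f \<oplus>\<^bsub>Hom C A D\<^esub> g' \<bullet> f"

definition is_iso :: "('o, 'm, 'k, 'z) cat_scheme \<Rightarrow> 'o \<Rightarrow> 'o \<Rightarrow> 'm \<Rightarrow> bool" where
  "is_iso C A B f \<longleftrightarrow> f \<in> mor C A B \<and>
     (\<exists>g \<in> mor C B A. g \<bullet>\<^bsub>C\<^esub> f = Ident C A \<and> f \<bullet>\<^bsub>C\<^esub> g = Ident C B)"

text \<open>
  Biproduct diagrams of a finite list of objects; the empty list gives exactly the zero objects.
\<close>

definition direct_sum_diagram ::
  "('o, 'm, 'k, 'z) cat_scheme \<Rightarrow> 'o list \<Rightarrow> 'o \<Rightarrow> (nat \<Rightarrow> 'm) \<Rightarrow> (nat \<Rightarrow> 'm) \<Rightarrow> bool" where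
  "direct_sum_diagram C Xs S i p \<longleftrightarrow> set Xs \<subseteq> Obj C \<and> S \<in> Obj C \<and>
     (\<forall>n < length Xs. i n \<in> mor C (Xs ! n) S \<and> p n \<in> mor C S (Xs ! n)) \<and>
     (\<forall>m < length Xs. \<forall>n < length Xs.
        p m \<bullet>\<^bsub>C\<^esub> i n = (if m = n then Ident C (Xs ! n) else \<zero>\<^bsub>Hom C (Xs ! n) (Xs ! m)\<^esub>)) \<and>
     (\<Oplus>\<^bsub>Hom C S S\<^esub> n \<in> {..<length Xs}. i n \<bullet>\<^bsub>C\<^esub> p n) = Ident C S"

definition is_direct_sum :: "('o, 'm, 'k, 'z) cat_scheme \<Rightarrow> 'o list \<Rightarrow> 'o \<Rightarrow> bool" where
  "is_direct_sum C Xs S \<longleftrightarrow> (\<exists>i p. direct_sum_diagram C Xs S i p)"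

definition is_zero_object :: "('o, 'm, 'k, 'z) cat_scheme \<Rightarrow> 'o \<Rightarrow> bool" where
  "is_zero_object C X \<longleftrightarrow> X \<in> Obj C \<and> Ident C X = \<zero>\<^bsub>Hom C X X\<^esub>"

locale additive_category = preadditive_category +
  assumes direct_sums: "set Xs \<subseteq> Obj C \<Longrightarrow> \<exists>S. is_direct_sum C Xs S"

definition local_endomorphism_ring :: "('o, 'm, 'k, 'z) cat_scheme \<Rightarrow> 'o \<Rightarrow> bool" where
  "local_endomorphism_ring C X \<longleftrightarrow> Ident C X \<noteq> \<zero>\<^bsub>Hom C X X\<^esub> \<and>
     (\<forall>f \<in> mor C X X. \<forall>g \<in> mor C X X.
        \<not> is_iso C X X f \<and> \<not> is_iso C X X g \<longrightarrow> \<not> is_iso C X X (f \<oplus>\<^bsub>Hom C X X\<^esub> g))"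

locale krull_schmidt_category = additive_category +
  assumes krull_schmidt: "X \<in> Obj C \<Longrightarrow>
    \<exists>Xs. is_direct_sum C Xs X \<and> (\<forall>Y \<in> set Xs. local_endomorphism_ring C Y)"

text \<open>Full subcategories are identified with their sets of objects.\<close>

definition subcategory :: "('o, 'm, 'k, 'z) cat_scheme \<Rightarrow> 'o set \<Rightarrow> bool" where
  "subcategory C U \<longleftrightarrow> U \<subseteq> Obj C \<and>
     (\<forall>X Y f. X \<in> U \<and> Y \<in> Obj C \<and> is_iso C X Y f \<longrightarrow> Y \<in> U) \<and>
     (\<forall>Xs S. set Xs \<subseteq> U \<and> is_direct_sum C Xs S \<longrightarrow> S \<in> U) \<and>
     (\<forall>X Y S. S \<in> U \<and> is_direct_sum C [X, Y] S \<longrightarrow> X \<in> U)"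

definition add_closure :: "('o, 'm, 'k, 'z) cat_scheme \<Rightarrow> 'o \<Rightarrow> 'o set" where
  "add_closure C M = {X. \<exists>n Y S. is_direct_sum C (replicate n M) S \<and> is_direct_sum C [X, Y] S}"

definition left_approximation ::
  "('o, 'm, 'k, 'z) cat_scheme \<Rightarrow> 'o set \<Rightarrow> 'o \<Rightarrow> 'o \<Rightarrow> 'm \<Rightarrow> bool" where
  "left_approximation C U X N a \<longleftrightarrow> N \<in> U \<and> a \<in> mor C X N \<and>
     (\<forall>N' \<in> U. \<forall>u \<in> mor C X N'. \<exists>v \<in> mor C N N'. v \<bullet>\<^bsub>C\<^esub> a = u)"

definition right_approximation ::
  "('o, 'm, 'k, 'z) cat_scheme \<Rightarrow> 'o set \<Rightarrow> 'o \<Rightarrow> 'o \<Rightarrow> 'm \<Rightarrow> bool" where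
  "right_approximation C U N X b \<longleftrightarrow> N \<in> U \<and> b \<in> mor C N X \<and>
     (\<forall>N' \<in> U. \<forall>u \<in> mor C N' X. \<exists>v \<in> mor C N' N. b \<bullet>\<^bsub>C\<^esub> v = u)"

definition functorially_finite :: "('o, 'm, 'k, 'z) cat_scheme \<Rightarrow> 'o set \<Rightarrow> bool" where
  "functorially_finite C U \<longleftrightarrow> (\<forall>X \<in> Obj C.
     (\<exists>N a. left_approximation C U X N a) \<and> (\<exists>N b. right_approximation C U N X b))"


section \<open>Extriangulated categories\<close>

text \<open>
  \<open>Ext C D A\<close> is \<open>\<E>(D, A)\<close>, and \<open>EMap C c a\<close> is \<open>\<E>(c, a)\<close>, contravariant in \<open>c\<close> and covariant in \<open>a\<close>.
  \<open>Realize C D A \<delta>\<close> is \<open>\<s>(\<delta>)\<close>, an equivalence class of triples \<open>(B, x, y)\<close> standing for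
  the sequences \<open>A \<rightarrow> B \<rightarrow> D\<close> with maps \<open>x\<close> and \<open>y\<close>.
\<close>

record ('o, 'm, 'k, 'e) extri = "('o, 'm, 'k) cat" +
  Ext :: "'o \<Rightarrow> 'o \<Rightarrow> ('k, 'e) module"
  EMap :: "'m \<Rightarrow> 'm \<Rightarrow> 'e \<Rightarrow> 'e"
  Realize :: "'o \<Rightarrow> 'o \<Rightarrow> 'e \<Rightarrow> ('o \<times> 'm \<times> 'm) set"

abbreviation ext :: "('o, 'm, 'k, 'e) extri \<Rightarrow> 'o \<Rightarrow> 'o \<Rightarrow> 'e set" where
  "ext C D A \<equiv> carrier (Ext C D A)"

definition sequences :: "('o, 'm, 'k, 'z) cat_scheme \<Rightarrow> 'o \<Rightarrow> 'o \<Rightarrow> ('o \<times> 'm \<times> 'm) set" where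
  "sequences C D A = {(B, x, y). B \<in> Obj C \<and> x \<in> mor C A B \<and> y \<in> mor C B D}"

definition sequence_equiv ::
  "('o, 'm, 'k, 'z) cat_scheme \<Rightarrow> 'o \<Rightarrow> 'o \<Rightarrow> (('o \<times> 'm \<times> 'm) \<times> ('o \<times> 'm \<times> 'm)) set" where
  "sequence_equiv C D A = {((B, x, y), (B', x', y')).
     (B, x, y) \<in> sequences C D A \<and> (B', x', y') \<in> sequences C D A \<and>
     (\<exists>b. is_iso C B B' b \<and> b \<bullet>\<^bsub>C\<^esub> x = x' \<and> y' \<bullet>\<^bsub>C\<^esub> b = y)}"

abbreviation push :: "('o, 'm, 'k, 'e) extri \<Rightarrow> 'o \<Rightarrow> 'm \<Rightarrow> 'e \<Rightarrow> 'e" where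
  "push C D a \<delta> \<equiv> EMap C (Ident C D) a \<delta>"

abbreviation pull :: "('o, 'm, 'k, 'e) extri \<Rightarrow> 'o \<Rightarrow> 'm \<Rightarrow> 'e \<Rightarrow> 'e" where
  "pull C A c \<delta> \<equiv> EMap C c (Ident C A) \<delta>"

fun etriangle :: "('o, 'm, 'k, 'e) extri \<Rightarrow> 'o \<times> 'o \<times> 'o \<times> 'm \<times> 'm \<times> 'e \<Rightarrow> bool" where
  "etriangle C (A, B, D, x, y, \<delta>) \<longleftrightarrow> A \<in> Obj C \<and> D \<in> Obj C \<and> \<delta> \<in> ext C D A \<and>
     (B, x, y) \<in> Realize C D A \<delta>"

fun etriangle_morphism :: "('o, 'm, 'k, 'e) extri \<Rightarrow> 'o \<times> 'o \<times> 'o \<times> 'm \<times> 'm \<times> 'e \<Rightarrow>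
    'o \<times> 'o \<times> 'o \<times> 'm \<times> 'm \<times> 'e \<Rightarrow> 'm \<Rightarrow> 'm \<Rightarrow> 'm \<Rightarrow> bool" where
  "etriangle_morphism C (A, B, D, x, y, \<delta>) (A', B', D', x', y', \<delta>') a b c \<longleftrightarrow>
     a \<in> mor C A A' \<and> b \<in> mor C B B' \<and> c \<in> mor C D D' \<and>
     b \<bullet>\<^bsub>C\<^esub> x = x' \<bullet>\<^bsub>C\<^esub> a \<and> y' \<bullet>\<^bsub>C\<^esub> b = c \<bullet>\<^bsub>C\<^esub> y \<and> push C D a \<delta> = pull C A' c \<delta>'"

locale extriangulated_category = additive_category C
  for C :: "('o, 'm, 'k, 'e) extri" (structure) +
  assumes ext_group: "\<lbrakk>D \<in> Obj C; A \<in> Obj C\<rbrakk> \<Longrightarrow> abelian_group (Ext C D A)"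
    and emap_closed: "\<lbrakk>D \<in> Obj C; D' \<in> Obj C; A \<in> Obj C; A' \<in> Obj C;
        c \<in> mor C D' D; a \<in> mor C A A'; \<delta> \<in> ext C D A\<rbrakk> \<Longrightarrow> EMap C c a \<delta> \<in> ext C D' A'"
    and emap_add: "\<lbrakk>D \<in> Obj C; D' \<in> Obj C; A \<in> Obj C; A' \<in> Obj C;
        c \<in> mor C D' D; a \<in> mor C A A'; \<delta> \<in> ext C D A; \<delta>' \<in> ext C D A\<rbrakk>
      \<Longrightarrow> EMap C c a (\<delta> \<oplus>\<^bsub>Ext C D A\<^esub> \<delta>') = EMap C c a \<delta> \<oplus>\<^bsub>Ext C D' A'\<^esub> EMap C c a \<delta>'"
    and emap_ident: "\<lbrakk>D \<in> Obj C; A \<in> Obj C; \<delta> \<in> ext C D A\<rbrakk>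
      \<Longrightarrow> EMap C (Ident C D) (Ident C A) \<delta> = \<delta>"
    and emap_comp: "\<lbrakk>D \<in> Obj C; D' \<in> Obj C; D'' \<in> Obj C; A \<in> Obj C; A' \<in> Obj C; A'' \<in> Obj C;
        c \<in> mor C D' D; c' \<in> mor C D'' D'; a \<in> mor C A A'; a' \<in> mor C A' A''; \<delta> \<in> ext C D A\<rbrakk>
      \<Longrightarrow> EMap C (c \<bullet> c') (a' \<bullet> a) \<delta> = EMap C c' a' (EMap C c a \<delta>)"
    and emap_biadditive_left: "\<lbrakk>D \<in> Obj C; D' \<in> Obj C; A \<in> Obj C; A' \<in> Obj C;
        c \<in> mor C D' D; c' \<in> mor C D' D; a \<in> mor C A A'; \<delta> \<in> ext C D A\<rbrakk>
      \<Longrightarrow> EMap C (c \<oplus>\<^bsub>Hom C D' D\<^esub> c') a \<delta> = EMap C c a \<delta> \<oplus>\<^bsub>Ext C D' A'\<^esub> EMap C c' a \<delta>"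
    and emap_biadditive_right: "\<lbrakk>D \<in> Obj C; D' \<in> Obj C; A \<in> Obj C; A' \<in> Obj C;
        c \<in> mor C D' D; a \<in> mor C A A'; a' \<in> mor C A A'; \<delta> \<in> ext C D A\<rbrakk>
      \<Longrightarrow> EMap C c (a \<oplus>\<^bsub>Hom C A A'\<^esub> a') \<delta> = EMap C c a \<delta> \<oplus>\<^bsub>Ext C D' A'\<^esub> EMap C c a' \<delta>"
    and realize_class: "\<lbrakk>D \<in> Obj C; A \<in> Obj C; \<delta> \<in> ext C D A\<rbrakk>
      \<Longrightarrow> Realize C D A \<delta> \<in> sequences C D A // sequence_equiv C D A"
    and realize_morphism: "\<lbrakk>etriangle C (A, B, D, x, y, \<delta>); etriangle C (A', B', D', x', y', \<delta>');
        a \<in> mor C A A'; c \<in> mor C D D'; push C D a \<delta> = pull C A' c \<delta>'\<rbrakk>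
      \<Longrightarrow> \<exists>b \<in> mor C B B'. b \<bullet> x = x' \<bullet> a \<and> y' \<bullet> b = c \<bullet> y"
    and realize_zero: "direct_sum_diagram C [A, D] S i p
      \<Longrightarrow> (S, i 0, p 1) \<in> Realize C D A \<zero>\<^bsub>Ext C D A\<^esub>"
    and realize_sum: "\<lbrakk>etriangle C (A, B, D, x, y, \<delta>); etriangle C (A', B', D', x', y', \<delta>');
        direct_sum_diagram C [A, A'] SA iA pA; direct_sum_diagram C [B, B'] SB iB pB;
        direct_sum_diagram C [D, D'] SD iD pD\<rbrakk>
      \<Longrightarrow> (SB, iB 0 \<bullet> x \<bullet> pA 0 \<oplus>\<^bsub>Hom C SA SB\<^esub> iB 1 \<bullet> x' \<bullet> pA 1,
               iD 0 \<bullet> y \<bullet> pB 0 \<oplus>\<^bsub>Hom C SB SD\<^esub> iD 1 \<bullet> y' \<bullet> pB 1)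
          \<in> Realize C SD SA
              (EMap C (pD 0) (iA 0) \<delta> \<oplus>\<^bsub>Ext C SD SA\<^esub> EMap C (pD 1) (iA 1) \<delta>')"
    and ET3: "\<lbrakk>etriangle C (A, B, D, x, y, \<delta>); etriangle C (A', B', D', x', y', \<delta>');
        a \<in> mor C A A'; b \<in> mor C B B'; b \<bullet> x = x' \<bullet> a\<rbrakk>
      \<Longrightarrow> \<exists>c \<in> mor C D D'. c \<bullet> y = y' \<bullet> b \<and> push C D a \<delta> = pull C A' c \<delta>'"
    and ET3_op: "\<lbrakk>etriangle C (A, B, D, x, y, \<delta>); etriangle C (A', B', D', x', y', \<delta>');
        b \<in> mor C B B'; c \<in> mor C D D'; c \<bullet> y = y' \<bullet> b\<rbrakk>
      \<Longrightarrow> \<exists>a \<in> mor C A A'. b \<bullet> x = x' \<bullet> a \<and> push C D a \<delta> = pull C A' c \<delta>'"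
    and ET4: "\<lbrakk>etriangle C (A, B, D, f, f', \<delta>); etriangle C (B, M, F, g, g', \<delta>')\<rbrakk>
      \<Longrightarrow> \<exists>E \<delta>''. \<exists>h' \<in> mor C M E. \<exists>d \<in> mor C D E. \<exists>e \<in> mor C E F.
            h' \<bullet> g = d \<bullet> f' \<and> e \<bullet> h' = g' \<and>
            etriangle C (A, M, E, g \<bullet> f, h', \<delta>'') \<and>
            etriangle C (D, E, F, d, e, push C F f' \<delta>') \<and>
            pull C A d \<delta>'' = \<delta> \<and> push C E f \<delta>'' = pull C B e \<delta>'"
    and ET4_op: "\<lbrakk>etriangle C (D, B, A, f', f, \<delta>); etriangle C (F, M, B, g', g, \<delta>')\<rbrakk>
      \<Longrightarrow> \<exists>E \<delta>''. \<exists>h' \<in> mor C E M. \<exists>d \<in> mor C E D. \<exists>e \<in> mor C F E.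
            g \<bullet> h' = f' \<bullet> d \<and> h' \<bullet> e = g' \<and>
            etriangle C (E, M, A, h', f \<bullet> g, \<delta>'') \<and>
            etriangle C (F, E, D, e, d, pull C F f' \<delta>') \<and>
            push C A d \<delta>'' = \<delta> \<and> pull C E f \<delta>'' = push C B e \<delta>'"

definition projective :: "('o, 'm, 'k, 'e) extri \<Rightarrow> 'o \<Rightarrow> bool" where
  "projective C P \<longleftrightarrow> P \<in> Obj C \<and> (\<forall>A B D x y \<delta>. etriangle C (A, B, D, x, y, \<delta>) \<longrightarrow>
     (\<forall>f \<in> mor C P D. \<exists>g \<in> mor C P B. y \<bullet>\<^bsub>C\<^esub> g = f))"

definition injective :: "('o, 'm, 'k, 'e) extri \<Rightarrow> 'o \<Rightarrow> bool" where
  "injective C Q \<longleftrightarrow> Q \<in> Obj C \<and> (\<forall>A B D x y \<delta>. etriangle C (A, B, D, x, y, \<delta>) \<longrightarrow>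
     (\<forall>f \<in> mor C A Q. \<exists>g \<in> mor C B Q. g \<bullet>\<^bsub>C\<^esub> x = f))"

definition enough_projectives :: "('o, 'm, 'k, 'e) extri \<Rightarrow> bool" where
  "enough_projectives C \<longleftrightarrow>
     (\<forall>D \<in> Obj C. \<exists>A P x y \<delta>. projective C P \<and> etriangle C (A, P, D, x, y, \<delta>))"

definition enough_injectives :: "('o, 'm, 'k, 'e) extri \<Rightarrow> bool" where
  "enough_injectives C \<longleftrightarrow>
     (\<forall>A \<in> Obj C. \<exists>Q D x y \<delta>. injective C Q \<and> etriangle C (A, Q, D, x, y, \<delta>))"

text \<open>The assertion \<open>\<E>(\<X>, \<Y>) = 0\<close>.\<close>

definition ext_vanish :: "('o, 'm, 'k, 'e) extri \<Rightarrow> 'o set \<Rightarrow> 'o set \<Rightarrow> bool" where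
  "ext_vanish C X Y \<longleftrightarrow> (\<forall>M \<in> X. \<forall>N \<in> Y. ext C M N = {\<zero>\<^bsub>Ext C M N\<^esub>})"

definition left_perp :: "('o, 'm, 'k, 'e) extri \<Rightarrow> 'o set \<Rightarrow> 'o set" where
  "left_perp C I = {M \<in> Obj C. ext_vanish C {M} I}"

definition rigid_subcategory :: "('o, 'm, 'k, 'e) extri \<Rightarrow> 'o set \<Rightarrow> bool" where
  "rigid_subcategory C R \<longleftrightarrow> subcategory C R \<and> ext_vanish C R R"

definition cluster_tilting_subcategory :: "('o, 'm, 'k, 'e) extri \<Rightarrow> 'o set \<Rightarrow> bool" where
  "cluster_tilting_subcategory C R \<longleftrightarrow> subcategory C R \<and> functorially_finite C R \<and>
     (\<forall>M \<in> Obj C. (M \<in> R \<longleftrightarrow> ext_vanish C {M} R) \<and> (M \<in> R \<longleftrightarrow> ext_vanish C R {M}))"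

definition cluster_tilting_object :: "('o, 'm, 'k, 'e) extri \<Rightarrow> 'o \<Rightarrow> bool" where
  "cluster_tilting_object C T \<longleftrightarrow> T \<in> Obj C \<and> cluster_tilting_subcategory C (add_closure C T)"

definition cotorsion_pair :: "('o, 'm, 'k, 'e) extri \<Rightarrow> 'o set \<Rightarrow> 'o set \<Rightarrow> bool" where
  "cotorsion_pair C X Y \<longleftrightarrow> subcategory C X \<and> subcategory C Y \<and> ext_vanish C X Y \<and>
     (\<forall>M \<in> Obj C.
        (\<exists>A \<in> Y. \<exists>B \<in> X. \<exists>x y \<delta>. etriangle C (A, B, M, x, y, \<delta>)) \<and>
        (\<exists>A \<in> Y. \<exists>B \<in> X. \<exists>x y \<delta>. etriangle C (M, A, B, x, y, \<delta>)))"

definition cotorsion_pair_with_core ::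
  "('o, 'm, 'k, 'e) extri \<Rightarrow> 'o set \<Rightarrow> 'o set \<Rightarrow> 'o set \<Rightarrow> bool" where
  "cotorsion_pair_with_core C I X Y \<longleftrightarrow> cotorsion_pair C X Y \<and> X \<inter> Y = I"


section \<open>The 2-Calabi-Yau condition\<close>

definition field_as_module :: "'k ring \<Rightarrow> ('k, 'k) module" where
  "field_as_module K = \<lparr>carrier = carrier K, mult = mult K, one = one K, zero = zero K, add = add K,
     smult = mult K\<rparr>"

text \<open>
  The dual space \<open>Hom\<^sub>k(V, k)\<close>; its elements are extensional functions, so that equality of
  functionals is equality in HOL.
\<close>

definition dual_space :: "'k ring \<Rightarrow> ('k, 'v) module \<Rightarrow> ('k, 'v \<Rightarrow> 'k) module" where
  "dual_space K V = (ring.func_space K (carrier V))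
     \<lparr>carrier := module_hom K V (field_as_module K) \<inter> extensional (carrier V)\<rparr>"

locale linear_extriangulated_category = extriangulated_category C + field K
  for K :: "'k ring" and C :: "('o, 'm, 'k, 'e) extri" (structure) +
  assumes hom_vectorspace: "\<lbrakk>A \<in> Obj C; B \<in> Obj C\<rbrakk> \<Longrightarrow> vectorspace K (Hom C A B)"
    and comp_smult: "\<lbrakk>A \<in> Obj C; B \<in> Obj C; D \<in> Obj C; r \<in> carrier K; f \<in> mor C A B; g \<in> mor C B D\<rbrakk>
      \<Longrightarrow> g \<bullet> (r \<odot>\<^bsub>Hom C A B\<^esub> f) = r \<odot>\<^bsub>Hom C A D\<^esub> (g \<bullet> f) \<and>
          (r \<odot>\<^bsub>Hom C B D\<^esub> g) \<bullet> f = r \<odot>\<^bsub>Hom C A D\<^esub> (g \<bullet> f)"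
    and ext_vectorspace: "\<lbrakk>D \<in> Obj C; A \<in> Obj C\<rbrakk> \<Longrightarrow> vectorspace K (Ext C D A)"
    and emap_smult: "\<lbrakk>D \<in> Obj C; D' \<in> Obj C; A \<in> Obj C; A' \<in> Obj C; r \<in> carrier K;
        c \<in> mor C D' D; a \<in> mor C A A'; \<delta> \<in> ext C D A\<rbrakk>
      \<Longrightarrow> EMap C c a (r \<odot>\<^bsub>Ext C D A\<^esub> \<delta>) = r \<odot>\<^bsub>Ext C D' A'\<^esub> EMap C c a \<delta> \<and>
          EMap C (r \<odot>\<^bsub>Hom C D' D\<^esub> c) a \<delta> = r \<odot>\<^bsub>Ext C D' A'\<^esub> EMap C c a \<delta> \<and>
          EMap C c (r \<odot>\<^bsub>Hom C A A'\<^esub> a) \<delta> = r \<odot>\<^bsub>Ext C D' A'\<^esub> EMap C c a \<delta>"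

text \<open>
  In the naturality condition \<open>EMap C b c\<close> is the map \<open>\<E>(B', A') \<rightarrow> \<E>(B, A)\<close> whose transpose is
  the action of \<open>c : A' \<rightarrow> A\<close> and \<open>b : B \<rightarrow> B'\<close> on \<open>Hom\<^sub>k(\<E>(B, A), k)\<close>.
\<close>

locale two_calabi_yau = linear_extriangulated_category K C
  for K :: "'k ring" and C :: "('o, 'm, 'k, 'e) extri" (structure) +
  assumes hom_fin_dim: "\<lbrakk>A \<in> Obj C; B \<in> Obj C\<rbrakk> \<Longrightarrow> vectorspace.fin_dim K (Hom C A B)"
    and ext_fin_dim: "\<lbrakk>A \<in> Obj C; B \<in> Obj C\<rbrakk> \<Longrightarrow> vectorspace.fin_dim K (Ext C A B)"
    and duality: "\<exists>\<Phi>.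
      (\<forall>A \<in> Obj C. \<forall>B \<in> Obj C.
         \<Phi> A B \<in> module_hom K (Ext C A B) (dual_space K (Ext C B A)) \<and>
         bij_betw (\<Phi> A B) (ext C A B) (carrier (dual_space K (Ext C B A)))) \<and>
      (\<forall>A \<in> Obj C. \<forall>A' \<in> Obj C. \<forall>B \<in> Obj C. \<forall>B' \<in> Obj C.
         \<forall>c \<in> mor C A' A. \<forall>b \<in> mor C B B'. \<forall>\<delta> \<in> ext C A B. \<forall>\<epsilon> \<in> ext C B' A'.
           \<Phi> A' B' (EMap C c b \<delta>) \<epsilon> = \<Phi> A B \<delta> (EMap C b c \<epsilon>))"


section \<open>Categories with shift and triangles\<close>

text \<open>
  An element \<open>(X, Y, Z, u, v, w)\<close> of \<open>Triangles T\<close> is a triangle \<open>X \<rightarrow> Y \<rightarrow> Z \<rightarrow> Shift T X\<close>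
  with maps \<open>u\<close>, \<open>v\<close>, \<open>w\<close>.
\<close>

record ('o, 'm, 'k) tri_cat = "('o, 'm, 'k) cat" +
  Shift :: "'o \<Rightarrow> 'o"
  ShiftMor :: "'m \<Rightarrow> 'm"
  Triangles :: "('o \<times> 'o \<times> 'o \<times> 'm \<times> 'm \<times> 'm) set"

definition triangulated_subcategory :: "('o, 'm, 'k) tri_cat \<Rightarrow> 'o set \<Rightarrow> bool" where
  "triangulated_subcategory T U \<longleftrightarrow> subcategory T U \<and>
     (\<forall>X \<in> Obj T. Shift T X \<in> U \<longleftrightarrow> X \<in> U) \<and>
     (\<forall>X \<in> Obj T. \<forall>Y \<in> Obj T. \<forall>Z \<in> Obj T. \<forall>u v w. (X, Y, Z, u, v, w) \<in> Triangles T \<longrightarrow>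
        (X \<in> U \<and> Y \<in> U \<longrightarrow> Z \<in> U) \<and> (Y \<in> U \<and> Z \<in> U \<longrightarrow> X \<in> U) \<and> (X \<in> U \<and> Z \<in> U \<longrightarrow> Y \<in> U))"

text \<open>The objects of \<open>\<Oplus>\<^bsub>j \<in> J\<^esub> A\<^sub>j\<close>; for empty \<open>J\<close> these are the zero objects.\<close>

definition sum_of_subcategories ::
  "('o, 'm, 'k, 'z) cat_scheme \<Rightarrow> 'j set \<Rightarrow> ('j \<Rightarrow> 'o set) \<Rightarrow> 'o set" where
  "sum_of_subcategories T J A =
     {M \<in> Obj T. \<exists>Xs. set Xs \<subseteq> (\<Union>j \<in> J. A j) \<and> is_direct_sum T Xs M}"

definition decomposition :: "('o, 'm, 'k) tri_cat \<Rightarrow> 'j set \<Rightarrow> ('j \<Rightarrow> 'o set) \<Rightarrow> bool" where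
  "decomposition T J A \<longleftrightarrow>
     (\<forall>j \<in> J. triangulated_subcategory T (A j)) \<and>
     (\<forall>i \<in> J. \<forall>j \<in> J. i \<noteq> j \<longrightarrow> (\<forall>X \<in> A i. \<forall>Y \<in> A j. mor T X Y = {\<zero>\<^bsub>Hom T X Y\<^esub>})) \<and>
     sum_of_subcategories T J A = Obj T"

definition nonzero_category :: "('o, 'm, 'k, 'z) cat_scheme \<Rightarrow> bool" where
  "nonzero_category T \<longleftrightarrow> (\<exists>X \<in> Obj T. \<not> is_zero_object T X)"

abbreviation full_sub :: "('o, 'm, 'k) tri_cat \<Rightarrow> 'o set \<Rightarrow> ('o, 'm, 'k) tri_cat" where
  "full_sub T U \<equiv> T\<lparr>Obj := U\<rparr>"

definition indecomposable_triangulated :: "('o, 'm, 'k) tri_cat \<Rightarrow> bool" where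
  "indecomposable_triangulated T \<longleftrightarrow> nonzero_category T \<and>
     \<not> (\<exists>A :: bool \<Rightarrow> 'o set. decomposition T UNIV A \<and> (\<forall>b. nonzero_category (full_sub T (A b))))"

definition complete_decomposition :: "('o, 'm, 'k) tri_cat \<Rightarrow> 'j set \<Rightarrow> ('j \<Rightarrow> 'o set) \<Rightarrow> bool" where
  "complete_decomposition T J A \<longleftrightarrow> decomposition T J A \<and>
     (\<forall>j \<in> J. indecomposable_triangulated (full_sub T (A j)))"


section \<open>The quotient of the left perpendicular category by \<open>\<I>\<close>\<close>

definition factoring :: "('o, 'm, 'k, 'z) cat_scheme \<Rightarrow> 'o set \<Rightarrow> 'o \<Rightarrow> 'o \<Rightarrow> 'm set" where
  "factoring C I A B = {f \<in> mor C A B. \<exists>N \<in> I. \<exists>u \<in> mor C A N. \<exists>v \<in> mor C N B. f = v \<bullet>\<^bsub>C\<^esub> u}"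

text \<open>The quotient functor on morphisms; on objects it is the identity.\<close>

definition quot_mor :: "('o, 'm, 'k, 'z) cat_scheme \<Rightarrow> 'o set \<Rightarrow> 'm \<Rightarrow> 'm set" where
  "quot_mor C I f = factoring C I (Dom C f) (Cod C f) +>\<^bsub>Hom C (Dom C f) (Cod C f)\<^esub> f"

definition quot_hom ::
  "('o, 'm, 'k, 'z) cat_scheme \<Rightarrow> 'o set \<Rightarrow> 'o \<Rightarrow> 'o \<Rightarrow> ('k, 'm set) module" where
  "quot_hom C I A B =
     \<lparr>carrier = a_rcosets\<^bsub>Hom C A B\<^esub> (factoring C I A B),
      mult = undefined, one = undefined,
      zero = factoring C I A B,
      add = set_add (Hom C A B),
      smult = (\<lambda>r F. \<Union>f \<in> F. quot_mor C I (r \<odot>\<^bsub>Hom C A B\<^esub> f))\<rparr>"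

text \<open>
  The unions below are over families of equal cosets: they pick out the class of a composite (or
  scalar multiple) of arbitrary representatives.
\<close>

definition quot_cat ::
  "('o, 'm, 'k, 'z) cat_scheme \<Rightarrow> 'o set \<Rightarrow> 'o set \<Rightarrow> ('o, 'm set, 'k) cat" where
  "quot_cat C U I =
     \<lparr>Obj = U,
      Hom = quot_hom C I,
      Dom = (\<lambda>F. Dom C (SOME f. f \<in> F)),
      Cod = (\<lambda>F. Cod C (SOME f. f \<in> F)),
      Comp = (\<lambda>G F. \<Union>g \<in> G. \<Union>f \<in> F. quot_mor C I (g \<bullet>\<^bsub>C\<^esub> f)),
      Ident = (\<lambda>A. quot_mor C I (Ident C A))\<rparr>"

abbreviation perp_quot :: "('o, 'm, 'k, 'e) extri \<Rightarrow> 'o set \<Rightarrow> ('o, 'm set, 'k) cat" where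
  "perp_quot C I \<equiv> quot_cat C (left_perp C I) I"

text \<open>
  A shift \<open>A\<langle>1\<rangle>\<close> is determined by a choice of a triangle \<open>A \<rightarrow> I\<^sub>A \<rightarrow> A\<langle>1\<rangle>\<close> with
  approximations; different choices give isomorphic objects of the quotient.
\<close>

fun is_shift_triangle ::
  "('o, 'm, 'k, 'e) extri \<Rightarrow> 'o set \<Rightarrow> 'o \<Rightarrow> 'o \<times> 'o \<times> 'o \<times> 'm \<times> 'm \<times> 'e \<Rightarrow> bool" where
  "is_shift_triangle C I X (A, N, A', a, b, \<delta>) \<longleftrightarrow> A = X \<and> etriangle C (A, N, A', a, b, \<delta>) \<and>
     left_approximation C I A N a \<and> right_approximation C I N A' b"

definition shift_triangle ::
  "('o, 'm, 'k, 'e) extri \<Rightarrow> 'o set \<Rightarrow> 'o \<Rightarrow> 'o \<times> 'o \<times> 'o \<times> 'm \<times> 'm \<times> 'e" where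
  "shift_triangle C I A = (SOME t. is_shift_triangle C I A t)"

definition shift_obj :: "('o, 'm, 'k, 'e) extri \<Rightarrow> 'o set \<Rightarrow> 'o \<Rightarrow> 'o" where
  "shift_obj C I A = fst (snd (snd (shift_triangle C I A)))"

text \<open>
  The shift of the class of \<open>f : A \<rightarrow> B\<close> is the class of the maps \<open>h : A\<langle>1\<rangle> \<rightarrow> B\<langle>1\<rangle>\<close> completing \<open>f\<close>
  to a morphism of the chosen triangles; the set of these maps is a full coset.
\<close>

definition shift_mor :: "('o, 'm, 'k, 'e) extri \<Rightarrow> 'o set \<Rightarrow> 'm set \<Rightarrow> 'm set" where
  "shift_mor C I F = {h. \<exists>f \<in> F. \<exists>b.
     etriangle_morphism C (shift_triangle C I (Dom C f)) (shift_triangle C I (Cod C f)) f b h}"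

definition standard_triangles ::
  "('o, 'm, 'k, 'e) extri \<Rightarrow> 'o set \<Rightarrow> ('o \<times> 'o \<times> 'o \<times> 'm set \<times> 'm set \<times> 'm set) set" where
  "standard_triangles C I = {(A, B, D, quot_mor C I f, quot_mor C I g, quot_mor C I h) | A B D f g h.
     A \<in> left_perp C I \<and> B \<in> left_perp C I \<and> D \<in> left_perp C I \<and>
     (\<exists>\<delta> b. etriangle C (A, B, D, f, g, \<delta>) \<and>
        (\<forall>N \<in> I. \<forall>u \<in> mor C A N. \<exists>v \<in> mor C B N. v \<bullet>\<^bsub>C\<^esub> f = u) \<and>
        etriangle_morphism C (A, B, D, f, g, \<delta>) (shift_triangle C I A) (Ident C A) b h)}"

definition quot_triangles ::
  "('o, 'm, 'k, 'e) extri \<Rightarrow> 'o set \<Rightarrow> ('o \<times> 'o \<times> 'o \<times> 'm set \<times> 'm set \<times> 'm set) set" where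
  "quot_triangles C I = {(X, Y, Z, u, v, w).
     X \<in> left_perp C I \<and> Y \<in> left_perp C I \<and> Z \<in> left_perp C I \<and>
     u \<in> mor (perp_quot C I) X Y \<and> v \<in> mor (perp_quot C I) Y Z \<and>
     w \<in> mor (perp_quot C I) Z (shift_obj C I X) \<and>
     (\<exists>A B D f g h \<alpha> \<beta> \<gamma>. (A, B, D, f, g, h) \<in> standard_triangles C I \<and>
        is_iso (perp_quot C I) X A \<alpha> \<and> is_iso (perp_quot C I) Y B \<beta> \<and>
        is_iso (perp_quot C I) Z D \<gamma> \<and>
        \<beta> \<bullet>\<^bsub>perp_quot C I\<^esub> u = f \<bullet>\<^bsub>perp_quot C I\<^esub> \<alpha> \<and>
        \<gamma> \<bullet>\<^bsub>perp_quot C I\<^esub> v = g \<bullet>\<^bsub>perp_quot C I\<^esub> \<beta> \<and>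
        shift_mor C I \<alpha> \<bullet>\<^bsub>perp_quot C I\<^esub> w = h \<bullet>\<^bsub>perp_quot C I\<^esub> \<gamma>)}"

definition perp_quot_tri :: "('o, 'm, 'k, 'e) extri \<Rightarrow> 'o set \<Rightarrow> ('o, 'm set, 'k) tri_cat" where
  "perp_quot_tri C I = cat.extend (perp_quot C I)
     (tri_cat.fields (shift_obj C I) (shift_mor C I) (quot_triangles C I))"

text \<open>The preimage of a full subcategory under the quotient functor, which is the identity on objects.\<close>

definition quot_preimage :: "('o, 'm, 'k, 'e) extri \<Rightarrow> 'o set \<Rightarrow> 'o set \<Rightarrow> 'o set" where
  "quot_preimage C I U = {M \<in> left_perp C I. M \<in> U}"

end

theory Submission
  imports Defs Complex_Main
begin

text \<open>
  Inside \<open>Perp\<close>, the left perpendicular category of \<open>I\<close>, extensions of \<open>W\<close> by \<open>A\<close> correspond to maps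
  from \<open>W\<close> to the cosyzygy of \<open>A\<close> modulo \<open>I\<close>. For a cotorsion pair \<open>(X, Y)\<close> with core \<open>I\<close> this gives
  at once that maps \<open>X \<rightarrow> Y\<close> vanish modulo \<open>I\<close>. The crucial point is that maps \<open>Y \<rightarrow> X\<close> vanish as
  well. The cluster tilting object enters here: an index argument bounds the number of summands of
  rigid objects, so a maximal rigid object of \<open>X\<close> stays maximal after shifting, rigid objects of \<open>X\<close>
  are arbitrarily high cosyzygies, and every object of \<open>X\<close> is built from rigid ones by truncating a
  cluster tilting resolution.

  Hence \<open>X\<close> and \<open>Y\<close> are closed under shifts in both directions and split \<open>Perp\<close> modulo \<open>I\<close> into two
  triangulated summands, and every indecomposable \<open>A\<^sub>j\<close> lies in one of them. Conversely, any such splitting of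
  \<open>Perp\<close> extends to a cotorsion pair of the whole category by truncating along \<open>I\<close>-approximations. Since
  every \<open>A\<^sub>j\<close> contains a rigid object outside \<open>I\<close> and these are mutually orthogonal, the bound on
  rigid objects also shows that \<open>J\<close> is finite.
\<close>

section \<open>Preadditive categories\<close>

text \<open>A cotorsion pair with core \<open>I\<close> formally gives only half of a splitting:
  \<open>X\<close> is closed under cosyzygies and \<open>Y\<close> under syzygies, as for a
  t-structure, and this alone does not make maps \<open>Y -> X\<close> vanish. The 2-Calabi-Yau
  property enters through the symmetry of \<open>orth\<close>, finite dimensionality through finite
  generation of Hom; with the remaining assumptions these form the self-dual locale
  \<open>cluster_setting\<close>, so one-sided statements are proved once and then read in
  \<open>opp C\<close>. Approximations by \<open>I\<close> exist because a maximal chain of rigid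
  objects generates \<open>I\<close>. The quotient is handled through a dictionary with
  \<open>Perp\<close>, without establishing its triangulated structure: zero objects are
  \<open>I\<close>, subcategories are the \<open>admissible\<close> sets, zero hom-sets are
  \<open>no_maps\<close>, the shift is an instance of \<open>syz\<close>, triangles give conflations
  up to isomorphism. The pivot is \<open>splitting\<close>, a description of cotorsion pairs with
  core \<open>I\<close> that is visibly symmetric in \<open>X\<close> and \<open>Y\<close>; it
  yields part 2 and is compared with the sums of the \<open>A j\<close>.\<close>

context preadditive_category
begin

text \<open>Membership in a hom-set needs explicit objects. An arrow carries its own
  \<open>Dom\<close> and \<open>Cod\<close>, so typing conditions become equations for the
  simplifier and \<open>plus\<close> and \<open>neg\<close> need no hom-set subscript.\<close>

definition arrow :: "'m \<Rightarrow> bool" where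
  "arrow f \<longleftrightarrow> Dom C f \<in> Obj C \<and> Cod C f \<in> Obj C \<and> f \<in> mor C (Dom C f) (Cod C f)"

abbreviation null :: "'o \<Rightarrow> 'o \<Rightarrow> 'm" where
  "null A B \<equiv> \<zero>\<^bsub>Hom C A B\<^esub>"

definition plus :: "'m \<Rightarrow> 'm \<Rightarrow> 'm" (infixl \<open>\<boxplus>\<close> 65) where
  "f \<boxplus> g = f \<oplus>\<^bsub>Hom C (Dom C f) (Cod C f)\<^esub> g"

definition neg :: "'m \<Rightarrow> 'm" where
  "neg f = \<ominus>\<^bsub>Hom C (Dom C f) (Cod C f)\<^esub> f"

lemma mor_iff: "\<lbrakk>A \<in> Obj C; B \<in> Obj C\<rbrakk> \<Longrightarrow> f \<in> mor C A B \<longleftrightarrow> arrow f \<and> Dom C f = A \<and> Cod C f = B"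
  using dom_cod unfolding arrow_def by blast

lemma arrow_mor: "\<lbrakk>arrow f; Dom C f = A; Cod C f = B\<rbrakk> \<Longrightarrow> f \<in> mor C A B"
  by (auto simp: arrow_def)

lemma arrow_obj [simp]: "arrow f \<Longrightarrow> Dom C f \<in> Obj C" "arrow f \<Longrightarrow> Cod C f \<in> Obj C"
  by (auto simp: arrow_def)

lemma morD:
  assumes "f \<in> mor C A B" "A \<in> Obj C" "B \<in> Obj C"
  shows "arrow f" "Dom C f = A" "Cod C f = B"
  using assms by (simp_all add: mor_iff)

lemma arrow_comp [simp]:
  assumes "arrow f" "arrow g" "Cod C f = Dom C g"
  shows "arrow (g \<bullet> f)" "Dom C (g \<bullet> f) = Dom C f" "Cod C (g \<bullet> f) = Cod C g"
proof -
  have "f \<in> mor C (Dom C f) (Cod C f)" "g \<in> mor C (Cod C f) (Cod C g)"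
    using arrow_mor assms by simp_all
  then have "g \<bullet> f \<in> mor C (Dom C f) (Cod C g)" using comp_mor assms by (meson arrow_obj)
  note morD[OF this]
  then show "arrow (g \<bullet> f)" "Dom C (g \<bullet> f) = Dom C f" "Cod C (g \<bullet> f) = Cod C g" using assms by simp_all
qed

lemma arrow_ident [simp]:
  assumes "A \<in> Obj C" shows "arrow (Ident C A)" "Dom C (Ident C A) = A" "Cod C (Ident C A) = A"
  by (rule morD[OF ident_mor[OF assms] assms assms])+

lemma arrow_null [simp]:
  assumes "A \<in> Obj C" "B \<in> Obj C"
  shows "arrow (null A B)" "Dom C (null A B) = A" "Cod C (null A B) = B"
proof -
  interpret abelian_group "Hom C A B" using hom_group assms by simp
  show "arrow (null A B)" "Dom C (null A B) = A" "Cod C (null A B) = B"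
    by (rule morD[OF zero_closed assms])+
qed

lemma arrow_plus [simp]:
  assumes "arrow f" "arrow g" "Dom C f = Dom C g" "Cod C f = Cod C g"
  shows "arrow (f \<boxplus> g)" "Dom C (f \<boxplus> g) = Dom C g" "Cod C (f \<boxplus> g) = Cod C g"
proof -
  interpret abelian_group "Hom C (Dom C f) (Cod C f)" using hom_group assms by simp
  have "f \<boxplus> g \<in> mor C (Dom C f) (Cod C f)"
    unfolding plus_def by (rule a_closed) (use assms in \<open>auto intro: arrow_mor\<close>)
  note morD[OF this]
  then show "arrow (f \<boxplus> g)" "Dom C (f \<boxplus> g) = Dom C g" "Cod C (f \<boxplus> g) = Cod C g"
    using assms by simp_all
qed

lemma arrow_neg [simp]:
  assumes "arrow f" shows "arrow (neg f)" "Dom C (neg f) = Dom C f" "Cod C (neg f) = Cod C f"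
proof -
  interpret abelian_group "Hom C (Dom C f) (Cod C f)" using hom_group assms by simp
  have "neg f \<in> mor C (Dom C f) (Cod C f)"
    unfolding neg_def by (rule a_inv_closed) (use assms in \<open>auto intro: arrow_mor\<close>)
  note morD[OF this]
  then show "arrow (neg f)" "Dom C (neg f) = Dom C f" "Cod C (neg f) = Cod C f"
    using assms by simp_all
qed

lemma comp_assoc' [simp]:
  "\<lbrakk>arrow f; arrow g; arrow h; Cod C f = Dom C g; Cod C g = Dom C h\<rbrakk> \<Longrightarrow> (h \<bullet> g) \<bullet> f = h \<bullet> (g \<bullet> f)"
  using comp_assoc[of "Dom C f" "Cod C f" "Cod C g" "Cod C h" f g h] by (simp add: arrow_mor)

lemma comp_ident' [simp]:
  "\<lbrakk>arrow f; Dom C f = A\<rbrakk> \<Longrightarrow> f \<bullet> Ident C A = f"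
  "\<lbrakk>arrow f; Cod C f = A\<rbrakk> \<Longrightarrow> Ident C A \<bullet> f = f"
  using comp_ident[of "Dom C f" "Cod C f" f] arrow_mor[of f, OF _ refl refl] by auto

lemma plus_fold:
  "\<lbrakk>Dom C f = A; Cod C f = B\<rbrakk> \<Longrightarrow> f \<oplus>\<^bsub>Hom C A B\<^esub> g = f \<boxplus> g"
  by (simp add: plus_def)

lemma comp_plus_right [simp]:
  assumes "arrow f" "arrow g" "arrow h" "Dom C f = Dom C g" "Cod C f = Cod C g" "Cod C g = Dom C h"
  shows "h \<bullet> (f \<boxplus> g) = h \<bullet> f \<boxplus> h \<bullet> g"
  using comp_add_right[of "Dom C f" "Cod C f" "Cod C h" f g h] assms by (simp add: plus_def arrow_mor)

lemma comp_plus_left [simp]: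
  assumes "arrow f" "arrow g" "arrow h" "Dom C f = Dom C g" "Cod C f = Cod C g" "Cod C h = Dom C g"
  shows "(f \<boxplus> g) \<bullet> h = f \<bullet> h \<boxplus> g \<bullet> h"
  using comp_add_left[of "Dom C h" "Cod C h" "Cod C f" h f g] assms by (simp add: plus_def arrow_mor)

lemma plus_ac:
  assumes "arrow f" "arrow g" "Dom C f = Dom C g" "Cod C f = Cod C g"
  shows plus_comm: "f \<boxplus> g = g \<boxplus> f"
    and plus_assoc: "\<lbrakk>arrow h; Dom C g = Dom C h; Cod C g = Cod C h\<rbrakk> \<Longrightarrow> (f \<boxplus> g) \<boxplus> h = f \<boxplus> (g \<boxplus> h)"
    and plus_lcomm: "\<lbrakk>arrow h; Dom C g = Dom C h; Cod C g = Cod C h\<rbrakk> \<Longrightarrow> f \<boxplus> (g \<boxplus> h) = g \<boxplus> (f \<boxplus> h)"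
proof -
  interpret abelian_group "Hom C (Dom C g) (Cod C g)" using hom_group assms by simp
  have m: "f \<in> mor C (Dom C g) (Cod C g)" "g \<in> mor C (Dom C g) (Cod C g)"
    using assms by (auto intro!: arrow_mor)
  show "f \<boxplus> g = g \<boxplus> f" using a_comm[OF m] assms by (simp add: plus_def)
  assume h: "arrow h" "Dom C g = Dom C h" "Cod C g = Cod C h"
  have m': "h \<in> mor C (Dom C g) (Cod C g)" using h assms by (auto intro!: arrow_mor)
  show "(f \<boxplus> g) \<boxplus> h = f \<boxplus> (g \<boxplus> h)"
  proof -
    have "(f \<boxplus> g) \<boxplus> h = (f \<boxplus> g) \<oplus>\<^bsub>Hom C (Dom C g) (Cod C g)\<^esub> h"
      using assms h by (simp add: plus_def[of "f \<boxplus> g"])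
    also have "\<dots> = (f \<oplus>\<^bsub>Hom C (Dom C g) (Cod C g)\<^esub> g) \<oplus>\<^bsub>Hom C (Dom C g) (Cod C g)\<^esub> h"
      using assms by (simp add: plus_def[of f g])
    also have "\<dots> = f \<boxplus> (g \<boxplus> h)" using a_assoc[OF m m'] assms h by (simp add: plus_def)
    finally show ?thesis .
  qed
  show "f \<boxplus> (g \<boxplus> h) = g \<boxplus> (f \<boxplus> h)"
    using m m' assms h a_lcomm[OF m m'] by (simp add: plus_def)
qed

lemma plus_null [simp]:
  assumes "arrow f" "Dom C f = A" "Cod C f = B"
  shows "f \<boxplus> null A B = f" "null A B \<boxplus> f = f"
proof -
  interpret abelian_group "Hom C A B" using hom_group assms by auto
  have m: "f \<in> mor C A B" using assms by (auto intro!: arrow_mor)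
  have "A \<in> Obj C" "B \<in> Obj C" using assms by auto
  then show "f \<boxplus> null A B = f" "null A B \<boxplus> f = f" using m assms by (simp_all add: plus_def)
qed

lemma plus_neg [simp]:
  assumes "arrow f"
  shows "f \<boxplus> neg f = null (Dom C f) (Cod C f)" "neg f \<boxplus> f = null (Dom C f) (Cod C f)"
proof -
  interpret abelian_group "Hom C (Dom C f) (Cod C f)" using hom_group assms by auto
  have m: "f \<in> mor C (Dom C f) (Cod C f)" using assms by (auto intro!: arrow_mor)
  then show "f \<boxplus> neg f = null (Dom C f) (Cod C f)" "neg f \<boxplus> f = null (Dom C f) (Cod C f)"
    using assms arrow_neg[OF assms] unfolding plus_def[of "neg f"] plus_def[of f]
    by (simp_all add: neg_def r_neg l_neg)
qed

lemma plus_cancel: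
  assumes "arrow f" "arrow g" "arrow h" "Dom C f = Dom C g" "Cod C f = Cod C g"
    "Dom C g = Dom C h" "Cod C g = Cod C h" "f \<boxplus> g = f \<boxplus> h"
  shows "g = h"
proof -
  have "neg f \<boxplus> (f \<boxplus> g) = neg f \<boxplus> (f \<boxplus> h)" using assms by simp
  then have "(neg f \<boxplus> f) \<boxplus> g = (neg f \<boxplus> f) \<boxplus> h" using assms by (simp add: plus_assoc del: plus_neg)
  then show ?thesis using assms by simp
qed

lemma null_unique:
  assumes "arrow f" "arrow g" "Dom C f = Dom C g" "Cod C f = Cod C g" "f \<boxplus> g = f"
  shows "g = null (Dom C f) (Cod C f)"
  by (rule plus_cancel[of f]) (use assms in auto)

lemma comp_null [simp]:
  assumes "arrow h"
  shows "\<lbrakk>A \<in> Obj C; Dom C h = B\<rbrakk> \<Longrightarrow> h \<bullet> null A B = null A (Cod C h)"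
    and "\<lbrakk>B \<in> Obj C; Cod C h = A\<rbrakk> \<Longrightarrow> null A B \<bullet> h = null (Dom C h) B"
proof -
  show "h \<bullet> null A B = null A (Cod C h)" if "A \<in> Obj C" "Dom C h = B"
  proof -
    have B: "B \<in> Obj C" using that assms by auto
    have "h \<bullet> null A B \<boxplus> h \<bullet> null A B = h \<bullet> (null A B \<boxplus> null A B)"
      using that assms B by (intro comp_plus_right[symmetric]) auto
    also have "\<dots> = h \<bullet> null A B" using that assms B by simp
    finally show ?thesis using null_unique[of "h \<bullet> null A B" "h \<bullet> null A B"] that assms B by simp
  qed
  show "null A B \<bullet> h = null (Dom C h) B" if "B \<in> Obj C" "Cod C h = A"
  proof -
    have A: "A \<in> Obj C" using that assms by auto
    have "null A B \<bullet> h \<boxplus> null A B \<bullet> h = (null A B \<boxplus> null A B) \<bullet> h"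
      using that assms A by (intro comp_plus_left[symmetric]) auto
    also have "\<dots> = null A B \<bullet> h" using that assms A by simp
    finally show ?thesis using null_unique[of "null A B \<bullet> h" "null A B \<bullet> h"] that assms A by simp
  qed
qed

lemma neg_unique:
  assumes "arrow f" "arrow g" "Dom C f = Dom C g" "Cod C f = Cod C g" "f \<boxplus> g = null (Dom C f) (Cod C f)"
  shows "g = neg f"
  by (rule plus_cancel[of f]) (use assms in auto)

lemma comp_neg [simp]:
  assumes "arrow f" "arrow g" "Cod C f = Dom C g"
  shows "g \<bullet> neg f = neg (g \<bullet> f)" "neg g \<bullet> f = neg (g \<bullet> f)"
proof -
  have 1: "g \<bullet> f \<boxplus> g \<bullet> neg f = null (Dom C f) (Cod C g)"
    using comp_plus_right[of f "neg f" g] assms by simp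
  have 2: "g \<bullet> f \<boxplus> neg g \<bullet> f = null (Dom C f) (Cod C g)"
    using comp_plus_left[of g "neg g" f] assms by simp
  show "g \<bullet> neg f = neg (g \<bullet> f)" "neg g \<bullet> f = neg (g \<bullet> f)"
    using 1 2 assms by (auto intro!: neg_unique)
qed

lemma neg_null [simp]: "\<lbrakk>A \<in> Obj C; B \<in> Obj C\<rbrakk> \<Longrightarrow> neg (null A B) = null A B"
  by (rule neg_unique[symmetric]) auto

text \<open>Equations between composites have to be extended on the right to act on normalized terms.\<close>

lemma reassoc:
  "\<lbrakk>g \<bullet> f = h; arrow f; arrow g; arrow k; Cod C f = Dom C g; Cod C k = Dom C f\<rbrakk> \<Longrightarrow> g \<bullet> (f \<bullet> k) = h \<bullet> k"
  by (metis comp_assoc')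

subsection \<open>Finite direct sums\<close>

text \<open>Recursion on the head of the family matches \<open>X # Xs\<close>: the
  \<open>finsum\<close> of a direct sum diagram can then be split off term by term and treated with
  the rules for arrows.\<close>

primrec hsum :: "'o \<Rightarrow> 'o \<Rightarrow> (nat \<Rightarrow> 'm) \<Rightarrow> nat \<Rightarrow> 'm" where
  "hsum A B f 0 = null A B"
| "hsum A B f (Suc n) = f 0 \<boxplus> hsum A B (\<lambda>k. f (Suc k)) n"

definition family :: "'o \<Rightarrow> 'o \<Rightarrow> (nat \<Rightarrow> 'm) \<Rightarrow> nat \<Rightarrow> bool" where
  "family A B f n \<longleftrightarrow> A \<in> Obj C \<and> B \<in> Obj C \<and> (\<forall>k<n. arrow (f k) \<and> Dom C (f k) = A \<and> Cod C (f k) = B)"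

lemma family_Suc: "family A B f (Suc n) \<longleftrightarrow>
    arrow (f 0) \<and> Dom C (f 0) = A \<and> Cod C (f 0) = B \<and> family A B (\<lambda>k. f (Suc k)) n"
  unfolding family_def using less_Suc_eq_0_disj by auto

lemma hsum_typed [simp]:
  "family A B f n \<Longrightarrow> arrow (hsum A B f n) \<and> Dom C (hsum A B f n) = A \<and> Cod C (hsum A B f n) = B"
  by (induction n arbitrary: f) (auto simp: family_Suc, auto simp: family_def)

lemma finsum_hsum:
  "family A B f n \<Longrightarrow> (\<Oplus>\<^bsub>Hom C A B\<^esub> k \<in> {..<n}. f k) = hsum A B f n"
proof (induction n arbitrary: f)
  case 0
  then interpret abelian_group "Hom C A B" using hom_group by (simp add: family_def)
  show ?case by simp
next
  case (Suc n)
  have AB: "A \<in> Obj C" "B \<in> Obj C" using Suc.prems by (auto simp: family_def)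
  interpret abelian_group "Hom C A B" using AB hom_group by simp
  have c: "f k \<in> mor C A B" if "k < Suc n" for k
    using that Suc.prems mor_iff[OF AB] by (auto simp: family_def)
  have s: "{..<Suc n} = insert 0 (Suc ` {..<n})" by (rule lessThan_Suc_eq_insert_0)
  have "(\<Oplus>\<^bsub>Hom C A B\<^esub> k \<in> {..<Suc n}. f k)
      = f 0 \<oplus>\<^bsub>Hom C A B\<^esub> (\<Oplus>\<^bsub>Hom C A B\<^esub> k \<in> Suc ` {..<n}. f k)"
    unfolding s by (rule finsum_insert) (use c in auto)
  also have "(\<Oplus>\<^bsub>Hom C A B\<^esub> k \<in> Suc ` {..<n}. f k) = (\<Oplus>\<^bsub>Hom C A B\<^esub> k \<in> {..<n}. f (Suc k))"
    by (rule finsum_reindex) (use c in auto)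
  also have "\<dots> = hsum A B (\<lambda>k. f (Suc k)) n"
    by (rule Suc.IH) (use Suc.prems in \<open>simp add: family_Suc\<close>)
  finally show ?case using Suc.prems by (simp add: plus_fold family_Suc)
qed

lemma hsum_cong: "(\<And>k. k < n \<Longrightarrow> f k = g k) \<Longrightarrow> hsum A B f n = hsum A B g n"
proof (induction n arbitrary: f g)
  case (Suc n)
  have "hsum A B (\<lambda>k. f (Suc k)) n = hsum A B (\<lambda>k. g (Suc k)) n" by (rule Suc.IH) (use Suc.prems in auto)
  then show ?case using Suc.prems by simp
qed simp

lemma comp_hsum_right:
  "\<lbrakk>family A B f n; arrow g; Dom C g = B; Cod C g = D\<rbrakk>
    \<Longrightarrow> g \<bullet> hsum A B f n = hsum A D (\<lambda>k. g \<bullet> f k) n"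
proof (induction n arbitrary: f)
  case 0 then show ?case by (auto simp: family_def)
next
  case (Suc n) then show ?case by (auto simp: family_Suc)
qed

lemma comp_hsum_left:
  "\<lbrakk>family A B f n; arrow g; Cod C g = A; Dom C g = D\<rbrakk>
    \<Longrightarrow> hsum A B f n \<bullet> g = hsum D B (\<lambda>k. f k \<bullet> g) n"
proof (induction n arbitrary: f)
  case 0 then show ?case by (auto simp: family_def)
next
  case (Suc n) then show ?case by (auto simp: family_Suc)
qed

lemma hsum_null: "\<lbrakk>A \<in> Obj C; B \<in> Obj C\<rbrakk> \<Longrightarrow> hsum A B (\<lambda>k. null A B) n = null A B"
  by (induction n) auto

lemma hsum_delta:
  "\<lbrakk>A \<in> Obj C; B \<in> Obj C; m < n; arrow (f m); Dom C (f m) = A; Cod C (f m) = B\<rbrakk>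
    \<Longrightarrow> hsum A B (\<lambda>k. if k = m then f k else null A B) n = f m"
proof (induction n arbitrary: f m)
  case (Suc n)
  show ?case
  proof (cases m)
    case 0 then show ?thesis using Suc.prems by (simp add: hsum_null)
  next
    case (Suc m')
    then have "hsum A B (\<lambda>k. if Suc k = m then f (Suc k) else null A B) n = f m"
      using Suc.IH[of m' "\<lambda>k. f (Suc k)"] Suc.prems by simp
    then show ?thesis using Suc Suc.prems by simp
  qed
qed simp

definition biprod :: "'o \<Rightarrow> 'o \<Rightarrow> 'o \<Rightarrow> 'm \<Rightarrow> 'm \<Rightarrow> 'm \<Rightarrow> 'm \<Rightarrow> bool" where
  "biprod A B S i j p q \<longleftrightarrow> A \<in> Obj C \<and> B \<in> Obj C \<and> S \<in> Obj C \<and>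
     arrow i \<and> Dom C i = A \<and> Cod C i = S \<and> arrow j \<and> Dom C j = B \<and> Cod C j = S \<and>
     arrow p \<and> Dom C p = S \<and> Cod C p = A \<and> arrow q \<and> Dom C q = S \<and> Cod C q = B \<and>
     p \<bullet> i = Ident C A \<and> q \<bullet> j = Ident C B \<and> q \<bullet> i = null A B \<and> p \<bullet> j = null B A \<and>
     i \<bullet> p \<boxplus> j \<bullet> q = Ident C S"

lemma diagram_hsum:
  assumes "set Xs \<subseteq> Obj C" "S \<in> Obj C"
    "\<And>n. n < length Xs \<Longrightarrow> i n \<in> mor C (Xs ! n) S \<and> p n \<in> mor C S (Xs ! n)"
  shows "(\<Oplus>\<^bsub>Hom C S S\<^esub> n \<in> {..<length Xs}. i n \<bullet> p n) = hsum S S (\<lambda>n. i n \<bullet> p n) (length Xs)"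
proof (rule finsum_hsum)
  have "arrow (i n) \<and> Dom C (i n) = Xs ! n \<and> Cod C (i n) = S \<and> arrow (p n) \<and> Dom C (p n) = S \<and> Cod C (p n) = Xs ! n"
    if "n < length Xs" for n
    using assms that mor_iff[of "Xs ! n" S] mor_iff[of S "Xs ! n"] nth_mem by blast
  then show "family S S (\<lambda>n. i n \<bullet> p n) (length Xs)" using assms by (simp add: family_def)
qed

lemma direct_sum_diagram_iff:
  "direct_sum_diagram C Xs S i p \<longleftrightarrow> set Xs \<subseteq> Obj C \<and> S \<in> Obj C \<and>
     (\<forall>n < length Xs. arrow (i n) \<and> Dom C (i n) = Xs ! n \<and> Cod C (i n) = S \<and>
        arrow (p n) \<and> Dom C (p n) = S \<and> Cod C (p n) = Xs ! n) \<and>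
     (\<forall>m < length Xs. \<forall>n < length Xs.
        p m \<bullet> i n = (if m = n then Ident C (Xs ! n) else null (Xs ! n) (Xs ! m))) \<and>
     hsum S S (\<lambda>n. i n \<bullet> p n) (length Xs) = Ident C S" (is "_ \<longleftrightarrow> ?R")
proof (cases "set Xs \<subseteq> Obj C \<and> S \<in> Obj C")
  case True
  define Q where "Q n \<longleftrightarrow> i n \<in> mor C (Xs ! n) S \<and> p n \<in> mor C S (Xs ! n)" for n
  have *: "Q n \<longleftrightarrow> arrow (i n) \<and> Dom C (i n) = Xs ! n \<and> Cod C (i n) = S \<and>
        arrow (p n) \<and> Dom C (p n) = S \<and> Cod C (p n) = Xs ! n" if "n < length Xs" for n
    unfolding Q_def using True that mor_iff[of "Xs ! n" S] mor_iff[of S "Xs ! n"] nth_mem by blast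
  show ?thesis
  proof (cases "\<forall>n<length Xs. Q n")
    case Q: True
    have "(\<Oplus>\<^bsub>Hom C S S\<^esub> n \<in> {..<length Xs}. i n \<bullet> p n) = hsum S S (\<lambda>n. i n \<bullet> p n) (length Xs)"
      using diagram_hsum[of Xs S i p] True Q unfolding Q_def by blast
    then show ?thesis unfolding direct_sum_diagram_def Q_def[symmetric] using * Q by simp
  next
    case False
    then show ?thesis unfolding direct_sum_diagram_def Q_def[symmetric] using * by blast
  qed
next
  case False
  then show ?thesis unfolding direct_sum_diagram_def by blast
qed

lemma biprod_diagram:
  "direct_sum_diagram C [A, B] S i p \<longleftrightarrow> biprod A B S (i 0) (i 1) (p 0) (p 1)"
proof -
  have all2: "(\<forall>n < length [A, B]. R n) \<longleftrightarrow> R 0 \<and> R 1" for R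
    by (auto simp: less_Suc_eq)
  have h: "hsum S S (\<lambda>n. i n \<bullet> p n) (length [A, B]) = i 0 \<bullet> p 0 \<boxplus> i 1 \<bullet> p 1"
    if "S \<in> Obj C" "arrow (i 1)" "arrow (p 1)" "Cod C (p 1) = Dom C (i 1)" "Dom C (p 1) = S" "Cod C (i 1) = S"
    using that by simp
  show ?thesis
  proof
    assume "direct_sum_diagram C [A, B] S i p"
    note d = this[unfolded direct_sum_diagram_iff all2]
    have "hsum S S (\<lambda>n. i n \<bullet> p n) (length [A, B]) = i 0 \<bullet> p 0 \<boxplus> i 1 \<bullet> p 1" by (rule h) (use d in auto)
    with d have "i 0 \<bullet> p 0 \<boxplus> i 1 \<bullet> p 1 = Ident C S" by metis
    then show "biprod A B S (i 0) (i 1) (p 0) (p 1)" using d unfolding biprod_def by simp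
  next
    assume b: "biprod A B S (i 0) (i 1) (p 0) (p 1)"
    then have "hsum S S (\<lambda>n. i n \<bullet> p n) (length [A, B]) = Ident C S"
      using h unfolding biprod_def by simp
    with b show "direct_sum_diagram C [A, B] S i p"
      unfolding direct_sum_diagram_iff all2 biprod_def by simp
  qed
qed

lemma is_direct_sum_Nil: "is_direct_sum C [] S \<longleftrightarrow> is_zero_object C S"
  by (auto simp: is_direct_sum_def direct_sum_diagram_iff is_zero_object_def)

lemma is_direct_sum_two: "is_direct_sum C [A, B] S \<longleftrightarrow> (\<exists>i j p q. biprod A B S i j p q)"
proof
  assume "\<exists>i j p q. biprod A B S i j p q"
  then obtain i j p q where "biprod A B S i j p q" by blast
  then have "direct_sum_diagram C [A, B] S (\<lambda>n. if n = 0 then i else j) (\<lambda>n. if n = 0 then p else q)"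
    by (simp add: biprod_diagram)
  then show "is_direct_sum C [A, B] S" by (auto simp: is_direct_sum_def)
qed (auto simp: is_direct_sum_def biprod_diagram)

lemma biprod_swap: "biprod A B S i j p q \<Longrightarrow> biprod B A S j i q p"
  unfolding biprod_def by (auto simp: plus_comm[of "j \<bullet> q" "i \<bullet> p"])

lemma direct_sum_swap: "is_direct_sum C [A, B] S \<Longrightarrow> is_direct_sum C [B, A] S"
  using biprod_swap unfolding is_direct_sum_two by blast

lemma direct_sum_ConsI:
  assumes "is_direct_sum C Xs S'" "is_direct_sum C [X, S'] S"
  shows "is_direct_sum C (X # Xs) S"
proof -
  obtain i' p' where d: "direct_sum_diagram C Xs S' i' p'" using assms by (auto simp: is_direct_sum_def)
  obtain i j p q where b: "biprod X S' S i j p q" using assms by (auto simp: is_direct_sum_two)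
  note dd = d[unfolded direct_sum_diagram_iff]
  note bb = b[unfolded biprod_def]
  define I where "I n = (case n of 0 \<Rightarrow> i | Suc m \<Rightarrow> j \<bullet> i' m)" for n
  define P where "P n = (case n of 0 \<Rightarrow> p | Suc m \<Rightarrow> p' m \<bullet> q)" for n
  have IS[simp]: "I 0 = i" "P 0 = p" "I (Suc n) = j \<bullet> i' n" "P (Suc n) = p' n \<bullet> q" for n
    by (auto simp: I_def P_def)
  have ty: "arrow (i' n)" "Dom C (i' n) = Xs ! n" "Cod C (i' n) = S'"
        "arrow (p' n)" "Dom C (p' n) = S'" "Cod C (p' n) = Xs ! n" "Xs ! n \<in> Obj C" if "n < length Xs" for n
    using that dd nth_mem by blast+
  have e: "p' m \<bullet> i' n = (if m = n then Ident C (Xs ! n) else null (Xs ! n) (Xs ! m))"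
    if "m < length Xs" "n < length Xs" for m n using that dd by blast
  have h: "hsum S S (\<lambda>n. (j \<bullet> i' n) \<bullet> (p' n \<bullet> q)) (length Xs) = j \<bullet> q"
  proof -
    have f: "family S' S' (\<lambda>n. i' n \<bullet> p' n) (length Xs)" using ty bb by (auto simp: family_def)
    have f2: "family S S' (\<lambda>n. (i' n \<bullet> p' n) \<bullet> q) (length Xs)" using ty bb by (auto simp: family_def)
    have "j \<bullet> q = j \<bullet> (hsum S' S' (\<lambda>n. i' n \<bullet> p' n) (length Xs) \<bullet> q)" using dd bb by simp
    also have "\<dots> = j \<bullet> hsum S S' (\<lambda>n. (i' n \<bullet> p' n) \<bullet> q) (length Xs)"
      using comp_hsum_left[OF f, of q S] bb by simp
    also have "\<dots> = hsum S S (\<lambda>n. j \<bullet> ((i' n \<bullet> p' n) \<bullet> q)) (length Xs)"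
      using comp_hsum_right[OF f2, of j S] bb by simp
    also have "\<dots> = hsum S S (\<lambda>n. (j \<bullet> i' n) \<bullet> (p' n \<bullet> q)) (length Xs)"
      by (rule hsum_cong) (use ty bb in simp)
    finally show ?thesis by simp
  qed
  have nj: "q \<bullet> (j \<bullet> k) = k" "p \<bullet> (j \<bullet> k) = null (Dom C k) X" if "arrow k" "Cod C k = S'" for k
    using reassoc[of q j "Ident C S'" k] reassoc[of p j "null S' X" k] bb that by auto
  have tb: "arrow i" "Dom C i = X" "Cod C i = S" "arrow p" "Dom C p = S" "Cod C p = X"
    "arrow j" "Dom C j = S'" "Cod C j = S" "arrow q" "Dom C q = S" "Cod C q = S'"
    "X \<in> Obj C" "S' \<in> Obj C" "S \<in> Obj C"
    and eb: "p \<bullet> i = Ident C X" "q \<bullet> i = null X S'" "i \<bullet> p \<boxplus> j \<bullet> q = Ident C S"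
    using bb by auto
  have pi: "P m \<bullet> I n = (if m = n then Ident C ((X # Xs) ! n) else null ((X # Xs) ! n) ((X # Xs) ! m))"
    if m: "m < length (X # Xs)" and n: "n < length (X # Xs)" for m n
  proof (cases m)
    case 0 then show ?thesis using tb eb ty n nj by (cases n) simp_all
  next
    case (Suc m')
    then show ?thesis using tb eb ty m n nj e by (cases n) simp_all
  qed
  have tI: "arrow (I n) \<and> Dom C (I n) = (X # Xs) ! n \<and> Cod C (I n) = S \<and> arrow (P n) \<and> Dom C (P n) = S \<and>
      Cod C (P n) = (X # Xs) ! n" if n: "n < length (X # Xs)" for n
    using tb ty n by (cases n) simp_all
  have "direct_sum_diagram C (X # Xs) S I P"
    unfolding direct_sum_diagram_iff using pi tI tb eb h dd by simp
  then show ?thesis by (auto simp: is_direct_sum_def)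
qed

text \<open>The tail of the big diagram is itself a sum diagram for \<open>Xs\<close>; comparing it
  componentwise with the given sum \<open>S'\<close> supplies the second injection and
  projection.\<close>

lemma direct_sum_ConsD:
  assumes "is_direct_sum C (X # Xs) S" "is_direct_sum C Xs S'"
  shows "is_direct_sum C [X, S'] S"
proof -
  obtain i' p' where d': "direct_sum_diagram C Xs S' i' p'" using assms by (auto simp: is_direct_sum_def)
  obtain i p where d: "direct_sum_diagram C (X # Xs) S i p" using assms by (auto simp: is_direct_sum_def)
  note dd' = d'[unfolded direct_sum_diagram_iff]
  note dd = d[unfolded direct_sum_diagram_iff]
  let ?l = "length Xs"
  have ty': "arrow (i' n)" "Dom C (i' n) = Xs ! n" "Cod C (i' n) = S'"
        "arrow (p' n)" "Dom C (p' n) = S'" "Cod C (p' n) = Xs ! n" "Xs ! n \<in> Obj C" if "n < ?l" for n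
    using that dd' nth_mem by blast+
  have ty: "arrow (i 0)" "Dom C (i 0) = X" "Cod C (i 0) = S"
        "arrow (p 0)" "Dom C (p 0) = S" "Cod C (p 0) = X" "X \<in> Obj C" using dd by force+
  have tyS: "arrow (i (Suc n))" "Dom C (i (Suc n)) = Xs ! n" "Cod C (i (Suc n)) = S"
        "arrow (p (Suc n))" "Dom C (p (Suc n)) = S" "Cod C (p (Suc n)) = Xs ! n" if "n < ?l" for n
    using that dd by force+
  have SS: "S \<in> Obj C" "S' \<in> Obj C" using dd dd' by auto
  have e': "p' m \<bullet> i' n = (if m = n then Ident C (Xs ! n) else null (Xs ! n) (Xs ! m))"
    if "m < ?l" "n < ?l" for m n using that dd' by blast
  have ee: "p m \<bullet> i n = (if m = n then Ident C ((X # Xs) ! n) else null ((X # Xs) ! n) ((X # Xs) ! m))"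
    if "m < Suc ?l" "n < Suc ?l" for m n using that dd by simp
  have e: "p (Suc m) \<bullet> i (Suc n) = (if m = n then Ident C (Xs ! n) else null (Xs ! n) (Xs ! m))"
    if "m < ?l" "n < ?l" for m n using that ee[of "Suc m" "Suc n"] by simp
  have e0: "p 0 \<bullet> i (Suc n) = null (Xs ! n) X" "p (Suc n) \<bullet> i 0 = null X (Xs ! n)" if "n < ?l" for n
    using that ee[of 0 "Suc n"] ee[of "Suc n" 0] by simp_all
  have e00: "p 0 \<bullet> i 0 = Ident C X" using ee[of 0 0] by simp
  \<comment> \<open>\<open>j\<close> and \<open>q\<close> match the copy of the tail inside
    \<open>S\<close> with \<open>S'\<close>: include by one diagram after projecting by the other,
    and add up. They are determined by \<open>pj\<close> and \<open>pq\<close> below.\<close>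
  define j where "j = hsum S' S (\<lambda>n. i (Suc n) \<bullet> p' n) ?l"
  define q where "q = hsum S S' (\<lambda>n. i' n \<bullet> p (Suc n)) ?l"
  have fj: "family S' S (\<lambda>n. i (Suc n) \<bullet> p' n) ?l" and fq: "family S S' (\<lambda>n. i' n \<bullet> p (Suc n)) ?l"
    using ty' tyS SS by (auto simp: family_def)
  have jq: "arrow j" "Dom C j = S'" "Cod C j = S" "arrow q" "Dom C q = S" "Cod C q = S'"
    using hsum_typed[OF fj] hsum_typed[OF fq] by (auto simp: j_def q_def)
  have pj: "p (Suc m) \<bullet> j = p' m" if m: "m < ?l" for m
  proof -
    have "p (Suc m) \<bullet> j = hsum S' (Xs ! m) (\<lambda>n. p (Suc m) \<bullet> (i (Suc n) \<bullet> p' n)) ?l"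
      unfolding j_def by (rule comp_hsum_right[OF fj]) (use tyS m in auto)
    also have "\<dots> = hsum S' (Xs ! m) (\<lambda>n. if n = m then p' n else null S' (Xs ! m)) ?l"
    proof (rule hsum_cong)
      fix k assume k: "k < ?l"
      have "p (Suc m) \<bullet> (i (Suc k) \<bullet> p' k) = (p (Suc m) \<bullet> i (Suc k)) \<bullet> p' k"
        using k m tyS ty' by simp
      then show "p (Suc m) \<bullet> (i (Suc k) \<bullet> p' k) = (if k = m then p' k else null S' (Xs ! m))"
        using k m tyS ty' by (simp add: e)
    qed
    also have "\<dots> = p' m" by (rule hsum_delta) (use m ty' SS in auto)
    finally show ?thesis .
  qed
  have pq: "p' m \<bullet> q = p (Suc m)" if m: "m < ?l" for m
  proof -
    have "p' m \<bullet> q = hsum S (Xs ! m) (\<lambda>n. p' m \<bullet> (i' n \<bullet> p (Suc n))) ?l"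
      unfolding q_def by (rule comp_hsum_right[OF fq]) (use ty' m in auto)
    also have "\<dots> = hsum S (Xs ! m) (\<lambda>n. if n = m then p (Suc n) else null S (Xs ! m)) ?l"
    proof (rule hsum_cong)
      fix k assume k: "k < ?l"
      have "p' m \<bullet> (i' k \<bullet> p (Suc k)) = (p' m \<bullet> i' k) \<bullet> p (Suc k)"
        using k m tyS ty' by simp
      then show "p' m \<bullet> (i' k \<bullet> p (Suc k)) = (if k = m then p (Suc k) else null S (Xs ! m))"
        using k m tyS ty' by (simp add: e')
    qed
    also have "\<dots> = p (Suc m)" by (rule hsum_delta[where f = "\<lambda>n. p (Suc n)"]) (use m tyS ty' SS in auto)
    finally show ?thesis .
  qed
  have qj: "q \<bullet> j = Ident C S'"
  proof -
    have "q \<bullet> j = hsum S' S' (\<lambda>n. (i' n \<bullet> p (Suc n)) \<bullet> j) ?l"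
      unfolding q_def by (rule comp_hsum_left[OF fq]) (use jq in auto)
    also have "\<dots> = hsum S' S' (\<lambda>n. i' n \<bullet> p' n) ?l"
      by (rule hsum_cong) (use jq ty' tyS pj in simp)
    finally show ?thesis using dd' by simp
  qed
  have jq': "j \<bullet> q = hsum S S (\<lambda>n. i (Suc n) \<bullet> p (Suc n)) ?l"
  proof -
    have "j \<bullet> q = hsum S S (\<lambda>n. (i (Suc n) \<bullet> p' n) \<bullet> q) ?l"
      unfolding j_def by (rule comp_hsum_left[OF fj]) (use jq in auto)
    also have "\<dots> = hsum S S (\<lambda>n. i (Suc n) \<bullet> p (Suc n)) ?l"
      by (rule hsum_cong) (use jq ty' tyS pq in simp)
    finally show ?thesis .
  qed
  have qi: "q \<bullet> i 0 = null X S'"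
  proof -
    have "q \<bullet> i 0 = hsum X S' (\<lambda>n. (i' n \<bullet> p (Suc n)) \<bullet> i 0) ?l"
      unfolding q_def by (rule comp_hsum_left[OF fq]) (use ty in auto)
    also have "\<dots> = hsum X S' (\<lambda>n. null X S') ?l"
      by (rule hsum_cong) (use ty ty' tyS e0 in simp)
    finally show ?thesis using hsum_null ty SS by simp
  qed
  have pj0: "p 0 \<bullet> j = null S' X"
  proof -
    have "p 0 \<bullet> j = hsum S' X (\<lambda>n. p 0 \<bullet> (i (Suc n) \<bullet> p' n)) ?l"
      unfolding j_def by (rule comp_hsum_right[OF fj]) (use ty in auto)
    also have "\<dots> = hsum S' X (\<lambda>n. null S' X) ?l"
    proof (rule hsum_cong)
      fix k assume k: "k < ?l"
      show "p 0 \<bullet> (i (Suc k) \<bullet> p' k) = null S' X"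
        using k reassoc[OF e0(1)[OF k], of "p' k"] ty ty' tyS by simp
    qed
    finally show ?thesis using hsum_null ty SS by simp
  qed
  have "biprod X S' S (i 0) j (p 0) q"
    unfolding biprod_def using ty SS jq qj pj0 qi e00 jq' dd by simp
  then show ?thesis by (auto simp: is_direct_sum_two)
qed

end


section \<open>Krull-Schmidt categories\<close>

context preadditive_category
begin

lemma is_iso_iff:
  "\<lbrakk>X \<in> Obj C; Y \<in> Obj C\<rbrakk> \<Longrightarrow> is_iso C X Y f \<longleftrightarrow> arrow f \<and> Dom C f = X \<and> Cod C f = Y \<and>
    (\<exists>g. arrow g \<and> Dom C g = Y \<and> Cod C g = X \<and> g \<bullet> f = Ident C X \<and> f \<bullet> g = Ident C Y)"
  by (auto simp: is_iso_def Bex_def mor_iff)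

text \<open>A summand without a chosen complement. In the Krull-Schmidt case subcategories are
  closed under retracts as well, see \<open>subcategory_retract\<close>.\<close>

definition retract :: "'o \<Rightarrow> 'o \<Rightarrow> bool" where
  "retract X S \<longleftrightarrow> (\<exists>s r. arrow s \<and> Dom C s = X \<and> Cod C s = S \<and> arrow r \<and> Dom C r = S \<and> Cod C r = X \<and>
     r \<bullet> s = Ident C X)"

definition isomorphic :: "'o \<Rightarrow> 'o \<Rightarrow> bool" where
  "isomorphic X Y \<longleftrightarrow> X \<in> Obj C \<and> Y \<in> Obj C \<and> (\<exists>f. is_iso C X Y f)"

lemma retractI:
  "\<lbrakk>r \<bullet> s = Ident C X; arrow s; Dom C s = X; Cod C s = S; arrow r; Dom C r = S; Cod C r = X\<rbrakk> \<Longrightarrow> retract X S"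
  unfolding retract_def by blast

lemma retractE:
  assumes "retract X S"
  obtains s r where "arrow s" "Dom C s = X" "Cod C s = S" "arrow r" "Dom C r = S" "Cod C r = X" "r \<bullet> s = Ident C X"
  using assms unfolding retract_def by blast

lemma is_isoI:
  "\<lbrakk>g \<bullet> f = Ident C X; f \<bullet> g = Ident C Y; arrow f; Dom C f = X; Cod C f = Y; arrow g; Dom C g = Y; Cod C g = X\<rbrakk>
    \<Longrightarrow> is_iso C X Y f"
  using is_iso_iff[of X Y f] arrow_obj by blast

lemma is_iso_ident: "X \<in> Obj C \<Longrightarrow> is_iso C X X (Ident C X)"
  by (rule is_isoI[of "Ident C X"]) simp_all

lemma isomorphicI:
  "\<lbrakk>g \<bullet> f = Ident C X; f \<bullet> g = Ident C Y; arrow f; Dom C f = X; Cod C f = Y; arrow g; Dom C g = Y; Cod C g = X\<rbrakk>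
    \<Longrightarrow> isomorphic X Y"
  unfolding isomorphic_def using is_isoI[of g f X Y] arrow_obj by blast

lemma isomorphicE:
  assumes "isomorphic X Y"
  obtains f g where "arrow f" "Dom C f = X" "Cod C f = Y" "arrow g" "Dom C g = Y" "Cod C g = X"
    "g \<bullet> f = Ident C X" "f \<bullet> g = Ident C Y"
  using assms unfolding isomorphic_def using is_iso_iff by metis

lemma retract_obj: "retract X S \<Longrightarrow> X \<in> Obj C \<and> S \<in> Obj C"
  unfolding retract_def using arrow_obj by metis

lemma retract_refl: "X \<in> Obj C \<Longrightarrow> retract X X"
  unfolding retract_def by (intro exI[of _ "Ident C X"]) simp

lemma retract_trans:
  assumes "retract X Y" "retract Y Z" shows "retract X Z"
proof -
  obtain s r where a: "arrow s" "Dom C s = X" "Cod C s = Y" "arrow r" "Dom C r = Y" "Cod C r = X" "r \<bullet> s = Ident C X"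
    using assms(1) by (rule retractE)
  obtain s' r' where b: "arrow s'" "Dom C s' = Y" "Cod C s' = Z" "arrow r'" "Dom C r' = Z" "Cod C r' = Y" "r' \<bullet> s' = Ident C Y"
    using assms(2) by (rule retractE)
  have "(r \<bullet> r') \<bullet> (s' \<bullet> s) = Ident C X" using a b by (simp add: reassoc[OF b(7)])
  then show ?thesis unfolding retract_def using a b by (intro exI[of _ "s' \<bullet> s"] exI[of _ "r \<bullet> r'"]) simp
qed

lemma isomorphic_sym: "isomorphic X Y \<Longrightarrow> isomorphic Y X"
  by (erule isomorphicE) (rule isomorphicI; assumption)

lemma isomorphic_retract: "isomorphic X Y \<Longrightarrow> retract X Y"
  by (erule isomorphicE) (rule retractI; assumption)

lemma isomorphic_refl: "X \<in> Obj C \<Longrightarrow> isomorphic X X"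
  by (rule isomorphicI[of "Ident C X" "Ident C X"]) simp_all

lemma biprod_retract:
  assumes "biprod A B S i j p q" shows "retract A S" "retract B S"
  using assms unfolding biprod_def retract_def by metis+

lemma direct_sum_retract:
  assumes "is_direct_sum C [A, B] S" shows "retract A S" "retract B S"
  using assms biprod_retract unfolding is_direct_sum_two by blast+

lemma direct_sum_obj: "is_direct_sum C Xs S \<Longrightarrow> S \<in> Obj C \<and> set Xs \<subseteq> Obj C"
  by (auto simp: is_direct_sum_def direct_sum_diagram_def)

lemma zero_object_biprod:
  assumes "is_zero_object C Z" "X \<in> Obj C"
  shows "biprod X Z X (Ident C X) (null Z X) (Ident C X) (null X Z)"
  using assms unfolding biprod_def is_zero_object_def by simp

lemma direct_sum_zero:
  assumes "is_zero_object C Z" "X \<in> Obj C" shows "is_direct_sum C [X, Z] X"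
  using zero_object_biprod[OF assms] is_direct_sum_two by blast

lemma direct_sum_cong:
  assumes "is_direct_sum C Xs S" "isomorphic S S'" shows "is_direct_sum C Xs S'"
proof -
  obtain i p where d: "direct_sum_diagram C Xs S i p" using assms by (auto simp: is_direct_sum_def)
  obtain f g where f: "arrow f" "Dom C f = S" "Cod C f = S'" "arrow g" "Dom C g = S'" "Cod C g = S"
    "g \<bullet> f = Ident C S" "f \<bullet> g = Ident C S'" using assms(2) by (rule isomorphicE)
  note dd = d[unfolded direct_sum_diagram_iff]
  have O: "S \<in> Obj C" "S' \<in> Obj C" using f by auto
  have ty: "arrow (i n)" "Dom C (i n) = Xs ! n" "Cod C (i n) = S"
        "arrow (p n)" "Dom C (p n) = S" "Cod C (p n) = Xs ! n" "Xs ! n \<in> Obj C" if "n < length Xs" for n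
    using that dd nth_mem by blast+
  have fam: "family S S (\<lambda>n. i n \<bullet> p n) (length Xs)" using ty O by (auto simp: family_def)
  have fam2: "family S' S (\<lambda>n. (i n \<bullet> p n) \<bullet> g) (length Xs)" using ty O f by (auto simp: family_def)
  have h: "hsum S' S' (\<lambda>n. (f \<bullet> i n) \<bullet> (p n \<bullet> g)) (length Xs) = Ident C S'"
  proof -
    have "hsum S' S' (\<lambda>n. (f \<bullet> i n) \<bullet> (p n \<bullet> g)) (length Xs) = hsum S' S' (\<lambda>n. f \<bullet> ((i n \<bullet> p n) \<bullet> g)) (length Xs)"
      by (rule hsum_cong) (use ty f in simp)
    also have "\<dots> = f \<bullet> hsum S' S (\<lambda>n. (i n \<bullet> p n) \<bullet> g) (length Xs)"
      using comp_hsum_right[OF fam2, of f S'] f by simp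
    also have "\<dots> = f \<bullet> (hsum S S (\<lambda>n. i n \<bullet> p n) (length Xs) \<bullet> g)"
      using comp_hsum_left[OF fam, of g S'] f by simp
    also have "\<dots> = Ident C S'" using dd f by simp
    finally show ?thesis .
  qed
  have "direct_sum_diagram C Xs S' (\<lambda>n. f \<bullet> i n) (\<lambda>n. p n \<bullet> g)"
    unfolding direct_sum_diagram_iff
  proof (intro conjI allI impI)
    fix m n assume mn: "m < length Xs" "n < length Xs"
    have "(p m \<bullet> g) \<bullet> (f \<bullet> i n) = p m \<bullet> i n" using ty mn f by (simp add: reassoc[OF f(7)])
    then show "(p m \<bullet> g) \<bullet> (f \<bullet> i n) = (if m = n then Ident C (Xs ! n) else null (Xs ! n) (Xs ! m))"
      using mn dd by simp
  qed (use dd O h ty f in auto)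
  then show ?thesis by (auto simp: is_direct_sum_def)
qed

lemma direct_sum_unique:
  assumes "is_direct_sum C [A, B] S" "is_direct_sum C [A, B] S'" shows "isomorphic S S'"
proof -
  obtain i j p q where a: "biprod A B S i j p q" using assms by (auto simp: is_direct_sum_two)
  obtain i' j' p' q' where b: "biprod A B S' i' j' p' q'" using assms by (auto simp: is_direct_sum_two)
  note a' = a[unfolded biprod_def] and b' = b[unfolded biprod_def]
  have e: "p \<bullet> i = Ident C A" "q \<bullet> j = Ident C B" "q \<bullet> i = null A B" "p \<bullet> j = null B A"
    "p' \<bullet> i' = Ident C A" "q' \<bullet> j' = Ident C B" "q' \<bullet> i' = null A B" "p' \<bullet> j' = null B A" using a' b' by auto
  have "(i \<bullet> p' \<boxplus> j \<bullet> q') \<bullet> (i' \<bullet> p \<boxplus> j' \<bullet> q) = Ident C S"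
    "(i' \<bullet> p \<boxplus> j' \<bullet> q) \<bullet> (i \<bullet> p' \<boxplus> j \<bullet> q') = Ident C S'"
    using a' b' by (simp_all add: e[THEN reassoc])
  then show ?thesis by (rule isomorphicI) (use a' b' in simp_all)
qed

lemma direct_sum_assoc:
  assumes "is_direct_sum C [X, A'] A" "is_direct_sum C [A, B] S" "is_direct_sum C [A', B] S'"
  shows "is_direct_sum C [X, S'] S"
proof -
  obtain i j p q where a: "biprod X A' A i j p q" using assms by (auto simp: is_direct_sum_two)
  obtain I J P Q where b: "biprod A B S I J P Q" using assms by (auto simp: is_direct_sum_two)
  obtain k l r t where c: "biprod A' B S' k l r t" using assms by (auto simp: is_direct_sum_two)
  note a' = a[unfolded biprod_def] and b' = b[unfolded biprod_def] and c' = c[unfolded biprod_def]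
  have e: "p \<bullet> i = Ident C X" "q \<bullet> j = Ident C A'" "q \<bullet> i = null X A'" "p \<bullet> j = null A' X"
    "P \<bullet> I = Ident C A" "Q \<bullet> J = Ident C B" "Q \<bullet> I = null A B" "P \<bullet> J = null B A"
    "r \<bullet> k = Ident C A'" "t \<bullet> l = Ident C B" "t \<bullet> k = null A' B" "r \<bullet> l = null B A'"
    and s: "i \<bullet> p \<boxplus> j \<bullet> q = Ident C A" "I \<bullet> P \<boxplus> J \<bullet> Q = Ident C S" "k \<bullet> r \<boxplus> l \<bullet> t = Ident C S'"
    using a' b' c' by auto
  have "I \<bullet> (i \<bullet> (p \<bullet> P)) \<boxplus> I \<bullet> (j \<bullet> (q \<bullet> P)) = I \<bullet> P"
  proof -
    have "P = i \<bullet> (p \<bullet> P) \<boxplus> j \<bullet> (q \<bullet> P)"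
      using a' b' comp_plus_left[of "i \<bullet> p" "j \<bullet> q" P] by simp
    then have "I \<bullet> P = I \<bullet> (i \<bullet> (p \<bullet> P) \<boxplus> j \<bullet> (q \<bullet> P))" by simp
    then show ?thesis using a' b' by simp
  qed
  then have t: "I \<bullet> (i \<bullet> (p \<bullet> P)) \<boxplus> (I \<bullet> (j \<bullet> (q \<bullet> P)) \<boxplus> J \<bullet> Q) = Ident C S"
    using a' b' s plus_assoc[of "I \<bullet> (i \<bullet> (p \<bullet> P))" "I \<bullet> (j \<bullet> (q \<bullet> P))" "J \<bullet> Q"] by simp
  have "biprod X S' S (I \<bullet> i) (I \<bullet> (j \<bullet> r) \<boxplus> J \<bullet> t) (p \<bullet> P) (k \<bullet> (q \<bullet> P) \<boxplus> l \<bullet> Q)"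
    unfolding biprod_def using a' b' c' by (simp add: e[THEN reassoc] t)
  then show ?thesis using is_direct_sum_two by blast
qed

text \<open>Defined from above, so that a property passes from \<open>S\<close> to the hull as soon
  as the objects having it form a subcategory; the closure arguments below use
  \<open>hull_least\<close> in this way.\<close>

definition add_hull :: "'o set \<Rightarrow> 'o set" where
  "add_hull S = {M \<in> Obj C. \<forall>U. subcategory C U \<and> S \<inter> Obj C \<subseteq> U \<longrightarrow> M \<in> U}"

definition local :: "'o \<Rightarrow> bool" where
  "local X \<longleftrightarrow> X \<in> Obj C \<and> local_endomorphism_ring C X"

end

context additive_category
begin

lemma two_sum_exists: "\<lbrakk>A \<in> Obj C; B \<in> Obj C\<rbrakk> \<Longrightarrow> \<exists>S. is_direct_sum C [A, B] S"
  using direct_sums[of "[A, B]"] by simp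

lemma zero_exists: "\<exists>Z. is_zero_object C Z"
  using direct_sums[of "[]"] by (simp add: is_direct_sum_Nil)

lemma direct_sum_ConsE:
  assumes "is_direct_sum C (X # Xs) S"
  obtains S' where "is_direct_sum C Xs S'" "is_direct_sum C [X, S'] S"
proof -
  obtain S' where "is_direct_sum C Xs S'" using direct_sums direct_sum_obj[OF assms] by auto
  then show ?thesis using that direct_sum_ConsD[OF assms] by blast
qed

lemma direct_sum_single: "X \<in> Obj C \<Longrightarrow> is_direct_sum C [X] X"
  using zero_exists direct_sum_zero direct_sum_ConsI is_direct_sum_Nil by metis

lemma direct_sum_append:
  "\<lbrakk>is_direct_sum C Xs A; is_direct_sum C Ys B; is_direct_sum C [A, B] S\<rbrakk> \<Longrightarrow> is_direct_sum C (Xs @ Ys) S"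
proof (induction Xs arbitrary: A S)
  case Nil
  have "is_direct_sum C [B, A] B" using Nil direct_sum_obj by (simp add: is_direct_sum_Nil direct_sum_zero)
  then have "isomorphic B S" using Nil direct_sum_swap direct_sum_unique by blast
  then show ?case using Nil direct_sum_cong by simp
next
  case (Cons X Xs)
  obtain A' where A': "is_direct_sum C Xs A'" "is_direct_sum C [X, A'] A"
    using Cons.prems(1) by (rule direct_sum_ConsE)
  obtain S' where S': "is_direct_sum C [A', B] S'"
    using two_sum_exists[of A' B] A' Cons.prems(2) direct_sum_obj by blast
  have "is_direct_sum C [X, S'] S" using direct_sum_assoc A' Cons.prems S' by blast
  moreover have "is_direct_sum C (Xs @ Ys) S'" using Cons.IH A' Cons.prems S' by blast
  ultimately show ?case using direct_sum_ConsI by simp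
qed

section \<open>Closure properties of subcategories and hulls\<close>

lemma subcategory_obj: "\<lbrakk>subcategory C U; X \<in> U\<rbrakk> \<Longrightarrow> X \<in> Obj C"
  unfolding subcategory_def by blast

lemma subcategory_iso:
  assumes "subcategory C U" "X \<in> U" "isomorphic X Y" shows "Y \<in> U"
proof -
  obtain f where "Y \<in> Obj C" "is_iso C X Y f" using assms(3) unfolding isomorphic_def by blast
  then show ?thesis using assms(1,2) unfolding subcategory_def by blast
qed

lemma subcategory_sum: "\<lbrakk>subcategory C U; set Xs \<subseteq> U; is_direct_sum C Xs S\<rbrakk> \<Longrightarrow> S \<in> U"
  unfolding subcategory_def by blast

lemma subcategory_sum2: "\<lbrakk>subcategory C U; X \<in> U; Y \<in> U; is_direct_sum C [X, Y] S\<rbrakk> \<Longrightarrow> S \<in> U"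
  using subcategory_sum[of U "[X, Y]" S] by simp

lemma subcategory_zero: "\<lbrakk>subcategory C U; is_zero_object C Z\<rbrakk> \<Longrightarrow> Z \<in> U"
  using subcategory_sum[of U "[]" Z] by (simp add: is_direct_sum_Nil)

lemma subcategory_summand:
  assumes "subcategory C U" "S \<in> U" "is_direct_sum C [X, Y] S" shows "X \<in> U" "Y \<in> U"
proof -
  have *: "\<And>X Y. is_direct_sum C [X, Y] S \<Longrightarrow> X \<in> U" using assms(1,2) unfolding subcategory_def by blast
  show "X \<in> U" "Y \<in> U" by (rule *[OF assms(3)], rule *[OF direct_sum_swap[OF assms(3)]])
qed

lemma subcategory_summands:
  "\<lbrakk>subcategory C U; S \<in> U; is_direct_sum C Xs S\<rbrakk> \<Longrightarrow> set Xs \<subseteq> U"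
proof (induction Xs arbitrary: S)
  case (Cons X Xs)
  obtain S' where S': "is_direct_sum C Xs S'" "is_direct_sum C [X, S'] S"
    using Cons.prems(3) by (rule direct_sum_ConsE)
  have "X \<in> U" "S' \<in> U" using subcategory_summand[OF Cons.prems(1,2) S'(2)] by auto
  then show ?case using Cons.IH[OF Cons.prems(1) _ S'(1)] by simp
qed simp

lemma direct_sum_retract_list: "\<lbrakk>is_direct_sum C Xs S; X \<in> set Xs\<rbrakk> \<Longrightarrow> retract X S"
proof (induction Xs arbitrary: S)
  case (Cons Y Xs)
  obtain S' where S': "is_direct_sum C Xs S'" "is_direct_sum C [Y, S'] S"
    using Cons.prems(1) by (rule direct_sum_ConsE)
  show ?case
  proof (cases "X = Y")
    case True then show ?thesis using direct_sum_retract(1)[OF S'(2)] by simp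
  next
    case False
    then have "retract X S'" using Cons.IH[OF S'(1)] Cons.prems by simp
    then show ?thesis by (rule retract_trans[OF _ direct_sum_retract(2)[OF S'(2)]])
  qed
qed simp

lemma subcategoryI:
  assumes "U \<subseteq> Obj C" "\<And>X S. \<lbrakk>retract X S; S \<in> U\<rbrakk> \<Longrightarrow> X \<in> U"
    "\<And>Z. is_zero_object C Z \<Longrightarrow> Z \<in> U"
    "\<And>A B S. \<lbrakk>A \<in> U; B \<in> U; is_direct_sum C [A, B] S\<rbrakk> \<Longrightarrow> S \<in> U"
  shows "subcategory C U"
  unfolding subcategory_def
proof (intro conjI allI impI)
  fix Xs S assume "set Xs \<subseteq> U \<and> is_direct_sum C Xs S"
  then have "set Xs \<subseteq> U" "is_direct_sum C Xs S" by auto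
  then show "S \<in> U"
  proof (induction Xs arbitrary: S)
    case Nil then show ?case using assms(3) by (simp add: is_direct_sum_Nil)
  next
    case (Cons X Xs)
    obtain S' where S': "is_direct_sum C Xs S'" "is_direct_sum C [X, S'] S"
      using Cons.prems(2) by (rule direct_sum_ConsE)
    have "X \<in> U" "S' \<in> U" using Cons.IH[OF _ S'(1)] Cons.prems(1) by auto
    then show ?case by (rule assms(4)[OF _ _ S'(2)])
  qed
next
  fix X Y f assume a: "X \<in> U \<and> Y \<in> Obj C \<and> is_iso C X Y f"
  then have "isomorphic X Y" using assms(1) unfolding isomorphic_def by blast
  then have "retract Y X" by (rule isomorphic_retract[OF isomorphic_sym])
  then show "Y \<in> U" by (rule assms(2)) (use a in blast)
next
  fix X Y S assume a: "S \<in> U \<and> is_direct_sum C [X, Y] S"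
  show "X \<in> U" by (rule assms(2)[of _ S]) (use a direct_sum_retract(1) in blast)+
qed (rule assms(1))

lemma hull_subcategory: "subcategory C (add_hull S)"
  unfolding subcategory_def
proof (intro conjI allI impI)
  fix X Y f assume a: "X \<in> add_hull S \<and> Y \<in> Obj C \<and> is_iso C X Y f"
  then have i: "isomorphic X Y" by (auto simp: isomorphic_def add_hull_def)
  have "Y \<in> U" if "subcategory C U \<and> S \<inter> Obj C \<subseteq> U" for U
    by (rule subcategory_iso[OF _ _ i]) (use a that in \<open>auto simp: add_hull_def\<close>)
  then show "Y \<in> add_hull S" using a by (simp add: add_hull_def)
next
  fix Xs M assume a: "set Xs \<subseteq> add_hull S \<and> is_direct_sum C Xs M"
  have "M \<in> U" if "subcategory C U \<and> S \<inter> Obj C \<subseteq> U" for U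
    by (rule subcategory_sum[of _ Xs]) (use a that in \<open>auto simp: add_hull_def\<close>)
  then show "M \<in> add_hull S" using a direct_sum_obj[of Xs M] by (simp add: add_hull_def)
next
  fix X Y M assume a: "M \<in> add_hull S \<and> is_direct_sum C [X, Y] M"
  have "X \<in> U" if "subcategory C U \<and> S \<inter> Obj C \<subseteq> U" for U
    by (rule subcategory_summand(1)[of _ M X Y]) (use a that in \<open>auto simp: add_hull_def\<close>)
  then show "X \<in> add_hull S" using a direct_sum_obj[of "[X, Y]" M] by (simp add: add_hull_def)
qed (auto simp: add_hull_def)

lemma hull_incl: "S \<subseteq> Obj C \<Longrightarrow> S \<subseteq> add_hull S"
  by (auto simp: add_hull_def)

lemma hull_least: "\<lbrakk>subcategory C U; S \<subseteq> U\<rbrakk> \<Longrightarrow> add_hull S \<subseteq> U"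
  by (auto simp: add_hull_def)

lemma hull_mono: "\<lbrakk>S \<subseteq> S'; S' \<subseteq> Obj C\<rbrakk> \<Longrightarrow> add_hull S \<subseteq> add_hull S'"
  by (meson hull_incl hull_least hull_subcategory subset_trans)

section \<open>Objects with local endomorphism ring\<close>

lemma local_obj: "local X \<Longrightarrow> X \<in> Obj C" by (simp add: local_def)

lemma local_nonzero: "local X \<Longrightarrow> Ident C X \<noteq> null X X"
  by (simp add: local_def local_endomorphism_ring_def)

lemma local_add:
  assumes "local X" "arrow f" "Dom C f = X" "Cod C f = X" "arrow g" "Dom C g = X" "Cod C g = X"
    "is_iso C X X (f \<boxplus> g)"
  shows "is_iso C X X f \<or> is_iso C X X g"
proof -
  have m: "f \<in> mor C X X" "g \<in> mor C X X" using assms by (auto intro: arrow_mor)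
  show ?thesis using assms(1,8) m assms(3,4)
    unfolding local_def local_endomorphism_ring_def by (metis plus_fold)
qed

text \<open>The identity of \<open>X\<close> is the sum of its two components through
  \<open>A\<close> and \<open>B\<close>. In a local endomorphism ring one of the two is invertible,
  which exhibits \<open>X\<close> as a retract of that summand.\<close>

lemma local_retract_sum:
  assumes "local X" "retract X S" "is_direct_sum C [A, B] S"
  shows "retract X A \<or> retract X B"
proof -
  obtain s r where a: "arrow s" "Dom C s = X" "Cod C s = S" "arrow r" "Dom C r = S" "Cod C r = X" "r \<bullet> s = Ident C X"
    using assms(2) by (rule retractE)
  obtain i j p q where b: "biprod A B S i j p q" using assms by (auto simp: is_direct_sum_two)
  note b' = b[unfolded biprod_def]
  have X: "X \<in> Obj C" using assms(1) local_obj by simp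
  have "s = i \<bullet> (p \<bullet> s) \<boxplus> j \<bullet> (q \<bullet> s)"
    using a b' comp_plus_left[of "i \<bullet> p" "j \<bullet> q" s] by simp
  from arg_cong[OF this, of "(\<bullet>) r"]
  have "Ident C X = r \<bullet> (i \<bullet> (p \<bullet> s) \<boxplus> j \<bullet> (q \<bullet> s))" using a(7) by simp
  also have "\<dots> = (r \<bullet> i) \<bullet> (p \<bullet> s) \<boxplus> (r \<bullet> j) \<bullet> (q \<bullet> s)" using a b' by simp
  finally have "Ident C X = (r \<bullet> i) \<bullet> (p \<bullet> s) \<boxplus> (r \<bullet> j) \<bullet> (q \<bullet> s)" .
  moreover have "is_iso C X X (Ident C X)" using X by (rule is_iso_ident)
  ultimately have "is_iso C X X ((r \<bullet> i) \<bullet> (p \<bullet> s)) \<or> is_iso C X X ((r \<bullet> j) \<bullet> (q \<bullet> s))"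
    using local_add[of X "(r \<bullet> i) \<bullet> (p \<bullet> s)" "(r \<bullet> j) \<bullet> (q \<bullet> s)"] assms(1) a b' by simp
  moreover have "retract X Y" if gf: "is_iso C X X (g \<bullet> f)" "arrow f" "Dom C f = X" "Cod C f = Y" "arrow g" "Dom C g = Y" "Cod C g = X"
    for f g Y
  proof -
    obtain h where "arrow h" "Dom C h = X" "Cod C h = X" "h \<bullet> (g \<bullet> f) = Ident C X"
      using gf(1) unfolding is_iso_iff[OF X X] by blast
    then show ?thesis using gf by (intro retractI[of "h \<bullet> g" f]) simp_all
  qed
  ultimately show ?thesis using a b' by (metis arrow_comp)
qed

lemma local_retract_list:
  "\<lbrakk>local X; retract X S; is_direct_sum C Ss S\<rbrakk> \<Longrightarrow> \<exists>Y\<in>set Ss. retract X Y"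
proof (induction Ss arbitrary: S)
  case Nil
  then obtain s r where a: "arrow s" "Dom C s = X" "Cod C s = S" "arrow r" "Dom C r = S" "Cod C r = X" "r \<bullet> s = Ident C X"
    unfolding retract_def by blast
  have "Ident C S = null S S" "S \<in> Obj C" using Nil by (auto simp: is_direct_sum_Nil is_zero_object_def)
  then have "r \<bullet> s = r \<bullet> (null S S \<bullet> s)" using a by (metis comp_ident'(2))
  also have "\<dots> = null X X" using a \<open>S \<in> Obj C\<close> by (metis comp_null arrow_obj)
  finally show ?case using a Nil local_nonzero by simp
next
  case (Cons Y Ss)
  obtain S' where "is_direct_sum C Ss S'" "is_direct_sum C [Y, S'] S"
    using Cons.prems(3) by (rule direct_sum_ConsE)
  then show ?case using Cons.IH Cons.prems local_retract_sum by (metis list.set_intros)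
qed

text \<open>The idempotent \<open>e = s \<bullet> r\<close> and its complement add up to the
  identity of the local object \<open>Y\<close>, so one of them is invertible. An invertible
  idempotent is the identity; if the complement is invertible, then \<open>e\<close> vanishes and
  with it the identity of \<open>X\<close>.\<close>

lemma local_retract_iso:
  assumes "retract X Y" "local Y" "Ident C X \<noteq> null X X" shows "isomorphic X Y"
proof -
  obtain s r where a: "arrow s" "Dom C s = X" "Cod C s = Y" "arrow r" "Dom C r = Y" "Cod C r = X" "r \<bullet> s = Ident C X"
    using assms(1) by (rule retractE)
  have O: "X \<in> Obj C" "Y \<in> Obj C" using a by auto
  define e where "e = s \<bullet> r"
  have e: "arrow e" "Dom C e = Y" "Cod C e = Y" "e \<bullet> e = e" using a by (simp_all add: e_def reassoc[OF a(7)])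
  have "e \<boxplus> (Ident C Y \<boxplus> neg e) = Ident C Y" using e O plus_lcomm[of e "Ident C Y" "neg e"] by simp
  then have "is_iso C Y Y (e \<boxplus> (Ident C Y \<boxplus> neg e))" using O by (simp add: is_iso_ident)
  then have "is_iso C Y Y e \<or> is_iso C Y Y (Ident C Y \<boxplus> neg e)"
    using local_add[of Y e "Ident C Y \<boxplus> neg e"] assms(2) e O by simp
  then show ?thesis
  proof
    assume "is_iso C Y Y e"
    then obtain h where h: "arrow h" "Dom C h = Y" "Cod C h = Y" "h \<bullet> e = Ident C Y" using O by (auto simp: is_iso_iff)
    have "e = h \<bullet> (e \<bullet> e)" using h e O reassoc[OF h(4), of e] by simp
    then have "e = Ident C Y" using e h by simp
    then show ?thesis using a O unfolding e_def by (intro isomorphicI[of r s])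
  next
    assume "is_iso C Y Y (Ident C Y \<boxplus> neg e)"
    then obtain h where h: "arrow h" "Dom C h = Y" "Cod C h = Y" "h \<bullet> (Ident C Y \<boxplus> neg e) = Ident C Y" using O by (auto simp: is_iso_iff)
    have "(Ident C Y \<boxplus> neg e) \<bullet> e = null Y Y" using e O by simp
    moreover have "h \<bullet> ((Ident C Y \<boxplus> neg e) \<bullet> e) = e" using reassoc[OF h(4), of e] h e O by (simp del: comp_plus_left comp_plus_right)
    ultimately have "e = null Y Y" using h O by simp
    then have "r \<bullet> (e \<bullet> s) = null X X" using a O by simp
    moreover have "r \<bullet> (e \<bullet> s) = Ident C X" using a by (simp add: e_def reassoc[OF a(7)])
    ultimately show ?thesis using assms by simp
  qed
qed

end

context krull_schmidt_category
begin

lemma local_decomposition: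
  assumes "X \<in> Obj C" obtains Xs where "is_direct_sum C Xs X" "\<And>Y. Y \<in> set Xs \<Longrightarrow> local Y"
proof -
  obtain Xs where Xs: "is_direct_sum C Xs X" "\<forall>Y \<in> set Xs. local_endomorphism_ring C Y"
    using krull_schmidt[OF assms] by blast
  have "local Y" if "Y \<in> set Xs" for Y
    using Xs(2) direct_sum_obj[OF Xs(1)] that unfolding local_def by blast
  with Xs(1) show ?thesis by (rule that)
qed

lemma subcategory_local_retract:
  assumes "subcategory C U" "S \<in> U" "local X" "retract X S" shows "X \<in> U"
proof -
  obtain Ys where Ys: "is_direct_sum C Ys S" "\<And>Y. Y \<in> set Ys \<Longrightarrow> local Y"
    using local_decomposition[OF subcategory_obj[OF assms(1,2)]] by blast
  obtain Y where Y: "Y \<in> set Ys" "retract X Y" using local_retract_list[OF assms(3,4) Ys(1)] by blast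
  have "isomorphic Y X"
    by (rule isomorphic_sym, rule local_retract_iso[OF Y(2) Ys(2)[OF Y(1)] local_nonzero[OF assms(3)]])
  moreover have "Y \<in> U" using subcategory_summands[OF assms(1,2) Ys(1)] Y by blast
  ultimately show ?thesis using subcategory_iso[OF assms(1)] by blast
qed

lemma subcategory_if_locals:
  assumes "subcategory C U" "M \<in> Obj C" "\<And>X. \<lbrakk>local X; retract X M\<rbrakk> \<Longrightarrow> X \<in> U" shows "M \<in> U"
proof -
  obtain Ys where Ys: "is_direct_sum C Ys M" "\<And>Y. Y \<in> set Ys \<Longrightarrow> local Y"
    using local_decomposition[OF assms(2)] by blast
  then have "set Ys \<subseteq> U" using direct_sum_retract_list[OF Ys(1)] assms(3) by blast
  then show ?thesis using subcategory_sum[OF assms(1) _ Ys(1)] by blast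
qed

text \<open>Only complemented summands are covered by \<open>subcategory\<close>. The complement is
  avoided by decomposing \<open>M\<close>: its local summands are retracts of \<open>S\<close>,
  hence isomorphic to local summands of \<open>S\<close>.\<close>

lemma subcategory_retract:
  assumes "subcategory C U" "S \<in> U" "retract M S" shows "M \<in> U"
proof (rule subcategory_if_locals[OF assms(1)])
  show "M \<in> Obj C" using retract_obj[OF assms(3)] by simp
  show "X \<in> U" if "local X" "retract X M" for X
    by (rule subcategory_local_retract[OF assms(1,2) that(1) retract_trans[OF that(2) assms(3)]])
qed

text \<open>An induction principle: the objects all of whose local retracts satisfy \<open>P\<close>
  form a subcategory, because a local retract of a direct sum is a retract of one of the
  terms.\<close>

lemma hull_local:
  assumes "local X" "X \<in> add_hull S" "\<And>s Y. \<lbrakk>s \<in> S; local Y; retract Y s\<rbrakk> \<Longrightarrow> P Y"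
  shows "P X"
proof -
  define V where "V = {M \<in> Obj C. \<forall>X. local X \<longrightarrow> retract X M \<longrightarrow> P X}"
  have "subcategory C V"
  proof (rule subcategoryI)
    fix Z assume Z: "is_zero_object C Z"
    then have "is_direct_sum C [] Z" by (simp add: is_direct_sum_Nil)
    then have "\<not> retract X Z" if "local X" for X using local_retract_list[OF that, of Z "[]"] by auto
    then show "Z \<in> V" using Z unfolding V_def is_zero_object_def by blast
  next
    fix A B S assume a: "A \<in> V" "B \<in> V" "is_direct_sum C [A, B] S"
    have "P X" if "local X" "retract X S" for X
      using local_retract_sum[OF that a(3)] that a(1,2) unfolding V_def by blast
    then show "S \<in> V" using direct_sum_obj[OF a(3)] unfolding V_def by blast
  next
    fix X S assume a: "retract X S" "S \<in> V"
    then show "X \<in> V" unfolding V_def using retract_trans[OF _ a(1)] retract_obj[OF a(1)] by blast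
  qed (auto simp: V_def)
  moreover have "S \<inter> Obj C \<subseteq> V" unfolding V_def using assms(3) by blast
  ultimately have "X \<in> V" using assms(2) unfolding add_hull_def by blast
  then show ?thesis using assms(1) retract_refl[OF local_obj[OF assms(1)]] unfolding V_def by blast
qed

lemma hull_local_Union:
  assumes "local X" "X \<in> add_hull S" "\<And>s. s \<in> S \<Longrightarrow> \<exists>U\<in>\<U>. subcategory C U \<and> s \<in> U"
  shows "\<exists>U\<in>\<U>. X \<in> U"
proof (rule hull_local[OF assms(1,2)])
  fix s Y assume a: "s \<in> S" "local Y" "retract Y s"
  obtain U where U: "U \<in> \<U>" "subcategory C U" "s \<in> U" using assms(3)[OF a(1)] by blast
  then show "\<exists>U\<in>\<U>. Y \<in> U" using subcategory_local_retract[OF U(2,3) a(2,3)] by blast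
qed

lemma hull_local_iso:
  assumes "local X" "X \<in> add_hull S" "\<And>s. s \<in> S \<Longrightarrow> local s"
  shows "\<exists>s\<in>S. isomorphic X s"
proof (rule hull_local[OF assms(1,2)])
  fix s Y assume a: "s \<in> S" "local Y" "retract Y s"
  then show "\<exists>s\<in>S. isomorphic Y s" using local_retract_iso[OF a(3) assms(3)[OF a(1)] local_nonzero[OF a(2)]] by blast
qed

end


section \<open>Multiplicities of local summands\<close>

context ring
begin

text \<open>If \<open>z\<close> inverts \<open>x \<otimes> y\<close>, then
  \<open>e = y \<otimes> (z \<otimes> x)\<close> is idempotent, and \<open>e\<close> or its
  complement is a unit, so \<open>e\<close> is one or zero. Zero is impossible, since
  \<open>x \<otimes> e \<otimes> (y \<otimes> z)\<close> is one. Hence one-sided inverses are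
  two-sided; the zero ring is treated apart.\<close>

lemma Units_factor:
  assumes nonunit_add: "\<And>x y. \<lbrakk>x \<in> carrier R; y \<in> carrier R; x \<notin> Units R; y \<notin> Units R\<rbrakk> \<Longrightarrow> x \<oplus> y \<notin> Units R"
    and x: "x \<in> carrier R" "y \<in> carrier R" "x \<otimes> y \<in> Units R"
  shows "x \<in> Units R" "y \<in> Units R"
proof -
  obtain z where z: "z \<in> carrier R" "z \<otimes> (x \<otimes> y) = \<one>" "(x \<otimes> y) \<otimes> z = \<one>"
    using x by (auto simp: Units_def)
  have "x \<in> Units R \<and> y \<in> Units R"
  proof (cases "\<one> = \<zero>")
    case True
    then have "a = \<zero>" if "a \<in> carrier R" for a using that l_one l_null by metis
    then have "a \<in> Units R" if "a \<in> carrier R" for a using that one_closed Units_one_closed by metis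
    then show ?thesis using x by blast
  next
    case False
    define e where "e = y \<otimes> (z \<otimes> x)"
    have e: "e \<in> carrier R" using x z by (simp add: e_def)
    have ee: "e \<otimes> e = e"
    proof -
      have "e \<otimes> e = y \<otimes> (z \<otimes> (((x \<otimes> y) \<otimes> z) \<otimes> x))" using x z(1) unfolding e_def by (simp add: m_assoc)
      also have "\<dots> = e" unfolding z(3) using x z(1) by (simp add: e_def)
      finally show ?thesis .
    qed
    have "e \<oplus> (\<one> \<ominus> e) = \<one>" using e a_lcomm[of e \<one> "\<ominus> e"] by (simp add: minus_eq r_neg)
    then have "e \<in> Units R \<or> \<one> \<ominus> e \<in> Units R"
      using nonunit_add[of e "\<one> \<ominus> e"] e by auto
    then have "e = \<one>"
    proof
      assume u: "e \<in> Units R"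
      have "inv e \<otimes> (e \<otimes> e) = inv e \<otimes> e" using ee by simp
      then show ?thesis using u e by (simp add: m_assoc[symmetric])
    next
      assume u: "\<one> \<ominus> e \<in> Units R"
      have "(\<one> \<ominus> e) \<otimes> e = \<zero>" using e ee by (simp add: minus_eq l_distr l_minus r_neg)
      then have "inv (\<one> \<ominus> e) \<otimes> ((\<one> \<ominus> e) \<otimes> e) = inv (\<one> \<ominus> e) \<otimes> \<zero>" by simp
      then have "e = \<zero>" using u e by (simp add: m_assoc[symmetric])
      then have "x \<otimes> e \<otimes> (y \<otimes> z) = \<zero>" using x z by simp
      moreover have "x \<otimes> e \<otimes> (y \<otimes> z) = ((x \<otimes> y) \<otimes> z) \<otimes> ((x \<otimes> y) \<otimes> z)"
        using x z unfolding e_def by (simp add: m_assoc)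
      ultimately show ?thesis using z False by simp
    qed
    then have 1: "y \<otimes> z \<otimes> x = \<one>" using x z by (simp add: e_def m_assoc)
    have 2: "x \<otimes> (y \<otimes> z) = \<one>" using x z by (simp add: m_assoc)
    have "x \<in> Units R" unfolding Units_def using 1 2 x z by auto
    moreover have "z \<otimes> x \<otimes> y = \<one>" "y \<otimes> (z \<otimes> x) = \<one>" using x z 1 by (simp_all add: m_assoc)
    then have "y \<in> Units R" unfolding Units_def using x z by auto
    ultimately show ?thesis by simp
  qed
  then show "x \<in> Units R" "y \<in> Units R" by auto
qed

lemma nonunit_finsum:
  assumes "\<And>x y. \<lbrakk>x \<in> carrier R; y \<in> carrier R; x \<notin> Units R; y \<notin> Units R\<rbrakk> \<Longrightarrow> x \<oplus> y \<notin> Units R" "\<one> \<noteq> \<zero>"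
  shows "\<lbrakk>finite b; \<And>n. n \<in> b \<Longrightarrow> f n \<in> carrier R; \<And>n. n \<in> b \<Longrightarrow> f n \<notin> Units R\<rbrakk> \<Longrightarrow> (\<Oplus>n\<in>b. f n) \<notin> Units R"
proof (induction b rule: finite_induct)
  case empty
  have "\<zero> \<notin> Units R"
  proof
    assume "\<zero> \<in> Units R" then obtain x where "x \<in> carrier R" "x \<otimes> \<zero> = \<one>" by (auto simp: Units_def)
    then show False using assms(2) by simp
  qed
  then show ?case by simp
next
  case (insert n b)
  have "(\<Oplus>n\<in>b. f n) \<in> carrier R" using insert by (intro finsum_closed) auto
  then show ?case using insert assms(1) by (simp add: finsum_insert Pi_def)
qed

text \<open>Gaussian elimination modulo the ideal of nonunits.\<close>

lemma local_matrix_card_le: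
  assumes nonunit_add: "\<And>x y. \<lbrakk>x \<in> carrier R; y \<in> carrier R; x \<notin> Units R; y \<notin> Units R\<rbrakk> \<Longrightarrow> x \<oplus> y \<notin> Units R"
    and one: "\<one> \<noteq> \<zero>"
  shows "\<lbrakk>finite a; finite (b :: nat set); \<And>m n. \<lbrakk>m \<in> a; n \<in> b\<rbrakk> \<Longrightarrow> \<alpha> n m \<in> carrier R \<and> \<beta> m n \<in> carrier R;
     \<And>m m'. \<lbrakk>m \<in> a; m' \<in> a\<rbrakk> \<Longrightarrow> (\<Oplus>n\<in>b. \<beta> m n \<otimes> \<alpha> n m') \<ominus> (if m = m' then \<one> else \<zero>) \<notin> Units R\<rbrakk>
     \<Longrightarrow> card (a :: nat set) \<le> card b"
proof (induction a arbitrary: b \<alpha> rule: finite_induct)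
  case (insert m a)
  note fin = \<open>finite b\<close>
  have cl: "\<alpha> n k \<in> carrier R" "\<beta> k n \<in> carrier R" if "k \<in> insert m a" "n \<in> b" for k n
    using insert.prems(2) that by auto
  have scl: "(\<Oplus>n\<in>b. \<beta> k n \<otimes> \<alpha> n l) \<in> carrier R" if "k \<in> insert m a" "l \<in> insert m a" for k l
    by (intro finsum_closed) (use cl that in auto)
  have pos: "x \<in> Units R" if "x \<ominus> \<one> \<notin> Units R" "x \<in> carrier R" for x
  proof (rule ccontr)
    assume "x \<notin> Units R"
    moreover have "\<ominus> (x \<ominus> \<one>) \<notin> Units R"
    proof
      assume "\<ominus> (x \<ominus> \<one>) \<in> Units R"
      moreover have "\<ominus> (x \<ominus> \<one>) = (\<ominus> \<one>) \<otimes> (x \<ominus> \<one>)" using that by (simp add: l_minus)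
      ultimately show False using Units_factor(2)[OF nonunit_add, of "\<ominus> \<one>" "x \<ominus> \<one>"] that by auto
    qed
    ultimately have "x \<oplus> \<ominus> (x \<ominus> \<one>) \<notin> Units R" using nonunit_add that by auto
    moreover have "x \<oplus> \<ominus> (x \<ominus> \<one>) = \<one>" using that by (simp add: minus_eq minus_add r_neg2)
    ultimately show False by simp
  qed
  have "(\<Oplus>n\<in>b. \<beta> m n \<otimes> \<alpha> n m) \<in> Units R" using pos insert.prems(3)[of m m] scl by auto
  then have "\<not> (\<forall>n\<in>b. \<beta> m n \<otimes> \<alpha> n m \<notin> Units R)"
    using nonunit_finsum[OF nonunit_add one fin, of "\<lambda>n. \<beta> m n \<otimes> \<alpha> n m"] cl by auto
  then obtain n0 where n0: "n0 \<in> b" "\<beta> m n0 \<otimes> \<alpha> n0 m \<in> Units R" by blast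
  define u where "u = \<alpha> n0 m"
  have u: "u \<in> Units R" unfolding u_def using Units_factor(2)[OF nonunit_add, of "\<beta> m n0" "\<alpha> n0 m"] n0 cl by auto
  have uc: "u \<in> carrier R" "inv u \<in> carrier R" "u \<otimes> inv u = \<one>" using u by auto
  define \<alpha>' where "\<alpha>' n k = \<alpha> n k \<ominus> \<alpha> n m \<otimes> (inv u \<otimes> \<alpha> n0 k)" for n k
  have \<alpha>'c: "\<alpha>' n k \<in> carrier R" if "k \<in> a" "n \<in> b" for n k
    using that cl uc n0 by (auto simp: \<alpha>'_def)
  have z: "\<alpha>' n0 k = \<zero>" if "k \<in> a" for k
  proof -
    have "u \<otimes> (inv u \<otimes> \<alpha> n0 k) = \<alpha> n0 k" using that cl uc n0 by (simp add: m_assoc[symmetric])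
    then show ?thesis using that cl n0 by (simp add: \<alpha>'_def u_def[symmetric] minus_eq r_neg)
  qed
  have "card a \<le> card (b - {n0})"
  proof (rule insert.IH[of "b - {n0}" \<alpha>'])
    fix k l assume kl: "k \<in> a" "l \<in> a"
    let ?D = "if k = l then \<one> else \<zero>"
    define S where "S = (\<Oplus>n\<in>b. \<beta> k n \<otimes> \<alpha> n l)"
    define P where "P = (\<Oplus>n\<in>b. \<beta> k n \<otimes> \<alpha> n m)"
    define c where "c = inv u \<otimes> \<alpha> n0 l"
    have cc: "c \<in> carrier R" "S \<in> carrier R" "P \<in> carrier R" using kl cl uc n0 scl by (auto simp: c_def S_def P_def)
    have b: "b = insert n0 (b - {n0})" using n0 by auto
    have "(\<Oplus>n\<in>b. \<beta> k n \<otimes> \<alpha>' n l) = \<beta> k n0 \<otimes> \<alpha>' n0 l \<oplus> (\<Oplus>n\<in>b-{n0}. \<beta> k n \<otimes> \<alpha>' n l)"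
      by (subst b, rule finsum_insert) (use fin kl cl \<alpha>'c n0 in auto)
    also have "\<dots> = (\<Oplus>n\<in>b-{n0}. \<beta> k n \<otimes> \<alpha>' n l)"
      using z kl cl n0 \<alpha>'c by (simp add: finsum_closed Pi_def)
    finally have 1: "(\<Oplus>n\<in>b-{n0}. \<beta> k n \<otimes> \<alpha>' n l) = (\<Oplus>n\<in>b. \<beta> k n \<otimes> \<alpha>' n l)" by simp
    have "(\<Oplus>n\<in>b. \<beta> k n \<otimes> \<alpha>' n l) = (\<Oplus>n\<in>b. \<beta> k n \<otimes> \<alpha> n l \<oplus> (\<beta> k n \<otimes> \<alpha> n m) \<otimes> (\<ominus> c))"
    proof (rule finsum_cong'[OF refl])
      fix n assume n: "n \<in> b"
      have [simp]: "\<beta> k n \<in> carrier R" "\<alpha> n l \<in> carrier R" "\<alpha> n m \<in> carrier R" using kl cl n by auto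
      show "\<beta> k n \<otimes> \<alpha>' n l = \<beta> k n \<otimes> \<alpha> n l \<oplus> (\<beta> k n \<otimes> \<alpha> n m) \<otimes> (\<ominus> c)"
        unfolding \<alpha>'_def c_def[symmetric] using cc(1) by (simp add: minus_eq r_distr r_minus m_assoc)
    qed (use kl cl cc(1) in auto)
    also have "\<dots> = S \<oplus> (\<Oplus>n\<in>b. (\<beta> k n \<otimes> \<alpha> n m) \<otimes> (\<ominus> c))"
      unfolding S_def by (rule finsum_addf) (use kl cl cc in auto)
    also have "(\<Oplus>n\<in>b. (\<beta> k n \<otimes> \<alpha> n m) \<otimes> (\<ominus> c)) = P \<otimes> (\<ominus> c)"
      unfolding P_def by (rule finsum_ldistr[symmetric]) (use fin kl cl cc in auto)
    finally have 2: "(\<Oplus>n\<in>b-{n0}. \<beta> k n \<otimes> \<alpha>' n l) = S \<oplus> P \<otimes> (\<ominus> c)" using 1 by simp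
    have "k \<noteq> m" using kl insert.hyps by auto
    \<comment> \<open>\<open>P\<close> is the off-diagonal entry of the product at
      \<open>(k, m)\<close>, a nonunit. Hence the column operation leaves the product unchanged
      modulo nonunits.\<close>
    then have P: "P \<notin> Units R" using insert.prems(3)[of k m] kl cc by (simp add: P_def[symmetric] minus_eq)
    have "P \<otimes> (\<ominus> c) \<notin> Units R" using Units_factor(1)[OF nonunit_add, of P "\<ominus> c"] P cc by auto
    moreover have "S \<ominus> ?D \<notin> Units R" using insert.prems(3)[of k l] kl by (simp add: S_def)
    ultimately have "(S \<ominus> ?D) \<oplus> P \<otimes> (\<ominus> c) \<notin> Units R" using nonunit_add[of "S \<ominus> ?D" "P \<otimes> (\<ominus> c)"] cc by auto
    moreover have "(S \<ominus> ?D) \<oplus> P \<otimes> (\<ominus> c) = S \<oplus> P \<otimes> (\<ominus> c) \<ominus> ?D"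
      using cc by (simp add: minus_eq a_ac)
    ultimately show "(\<Oplus>n\<in>b-{n0}. \<beta> k n \<otimes> \<alpha>' n l) \<ominus> ?D \<notin> Units R" using 2 by simp
  qed (use fin cl \<alpha>'c in auto)
  then show ?case using insert.hyps card_Suc_Diff1[OF fin n0(1)] by simp
qed simp

end

text \<open>The case of the field of reals in \<open>local_matrix_card_le\<close>, where zero is the
  only nonunit: an identity matrix of size \<open>M\<close> cannot factor through dimension
  \<open>N < M\<close>.\<close>

lemma real_matrix_card_le:
  fixes \<beta> \<alpha> :: "nat \<Rightarrow> nat \<Rightarrow> real"
  assumes "\<And>m m'. \<lbrakk>m < M; m' < M\<rbrakk> \<Longrightarrow> (\<Sum>n<N. \<beta> m n * \<alpha> n m') = (if m = m' then 1 else 0)"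
  shows "M \<le> N"
proof -
  define R :: "real ring" where "R = \<lparr>carrier = UNIV, mult = (*), one = 1, zero = 0, add = (+)\<rparr>"
  have simps [simp]: "carrier R = UNIV" "mult R = (*)" "one R = 1" "zero R = 0" "add R = (+)"
    by (simp_all add: R_def)
  interpret ring R
  proof (rule ringI)
    show "abelian_group R"
    proof (rule abelian_groupI)
      show "\<exists>y\<in>carrier R. y \<oplus>\<^bsub>R\<^esub> x = \<zero>\<^bsub>R\<^esub>" for x
        by (rule bexI[of _ "- x"]) auto
    qed auto
    show "Group.monoid R" by unfold_locales auto
  qed (auto simp: algebra_simps)
  have minus: "x \<ominus>\<^bsub>R\<^esub> y = x - y" for x y
  proof -
    have "\<ominus>\<^bsub>R\<^esub> y = - y" by (rule minus_equality) auto
    then show ?thesis by (simp add: minus_eq)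
  qed
  have "\<exists>y. y * x = 1 \<and> x * y = 1" if "x \<noteq> 0" for x :: real
    using that by (intro exI[of _ "inverse x"]) simp
  then have Units: "Units R = {x. x \<noteq> 0}" unfolding Units_def by auto
  have fin: "finsum R f A = sum f A" if "finite A" for f and A :: "nat set"
    using that by (induction A rule: finite_induct) auto
  have "card {..<M} \<le> card {..<N}"
    by (rule local_matrix_card_le[where \<alpha> = \<alpha> and \<beta> = \<beta>]) (auto simp: Units fin minus assms)
  then show ?thesis by simp
qed

context krull_schmidt_category
begin

definition End_ring :: "'a \<Rightarrow> ('c, 'b) module" where
  "End_ring X = (Hom C X X)\<lparr>mult := (\<bullet>), one := Ident C X\<rparr>"

lemma End_ring_simps [simp]:
  "carrier (End_ring X) = mor C X X" "x \<otimes>\<^bsub>End_ring X\<^esub> y = x \<bullet> y" "\<one>\<^bsub>End_ring X\<^esub> = Ident C X"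
  "\<zero>\<^bsub>End_ring X\<^esub> = null X X" "x \<oplus>\<^bsub>End_ring X\<^esub> y = x \<oplus>\<^bsub>Hom C X X\<^esub> y"
  by (simp_all add: End_ring_def)

lemma End_ring_finsum: "finsum (End_ring X) f A = finsum (Hom C X X) f A"
  by (simp add: finsum_def End_ring_def)

lemma End_ring_ring:
  assumes X: "X \<in> Obj C" shows "ring (End_ring X)"
proof (rule ringI)
  have "abelian_group (Hom C X X)" using hom_group assms by simp
  then show "abelian_group (End_ring X)"
    unfolding abelian_group_def abelian_monoid_def abelian_group_axioms_def by (simp add: End_ring_def)
  show "Group.monoid (End_ring X)"
  proof (rule monoidI)
    show "(x \<otimes>\<^bsub>End_ring X\<^esub> y) \<otimes>\<^bsub>End_ring X\<^esub> z = x \<otimes>\<^bsub>End_ring X\<^esub> (y \<otimes>\<^bsub>End_ring X\<^esub> z)"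
      if "x \<in> carrier (End_ring X)" "y \<in> carrier (End_ring X)" "z \<in> carrier (End_ring X)" for x y z
      using comp_assoc[of X X X X z y x] X that by simp
  qed (use X comp_mor[OF X X X] comp_ident[OF X X] ident_mor[OF X] in simp_all)
qed (use X comp_add_left[OF X X X] comp_add_right[OF X X X] in simp_all)

lemma End_ring_Units: "X \<in> Obj C \<Longrightarrow> Units (End_ring X) = {f. is_iso C X X f}"
  unfolding Units_def is_iso_def by auto

text \<open>Restrict the identity of \<open>S\<close> to the summands isomorphic to \<open>X\<close>
  and expand it over the other decomposition. A path through a summand not isomorphic to
  \<open>X\<close> is a nonunit of the local ring of endomorphisms of \<open>X\<close>, so the paths
  through copies of \<open>X\<close> give two matrices whose product is the identity modulo
  nonunits.\<close>

lemma iso_count_le: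
  assumes X: "local X" and S: "is_direct_sum C Xs S" "is_direct_sum C Ys S"
    and loc: "\<And>Y. Y \<in> set Ys \<Longrightarrow> local Y"
  shows "card {m. m < length Xs \<and> isomorphic X (Xs ! m)} \<le> card {n. n < length Ys \<and> isomorphic X (Ys ! n)}"
    (is "card ?a \<le> card ?b")
proof -
  have XO: "X \<in> Obj C" using X local_obj by simp
  obtain i p where d: "direct_sum_diagram C Xs S i p" using S by (auto simp: is_direct_sum_def)
  obtain i' p' where d': "direct_sum_diagram C Ys S i' p'" using S by (auto simp: is_direct_sum_def)
  note dd = d[unfolded direct_sum_diagram_iff] and dd' = d'[unfolded direct_sum_diagram_iff]
  have ty: "arrow (i n)" "Dom C (i n) = Xs ! n" "Cod C (i n) = S"
        "arrow (p n)" "Dom C (p n) = S" "Cod C (p n) = Xs ! n" "Xs ! n \<in> Obj C" if "n < length Xs" for n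
    using that dd nth_mem by blast+
  have ty': "arrow (i' n)" "Dom C (i' n) = Ys ! n" "Cod C (i' n) = S"
        "arrow (p' n)" "Dom C (p' n) = S" "Cod C (p' n) = Ys ! n" "Ys ! n \<in> Obj C" if "n < length Ys" for n
    using that dd' nth_mem by blast+
  have e: "p m \<bullet> i n = (if m = n then Ident C (Xs ! n) else null (Xs ! n) (Xs ! m))"
    if "m < length Xs" "n < length Xs" for m n using that dd by blast
  define Q where "Q Z u u' \<longleftrightarrow> arrow u \<and> Dom C u = X \<and> Cod C u = Z \<and> arrow u' \<and> Dom C u' = Z \<and>
     Cod C u' = X \<and> u' \<bullet> u = Ident C X \<and> u \<bullet> u' = Ident C Z" for Z u u'
  have Q: "\<exists>u u'. isomorphic X Z \<longrightarrow> Q Z u u'" for Z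
    unfolding Q_def using isomorphicE[of X Z] by blast
  then obtain w w' where "\<And>Z. isomorphic X Z \<Longrightarrow> Q Z (w Z) (w' Z)" by metis
  then have w: "arrow (w Z) \<and> Dom C (w Z) = X \<and> Cod C (w Z) = Z \<and> arrow (w' Z) \<and> Dom C (w' Z) = Z \<and>
     Cod C (w' Z) = X \<and> w' Z \<bullet> w Z = Ident C X \<and> w Z \<bullet> w' Z = Ident C Z" if "isomorphic X Z" for Z
    using that unfolding Q_def by blast
  define u u' where "u m = w (Xs ! m)" and "u' m = w' (Xs ! m)" for m
  define v v' where "v n = w (Ys ! n)" and "v' n = w' (Ys ! n)" for n
  have u: "arrow (u m) \<and> Dom C (u m) = X \<and> Cod C (u m) = Xs ! m \<and> arrow (u' m) \<and>
     Dom C (u' m) = Xs ! m \<and> Cod C (u' m) = X \<and> u' m \<bullet> u m = Ident C X" if "m \<in> ?a" for m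
    using w[of "Xs ! m"] that by (simp add: u_def u'_def)
  have v: "arrow (v n) \<and> Dom C (v n) = X \<and> Cod C (v n) = Ys ! n \<and> arrow (v' n) \<and>
     Dom C (v' n) = Ys ! n \<and> Cod C (v' n) = X \<and> v n \<bullet> v' n = Ident C (Ys ! n)" if "n \<in> ?b" for n
    using w[of "Ys ! n"] that by (simp add: v_def v'_def)
  interpret R: ring "End_ring X" by (rule End_ring_ring[OF XO])
  have car: "f \<in> carrier (End_ring X)" if "arrow f" "Dom C f = X" "Cod C f = X" for f
    using that by (auto intro: arrow_mor)
  define \<alpha> where "\<alpha> n m = v' n \<bullet> (p' n \<bullet> (i m \<bullet> u m))" for n m
  define \<beta> where "\<beta> m n = u' m \<bullet> (p m \<bullet> (i' n \<bullet> v n))" for m n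
  \<comment> \<open>The path from the \<open>m'\<close>-th to the \<open>m\<close>-th summand of the
    first decomposition through the \<open>n\<close>-th summand of the second, transported to an
    endomorphism of \<open>X\<close>.\<close>
  define \<gamma> where "\<gamma> m m' n = u' m \<bullet> (p m \<bullet> (i' n \<bullet> (p' n \<bullet> (i m' \<bullet> u m'))))" for m m' n
  have \<gamma>c: "\<gamma> m m' n \<in> carrier (End_ring X)" if "m \<in> ?a" "m' \<in> ?a" "n < length Ys" for m m' n
    using that u[of m] u[of m'] ty ty' by (intro car) (simp_all add: \<gamma>_def)
  have \<gamma>b: "\<gamma> m m' n = \<beta> m n \<bullet> \<alpha> n m'" if "m \<in> ?a" "m' \<in> ?a" "n \<in> ?b" for m m' n
    using that u[of m] u[of m'] v[of n] ty ty' by (simp add: \<gamma>_def \<alpha>_def \<beta>_def reassoc[of "v n" "v' n"])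
  have \<gamma>n: "\<gamma> m m' n \<notin> Units (End_ring X)" if a: "m \<in> ?a" "m' \<in> ?a" "n < length Ys" "n \<notin> ?b" for m m' n
  proof
    assume "\<gamma> m m' n \<in> Units (End_ring X)"
    then obtain h where h: "arrow h" "Dom C h = X" "Cod C h = X" "h \<bullet> \<gamma> m m' n = Ident C X"
      using XO by (auto simp: End_ring_Units is_iso_iff)
    have "retract X (Ys ! n)"
      by (rule retractI[of "h \<bullet> (u' m \<bullet> (p m \<bullet> i' n))" "p' n \<bullet> (i m' \<bullet> u m')"])
        (use h a u[of m] u[of m'] ty ty' in \<open>simp_all add: \<gamma>_def\<close>)
    then have "isomorphic X (Ys ! n)" using local_retract_iso loc X local_nonzero a by auto
    then show False using a by simp
  qed
  have tot: "(\<Oplus>\<^bsub>End_ring X\<^esub> n\<in>{..<length Ys}. \<gamma> m m' n) = (if m = m' then Ident C X else null X X)"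
    if a: "m \<in> ?a" "m' \<in> ?a" for m m'
  proof -
    note um = u[OF a(1)] and um' = u[OF a(2)]
    have ml: "m < length Xs" "m' < length Xs" using a by auto
    have fam: "family X X (\<gamma> m m') (length Ys)"
      using XO um um' ty ty' ml by (auto simp: family_def \<gamma>_def)
    have "(\<Oplus>\<^bsub>End_ring X\<^esub> n\<in>{..<length Ys}. \<gamma> m m' n) = (\<Oplus>\<^bsub>Hom C X X\<^esub> n\<in>{..<length Ys}. \<gamma> m m' n)"
      by (rule End_ring_finsum)
    also have "\<dots> = hsum X X (\<gamma> m m') (length Ys)" by (rule finsum_hsum[OF fam])
    also have "\<dots> = hsum X X (\<lambda>n. (u' m \<bullet> p m) \<bullet> ((i' n \<bullet> p' n) \<bullet> (i m' \<bullet> u m'))) (length Ys)"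
      by (rule hsum_cong) (use um um' ty ty' ml in \<open>simp add: \<gamma>_def\<close>)
    also have "\<dots> = (u' m \<bullet> p m) \<bullet> hsum X S (\<lambda>n. (i' n \<bullet> p' n) \<bullet> (i m' \<bullet> u m')) (length Ys)"
      by (rule comp_hsum_right[symmetric]) (use XO um um' ty ty' ml dd in \<open>auto simp: family_def\<close>)
    also have "hsum X S (\<lambda>n. (i' n \<bullet> p' n) \<bullet> (i m' \<bullet> u m')) (length Ys)
        = hsum S S (\<lambda>n. i' n \<bullet> p' n) (length Ys) \<bullet> (i m' \<bullet> u m')"
      by (rule comp_hsum_left[symmetric]) (use XO um um' ty ty' ml dd in \<open>auto simp: family_def\<close>)
    also have "\<dots> = i m' \<bullet> u m'" using dd' um' ty ml by simp
    also have "(u' m \<bullet> p m) \<bullet> (i m' \<bullet> u m') = u' m \<bullet> ((p m \<bullet> i m') \<bullet> u m')"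
      using um um' ty ml by simp
    also have "\<dots> = (if m = m' then Ident C X else null X X)"
      using um um' ty ml XO by (simp add: e)
    finally show ?thesis .
  qed
  have one: "\<one>\<^bsub>End_ring X\<^esub> \<noteq> \<zero>\<^bsub>End_ring X\<^esub>" using local_nonzero X by simp
  have nonunit_add: "x \<oplus>\<^bsub>End_ring X\<^esub> y \<notin> Units (End_ring X)"
    if "x \<in> carrier (End_ring X)" "y \<in> carrier (End_ring X)" "x \<notin> Units (End_ring X)" "y \<notin> Units (End_ring X)" for x y
    using X that unfolding local_def local_endomorphism_ring_def using XO by (auto simp: End_ring_Units)
  show ?thesis
  proof (rule R.local_matrix_card_le[OF nonunit_add one, where \<alpha> = \<alpha> and \<beta> = \<beta>])
    fix m n assume mn: "m \<in> ?a" "n \<in> ?b"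
    show "\<alpha> n m \<in> carrier (End_ring X) \<and> \<beta> m n \<in> carrier (End_ring X)"
      using mn u[OF mn(1)] v[OF mn(2)] ty ty' by (intro conjI car) (simp_all add: \<alpha>_def \<beta>_def)
  next
    fix m m' assume a: "m \<in> ?a" "m' \<in> ?a"
    let ?D = "if m = m' then \<one>\<^bsub>End_ring X\<^esub> else \<zero>\<^bsub>End_ring X\<^esub>"
    let ?c = "{..<length Ys} - ?b"
    define s where "s = (\<Oplus>\<^bsub>End_ring X\<^esub> n\<in>?b. \<gamma> m m' n)"
    define t where "t = (\<Oplus>\<^bsub>End_ring X\<^esub> n\<in>?c. \<gamma> m m' n)"
    have st: "s \<in> carrier (End_ring X)" "t \<in> carrier (End_ring X)"
      unfolding s_def t_def by (intro R.finsum_closed; use \<gamma>c a in auto)+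
    have "(\<Oplus>\<^bsub>End_ring X\<^esub> n\<in>{..<length Ys}. \<gamma> m m' n) = (\<Oplus>\<^bsub>End_ring X\<^esub> n\<in>?b \<union> ?c. \<gamma> m m' n)"
      by (rule arg_cong[where f = "\<lambda>A. finsum (End_ring X) _ A"]) auto
    also have "\<dots> = s \<oplus>\<^bsub>End_ring X\<^esub> t"
      unfolding s_def t_def by (rule R.finsum_Un_disjoint) (use \<gamma>c a in auto)
    finally have F: "(\<Oplus>\<^bsub>End_ring X\<^esub> n\<in>{..<length Ys}. \<gamma> m m' n) = s \<oplus>\<^bsub>End_ring X\<^esub> t" .
    have D: "?D = s \<oplus>\<^bsub>End_ring X\<^esub> t" unfolding F[symmetric] tot[OF a] by (simp only: End_ring_simps)
    have "t \<notin> Units (End_ring X)"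
      unfolding t_def by (rule R.nonunit_finsum[OF nonunit_add one]) (use \<gamma>c \<gamma>n a in auto)
    \<comment> \<open>The full sum of \<open>s\<close> and \<open>t\<close> is the Kronecker delta,
      so \<open>s\<close> differs from it by the negative of the nonunit \<open>t\<close>.\<close>
    moreover have "s \<ominus>\<^bsub>End_ring X\<^esub> ?D = (\<ominus>\<^bsub>End_ring X\<^esub> \<one>\<^bsub>End_ring X\<^esub>) \<otimes>\<^bsub>End_ring X\<^esub> t"
      unfolding D using st by (simp add: R.minus_eq R.minus_add R.l_minus R.r_neg2 del: End_ring_simps)
    ultimately have "s \<ominus>\<^bsub>End_ring X\<^esub> ?D \<notin> Units (End_ring X)"
      using R.Units_factor(2)[OF nonunit_add, of "\<ominus>\<^bsub>End_ring X\<^esub> \<one>\<^bsub>End_ring X\<^esub>" t]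
        st R.a_inv_closed[OF R.one_closed] by (auto simp del: End_ring_simps)
    moreover have "s = (\<Oplus>\<^bsub>End_ring X\<^esub> n\<in>?b. \<beta> m n \<otimes>\<^bsub>End_ring X\<^esub> \<alpha> n m')"
      unfolding s_def
    proof (rule R.finsum_cong'[OF refl])
      have "\<gamma> m m' n \<in> carrier (End_ring X)" if "n \<in> ?b" for n by (rule \<gamma>c[OF a]) (use that in auto)
      then show "(\<lambda>n. \<beta> m n \<otimes>\<^bsub>End_ring X\<^esub> \<alpha> n m') \<in> ?b \<rightarrow> carrier (End_ring X)" using \<gamma>b[OF a] by auto
    qed (use \<gamma>b[OF a] in simp)
    ultimately show "(\<Oplus>\<^bsub>End_ring X\<^esub> n\<in>?b. \<beta> m n \<otimes>\<^bsub>End_ring X\<^esub> \<alpha> n m') \<ominus>\<^bsub>End_ring X\<^esub> ?D \<notin> Units (End_ring X)"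
      by simp
  qed auto
qed

definition multiplicity :: "'a \<Rightarrow> 'a \<Rightarrow> nat" where
  "multiplicity X M = length (filter (isomorphic X)
     (SOME Xs. is_direct_sum C Xs M \<and> (\<forall>Y\<in>set Xs. local Y)))"

text \<open>Krull-Schmidt uniqueness: \<open>iso_count_le\<close> in both directions makes the
  choice of decomposition in \<open>multiplicity\<close> immaterial.\<close>

lemma multiplicity_eq:
  assumes "local X" "is_direct_sum C Xs M" "\<And>Y. Y \<in> set Xs \<Longrightarrow> local Y"
  shows "multiplicity X M = length (filter (isomorphic X) Xs)"
proof -
  define Ys where "Ys = (SOME Xs. is_direct_sum C Xs M \<and> (\<forall>Y\<in>set Xs. local Y))"
  have "is_direct_sum C Ys M \<and> (\<forall>Y\<in>set Ys. local Y)"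
    unfolding Ys_def by (rule someI[of _ Xs]) (use assms in auto)
  then have "length (filter (isomorphic X) Ys) = length (filter (isomorphic X) Xs)"
    unfolding length_filter_conv_card using iso_count_le[OF assms(1)] assms(2,3) by (intro antisym) auto
  then show ?thesis by (simp add: multiplicity_def Ys_def)
qed

lemma multiplicity_sum:
  assumes "local X" "is_direct_sum C [A, B] S"
  shows "multiplicity X S = multiplicity X A + multiplicity X B"
proof -
  obtain Xs where Xs: "is_direct_sum C Xs A" "\<And>Y. Y \<in> set Xs \<Longrightarrow> local Y"
    using local_decomposition direct_sum_obj[OF assms(2)] by (metis insert_subset list.set(2))
  obtain Ys where Ys: "is_direct_sum C Ys B" "\<And>Y. Y \<in> set Ys \<Longrightarrow> local Y"
    using local_decomposition direct_sum_obj[OF assms(2)] by (metis insert_subset list.set(2))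
  have "is_direct_sum C (Xs @ Ys) S" using direct_sum_append Xs Ys assms by blast
  then have "multiplicity X S = length (filter (isomorphic X) (Xs @ Ys))"
    using multiplicity_eq[OF assms(1)] Xs Ys by (metis Un_iff set_append)
  then show ?thesis using multiplicity_eq[OF assms(1)] Xs Ys by simp
qed

lemma multiplicity_local:
  assumes "local X" "local Y" shows "multiplicity X Y = (if isomorphic X Y then 1 else 0)"
  using multiplicity_eq[OF assms(1), of "[Y]" Y] assms direct_sum_single local_obj by simp

end


section \<open>Extriangulated categories and their opposites\<close>

text \<open>The axioms are self-dual. Interpreting a locale at \<open>opp C\<close> dualizes all its
  lemmas at once; the two maps of a realizing sequence trade places and both arguments of
  \<open>Ext\<close> are exchanged.\<close>

definition opp :: "('o, 'm, 'k, 'e) extri \<Rightarrow> ('o, 'm, 'k, 'e) extri" where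
  "opp C = \<lparr>Obj = Obj C, Hom = (\<lambda>A B. Hom C B A), Dom = Cod C, Cod = Dom C,
     Comp = (\<lambda>g f. f \<bullet>\<^bsub>C\<^esub> g), Ident = Ident C, Ext = (\<lambda>D A. Ext C A D),
     EMap = (\<lambda>c a. EMap C a c), Realize = (\<lambda>D A \<delta>. {(B, x, y). (B, y, x) \<in> Realize C A D \<delta>})\<rparr>"

lemma opp_simps [simp]:
  "Obj (opp C) = Obj C" "Hom (opp C) A B = Hom C B A" "Dom (opp C) = Cod C" "Cod (opp C) = Dom C"
  "g \<bullet>\<^bsub>opp C\<^esub> f = f \<bullet>\<^bsub>C\<^esub> g" "Ident (opp C) = Ident C" "Ext (opp C) D A = Ext C A D"
  "EMap (opp C) c a = EMap C a c" "(B, x, y) \<in> Realize (opp C) D A \<delta> \<longleftrightarrow> (B, y, x) \<in> Realize C A D \<delta>"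
  by (simp_all add: opp_def)

lemma is_iso_opp [simp]: "is_iso (opp C) A B f \<longleftrightarrow> is_iso C B A f"
  by (auto simp: is_iso_def)

lemma direct_sum_diagram_opp [simp]: "direct_sum_diagram (opp C) Xs S i p \<longleftrightarrow> direct_sum_diagram C Xs S p i"
proof -
  define R where "R m n \<longleftrightarrow> i m \<bullet>\<^bsub>C\<^esub> p n = (if m = n then Ident C (Xs ! n) else \<zero>\<^bsub>Hom C (Xs ! n) (Xs ! m)\<^esub>)" for m n
  have "i n \<bullet>\<^bsub>C\<^esub> p m = (if m = n then Ident C (Xs ! n) else \<zero>\<^bsub>Hom C (Xs ! m) (Xs ! n)\<^esub>) \<longleftrightarrow> R n m" for m n
    by (auto simp: R_def)
  then show ?thesis unfolding direct_sum_diagram_def opp_simps R_def[symmetric] by auto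
qed

lemma is_direct_sum_opp [simp]: "is_direct_sum (opp C) Xs S \<longleftrightarrow> is_direct_sum C Xs S"
  unfolding is_direct_sum_def direct_sum_diagram_opp by blast

lemma subcategory_opp [simp]: "subcategory (opp C) U \<longleftrightarrow> subcategory C U"
proof -
  have "(\<exists>f. is_iso C Y X f) \<longleftrightarrow> (\<exists>f. is_iso C X Y f)" for X Y
    unfolding is_iso_def by blast
  then have "(\<forall>X Y f. X \<in> U \<and> Y \<in> Obj C \<and> is_iso C Y X f \<longrightarrow> Y \<in> U) \<longleftrightarrow>
      (\<forall>X Y f. X \<in> U \<and> Y \<in> Obj C \<and> is_iso C X Y f \<longrightarrow> Y \<in> U)" by metis
  then show ?thesis unfolding subcategory_def by simp
qed

lemma local_endomorphism_ring_opp [simp]: "local_endomorphism_ring (opp C) X \<longleftrightarrow> local_endomorphism_ring C X"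
  unfolding local_endomorphism_ring_def by simp

lemma etriangle_opp [simp]: "etriangle (opp C) (A, B, D, x, y, \<delta>) \<longleftrightarrow> etriangle C (D, B, A, y, x, \<delta>)"
  by auto

lemma sequences_opp: "(B, x, y) \<in> sequences (opp C) D A \<longleftrightarrow> (B, y, x) \<in> sequences C A D"
  by (auto simp: sequences_def)

lemma preadditive_opp:
  assumes "preadditive_category C" shows "preadditive_category (opp C)"
proof -
  interpret preadditive_category C using assms .
  show ?thesis
    by (rule preadditive_category.intro) (simp_all add: dom_cod ident_mor comp_mor comp_assoc comp_ident hom_group comp_add_left comp_add_right)
qed

lemma additive_opp:
  assumes "additive_category C" shows "additive_category (opp C)"
proof -
  interpret additive_category C using assms .
  interpret o: preadditive_category "opp C" by (rule preadditive_opp) unfold_locales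
  show ?thesis by unfold_locales (simp add: direct_sums)
qed

context preadditive_category
begin

text \<open>With transitivity, this allows every realization to represent its class, as
  \<open>realize_members\<close> records.\<close>

lemma sequence_equiv_sym:
  assumes "D \<in> Obj C" "A \<in> Obj C" "(s, t) \<in> sequence_equiv C D A" shows "(t, s) \<in> sequence_equiv C D A"
proof -
  obtain B x y B' x' y' b where 1: "s = (B, x, y)" "t = (B', x', y')" "(B, x, y) \<in> sequences C D A"
    "(B', x', y') \<in> sequences C D A" "is_iso C B B' b" "b \<bullet> x = x'" "y' \<bullet> b = y"
    using assms(3) unfolding sequence_equiv_def by blast
  have O: "B \<in> Obj C" "B' \<in> Obj C" using 1 by (auto simp: sequences_def)
  obtain c where c: "arrow b" "Dom C b = B" "Cod C b = B'" "arrow c" "Dom C c = B'" "Cod C c = B"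
    "c \<bullet> b = Ident C B" "b \<bullet> c = Ident C B'" using 1 O by (auto simp: is_iso_iff)
  have xy: "arrow x" "Dom C x = A" "Cod C x = B" "arrow y'" "Dom C y' = B'" "Cod C y' = D"
    using 1 O assms by (auto simp: sequences_def mor_iff)
  have "is_iso C B' B c" by (rule is_isoI[of b]) (use c in simp_all)
  moreover have "c \<bullet> x' = x" unfolding 1(6)[symmetric] using c xy by (simp add: reassoc)
  moreover have "y \<bullet> c = y'" unfolding 1(7)[symmetric] using c xy by simp
  ultimately show ?thesis unfolding sequence_equiv_def using 1 by blast
qed

lemma sequence_equiv_trans:
  assumes "D \<in> Obj C" "A \<in> Obj C" "(s, t) \<in> sequence_equiv C D A" "(t, u) \<in> sequence_equiv C D A"
  shows "(s, u) \<in> sequence_equiv C D A"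
proof -
  obtain B x y B' x' y' b where 1: "s = (B, x, y)" "t = (B', x', y')" "(B, x, y) \<in> sequences C D A"
    "(B', x', y') \<in> sequences C D A" "is_iso C B B' b" "b \<bullet> x = x'" "y' \<bullet> b = y"
    using assms(3) unfolding sequence_equiv_def by blast
  obtain B'' x'' y'' c where 2: "u = (B'', x'', y'')"
    "(B'', x'', y'') \<in> sequences C D A" "is_iso C B' B'' c" "c \<bullet> x' = x''" "y'' \<bullet> c = y'"
    using assms(4) 1(2) unfolding sequence_equiv_def by blast
  have O: "B \<in> Obj C" "B' \<in> Obj C" "B'' \<in> Obj C" using 1 2 by (auto simp: sequences_def)
  obtain b' where b: "arrow b" "Dom C b = B" "Cod C b = B'" "arrow b'" "Dom C b' = B'" "Cod C b' = B"
    "b' \<bullet> b = Ident C B" "b \<bullet> b' = Ident C B'" using 1 O by (auto simp: is_iso_iff)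
  obtain c' where c: "arrow c" "Dom C c = B'" "Cod C c = B''" "arrow c'" "Dom C c' = B''" "Cod C c' = B'"
    "c' \<bullet> c = Ident C B'" "c \<bullet> c' = Ident C B''" using 2 O by (auto simp: is_iso_iff)
  have xy: "arrow x" "Dom C x = A" "Cod C x = B" "arrow y''" "Dom C y'' = B''" "Cod C y'' = D"
    using 1 2 O assms by (auto simp: sequences_def mor_iff)
  have "is_iso C B B'' (c \<bullet> b)"
    by (rule is_isoI[of "b' \<bullet> c'"]) (use b c in \<open>simp_all add: reassoc[OF c(7)] reassoc[OF b(8)]\<close>)
  moreover have "(c \<bullet> b) \<bullet> x = x''" using 1 2 b c xy by simp
  moreover have "y'' \<bullet> (c \<bullet> b) = y" unfolding 1(7)[symmetric] 2(5)[symmetric] using b c xy by simp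
  ultimately show ?thesis unfolding sequence_equiv_def using 1 2 by blast
qed

end

context extriangulated_category
begin

lemma realize_members:
  assumes "D \<in> Obj C" "A \<in> Obj C" "\<delta> \<in> ext C D A" "s \<in> Realize C D A \<delta>"
  shows "s \<in> sequences C D A" "Realize C D A \<delta> = {t. (s, t) \<in> sequence_equiv C D A}"
proof -
  obtain r where r: "r \<in> sequences C D A" "Realize C D A \<delta> = sequence_equiv C D A `` {r}"
    using realize_class[OF assms(1-3)] unfolding quotient_def by blast
  have rs: "(r, s) \<in> sequence_equiv C D A" using r assms by auto
  then show "s \<in> sequences C D A" unfolding sequence_equiv_def by auto
  show "Realize C D A \<delta> = {t. (s, t) \<in> sequence_equiv C D A}"
    unfolding r(2) using rs sequence_equiv_sym[OF assms(1,2)] sequence_equiv_trans[OF assms(1,2)] by blast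
qed

lemma realize_exists:
  assumes "D \<in> Obj C" "A \<in> Obj C" "\<delta> \<in> ext C D A" shows "\<exists>B x y. etriangle C (A, B, D, x, y, \<delta>)"
proof -
  obtain r where r: "r \<in> sequences C D A" "Realize C D A \<delta> = sequence_equiv C D A `` {r}"
    using realize_class[OF assms(1-3)] unfolding quotient_def by blast
  obtain B x y where s: "r = (B, x, y)" by (cases r)
  have O: "B \<in> Obj C" "x \<in> mor C A B" "y \<in> mor C B D" using r s by (auto simp: sequences_def)
  then have "(r, r) \<in> sequence_equiv C D A"
    using r s assms is_iso_ident[OF O(1)] comp_ident[of A B x] comp_ident[of B D y]
    unfolding sequence_equiv_def by auto
  then show ?thesis using r s assms by auto
qed

lemma etriangleD:
  assumes "etriangle C (A, B, D, x, y, \<delta>)"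
  shows "A \<in> Obj C" "B \<in> Obj C" "D \<in> Obj C" "\<delta> \<in> ext C D A"
    "arrow x" "Dom C x = A" "Cod C x = B" "arrow y" "Dom C y = B" "Cod C y = D"
proof -
  have a: "A \<in> Obj C" "D \<in> Obj C" "\<delta> \<in> ext C D A" "(B, x, y) \<in> Realize C D A \<delta>" using assms by auto
  then have "(B, x, y) \<in> sequences C D A" using realize_members by blast
  then show "A \<in> Obj C" "B \<in> Obj C" "D \<in> Obj C" "\<delta> \<in> ext C D A"
    "arrow x" "Dom C x = A" "Cod C x = B" "arrow y" "Dom C y = B" "Cod C y = D"
    using a by (auto simp: sequences_def mor_iff)
qed

lemma realize_iso_middle:
  assumes "etriangle C (A, B, D, x, y, \<delta>)" "arrow f" "Dom C f = B" "Cod C f = B'" "arrow g" "Dom C g = B'" "Cod C g = B"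
    "g \<bullet> f = Ident C B" "f \<bullet> g = Ident C B'"
  shows "etriangle C (A, B', D, f \<bullet> x, y \<bullet> g, \<delta>)"
proof -
  note t = etriangleD[OF assms(1)]
  have B': "B' \<in> Obj C" using assms by auto
  have "is_iso C B B' f" by (rule is_isoI[of g]) (use assms in simp_all)
  moreover have "(B, x, y) \<in> sequences C D A" "(B', f \<bullet> x, y \<bullet> g) \<in> sequences C D A"
    using t assms B' by (auto simp: sequences_def intro!: arrow_mor)
  moreover have "(y \<bullet> g) \<bullet> f = y" using t assms by simp
  ultimately have "((B, x, y), (B', f \<bullet> x, y \<bullet> g)) \<in> sequence_equiv C D A"
    unfolding sequence_equiv_def by blast
  then show ?thesis using realize_members(2)[OF t(3,1,4), of "(B, x, y)"] assms(1) by auto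
qed

lemma realize_unique:
  assumes "etriangle C (A, B, D, x, y, \<delta>)" "etriangle C (A, B', D, x', y', \<delta>)"
  shows "isomorphic B B'"
proof -
  note t = etriangleD[OF assms(1)]
  have "((B, x, y), (B', x', y')) \<in> sequence_equiv C D A"
    using realize_members(2)[OF t(3,1,4), of "(B, x, y)"] assms by auto
  then show ?thesis unfolding sequence_equiv_def isomorphic_def using t etriangleD[OF assms(2)] by blast
qed

lemma extriangulated_opp: "extriangulated_category (opp C)"
proof -
  interpret o: additive_category "opp C" by (rule additive_opp) unfold_locales
  have cls: "Realize (opp C) D A \<delta> \<in> sequences (opp C) D A // sequence_equiv (opp C) D A"
    if O: "D \<in> Obj C" "A \<in> Obj C" "\<delta> \<in> ext C A D" for D A \<delta>
  proof -
    obtain B x y where t: "etriangle C (D, B, A, x, y, \<delta>)" using realize_exists[OF O(2,1,3)] by blast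
    have m: "(B, x, y) \<in> Realize C A D \<delta>" using t by auto
    have "((B, y, x), (B', y', x')) \<in> sequence_equiv (opp C) D A \<longleftrightarrow> ((B', x', y'), (B, x, y)) \<in> sequence_equiv C A D"
      for B' x' y' unfolding sequence_equiv_def by (auto simp: sequences_opp)
    moreover have "((B', x', y'), (B, x, y)) \<in> sequence_equiv C A D \<longleftrightarrow> (B', x', y') \<in> Realize C A D \<delta>" for B' x' y'
      using realize_members(2)[OF O(2,1,3) m] sequence_equiv_sym[OF O(2,1)] by blast
    ultimately have "sequence_equiv (opp C) D A `` {(B, y, x)} = Realize (opp C) D A \<delta>"
      by (auto simp: opp_def)
    moreover have "(B, y, x) \<in> sequences (opp C) D A"
      using realize_members(1)[OF O(2,1,3) m] by (simp add: sequences_opp)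
    ultimately show ?thesis unfolding quotient_def by blast
  qed
  have zer: "(S, i 0, p 1) \<in> Realize (opp C) D A \<zero>\<^bsub>Ext (opp C) D A\<^esub>"
    if "direct_sum_diagram (opp C) [A, D] S i p" for A D S i p
  proof -
    have "biprod A D S (p 0) (p 1) (i 0) (i 1)" using that by (simp add: biprod_diagram)
    \<comment> \<open>Passing to the opposite also exchanges the two summands, so the diagram has to
      be reindexed before \<open>realize_zero\<close> applies.\<close>
    then have "biprod D A S (p 1) (p 0) (i 1) (i 0)" by (rule biprod_swap)
    then have "direct_sum_diagram C [D, A] S (\<lambda>n. if n = 0 then p 1 else p 0) (\<lambda>n. if n = 0 then i 1 else i 0)"
      by (simp add: biprod_diagram)
    from realize_zero[OF this] show ?thesis by simp
  qed
  have sm: "(SB, iB 0 \<bullet>\<^bsub>opp C\<^esub> x \<bullet>\<^bsub>opp C\<^esub> pA 0 \<oplus>\<^bsub>Hom (opp C) SA SB\<^esub> iB 1 \<bullet>\<^bsub>opp C\<^esub> x' \<bullet>\<^bsub>opp C\<^esub> pA 1,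
               iD 0 \<bullet>\<^bsub>opp C\<^esub> y \<bullet>\<^bsub>opp C\<^esub> pB 0 \<oplus>\<^bsub>Hom (opp C) SB SD\<^esub> iD 1 \<bullet>\<^bsub>opp C\<^esub> y' \<bullet>\<^bsub>opp C\<^esub> pB 1)
          \<in> Realize (opp C) SD SA
              (EMap (opp C) (pD 0) (iA 0) \<delta> \<oplus>\<^bsub>Ext (opp C) SD SA\<^esub> EMap (opp C) (pD 1) (iA 1) \<delta>')"
    if "etriangle (opp C) (A, B, D, x, y, \<delta>)" "etriangle (opp C) (A', B', D', x', y', \<delta>')"
        "direct_sum_diagram (opp C) [A, A'] SA iA pA" "direct_sum_diagram (opp C) [B, B'] SB iB pB"
        "direct_sum_diagram (opp C) [D, D'] SD iD pD"
    for A B D x y \<delta> A' B' D' x' y' \<delta>' SA iA pA SB iB pB SD iD pD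
  proof -
    have t: "etriangle C (D, B, A, y, x, \<delta>)" "etriangle C (D', B', A', y', x', \<delta>')" using that by auto
    note tt = etriangleD[OF t(1)] etriangleD[OF t(2)]
    have b: "biprod A A' SA (pA 0) (pA 1) (iA 0) (iA 1)" "biprod B B' SB (pB 0) (pB 1) (iB 0) (iB 1)"
      "biprod D D' SD (pD 0) (pD 1) (iD 0) (iD 1)" using that(3-5) by (simp_all add: biprod_diagram)
    have "(SB, pB 0 \<bullet> y \<bullet> iD 0 \<oplus>\<^bsub>Hom C SD SB\<^esub> pB 1 \<bullet> y' \<bullet> iD 1,
               pA 0 \<bullet> x \<bullet> iB 0 \<oplus>\<^bsub>Hom C SB SA\<^esub> pA 1 \<bullet> x' \<bullet> iB 1)
          \<in> Realize C SA SD (EMap C (iA 0) (pD 0) \<delta> \<oplus>\<^bsub>Ext C SA SD\<^esub> EMap C (iA 1) (pD 1) \<delta>')"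
      using realize_sum[OF t] that(3-5) by auto
    moreover have "pB 0 \<bullet> y \<bullet> iD 0 = pB 0 \<bullet> (y \<bullet> iD 0)" "pB 1 \<bullet> y' \<bullet> iD 1 = pB 1 \<bullet> (y' \<bullet> iD 1)"
      "pA 0 \<bullet> x \<bullet> iB 0 = pA 0 \<bullet> (x \<bullet> iB 0)" "pA 1 \<bullet> x' \<bullet> iB 1 = pA 1 \<bullet> (x' \<bullet> iB 1)"
      using tt b unfolding biprod_def by simp_all
    ultimately show ?thesis by simp
  qed
  show ?thesis
  proof (intro extriangulated_category.intro extriangulated_category_axioms.intro)
    show "additive_category (opp C)" by unfold_locales
  next
    fix A B D x y \<delta> A' B' D' x' y' \<delta>' a c
    assume "etriangle (opp C) (A, B, D, x, y, \<delta>)" "etriangle (opp C) (A', B', D', x', y', \<delta>')"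
      "a \<in> mor (opp C) A A'" "c \<in> mor (opp C) D D'" "push (opp C) D a \<delta> = pull (opp C) A' c \<delta>'"
    then show "\<exists>b\<in>mor (opp C) B B'. b \<bullet>\<^bsub>opp C\<^esub> x = x' \<bullet>\<^bsub>opp C\<^esub> a \<and> y' \<bullet>\<^bsub>opp C\<^esub> b = c \<bullet>\<^bsub>opp C\<^esub> y"
      using realize_morphism[of D' B' A' y' x' \<delta>' D B A y x \<delta> c a] by auto
  next
    fix A B D x y \<delta> A' B' D' x' y' \<delta>' a b
    assume "etriangle (opp C) (A, B, D, x, y, \<delta>)" "etriangle (opp C) (A', B', D', x', y', \<delta>')"
      "a \<in> mor (opp C) A A'" "b \<in> mor (opp C) B B'" "b \<bullet>\<^bsub>opp C\<^esub> x = x' \<bullet>\<^bsub>opp C\<^esub> a"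
    then show "\<exists>c\<in>mor (opp C) D D'. c \<bullet>\<^bsub>opp C\<^esub> y = y' \<bullet>\<^bsub>opp C\<^esub> b \<and> push (opp C) D a \<delta> = pull (opp C) A' c \<delta>'"
      using ET3_op[of D' B' A' y' x' \<delta>' D B A y x \<delta> b a] by auto
  next
    fix A B D x y \<delta> A' B' D' x' y' \<delta>' b c
    assume "etriangle (opp C) (A, B, D, x, y, \<delta>)" "etriangle (opp C) (A', B', D', x', y', \<delta>')"
      "b \<in> mor (opp C) B B'" "c \<in> mor (opp C) D D'" "c \<bullet>\<^bsub>opp C\<^esub> y = y' \<bullet>\<^bsub>opp C\<^esub> b"
    then obtain a where "a \<in> mor C A' A" "a \<bullet> x' = x \<bullet> b" "push C A' c \<delta>' = pull C D a \<delta>"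
      using ET3[of D' B' A' y' x' \<delta>' D B A y x \<delta> c b] by auto
    then show "\<exists>a\<in>mor (opp C) A A'. b \<bullet>\<^bsub>opp C\<^esub> x = x' \<bullet>\<^bsub>opp C\<^esub> a \<and> push (opp C) D a \<delta> = pull (opp C) A' c \<delta>'"
      by (intro bexI[of _ a]) auto
  next
    fix A B D f f' \<delta> M F g g' \<delta>'
    assume "etriangle (opp C) (A, B, D, f, f', \<delta>)" "etriangle (opp C) (B, M, F, g, g', \<delta>')"
    then have "etriangle C (D, B, A, f', f, \<delta>)" "etriangle C (F, M, B, g', g, \<delta>')" by auto
    from ET4_op[OF this] show "\<exists>E \<delta>''. \<exists>h'\<in>mor (opp C) M E. \<exists>d\<in>mor (opp C) D E. \<exists>e\<in>mor (opp C) E F.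
        h' \<bullet>\<^bsub>opp C\<^esub> g = d \<bullet>\<^bsub>opp C\<^esub> f' \<and> e \<bullet>\<^bsub>opp C\<^esub> h' = g' \<and>
        etriangle (opp C) (A, M, E, g \<bullet>\<^bsub>opp C\<^esub> f, h', \<delta>'') \<and>
        etriangle (opp C) (D, E, F, d, e, push (opp C) F f' \<delta>') \<and>
        pull (opp C) A d \<delta>'' = \<delta> \<and> push (opp C) E f \<delta>'' = pull (opp C) B e \<delta>'"
      by (simp only: opp_simps etriangle_opp)
  next
    fix A B D f f' \<delta> M F g g' \<delta>'
    assume "etriangle (opp C) (D, B, A, f', f, \<delta>)" "etriangle (opp C) (F, M, B, g', g, \<delta>')"
    then have "etriangle C (A, B, D, f, f', \<delta>)" "etriangle C (B, M, F, g, g', \<delta>')" by auto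
    from ET4[OF this] show "\<exists>E \<delta>''. \<exists>h'\<in>mor (opp C) E M. \<exists>d\<in>mor (opp C) E D. \<exists>e\<in>mor (opp C) F E.
        g \<bullet>\<^bsub>opp C\<^esub> h' = f' \<bullet>\<^bsub>opp C\<^esub> d \<and> h' \<bullet>\<^bsub>opp C\<^esub> e = g' \<and>
        etriangle (opp C) (E, M, A, h', f \<bullet>\<^bsub>opp C\<^esub> g, \<delta>'') \<and>
        etriangle (opp C) (F, E, D, e, d, pull (opp C) F f' \<delta>') \<and>
        push (opp C) A d \<delta>'' = \<delta> \<and> pull (opp C) E f \<delta>'' = push (opp C) B e \<delta>'"
      by (simp only: opp_simps etriangle_opp)
  qed ((rule zer sm; assumption) | (rule cls; simp only: opp_simps) |
      (simp only: opp_simps, rule ext_group emap_closed emap_add emap_ident emap_comp emap_biadditive_left emap_biadditive_right; assumption))+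
qed

end


section \<open>Exact sequences and homotopy pushouts\<close>

declare etriangle.simps [simp del]

context extriangulated_category
begin

lemma ET3_arrow:
  assumes t: "etriangle C (A, B, D, x, y, \<delta>)" and t': "etriangle C (A', B', D', x', y', \<delta>')"
    and a: "arrow a" "Dom C a = A" "Cod C a = A'" and b: "arrow b" "Dom C b = B" "Cod C b = B'" and e: "b \<bullet> x = x' \<bullet> a"
  shows "\<exists>c. arrow c \<and> Dom C c = D \<and> Cod C c = D' \<and> c \<bullet> y = y' \<bullet> b \<and> push C D a \<delta> = pull C A' c \<delta>'"
proof -
  obtain c where "c \<in> mor C D D'" "c \<bullet> y = y' \<bullet> b" "push C D a \<delta> = pull C A' c \<delta>'"
    using ET3[OF t t' arrow_mor[OF a] arrow_mor[OF b] e] by blast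
  then show ?thesis using morD[of c D D'] etriangleD[OF t] etriangleD[OF t'] by blast
qed

lemma ET3_op_arrow:
  assumes t: "etriangle C (A, B, D, x, y, \<delta>)" and t': "etriangle C (A', B', D', x', y', \<delta>')"
    and b: "arrow b" "Dom C b = B" "Cod C b = B'" and c: "arrow c" "Dom C c = D" "Cod C c = D'" and e: "c \<bullet> y = y' \<bullet> b"
  shows "\<exists>a. arrow a \<and> Dom C a = A \<and> Cod C a = A' \<and> b \<bullet> x = x' \<bullet> a \<and> push C D a \<delta> = pull C A' c \<delta>'"
proof -
  obtain a where "a \<in> mor C A A'" "b \<bullet> x = x' \<bullet> a" "push C D a \<delta> = pull C A' c \<delta>'"
    using ET3_op[OF t t' arrow_mor[OF b] arrow_mor[OF c] e] by blast
  then show ?thesis using morD[of a A A'] etriangleD[OF t] etriangleD[OF t'] by blast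
qed

lemma realize_morphism_arrow:
  assumes t: "etriangle C (A, B, D, x, y, \<delta>)" and t': "etriangle C (A', B', D', x', y', \<delta>')"
    and a: "arrow a" "Dom C a = A" "Cod C a = A'" and c: "arrow c" "Dom C c = D" "Cod C c = D'"
    and e: "push C D a \<delta> = pull C A' c \<delta>'"
  shows "\<exists>b. arrow b \<and> Dom C b = B \<and> Cod C b = B' \<and> b \<bullet> x = x' \<bullet> a \<and> y' \<bullet> b = c \<bullet> y"
proof -
  obtain b where "b \<in> mor C B B'" "b \<bullet> x = x' \<bullet> a" "y' \<bullet> b = c \<bullet> y"
    using realize_morphism[OF t t' arrow_mor[OF a] arrow_mor[OF c] e] by blast
  then show ?thesis using morD[of b B B'] etriangleD[OF t] etriangleD[OF t'] by blast
qed

lemma arrow_opp: "preadditive_category.arrow (opp C) f \<longleftrightarrow> arrow f"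
proof -
  interpret o: extriangulated_category "opp C" by (rule extriangulated_opp)
  show ?thesis unfolding arrow_def o.arrow_def by auto
qed

lemma emap_arrow:
  assumes "arrow c" "arrow a" "\<delta> \<in> ext C (Cod C c) (Dom C a)"
  shows "EMap C c a \<delta> \<in> ext C (Dom C c) (Cod C a)"
  using assms by (intro emap_closed[of "Cod C c" "Dom C c" "Dom C a" "Cod C a"]) (auto intro: arrow_mor)

lemma ext_zero_closed [simp]: "\<lbrakk>D \<in> Obj C; A \<in> Obj C\<rbrakk> \<Longrightarrow> \<zero>\<^bsub>Ext C D A\<^esub> \<in> ext C D A"
  using ext_group[of D A] by (simp add: abelian_group_def abelian_monoid.zero_closed)

lemma ext_add_zero:
  "\<lbrakk>D \<in> Obj C; A \<in> Obj C; \<delta> \<in> ext C D A\<rbrakk> \<Longrightarrow> \<delta> \<oplus>\<^bsub>Ext C D A\<^esub> \<zero>\<^bsub>Ext C D A\<^esub> = \<delta>"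
  "\<lbrakk>D \<in> Obj C; A \<in> Obj C; \<delta> \<in> ext C D A\<rbrakk> \<Longrightarrow> \<zero>\<^bsub>Ext C D A\<^esub> \<oplus>\<^bsub>Ext C D A\<^esub> \<delta> = \<delta>"
  using ext_group[of D A] by (simp_all add: abelian_group_def abelian_monoid.r_zero abelian_monoid.l_zero)

lemma ext_idempotent:
  assumes "D \<in> Obj C" "A \<in> Obj C" "\<delta> \<in> ext C D A" "\<delta> \<oplus>\<^bsub>Ext C D A\<^esub> \<delta> = \<delta>" shows "\<delta> = \<zero>\<^bsub>Ext C D A\<^esub>"
proof -
  interpret abelian_group "Ext C D A" using ext_group assms by simp
  show ?thesis using assms(3,4) r_neg1[of \<delta> \<delta>] l_neg[of \<delta>] by simp
qed

lemma emap_zero: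
  assumes "arrow c" "arrow a" "Cod C c = D" "Dom C a = A"
  shows "EMap C c a \<zero>\<^bsub>Ext C D A\<^esub> = \<zero>\<^bsub>Ext C (Dom C c) (Cod C a)\<^esub>"
proof (rule ext_idempotent)
  have O: "D \<in> Obj C" "A \<in> Obj C" using assms by auto
  show "EMap C c a \<zero>\<^bsub>Ext C D A\<^esub> \<in> ext C (Dom C c) (Cod C a)" using assms O by (intro emap_arrow) auto
  show "EMap C c a \<zero>\<^bsub>Ext C D A\<^esub> \<oplus>\<^bsub>Ext C (Dom C c) (Cod C a)\<^esub> EMap C c a \<zero>\<^bsub>Ext C D A\<^esub> = EMap C c a \<zero>\<^bsub>Ext C D A\<^esub>"
    using emap_add[of D "Dom C c" A "Cod C a" c a "\<zero>\<^bsub>Ext C D A\<^esub>" "\<zero>\<^bsub>Ext C D A\<^esub>"] assms O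
    by (simp add: ext_add_zero arrow_mor)
qed (use assms in auto)

lemma emap_comp':
  assumes "arrow c" "arrow c'" "arrow a" "arrow a'" "Cod C c' = Dom C c" "Cod C a = Dom C a'" "\<delta> \<in> ext C (Cod C c) (Dom C a)"
  shows "EMap C c' a' (EMap C c a \<delta>) = EMap C (c \<bullet> c') (a' \<bullet> a) \<delta>"
  using emap_comp[of "Cod C c" "Dom C c" "Dom C c'" "Dom C a" "Cod C a" "Cod C a'" c c' a a' \<delta>] assms
  by (simp add: arrow_mor)

lemma emap_null_left:
  assumes "arrow a" "D \<in> Obj C" "D' \<in> Obj C" "\<delta> \<in> ext C D (Dom C a)"
  shows "EMap C (null D' D) a \<delta> = \<zero>\<^bsub>Ext C D' (Cod C a)\<^esub>"
proof (rule ext_idempotent)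
  show "EMap C (null D' D) a \<delta> \<in> ext C D' (Cod C a)" using emap_arrow[of "null D' D" a \<delta>] assms by simp
  show "EMap C (null D' D) a \<delta> \<oplus>\<^bsub>Ext C D' (Cod C a)\<^esub> EMap C (null D' D) a \<delta> = EMap C (null D' D) a \<delta>"
    using emap_biadditive_left[of D D' "Dom C a" "Cod C a" "null D' D" "null D' D" a \<delta>] assms
    by (simp add: arrow_mor plus_fold)
qed (use assms in auto)

lemma emap_plus_left:
  assumes "arrow c" "arrow c'" "Dom C c = Dom C c'" "Cod C c = Cod C c'" "arrow a" "\<delta> \<in> ext C (Cod C c') (Dom C a)"
  shows "EMap C (c \<boxplus> c') a \<delta> = EMap C c a \<delta> \<oplus>\<^bsub>Ext C (Dom C c') (Cod C a)\<^esub> EMap C c' a \<delta>"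
  using emap_biadditive_left[of "Cod C c" "Dom C c" "Dom C a" "Cod C a" c c' a \<delta>] assms
  by (simp add: arrow_mor plus_fold)

lemma push_closed:
  "\<lbrakk>D \<in> Obj C; arrow a; \<delta> \<in> ext C D (Dom C a)\<rbrakk> \<Longrightarrow> push C D a \<delta> \<in> ext C D (Cod C a)"
  using emap_arrow[of "Ident C D" a \<delta>] by simp

lemma pull_closed:
  "\<lbrakk>A \<in> Obj C; arrow c; \<delta> \<in> ext C (Cod C c) A\<rbrakk> \<Longrightarrow> pull C A c \<delta> \<in> ext C (Dom C c) A"
  using emap_arrow[of c "Ident C A" \<delta>] by simp

lemma push_push:
  "\<lbrakk>D \<in> Obj C; arrow a; arrow a'; Cod C a = Dom C a'; \<delta> \<in> ext C D (Dom C a)\<rbrakk>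
    \<Longrightarrow> push C D a' (push C D a \<delta>) = push C D (a' \<bullet> a) \<delta>"
  using emap_comp'[of "Ident C D" "Ident C D" a a' \<delta>] by simp

lemma pull_pull:
  "\<lbrakk>A \<in> Obj C; arrow c; arrow c'; Cod C c' = Dom C c; \<delta> \<in> ext C (Cod C c) A\<rbrakk>
    \<Longrightarrow> pull C A c' (pull C A c \<delta>) = pull C A (c \<bullet> c') \<delta>"
  using emap_comp'[of c c' "Ident C A" "Ident C A" \<delta>] by simp

lemma push_pull:
  assumes "arrow c" "arrow a" "\<delta> \<in> ext C (Cod C c) (Dom C a)"
  shows "push C (Dom C c) a (pull C (Dom C a) c \<delta>) = pull C (Cod C a) c (push C (Cod C c) a \<delta>)"
  using emap_comp'[of c "Ident C (Dom C c)" "Ident C (Dom C a)" a \<delta>]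
    emap_comp'[of "Ident C (Cod C c)" c a "Ident C (Cod C a)" \<delta>] assms by simp

lemma push_zero: "\<lbrakk>D \<in> Obj C; arrow a; Dom C a = A\<rbrakk> \<Longrightarrow> push C D a \<zero>\<^bsub>Ext C D A\<^esub> = \<zero>\<^bsub>Ext C D (Cod C a)\<^esub>"
  using emap_zero[of "Ident C D" a D A] by simp

lemma pull_zero: "\<lbrakk>A \<in> Obj C; arrow c; Cod C c = D\<rbrakk> \<Longrightarrow> pull C A c \<zero>\<^bsub>Ext C D A\<^esub> = \<zero>\<^bsub>Ext C (Dom C c) A\<^esub>"
  using emap_zero[of c "Ident C A" D A] by simp

section \<open>Split triangles and the pieces of the long exact sequences of Hom and Ext\<close>

lemma split_etriangle:
  assumes "biprod A D S i j p q" shows "etriangle C (A, S, D, i, q, \<zero>\<^bsub>Ext C D A\<^esub>)"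
proof -
  have "direct_sum_diagram C [A, D] S (\<lambda>n. if n = 0 then i else j) (\<lambda>n. if n = 0 then p else q)"
    using assms by (simp add: biprod_diagram)
  from realize_zero[OF this] show ?thesis using assms by (simp add: biprod_def etriangle.simps)
qed

lemma zero_sum_left:
  assumes "is_zero_object C Z" "X \<in> Obj C"
  shows "etriangle C (Z, X, X, null Z X, Ident C X, \<zero>\<^bsub>Ext C X Z\<^esub>)"
  by (rule split_etriangle[OF biprod_swap[OF zero_object_biprod[OF assms]]])

lemma zero_sum_right:
  assumes "is_zero_object C Z" "X \<in> Obj C"
  shows "etriangle C (X, X, Z, Ident C X, null X Z, \<zero>\<^bsub>Ext C Z X\<^esub>)"
  by (rule split_etriangle[OF zero_object_biprod[OF assms]])

lemma zero_etriangle_sum: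
  assumes "etriangle C (A, B, D, x, y, \<zero>\<^bsub>Ext C D A\<^esub>)" shows "is_direct_sum C [A, D] B"
proof -
  obtain S where S: "is_direct_sum C [A, D] S" using two_sum_exists etriangleD[OF assms] by blast
  then obtain i j p q where b: "biprod A D S i j p q" by (auto simp: is_direct_sum_two)
  show ?thesis using direct_sum_cong[OF S] realize_unique[OF split_etriangle[OF b] assms] by blast
qed

text \<open>The pair of the identity of \<open>B\<close> and \<open>y\<close> is completed by (ET3)
  for the opposite to a morphism from the trivial triangle \<open>0 -> B -> B\<close>; this writes
  the pullback as a pushforward of the zero extension.\<close>

lemma pull_deflation_zero:
  assumes t: "etriangle C (A, B, D, x, y, \<delta>)" shows "pull C A y \<delta> = \<zero>\<^bsub>Ext C B A\<^esub>"
proof -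
  note tt = etriangleD[OF t]
  obtain Z where Z: "is_zero_object C Z" using zero_exists by blast
  have ZO: "Z \<in> Obj C" using Z by (simp add: is_zero_object_def)
  obtain a where a: "arrow a" "Dom C a = Z" "Cod C a = A" "push C B a \<zero>\<^bsub>Ext C B Z\<^esub> = pull C A y \<delta>"
    using ET3_op_arrow[OF zero_sum_left[OF Z tt(2)] t, of "Ident C B" y] tt by fastforce
  then show ?thesis using push_zero[of B a Z] tt ZO by simp
qed

text \<open>If the pullback along \<open>f\<close> vanishes, then the identity of \<open>A\<close>
  and \<open>f\<close> form a morphism from a split extension; its realization, restricted to the
  second summand, is the lift.\<close>

lemma lift_deflation:
  assumes t: "etriangle C (A, B, D, x, y, \<delta>)" and f: "arrow f" "Cod C f = D" "pull C A f \<delta> = \<zero>\<^bsub>Ext C (Dom C f) A\<^esub>"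
  shows "\<exists>g. arrow g \<and> Dom C g = Dom C f \<and> Cod C g = B \<and> y \<bullet> g = f"
proof -
  note tt = etriangleD[OF t]
  let ?W = "Dom C f"
  have W: "?W \<in> Obj C" using f by simp
  obtain S i j p q where b: "biprod A ?W S i j p q" using two_sum_exists[OF tt(1) W] by (auto simp: is_direct_sum_two)
  note bb = b[unfolded biprod_def]
  have "push C ?W (Ident C A) \<zero>\<^bsub>Ext C ?W A\<^esub> = pull C A f \<delta>" using f W tt by (simp add: emap_ident)
  then obtain h where ha: "arrow h" "Dom C h = S" "Cod C h = B" and h: "y \<bullet> h = f \<bullet> q"
    using realize_morphism_arrow[OF split_etriangle[OF b] t, of "Ident C A" f] tt f by auto
  have "y \<bullet> (h \<bullet> j) = (y \<bullet> h) \<bullet> j" using ha bb tt by simp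
  also have "\<dots> = f" using h bb f by simp
  finally show ?thesis using ha bb by (intro exI[of _ "h \<bullet> j"]) simp
qed

lemma pull_factor_zero:
  assumes t: "etriangle C (A, B, D, x, y, \<delta>)" and g: "arrow g" "Cod C g = B"
  shows "pull C A (y \<bullet> g) \<delta> = \<zero>\<^bsub>Ext C (Dom C g) A\<^esub>"
proof -
  note tt = etriangleD[OF t]
  have "pull C A (y \<bullet> g) \<delta> = pull C A g (pull C A y \<delta>)" using pull_pull[of A y g \<delta>] tt g by simp
  then show ?thesis using pull_deflation_zero[OF t] pull_zero[of A g B] tt g by simp
qed

lemma push_inflation_zero:
  assumes t: "etriangle C (A, B, D, x, y, \<delta>)" shows "push C D x \<delta> = \<zero>\<^bsub>Ext C D B\<^esub>"
proof -
  interpret o: extriangulated_category "opp C" by (rule extriangulated_opp)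
  show ?thesis using o.pull_deflation_zero[of D B A y x \<delta>] t by simp
qed

lemma extend_inflation:
  assumes t: "etriangle C (A, B, D, x, y, \<delta>)" and f: "arrow f" "Dom C f = A" "push C D f \<delta> = \<zero>\<^bsub>Ext C D (Cod C f)\<^esub>"
  shows "\<exists>g. arrow g \<and> Dom C g = B \<and> Cod C g = Cod C f \<and> g \<bullet> x = f"
proof -
  interpret o: extriangulated_category "opp C" by (rule extriangulated_opp)
  show ?thesis using o.lift_deflation[of D B A y x \<delta> f] t f by (auto simp: arrow_opp)
qed

lemma push_factor_zero:
  assumes t: "etriangle C (A, B, D, x, y, \<delta>)" and g: "arrow g" "Dom C g = B"
  shows "push C D (g \<bullet> x) \<delta> = \<zero>\<^bsub>Ext C D (Cod C g)\<^esub>"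
proof -
  interpret o: extriangulated_category "opp C" by (rule extriangulated_opp)
  show ?thesis using o.pull_factor_zero[of D B A y x \<delta> g] t g by (simp add: arrow_opp)
qed

text \<open>Exactness at Ext(W, A): \<open>x\<close> extends along the inflation realizing
  \<open>\<epsilon>\<close>, and (ET3) turns this extension into the desired map on the third
  terms.\<close>

lemma ext_from_hom:
  assumes t: "etriangle C (A, B, D, x, y, \<delta>)" and W: "W \<in> Obj C" and e: "\<epsilon> \<in> ext C W A" "push C W x \<epsilon> = \<zero>\<^bsub>Ext C W B\<^esub>"
  shows "\<exists>f. arrow f \<and> Dom C f = W \<and> Cod C f = D \<and> \<epsilon> = pull C A f \<delta>"
proof -
  note tt = etriangleD[OF t]
  obtain M m n where r: "etriangle C (A, M, W, m, n, \<epsilon>)" using realize_exists[OF W tt(1) e(1)] by blast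
  note rr = etriangleD[OF r]
  obtain h where h: "arrow h" "Dom C h = M" "Cod C h = B" "h \<bullet> m = x" using extend_inflation[OF r, of x] e tt by auto
  have hx: "h \<bullet> m = x \<bullet> Ident C A" using h tt by simp
  then obtain f where f: "arrow f" "Dom C f = W" "Cod C f = D" "push C W (Ident C A) \<epsilon> = pull C A f \<delta>"
    using ET3_arrow[OF r t arrow_ident[OF tt(1)] h(1-3) hx] by blast
  then show ?thesis using W tt e by (intro exI[of _ f]) (simp add: emap_ident)
qed

lemma ext_from_hom_op:
  assumes t: "etriangle C (A, B, D, x, y, \<delta>)" and W: "W \<in> Obj C" and e: "\<epsilon> \<in> ext C D W" "pull C W y \<epsilon> = \<zero>\<^bsub>Ext C B W\<^esub>"
  shows "\<exists>f. arrow f \<and> Dom C f = A \<and> Cod C f = W \<and> \<epsilon> = push C D f \<delta>"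
proof -
  interpret o: extriangulated_category "opp C" by (rule extriangulated_opp)
  show ?thesis using o.ext_from_hom[of D B A y x \<delta> W \<epsilon>] assms by (auto simp: arrow_opp)
qed

text \<open>Exactness at Hom(W, B), by comparison with the trivial triangle
  \<open>W -> W -> 0\<close>. The factor \<open>g\<close> need not be unique.\<close>

lemma kernel_factor:
  assumes t: "etriangle C (A, B, D, x, y, \<delta>)" and f: "arrow f" "Cod C f = B" "y \<bullet> f = null (Dom C f) D"
  shows "\<exists>g. arrow g \<and> Dom C g = Dom C f \<and> Cod C g = A \<and> x \<bullet> g = f"
proof -
  note tt = etriangleD[OF t]
  obtain Z where Z: "is_zero_object C Z" using zero_exists by blast
  have ZO: "Z \<in> Obj C" "Dom C f \<in> Obj C" using Z f by (auto simp: is_zero_object_def)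
  have e: "null Z D \<bullet> null (Dom C f) Z = y \<bullet> f" using tt f ZO by simp
  then obtain a where a: "arrow a" "Dom C a = Dom C f" "Cod C a = A" "f \<bullet> Ident C (Dom C f) = x \<bullet> a"
    using ET3_op_arrow[OF zero_sum_right[OF Z ZO(2)] t f(1) refl f(2) arrow_null[OF ZO(1) tt(3)] e] by blast
  have "x \<bullet> a = f" using a(4) comp_ident'(1)[OF f(1) refl] by simp
  with a(1-3) show ?thesis by blast
qed

lemma comp_zero:
  assumes t: "etriangle C (A, B, D, x, y, \<delta>)" shows "y \<bullet> x = null A D"
proof -
  note tt = etriangleD[OF t]
  obtain Z where Z: "is_zero_object C Z" using zero_exists by blast
  have ZO: "Z \<in> Obj C" using Z by (auto simp: is_zero_object_def)
  obtain c where c: "arrow c" "Dom C c = Z" "Cod C c = D" "c \<bullet> null A Z = y \<bullet> x"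
    using ET3_arrow[OF zero_sum_right[OF Z tt(1)] t arrow_ident[OF tt(1)] tt(5-7) refl] by blast
  have "y \<bullet> x = c \<bullet> null A Z" by (rule c(4)[symmetric])
  also have "\<dots> = null A D" using comp_null(1)[OF c(1) tt(1) c(2)] c(3) by simp
  finally show ?thesis .
qed

text \<open>Exactness at Ext(W, B). (ET4) composes \<open>x\<close> with the inflation of
  \<open>\<epsilon>\<close>; the triangle from \<open>D\<close> to \<open>W\<close> it produces has
  class \<open>push C W y \<epsilon>\<close>, so it splits, and the class \<open>\<delta>''\<close>
  pulled back along the section \<open>s\<close> is the required \<open>\<epsilon>'\<close>.\<close>

lemma ext_middle_exact:
  assumes t: "etriangle C (A, B, D, x, y, \<delta>)" and W: "W \<in> Obj C" and e: "\<epsilon> \<in> ext C W B" "push C W y \<epsilon> = \<zero>\<^bsub>Ext C W D\<^esub>"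
  shows "\<exists>\<epsilon>'. \<epsilon>' \<in> ext C W A \<and> \<epsilon> = push C W x \<epsilon>'"
proof -
  note tt = etriangleD[OF t]
  obtain M g g' where r: "etriangle C (B, M, W, g, g', \<epsilon>)" using realize_exists[OF W tt(2) e(1)] by blast
  obtain E \<delta>'' d ee h' where *: "ee \<in> mor C E W" "d \<in> mor C D E" "etriangle C (A, M, E, g \<bullet> x, h', \<delta>'')"
     "etriangle C (D, E, W, d, ee, push C W y \<epsilon>)" "push C E x \<delta>'' = pull C B ee \<epsilon>"
    using ET4[OF t r] by blast
  note eee = etriangleD[OF *(4)] and rr = etriangleD[OF *(3)]
  have "pull C D (Ident C W) (push C W y \<epsilon>) = \<zero>\<^bsub>Ext C (Dom C (Ident C W)) D\<^esub>"
    using e W tt by (simp add: emap_ident)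
  then obtain s where s: "arrow s" "Dom C s = W" "Cod C s = E" "ee \<bullet> s = Ident C W"
    using lift_deflation[OF *(4), of "Ident C W"] W by auto
  have "\<epsilon> = pull C B (ee \<bullet> s) \<epsilon>" using s W tt e by (simp add: emap_ident)
  also have "\<dots> = pull C B s (pull C B ee \<epsilon>)" using pull_pull[of B ee s \<epsilon>] s eee tt e by simp
  also have "\<dots> = pull C B s (push C E x \<delta>'')" using * by simp
  also have "\<dots> = push C W x (pull C A s \<delta>'')" using push_pull[of s x \<delta>''] s tt rr by simp
  finally show ?thesis using pull_closed[of A s \<delta>''] s tt rr by auto
qed

text \<open>A five lemma by hand. (ET3) gives \<open>c\<close>, and \<open>\<delta>'\<close> pulled
  from \<open>\<delta>\<close> gives a candidate inverse \<open>s\<close>, correct only up to maps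
  through the deflations. A correction by such a map yields a right inverse \<open>r\<close>, and
  the error of \<open>r \<bullet> c\<close> is then shown to vanish.\<close>

lemma cone_unique:
  assumes t: "etriangle C (A, B, D, x, y, \<delta>)" and t': "etriangle C (A, B, D', x, y', \<delta>')"
  shows "isomorphic D D'"
proof -
  note tt = etriangleD[OF t] and tt' = etriangleD[OF t']
  have e: "Ident C B \<bullet> x = x \<bullet> Ident C A" using tt by simp
  then obtain c where ca: "arrow c" "Dom C c = D" "Cod C c = D'"
    and c: "c \<bullet> y = y' \<bullet> Ident C B" "push C D (Ident C A) \<delta> = pull C A c \<delta>'"
    using ET3_arrow[OF t t' arrow_ident[OF tt(1)] arrow_ident[OF tt(2)] e] by blast
  have cy: "c \<bullet> y = y'" and cd: "pull C A c \<delta>' = \<delta>" using c tt tt' by (simp_all add: emap_ident)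
  obtain s where s: "arrow s" "Dom C s = D'" "Cod C s = D" "\<delta>' = pull C A s \<delta>"
    using ext_from_hom[OF t, of D' \<delta>'] push_inflation_zero[OF t'] tt' by auto
  have ext1: "pull C A (f \<boxplus> neg h) \<eta> = \<zero>\<^bsub>Ext C (Dom C h) A\<^esub>"
    if fh: "arrow f" "arrow h" "Dom C f = Dom C h" "Cod C f = Cod C h" "\<eta> \<in> ext C (Cod C h) A" "pull C A f \<eta> = pull C A h \<eta>" for f h \<eta>
  proof -
    have "pull C A (f \<boxplus> neg h) \<eta> = pull C A f \<eta> \<oplus>\<^bsub>Ext C (Dom C h) A\<^esub> pull C A (neg h) \<eta>"
      using emap_plus_left[of f "neg h" "Ident C A" \<eta>] fh tt by simp
    also have "\<dots> = pull C A h \<eta> \<oplus>\<^bsub>Ext C (Dom C h) A\<^esub> pull C A (neg h) \<eta>" using fh by simp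
    also have "\<dots> = pull C A (h \<boxplus> neg h) \<eta>" using emap_plus_left[of h "neg h" "Ident C A" \<eta>] fh tt by simp
    also have "\<dots> = \<zero>\<^bsub>Ext C (Dom C h) A\<^esub>" using emap_null_left[of "Ident C A" "Cod C h" "Dom C h" \<eta>] fh tt by simp
    finally show ?thesis .
  qed
  have "pull C A (Ident C D' \<boxplus> neg (c \<bullet> s)) \<delta>' = \<zero>\<^bsub>Ext C (Dom C (Ident C D' \<boxplus> neg (c \<bullet> s))) A\<^esub>"
    using ext1[of "Ident C D'" "c \<bullet> s" \<delta>'] pull_pull[of A c s \<delta>'] ca s cd tt tt' by (simp add: emap_ident)
  then obtain g where g: "arrow g" "Dom C g = D'" "Cod C g = B" "y' \<bullet> g = Ident C D' \<boxplus> neg (c \<bullet> s)"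
    using lift_deflation[OF t', of "Ident C D' \<boxplus> neg (c \<bullet> s)"] ca s tt' by auto
  define r where "r = s \<boxplus> y \<bullet> g"
  have r: "arrow r" "Dom C r = D'" "Cod C r = D" using s g tt by (simp_all add: r_def)
  have "c \<bullet> r = c \<bullet> s \<boxplus> y' \<bullet> g" using ca s g tt reassoc[OF cy, of g] by (simp add: r_def)
  also have "\<dots> = Ident C D'" unfolding g(4) using ca s tt' plus_lcomm[of "c \<bullet> s" "Ident C D'" "neg (c \<bullet> s)"] by simp
  finally have cr: "c \<bullet> r = Ident C D'" .
  have "pull C A (r \<bullet> c) \<delta> = pull C A c (pull C A r \<delta>)" using pull_pull[of A r c \<delta>] r ca tt by simp
  also have "pull C A r \<delta> = pull C A s \<delta> \<oplus>\<^bsub>Ext C D' A\<^esub> pull C A (y \<bullet> g) \<delta>"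
    using emap_plus_left[of s "y \<bullet> g" "Ident C A" \<delta>] s g tt by (simp add: r_def)
  also have "\<dots> = \<delta>'" using pull_factor_zero[OF t, of g] g s tt tt' by (simp add: ext_add_zero)
  finally have "pull C A (r \<bullet> c) \<delta> = pull C A (Ident C D) \<delta>" using cd tt by (simp add: emap_ident)
  then have "pull C A (r \<bullet> c \<boxplus> neg (Ident C D)) \<delta> = \<zero>\<^bsub>Ext C (Dom C (r \<bullet> c \<boxplus> neg (Ident C D))) A\<^esub>"
    using ext1[of "r \<bullet> c" "Ident C D" \<delta>] r ca tt by simp
  then obtain h where h: "arrow h" "Dom C h = D" "Cod C h = B" "y \<bullet> h = r \<bullet> c \<boxplus> neg (Ident C D)"
    using lift_deflation[OF t, of "r \<bullet> c \<boxplus> neg (Ident C D)"] r ca tt by auto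
  \<comment> \<open>The error \<open>y \<bullet> h\<close> of \<open>r \<bullet> c\<close> is killed
    by \<open>c\<close>, because \<open>r\<close> is a right inverse of \<open>c\<close>. So
    \<open>h\<close> factors through \<open>x\<close>, and the error is zero.\<close>
  have "y' \<bullet> h = c \<bullet> (y \<bullet> h)" using reassoc[OF cy, of h] h ca tt by simp
  also have "\<dots> = null D D'" unfolding h(4) using r ca tt reassoc[OF cr, of c] by simp
  finally obtain k where k: "arrow k" "Dom C k = D" "Cod C k = A" "x \<bullet> k = h"
    using kernel_factor[OF t', of h] h by auto
  have "y \<bullet> h = null D D" using k reassoc[OF comp_zero[OF t], of k] tt by simp
  then have "r \<bullet> c \<boxplus> neg (Ident C D) = null D D" using h by simp
  then have "neg (Ident C D) \<boxplus> r \<bullet> c = neg (Ident C D) \<boxplus> Ident C D"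
    using plus_comm[of "neg (Ident C D)" "r \<bullet> c"] r ca tt by simp
  then have "r \<bullet> c = Ident C D" using plus_cancel[of "neg (Ident C D)" "r \<bullet> c" "Ident C D"] r ca tt by simp
  then show ?thesis by (rule isomorphicI) (use cr r ca in simp_all)
qed

text \<open>The inflation into the direct sum is a split inflation followed by \<open>x \<oplus> 1\<close>.\<close>

lemma mapping_cone:
  assumes t: "etriangle C (A, B, D, x, y, \<delta>)" and f: "arrow f" "Dom C f = A" "Cod C f = B'"
    and S: "biprod B B' S i j p q"
  shows "\<exists>E h \<theta> d e \<eta>. etriangle C (A, S, E, i \<bullet> x \<boxplus> j \<bullet> f, h, \<theta>) \<and> etriangle C (B', E, D, d, e, \<eta>) \<and>
    (push C D f \<delta> = \<zero>\<^bsub>Ext C D B'\<^esub> \<longrightarrow> \<eta> = \<zero>\<^bsub>Ext C D B'\<^esub>)"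
proof -
  note tt = etriangleD[OF t] and SS = S[unfolded biprod_def]
  have B': "B' \<in> Obj C" using f by auto
  obtain P a b u v where P: "biprod A B' P a b u v" using two_sum_exists[OF tt(1) B'] by (auto simp: is_direct_sum_two)
  note PP = P[unfolded biprod_def]
  have pe: "u \<bullet> a = Ident C A" "v \<bullet> b = Ident C B'" "v \<bullet> a = null A B'" "u \<bullet> b = null B' A" using PP by auto
  \<comment> \<open>The inflation with components the identity and \<open>f\<close> is the standard
    split inflation moved by a shear automorphism of \<open>P\<close>.\<close>
  have shear: "biprod A B' P (a \<boxplus> b \<bullet> f) b u (v \<boxplus> neg (f \<bullet> u))"
  proof -
    have "(v \<boxplus> neg (f \<bullet> u)) \<bullet> (a \<boxplus> b \<bullet> f) = null A B'"
      using PP f by (simp add: pe[THEN reassoc])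
    moreover have "(a \<boxplus> b \<bullet> f) \<bullet> u \<boxplus> b \<bullet> (v \<boxplus> neg (f \<bullet> u)) = Ident C P"
    proof -
      have "(a \<boxplus> b \<bullet> f) \<bullet> u \<boxplus> b \<bullet> (v \<boxplus> neg (f \<bullet> u)) = (a \<bullet> u \<boxplus> b \<bullet> (f \<bullet> u)) \<boxplus> (b \<bullet> v \<boxplus> neg (b \<bullet> (f \<bullet> u)))"
        using PP f by simp
      also have "\<dots> = a \<bullet> u \<boxplus> (b \<bullet> (f \<bullet> u) \<boxplus> (b \<bullet> v \<boxplus> neg (b \<bullet> (f \<bullet> u))))"
        using PP f by (intro plus_assoc) simp_all
      also have "b \<bullet> (f \<bullet> u) \<boxplus> (b \<bullet> v \<boxplus> neg (b \<bullet> (f \<bullet> u))) = b \<bullet> v"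
        using PP f plus_lcomm[of "b \<bullet> (f \<bullet> u)" "b \<bullet> v" "neg (b \<bullet> (f \<bullet> u))"] by simp
      finally show ?thesis using PP by simp
    qed
    moreover have "(v \<boxplus> neg (f \<bullet> u)) \<bullet> b = Ident C B'" "u \<bullet> (a \<boxplus> b \<bullet> f) = Ident C A"
      using PP f by (simp_all add: pe[THEN reassoc])
    ultimately show ?thesis unfolding biprod_def using PP f by simp
  qed
  have t1: "etriangle C (A, P, B', a \<boxplus> b \<bullet> f, v \<boxplus> neg (f \<bullet> u), \<zero>\<^bsub>Ext C B' A\<^esub>)" by (rule split_etriangle[OF shear])
  obtain Z where Z: "is_zero_object C Z" using zero_exists by blast
  have ZO: "Z \<in> Obj C" using Z by (simp add: is_zero_object_def)
  have diags: "direct_sum_diagram C [A, B'] P (\<lambda>n. if n = 0 then a else b) (\<lambda>n. if n = 0 then u else v)"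
    "direct_sum_diagram C [B, B'] S (\<lambda>n. if n = 0 then i else j) (\<lambda>n. if n = 0 then p else q)"
    "direct_sum_diagram C [D, Z] D (\<lambda>n. if n = 0 then Ident C D else null Z D) (\<lambda>n. if n = 0 then Ident C D else null D Z)"
    using P S zero_object_biprod[OF Z tt(3)] by (simp_all add: biprod_diagram)
  have x2: "i \<bullet> x \<bullet> u \<oplus>\<^bsub>Hom C P S\<^esub> j \<bullet> Ident C B' \<bullet> v = i \<bullet> (x \<bullet> u) \<boxplus> j \<bullet> v"
    using tt SS PP by (simp add: plus_fold)
  have y2: "Ident C D \<bullet> y \<bullet> p \<oplus>\<^bsub>Hom C S D\<^esub> null Z D \<bullet> null B' Z \<bullet> q = y \<bullet> p"
    using tt SS PP ZO by (simp add: plus_fold)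
  have e2: "EMap C (Ident C D) a \<delta> \<oplus>\<^bsub>Ext C D P\<^esub> EMap C (null D Z) b \<zero>\<^bsub>Ext C Z B'\<^esub> = push C D a \<delta>"
    using emap_zero[of "null D Z" b Z B'] push_closed[of D a \<delta>] tt PP ZO by (simp add: ext_add_zero)
  have t2: "etriangle C (P, S, D, i \<bullet> (x \<bullet> u) \<boxplus> j \<bullet> v, y \<bullet> p, push C D a \<delta>)"
    using realize_sum[OF t zero_sum_right[OF Z B'] diags] x2 y2 e2 push_closed[of D a \<delta>] tt PP by (simp add: etriangle.simps)
  have comp: "(i \<bullet> (x \<bullet> u) \<boxplus> j \<bullet> v) \<bullet> (a \<boxplus> b \<bullet> f) = i \<bullet> x \<boxplus> j \<bullet> f"
    using tt SS PP f by (simp add: pe[THEN reassoc])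
  obtain E \<theta> h d e where E: "etriangle C (A, S, E, i \<bullet> x \<boxplus> j \<bullet> f, h, \<theta>)"
    "etriangle C (B', E, D, d, e, push C D (v \<boxplus> neg (f \<bullet> u)) (push C D a \<delta>))"
    using ET4[OF t1 t2] unfolding comp by blast
  \<comment> \<open>The class obtained is the negative of \<open>push C D f \<delta>\<close>; the
    sign is harmless, since only its vanishing matters.\<close>
  have "push C D (v \<boxplus> neg (f \<bullet> u)) (push C D a \<delta>) = push C D ((v \<boxplus> neg (f \<bullet> u)) \<bullet> a) \<delta>"
    using push_push[of D a "v \<boxplus> neg (f \<bullet> u)" \<delta>] tt PP f by simp
  also have "(v \<boxplus> neg (f \<bullet> u)) \<bullet> a = neg (Ident C B') \<bullet> f" using tt PP f by (simp add: pe[THEN reassoc])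
  also have "push C D (neg (Ident C B') \<bullet> f) \<delta> = push C D (neg (Ident C B')) (push C D f \<delta>)"
    using push_push[of D f "neg (Ident C B')" \<delta>] tt f B' by simp
  finally have "push C D f \<delta> = \<zero>\<^bsub>Ext C D B'\<^esub> \<longrightarrow> push C D (v \<boxplus> neg (f \<bullet> u)) (push C D a \<delta>) = \<zero>\<^bsub>Ext C D B'\<^esub>"
    using push_zero[of D "neg (Ident C B')" B'] B' tt by simp
  then show ?thesis using E by blast
qed

text \<open>The map from \<open>A\<close> to the sum of \<open>B\<close> and \<open>B'\<close> is an
  inflation, and its cone fits into both triangles, depending on which of the two maps is treated as
  \<open>f\<close> in \<open>mapping_cone\<close>. \<open>cone_unique\<close> identifies the two
  cones.\<close>

lemma homotopy_pushout:
  assumes t: "etriangle C (A, B, D, x, y, \<delta>)" and t': "etriangle C (A, B', D', x', y', \<delta>')"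
  shows "\<exists>E d e \<eta> d' e' \<eta>'. etriangle C (B', E, D, d, e, \<eta>) \<and> etriangle C (B, E, D', d', e', \<eta>') \<and>
    (push C D x' \<delta> = \<zero>\<^bsub>Ext C D B'\<^esub> \<longrightarrow> \<eta> = \<zero>\<^bsub>Ext C D B'\<^esub>) \<and>
    (push C D' x \<delta>' = \<zero>\<^bsub>Ext C D' B\<^esub> \<longrightarrow> \<eta>' = \<zero>\<^bsub>Ext C D' B\<^esub>)"
proof -
  note tt = etriangleD[OF t] and tt' = etriangleD[OF t']
  obtain S i j p q where S: "biprod B B' S i j p q" using two_sum_exists[OF tt(2) tt'(2)] by (auto simp: is_direct_sum_two)
  note SS = S[unfolded biprod_def]
  obtain E h \<theta> d e \<eta> where E: "etriangle C (A, S, E, i \<bullet> x \<boxplus> j \<bullet> x', h, \<theta>)" "etriangle C (B', E, D, d, e, \<eta>)"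
    "push C D x' \<delta> = \<zero>\<^bsub>Ext C D B'\<^esub> \<longrightarrow> \<eta> = \<zero>\<^bsub>Ext C D B'\<^esub>"
    using mapping_cone[OF t tt'(5-7) S] by blast
  obtain E' h' \<theta>' d' e' \<eta>' where E': "etriangle C (A, S, E', j \<bullet> x' \<boxplus> i \<bullet> x, h', \<theta>')" "etriangle C (B, E', D', d', e', \<eta>')"
    "push C D' x \<delta>' = \<zero>\<^bsub>Ext C D' B\<^esub> \<longrightarrow> \<eta>' = \<zero>\<^bsub>Ext C D' B\<^esub>"
    using mapping_cone[OF t' tt(5-7) biprod_swap[OF S]] by blast
  have "j \<bullet> x' \<boxplus> i \<bullet> x = i \<bullet> x \<boxplus> j \<bullet> x'" using plus_comm[of "j \<bullet> x'" "i \<bullet> x"] SS tt tt' by simp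
  then have "isomorphic E' E" using cone_unique[of A S E' "i \<bullet> x \<boxplus> j \<bullet> x'" h' \<theta>'] E(1) E'(1) by simp
  then obtain k l where "arrow k" "Dom C k = E'" "Cod C k = E" "arrow l" "Dom C l = E" "Cod C l = E'"
    "l \<bullet> k = Ident C E'" "k \<bullet> l = Ident C E" by (rule isomorphicE)
  note t'' = realize_iso_middle[OF E'(2) this]
  show ?thesis by (intro exI conjI) (rule E(2), rule t'', rule E(3), rule E'(3))
qed

end


section \<open>Conflations and Ext-orthogonality\<close>

context extriangulated_category
begin

text \<open>Most arguments below concern membership of objects in subcategories, for which the maps
  and the extension class can be forgotten.\<close>

definition conflation :: "'o \<Rightarrow> 'o \<Rightarrow> 'o \<Rightarrow> bool" where
  "conflation A B D \<longleftrightarrow> (\<exists>x y \<delta>. etriangle C (A, B, D, x, y, \<delta>))"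

definition orth :: "'o \<Rightarrow> 'o \<Rightarrow> bool" where
  "orth D A \<longleftrightarrow> ext C D A = {\<zero>\<^bsub>Ext C D A\<^esub>}"

lemma conflation_opp: "extriangulated_category.conflation (opp C) A B D \<longleftrightarrow> conflation D B A"
proof -
  interpret o: extriangulated_category "opp C" by (rule extriangulated_opp)
  show ?thesis unfolding conflation_def o.conflation_def etriangle_opp by blast
qed

lemma orth_opp: "extriangulated_category.orth (opp C) D A \<longleftrightarrow> orth A D"
proof -
  interpret o: extriangulated_category "opp C" by (rule extriangulated_opp)
  show ?thesis unfolding orth_def o.orth_def by simp
qed

lemma conflationI: "etriangle C (A, B, D, x, y, \<delta>) \<Longrightarrow> conflation A B D"
  unfolding conflation_def by blast

lemma conflation_obj:
  assumes "conflation A B D" shows "A \<in> Obj C" "B \<in> Obj C" "D \<in> Obj C"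
  using assms etriangleD unfolding conflation_def by blast+

lemma orthI: "\<lbrakk>D \<in> Obj C; A \<in> Obj C; \<And>\<delta>. \<delta> \<in> ext C D A \<Longrightarrow> \<delta> = \<zero>\<^bsub>Ext C D A\<^esub>\<rbrakk> \<Longrightarrow> orth D A"
  unfolding orth_def using ext_zero_closed by blast

lemma orthD: "\<lbrakk>orth D A; \<delta> \<in> ext C D A\<rbrakk> \<Longrightarrow> \<delta> = \<zero>\<^bsub>Ext C D A\<^esub>"
  unfolding orth_def by blast

lemma orth_retract_left:
  assumes "retract M M'" "orth M' W" "W \<in> Obj C" shows "orth M W"
proof -
  obtain s r where r: "arrow s" "Dom C s = M" "Cod C s = M'" "arrow r" "Dom C r = M'" "Cod C r = M" "r \<bullet> s = Ident C M"
    using assms(1) by (rule retractE)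
  have MO: "M \<in> Obj C" "M' \<in> Obj C" using retract_obj[OF assms(1)] by auto
  show ?thesis
  proof (rule orthI)
    fix \<epsilon> assume e: "\<epsilon> \<in> ext C M W"
    have "\<epsilon> = pull C W (r \<bullet> s) \<epsilon>" using r(7) e MO assms(3) by (simp add: emap_ident)
    also have "\<dots> = pull C W s (pull C W r \<epsilon>)" using pull_pull[of W r s \<epsilon>] r e assms(3) by simp
    also have "pull C W r \<epsilon> = \<zero>\<^bsub>Ext C M' W\<^esub>" using orthD[OF assms(2)] pull_closed[of W r \<epsilon>] r e assms(3) by simp
    also have "pull C W s \<zero>\<^bsub>Ext C M' W\<^esub> = \<zero>\<^bsub>Ext C M W\<^esub>" using pull_zero[of W s M'] r assms(3) by simp
    finally show "\<epsilon> = \<zero>\<^bsub>Ext C M W\<^esub>" .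
  qed (use MO assms in simp_all)
qed

lemma orth_sum_left:
  assumes "is_direct_sum C [A, B] S" "orth A W" "orth B W" "W \<in> Obj C" shows "orth S W"
proof -
  obtain i j p q where b: "biprod A B S i j p q" using assms(1) by (auto simp: is_direct_sum_two)
  note bb = b[unfolded biprod_def]
  show ?thesis
  proof (rule orthI)
    fix \<epsilon> assume e: "\<epsilon> \<in> ext C S W"
    have z: "pull C W (f \<bullet> g) \<epsilon> = \<zero>\<^bsub>Ext C S W\<^esub>" if f: "arrow f" "Dom C f = X" "Cod C f = S" "arrow g" "Cod C g = X" "Dom C g = S" "orth X W"
      for f g X
    proof -
      have "pull C W (f \<bullet> g) \<epsilon> = pull C W g (pull C W f \<epsilon>)" using pull_pull[of W f g \<epsilon>] f e assms(4) by simp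
      also have "pull C W f \<epsilon> = \<zero>\<^bsub>Ext C X W\<^esub>" using orthD[OF f(7)] pull_closed[of W f \<epsilon>] f e assms(4) by simp
      also have "pull C W g \<zero>\<^bsub>Ext C X W\<^esub> = \<zero>\<^bsub>Ext C S W\<^esub>" using pull_zero[of W g X] f assms(4) by simp
      finally show ?thesis .
    qed
    have "\<epsilon> = pull C W (i \<bullet> p \<boxplus> j \<bullet> q) \<epsilon>" using bb e assms(4) by (simp add: emap_ident)
    also have "\<dots> = pull C W (i \<bullet> p) \<epsilon> \<oplus>\<^bsub>Ext C S W\<^esub> pull C W (j \<bullet> q) \<epsilon>"
      using emap_plus_left[of "i \<bullet> p" "j \<bullet> q" "Ident C W" \<epsilon>] bb e assms(4) by simp
    also have "\<dots> = \<zero>\<^bsub>Ext C S W\<^esub>" using z[of i A p] z[of j B q] bb assms by (simp add: ext_add_zero)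
    finally show "\<epsilon> = \<zero>\<^bsub>Ext C S W\<^esub>" .
  qed (use bb assms in simp_all)
qed

lemma orth_zero_left:
  assumes "is_zero_object C Z" "W \<in> Obj C" shows "orth Z W"
proof (rule orthI)
  have Z: "Z \<in> Obj C" "Ident C Z = null Z Z" using assms by (auto simp: is_zero_object_def)
  fix \<epsilon> assume e: "\<epsilon> \<in> ext C Z W"
  have "\<epsilon> = pull C W (null Z Z) \<epsilon>" using e assms Z emap_ident[of Z W \<epsilon>] by simp
  also have "\<dots> = \<zero>\<^bsub>Ext C Z W\<^esub>" using emap_null_left[of "Ident C W" Z Z \<epsilon>] e assms Z by simp
  finally show "\<epsilon> = \<zero>\<^bsub>Ext C Z W\<^esub>" .
qed (use assms in \<open>auto simp: is_zero_object_def\<close>)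

lemma orth_left_subcategory:
  assumes "S \<subseteq> Obj C" shows "subcategory C {M \<in> Obj C. \<forall>W\<in>S. orth M W}"
proof (rule subcategoryI)
  fix X M assume a: "retract X M" "M \<in> {M \<in> Obj C. \<forall>W\<in>S. orth M W}"
  have "orth X W" if "W \<in> S" for W by (rule orth_retract_left[OF a(1)]) (use a(2) that assms in auto)
  then show "X \<in> {M \<in> Obj C. \<forall>W\<in>S. orth M W}" using retract_obj[OF a(1)] by simp
next
  fix Z assume Z: "is_zero_object C Z"
  have "orth Z W" if "W \<in> S" for W by (rule orth_zero_left[OF Z]) (use that assms in auto)
  then show "Z \<in> {M \<in> Obj C. \<forall>W\<in>S. orth M W}" using Z by (simp add: is_zero_object_def)
next
  fix A B M assume a: "A \<in> {M \<in> Obj C. \<forall>W\<in>S. orth M W}" "B \<in> {M \<in> Obj C. \<forall>W\<in>S. orth M W}"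
    "is_direct_sum C [A, B] M"
  have "orth M W" if "W \<in> S" for W by (rule orth_sum_left[OF a(3)]) (use a(1,2) that assms in auto)
  then show "M \<in> {M \<in> Obj C. \<forall>W\<in>S. orth M W}" using direct_sum_obj[OF a(3)] by simp
qed simp

lemma orth_right_subcategory:
  assumes "S \<subseteq> Obj C" shows "subcategory C {M \<in> Obj C. \<forall>W\<in>S. orth W M}"
proof -
  interpret o: extriangulated_category "opp C" by (rule extriangulated_opp)
  show ?thesis using o.orth_left_subcategory[of S] assms by (simp add: orth_opp)
qed

lemma conflation_zero_left:
  assumes "is_zero_object C Z" "X \<in> Obj C" shows "conflation Z X X"
  using zero_sum_left[OF assms] by (rule conflationI)

lemma orth_split:
  assumes "conflation A B D" "orth D A" shows "is_direct_sum C [A, D] B"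
proof -
  obtain x y \<delta> where t: "etriangle C (A, B, D, x, y, \<delta>)" using assms unfolding conflation_def by blast
  have "\<delta> = \<zero>\<^bsub>Ext C D A\<^esub>" using orthD[OF assms(2)] etriangleD(4)[OF t] by blast
  with t show ?thesis using zero_etriangle_sum by blast
qed

lemma orth_middle_right:
  assumes "conflation A B D" "W \<in> Obj C" "orth W A" "orth W D" shows "orth W B"
proof -
  obtain x y \<delta> where t: "etriangle C (A, B, D, x, y, \<delta>)" using assms unfolding conflation_def by blast
  note tt = etriangleD[OF t]
  show ?thesis
  proof (rule orthI)
    fix \<epsilon> assume e: "\<epsilon> \<in> ext C W B"
    have "push C W y \<epsilon> = \<zero>\<^bsub>Ext C W D\<^esub>" using orthD[OF assms(4)] push_closed[of W y \<epsilon>] tt e assms(2) by simp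
    then obtain \<epsilon>' where "\<epsilon>' \<in> ext C W A" "\<epsilon> = push C W x \<epsilon>'" using ext_middle_exact[OF t assms(2) e] by blast
    then show "\<epsilon> = \<zero>\<^bsub>Ext C W B\<^esub>" using orthD[OF assms(3)] push_zero[of W x A] tt assms(2) by simp
  qed (use assms tt in simp_all)
qed

lemma orth_middle_left:
  assumes "conflation A B D" "W \<in> Obj C" "orth A W" "orth D W" shows "orth B W"
proof -
  interpret o: extriangulated_category "opp C" by (rule extriangulated_opp)
  show ?thesis using o.orth_middle_right[of D B A W] assms by (simp add: orth_opp conflation_opp)
qed

text \<open>The splitting clauses are the point: under orthogonality the pushout is a direct sum,
  and the square becomes an exchange of summands.\<close>

lemma pushout_conflation:
  assumes "conflation A B D" "conflation A B' D'"
  shows "\<exists>E. conflation B' E D \<and> conflation B E D' \<and> (orth D B' \<longrightarrow> is_direct_sum C [B', D] E) \<and>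
    (orth D' B \<longrightarrow> is_direct_sum C [B, D'] E)"
proof -
  obtain x y \<delta> where t: "etriangle C (A, B, D, x, y, \<delta>)" using assms unfolding conflation_def by blast
  obtain x' y' \<delta>' where t': "etriangle C (A, B', D', x', y', \<delta>')" using assms unfolding conflation_def by blast
  obtain E d e \<eta> d' e' \<eta>' where "etriangle C (B', E, D, d, e, \<eta>)" "etriangle C (B, E, D', d', e', \<eta>')"
    using homotopy_pushout[OF t t'] by blast
  then have "conflation B' E D" "conflation B E D'" by (auto intro: conflationI)
  then show ?thesis using orth_split by blast
qed

lemma pullback_conflation:
  assumes "conflation A B D" "conflation A' B' D"
  shows "\<exists>E. conflation A E B' \<and> conflation A' E B \<and> (orth B' A \<longrightarrow> is_direct_sum C [A, B'] E) \<and>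
    (orth B A' \<longrightarrow> is_direct_sum C [A', B] E)"
proof -
  interpret o: extriangulated_category "opp C" by (rule extriangulated_opp)
  obtain E where "conflation A E B'" "conflation A' E B"
    using o.pushout_conflation[of D B A B' A'] assms by (auto simp: conflation_opp)
  then show ?thesis using orth_split by blast
qed

lemma compose_inflations:
  assumes "conflation A B D" "conflation B M F" shows "\<exists>E. conflation A M E \<and> conflation D E F"
proof -
  obtain x y \<delta> where t: "etriangle C (A, B, D, x, y, \<delta>)" using assms unfolding conflation_def by blast
  obtain x' y' \<delta>' where t': "etriangle C (B, M, F, x', y', \<delta>')" using assms unfolding conflation_def by blast
  obtain E \<delta>'' h d e where "etriangle C (A, M, E, x' \<bullet> x, h, \<delta>'')" "etriangle C (D, E, F, d, e, push C F y \<delta>')"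
    using ET4[OF t t'] by blast
  then show ?thesis by (blast intro: conflationI)
qed

lemma compose_deflations:
  assumes "conflation D B A" "conflation F M B" shows "\<exists>E. conflation E M A \<and> conflation F E D"
proof -
  interpret o: extriangulated_category "opp C" by (rule extriangulated_opp)
  show ?thesis using o.compose_inflations[of A B D M F] assms by (simp add: conflation_opp)
qed

lemma conflation_sum:
  assumes "conflation A B D" "conflation A' B' D'"
    "is_direct_sum C [A, A'] SA" "is_direct_sum C [B, B'] SB" "is_direct_sum C [D, D'] SD"
  shows "conflation SA SB SD"
proof -
  obtain x y \<delta> where t: "etriangle C (A, B, D, x, y, \<delta>)" using assms unfolding conflation_def by blast
  obtain x' y' \<delta>' where t': "etriangle C (A', B', D', x', y', \<delta>')" using assms unfolding conflation_def by blast
  obtain iA pA where A: "direct_sum_diagram C [A, A'] SA iA pA" using assms(3) unfolding is_direct_sum_def by blast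
  obtain iB pB where B: "direct_sum_diagram C [B, B'] SB iB pB" using assms(4) unfolding is_direct_sum_def by blast
  obtain iD pD where D: "direct_sum_diagram C [D, D'] SD iD pD" using assms(5) unfolding is_direct_sum_def by blast
  note tt = etriangleD[OF t] and tt' = etriangleD[OF t']
  note DD = D[unfolded biprod_diagram biprod_def] and AA = A[unfolded biprod_diagram biprod_def]
  have "EMap C (pD 0) (iA 0) \<delta> \<in> ext C SD SA" "EMap C (pD 1) (iA 1) \<delta>' \<in> ext C SD SA"
    using emap_arrow[of "pD 0" "iA 0" \<delta>] emap_arrow[of "pD 1" "iA 1" \<delta>'] DD AA tt tt' by simp_all
  then have c: "EMap C (pD 0) (iA 0) \<delta> \<oplus>\<^bsub>Ext C SD SA\<^esub> EMap C (pD 1) (iA 1) \<delta>' \<in> ext C SD SA"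
    using ext_group[of SD SA] AA DD by (simp add: abelian_group_def abelian_monoid.a_closed)
  show ?thesis using realize_sum[OF t t' A B D] c AA DD
    by (intro conflationI) (unfold etriangle.simps, blast)
qed

lemma schanuel:
  assumes "conflation A B D" "conflation A B' D'" "orth D B'" "orth D' B"
  shows "\<exists>E. is_direct_sum C [B', D] E \<and> is_direct_sum C [B, D'] E"
  using pushout_conflation[OF assms(1,2)] assms(3,4) by blast

text \<open>An extension of \<open>D\<close> by \<open>D'\<close> dies on \<open>B\<close>, so it is
  pushed forward from a map \<open>A -> D'\<close>. This map lifts to \<open>B'\<close>, hence the
  extension comes from Ext(D, B'), which is zero.\<close>

lemma orth_cones:
  assumes t: "conflation A B D" and t': "conflation A' B' D'" and o: "orth A A'" "orth B D'" "orth D B'"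
  shows "orth D D'"
proof -
  obtain x y \<delta> where t: "etriangle C (A, B, D, x, y, \<delta>)" using t unfolding conflation_def by blast
  obtain x' y' \<delta>' where t': "etriangle C (A', B', D', x', y', \<delta>')" using t' unfolding conflation_def by blast
  note tt = etriangleD[OF t] and tt' = etriangleD[OF t']
  show ?thesis
  proof (rule orthI)
    fix \<epsilon> assume e: "\<epsilon> \<in> ext C D D'"
    have "pull C D' y \<epsilon> = \<zero>\<^bsub>Ext C B D'\<^esub>" using orthD[OF o(2)] pull_closed[of D' y \<epsilon>] tt tt' e by simp
    then obtain f where f: "arrow f" "Dom C f = A" "Cod C f = D'" "\<epsilon> = push C D f \<delta>"
      using ext_from_hom_op[OF t tt'(3) e] by blast
    have "pull C A' f \<delta>' = \<zero>\<^bsub>Ext C (Dom C f) A'\<^esub>" using orthD[OF o(1)] pull_closed[of A' f \<delta>'] f tt' by simp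
    then obtain g where g: "arrow g" "Dom C g = Dom C f" "Cod C g = B'" "y' \<bullet> g = f"
      using lift_deflation[OF t' f(1,3)] by blast
    have "\<epsilon> = push C D y' (push C D g \<delta>)" using push_push[of D g y' \<delta>] f(2,4) g tt tt' by simp
    also have "push C D g \<delta> = \<zero>\<^bsub>Ext C D B'\<^esub>" using orthD[OF o(3)] push_closed[of D g \<delta>] g f(2) tt by simp
    also have "push C D y' \<zero>\<^bsub>Ext C D B'\<^esub> = \<zero>\<^bsub>Ext C D D'\<^esub>" using push_zero[of D y' B'] tt tt' by simp
    finally show "\<epsilon> = \<zero>\<^bsub>Ext C D D'\<^esub>" .
  qed (use tt tt' in simp_all)
qed

subsection \<open>Approximations\<close>

text \<open>The defining property of a left approximation against one test object, without a
  condition on the codomain of \<open>x\<close>; this way the test objects themselves form a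
  subcategory.\<close>

definition factors_left :: "'m \<Rightarrow> 'o \<Rightarrow> bool" where
  "factors_left x W \<longleftrightarrow> (\<forall>f. arrow f \<and> Dom C f = Dom C x \<and> Cod C f = W \<longrightarrow>
     (\<exists>g. arrow g \<and> Dom C g = Cod C x \<and> Cod C g = W \<and> g \<bullet> x = f))"

definition factors_right :: "'m \<Rightarrow> 'o \<Rightarrow> bool" where
  "factors_right y W \<longleftrightarrow> (\<forall>f. arrow f \<and> Dom C f = W \<and> Cod C f = Cod C y \<longrightarrow>
     (\<exists>g. arrow g \<and> Dom C g = W \<and> Cod C g = Dom C y \<and> y \<bullet> g = f))"

lemma factors_leftI:
  assumes "\<And>f. \<lbrakk>arrow f; Dom C f = Dom C x; Cod C f = W\<rbrakk> \<Longrightarrow> \<exists>g. arrow g \<and> Dom C g = Cod C x \<and> Cod C g = W \<and> g \<bullet> x = f"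
  shows "factors_left x W"
  unfolding factors_left_def using assms by blast

lemma factors_leftE:
  assumes "factors_left x W" "arrow f" "Dom C f = Dom C x" "Cod C f = W"
  obtains g where "arrow g" "Dom C g = Cod C x" "Cod C g = W" "g \<bullet> x = f"
  using assms unfolding factors_left_def by blast

lemma factors_opp: "extriangulated_category.factors_left (opp C) y W \<longleftrightarrow> factors_right y W"
proof -
  interpret o: extriangulated_category "opp C" by (rule extriangulated_opp)
  show ?thesis unfolding factors_right_def o.factors_left_def by (auto simp: arrow_opp)
qed

text \<open>A Wakamatsu-type argument: a class in Ext(D, W) dies on \<open>B\<close>, so it is
  pushed forward from a map \<open>A -> W\<close>, and that map extends along
  \<open>x\<close>.\<close>

lemma orth_from_factors_left:
  assumes t: "etriangle C (A, B, D, x, y, \<delta>)" and f: "factors_left x W" and W: "W \<in> Obj C" and o: "orth B W"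
  shows "orth D W"
proof (rule orthI)
  note tt = etriangleD[OF t]
  fix \<epsilon> assume e: "\<epsilon> \<in> ext C D W"
  have "pull C W y \<epsilon> = \<zero>\<^bsub>Ext C B W\<^esub>" using orthD[OF o] pull_closed[of W y \<epsilon>] tt W e by simp
  then obtain f where f': "arrow f" "Dom C f = A" "Cod C f = W" "\<epsilon> = push C D f \<delta>"
    using ext_from_hom_op[OF t W e] by blast
  have "Dom C f = Dom C x" using f'(2) tt(6) by simp
  then obtain g where g: "arrow g" "Dom C g = Cod C x" "Cod C g = W" "g \<bullet> x = f"
    using factors_leftE[OF f f'(1) _ f'(3)] by blast
  have "push C D (g \<bullet> x) \<delta> = \<zero>\<^bsub>Ext C D W\<^esub>" using push_factor_zero[OF t g(1)] g(2,3) tt(7) by simp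
  then show "\<epsilon> = \<zero>\<^bsub>Ext C D W\<^esub>" unfolding f'(4) g(4) .
qed (use etriangleD[OF t] W in simp_all)

lemma factors_left_from_orth:
  assumes t: "etriangle C (A, B, D, x, y, \<delta>)" and o: "orth D W"
  shows "factors_left x W"
proof (rule factors_leftI)
  note tt = etriangleD[OF t]
  fix f assume f: "arrow f" "Dom C f = Dom C x" "Cod C f = W"
  have "push C D f \<delta> = \<zero>\<^bsub>Ext C D (Cod C f)\<^esub>" using orthD[OF o] push_closed[of D f \<delta>] f tt by simp
  then show "\<exists>g. arrow g \<and> Dom C g = Cod C x \<and> Cod C g = W \<and> g \<bullet> x = f"
    using extend_inflation[OF t f(1)] f tt by simp
qed

lemma orth_from_factors_right:
  assumes t: "etriangle C (A, B, D, x, y, \<delta>)" and f: "factors_right y W" and W: "W \<in> Obj C" and o: "orth W B"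
  shows "orth W A"
proof -
  interpret o: extriangulated_category "opp C" by (rule extriangulated_opp)
  show ?thesis using o.orth_from_factors_left[of D B A y x \<delta> W] assms by (simp add: orth_opp factors_opp)
qed

lemma factors_right_from_orth:
  assumes t: "etriangle C (A, B, D, x, y, \<delta>)" and o: "orth W A"
  shows "factors_right y W"
proof -
  interpret o: extriangulated_category "opp C" by (rule extriangulated_opp)
  show ?thesis using o.factors_left_from_orth[of D B A y x \<delta> W] assms by (simp add: orth_opp factors_opp)
qed

text \<open>An approximation \<open>a\<close> need not be an inflation. Joined with the inflation
  \<open>x\<close> it becomes one by \<open>mapping_cone\<close>, and it keeps the factorization
  properties of both components.\<close>

lemma inflation_approximation:
  assumes t: "etriangle C (M, Q, D, x, y, \<delta>)" and a: "arrow a" "Dom C a = M" "Cod C a = N"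
  shows "\<exists>S E x' y' \<delta>'. is_direct_sum C [Q, N] S \<and> etriangle C (M, S, E, x', y', \<delta>') \<and>
    (\<forall>W. factors_left a W \<or> factors_left x W \<longrightarrow> factors_left x' W)"
proof -
  note tt = etriangleD[OF t]
  have NO: "N \<in> Obj C" using a by auto
  obtain S i j p q where S: "biprod Q N S i j p q" using two_sum_exists[OF tt(2) NO] by (auto simp: is_direct_sum_two)
  note SS = S[unfolded biprod_def]
  have e: "p \<bullet> i = Ident C Q" "q \<bullet> j = Ident C N" "q \<bullet> i = null Q N" "p \<bullet> j = null N Q" using SS by auto
  obtain E h \<theta> where E: "etriangle C (M, S, E, i \<bullet> x \<boxplus> j \<bullet> a, h, \<theta>)" using mapping_cone[OF t a S] by blast
  let ?x = "i \<bullet> x \<boxplus> j \<bullet> a"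
  have px: "p \<bullet> ?x = x" "q \<bullet> ?x = a" using SS tt a by (simp_all add: e[THEN reassoc])
  have xt: "arrow ?x" "Dom C ?x = M" "Cod C ?x = S" using SS tt a by simp_all
  have "factors_left ?x W" if "factors_left a W \<or> factors_left x W" for W
  proof (rule factors_leftI)
    fix f assume f: "arrow f" "Dom C f = Dom C ?x" "Cod C f = W"
    from that show "\<exists>g. arrow g \<and> Dom C g = Cod C ?x \<and> Cod C g = W \<and> g \<bullet> ?x = f"
    proof
      assume fl: "factors_left a W"
      have "Dom C f = Dom C a" using f(2) a(2) xt(2) by simp
      then obtain g where g0: "arrow g" "Dom C g = Cod C a" "Cod C g = W" "g \<bullet> a = f"
        using factors_leftE[OF fl f(1) _ f(3)] by blast
      have g: "arrow g" "Dom C g = N" "Cod C g = W" "g \<bullet> a = f" using g0 a by simp_all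
      then have "(g \<bullet> q) \<bullet> ?x = f" using px(2) xt SS by (simp del: comp_plus_right)
      then show ?thesis using g SS xt by (intro exI[of _ "g \<bullet> q"]) simp
    next
      assume fl: "factors_left x W"
      have "Dom C f = Dom C x" using f(2) tt(6) xt(2) by simp
      then obtain g where g0: "arrow g" "Dom C g = Cod C x" "Cod C g = W" "g \<bullet> x = f"
        using factors_leftE[OF fl f(1) _ f(3)] by blast
      have g: "arrow g" "Dom C g = Q" "Cod C g = W" "g \<bullet> x = f" using g0 tt(7) by simp_all
      then have "(g \<bullet> p) \<bullet> ?x = f" using px(1) xt SS by (simp del: comp_plus_right)
      then show ?thesis using g SS xt by (intro exI[of _ "g \<bullet> p"]) simp
    qed
  qed
  moreover have "is_direct_sum C [Q, N] S" using S is_direct_sum_two by blast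
  ultimately show ?thesis using E by blast
qed

lemma deflation_approximation:
  assumes t: "etriangle C (D, Q, M, x, y, \<delta>)" and a: "arrow a" "Dom C a = N" "Cod C a = M"
  shows "\<exists>S E x' y' \<delta>'. is_direct_sum C [Q, N] S \<and> etriangle C (E, S, M, x', y', \<delta>') \<and>
    (\<forall>W. factors_right a W \<or> factors_right y W \<longrightarrow> factors_right y' W)"
proof -
  interpret o: extriangulated_category "opp C" by (rule extriangulated_opp)
  have "\<exists>S E x' y' \<delta>'. is_direct_sum C [Q, N] S \<and> etriangle C (E, S, M, y', x', \<delta>') \<and>
    (\<forall>W. factors_right a W \<or> factors_right y W \<longrightarrow> factors_right x' W)"
    using o.inflation_approximation[of M Q D y x \<delta> a N] assms by (simp add: factors_opp arrow_opp)
  then show ?thesis by blast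
qed

lemma factors_left_subcategory:
  assumes x: "arrow x" shows "subcategory C {W \<in> Obj C. factors_left x W}"
proof (rule subcategoryI)
  fix X M assume a: "retract X M" "M \<in> {W \<in> Obj C. factors_left x W}"
  obtain s r where r: "arrow s" "Dom C s = X" "Cod C s = M" "arrow r" "Dom C r = M" "Cod C r = X" "r \<bullet> s = Ident C X"
    using a(1) by (rule retractE)
  have "factors_left x X"
  proof (rule factors_leftI)
    fix f assume f: "arrow f" "Dom C f = Dom C x" "Cod C f = X"
    have fl: "factors_left x M" using a(2) by simp
    obtain g where g: "arrow g" "Dom C g = Cod C x" "Cod C g = M" "g \<bullet> x = s \<bullet> f"
      by (rule factors_leftE[OF fl, of "s \<bullet> f"]) (use r f in simp_all)
    have "(r \<bullet> g) \<bullet> x = f" using g r f x reassoc[OF r(7), of f] by simp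
    then show "\<exists>g. arrow g \<and> Dom C g = Cod C x \<and> Cod C g = X \<and> g \<bullet> x = f" using g r by (intro exI[of _ "r \<bullet> g"]) simp
  qed
  then show "X \<in> {W \<in> Obj C. factors_left x W}" using retract_obj a by blast
next
  fix Z assume Z: "is_zero_object C Z"
  then have ZO: "Z \<in> Obj C" "Ident C Z = null Z Z" by (auto simp: is_zero_object_def)
  have "factors_left x Z"
  proof (rule factors_leftI)
    fix f assume f: "arrow f" "Dom C f = Dom C x" "Cod C f = Z"
    have "f = null (Dom C x) Z" using comp_ident'(2)[OF f(1,3)] comp_null(2)[OF f(1) ZO(1) f(3)] f(2) ZO(2) by simp
    then show "\<exists>g. arrow g \<and> Dom C g = Cod C x \<and> Cod C g = Z \<and> g \<bullet> x = f"
      using x ZO by (intro exI[of _ "null (Cod C x) Z"]) simp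
  qed
  then show "Z \<in> {W \<in> Obj C. factors_left x W}" using ZO by blast
next
  fix A B S assume a: "A \<in> {W \<in> Obj C. factors_left x W}" "B \<in> {W \<in> Obj C. factors_left x W}" "is_direct_sum C [A, B] S"
  obtain i j p q where b: "biprod A B S i j p q" using a(3) by (auto simp: is_direct_sum_two)
  note bb = b[unfolded biprod_def]
  have "factors_left x S"
  proof (rule factors_leftI)
    fix f assume f: "arrow f" "Dom C f = Dom C x" "Cod C f = S"
    have fl: "factors_left x A" using a(1) by simp
    obtain g where g: "arrow g" "Dom C g = Cod C x" "Cod C g = A" "g \<bullet> x = p \<bullet> f"
      by (rule factors_leftE[OF fl, of "p \<bullet> f"]) (use bb f in simp_all)
    have fl: "factors_left x B" using a(2) by simp
    obtain h where h: "arrow h" "Dom C h = Cod C x" "Cod C h = B" "h \<bullet> x = q \<bullet> f"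
      by (rule factors_leftE[OF fl, of "q \<bullet> f"]) (use bb f in simp_all)
    have "(i \<bullet> g \<boxplus> j \<bullet> h) \<bullet> x = i \<bullet> (p \<bullet> f) \<boxplus> j \<bullet> (q \<bullet> f)" using g h bb x by simp
    also have "\<dots> = (i \<bullet> p \<boxplus> j \<bullet> q) \<bullet> f" using comp_plus_left[of "i \<bullet> p" "j \<bullet> q" f] bb f by simp
    also have "\<dots> = f" using bb f by simp
    finally show "\<exists>g. arrow g \<and> Dom C g = Cod C x \<and> Cod C g = S \<and> g \<bullet> x = f"
      using g h bb by (intro exI[of _ "i \<bullet> g \<boxplus> j \<bullet> h"]) simp
  qed
  then show "S \<in> {W \<in> Obj C. factors_left x W}" using bb by blast
qed blast

lemma common_extension:
  assumes "finite F" "M \<in> Obj C" "\<And>f. f \<in> F \<Longrightarrow> arrow f \<and> Dom C f = M \<and> Cod C f \<in> U" "subcategory C U"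
  shows "\<exists>a. arrow a \<and> Dom C a = M \<and> Cod C a \<in> U \<and>
     (\<forall>f\<in>F. \<exists>g. arrow g \<and> Dom C g = Cod C a \<and> Cod C g = Cod C f \<and> g \<bullet> a = f)"
  using assms(1,3)
proof (induction F rule: finite_induct)
  case empty
  obtain Z where "is_zero_object C Z" using zero_exists by blast
  then have "Z \<in> U" "Z \<in> Obj C" using subcategory_zero[OF assms(4)] subcategory_obj[OF assms(4)] by blast+
  then have "arrow (null M Z)" "Dom C (null M Z) = M" "Cod C (null M Z) \<in> U" using assms(2) by simp_all
  then show ?case by blast
next
  case (insert f F)
  have "\<exists>a. arrow a \<and> Dom C a = M \<and> Cod C a \<in> U \<and>
     (\<forall>f\<in>F. \<exists>g. arrow g \<and> Dom C g = Cod C a \<and> Cod C g = Cod C f \<and> g \<bullet> a = f)"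
  proof (rule insert.IH)
    fix g assume "g \<in> F"
    then show "arrow g \<and> Dom C g = M \<and> Cod C g \<in> U" using insert.prems[of g] by simp
  qed
  then obtain a where a: "arrow a" "Dom C a = M" "Cod C a \<in> U"
     "\<forall>f\<in>F. \<exists>g. arrow g \<and> Dom C g = Cod C a \<and> Cod C g = Cod C f \<and> g \<bullet> a = f" by blast
  have f: "arrow f" "Dom C f = M" "Cod C f \<in> U" using insert.prems[of f] by simp_all
  obtain S i j p q where S: "biprod (Cod C a) (Cod C f) S i j p q"
    using two_sum_exists[of "Cod C a" "Cod C f"] arrow_obj(2)[OF a(1)] arrow_obj(2)[OF f(1)] by (auto simp: is_direct_sum_two)
  note SS = S[unfolded biprod_def]
  have e: "p \<bullet> i = Ident C (Cod C a)" "q \<bullet> j = Ident C (Cod C f)" "q \<bullet> i = null (Cod C a) (Cod C f)" "p \<bullet> j = null (Cod C f) (Cod C a)"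
    using SS by auto
  define b where "b = i \<bullet> a \<boxplus> j \<bullet> f"
  have b: "arrow b" "Dom C b = M" "Cod C b = S" using SS a(1-3) f by (simp_all add: b_def)
  have pq: "p \<bullet> b = a" "q \<bullet> b = f" using SS a(1-3) f by (simp_all add: b_def e[THEN reassoc])
  have SU: "S \<in> U" using subcategory_sum2[OF assms(4) a(3) f(3)] S is_direct_sum_two by blast
  have "\<exists>g. arrow g \<and> Dom C g = Cod C b \<and> Cod C g = Cod C h \<and> g \<bullet> b = h" if "h \<in> insert f F" for h
  proof (cases "h = f")
    case True
    have "arrow q" "Dom C q = Cod C b" "Cod C q = Cod C h" "q \<bullet> b = h" using pq(2) SS b(3) True by auto
    then show ?thesis by blast
  next
    case False
    then have "h \<in> F" using that by simp
    from bspec[OF a(4) this] obtain g where g: "arrow g" "Dom C g = Cod C a" "Cod C g = Cod C h" "g \<bullet> a = h"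
      by (elim exE conjE)
    have "(g \<bullet> p) \<bullet> b = h" using pq(1) b(1,3) SS g by simp
    moreover have "arrow (g \<bullet> p)" "Dom C (g \<bullet> p) = Cod C b" "Cod C (g \<bullet> p) = Cod C h"
      using g(1-3) SS b(3) by simp_all
    ultimately show ?thesis by blast
  qed
  then have all: "\<forall>h\<in>insert f F. \<exists>g. arrow g \<and> Dom C g = Cod C b \<and> Cod C g = Cod C h \<and> g \<bullet> b = h" by blast
  have "Cod C b \<in> U" using b(3) SU by simp
  with all b(1,2) show ?case by (intro exI[of _ b] conjI)
qed

end


section \<open>Rigid objects have boundedly many summands\<close>

text \<open>The properties of a 2-Calabi-Yau category that are used; this collection is self-dual.\<close>

locale cluster_setting = extriangulated_category C + krull_schmidt_category C
  for C :: "('o, 'm, 'k, 'e) extri" (structure) +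
  fixes T :: 'o
  assumes orth_sym: "orth A B \<Longrightarrow> A \<in> Obj C \<Longrightarrow> B \<in> Obj C \<Longrightarrow> orth B A"
    and enough_proj: "enough_projectives C"
    and enough_inj: "enough_injectives C"
    \<comment> \<open>Finite generation over the endomorphisms of \<open>A\<close>, and of
      \<open>B\<close> in the next clause, phrased by closed subsets. It stands in for finite
      dimensionality without mentioning the field; the two clauses are dual to each other.\<close>
    and hom_finite_right: "\<lbrakk>A \<in> Obj C; B \<in> Obj C\<rbrakk> \<Longrightarrow> \<exists>F. finite F \<and> F \<subseteq> mor C A B \<and>
      (\<forall>U. U \<subseteq> mor C A B \<and> F \<subseteq> U \<and> null A B \<in> U \<and> (\<forall>f\<in>U. \<forall>g\<in>U. f \<boxplus> g \<in> U) \<and>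
        (\<forall>f\<in>U. \<forall>a\<in>mor C A A. f \<bullet> a \<in> U) \<longrightarrow> mor C A B \<subseteq> U)"
    and hom_finite_left: "\<lbrakk>A \<in> Obj C; B \<in> Obj C\<rbrakk> \<Longrightarrow> \<exists>F. finite F \<and> F \<subseteq> mor C A B \<and>
      (\<forall>U. U \<subseteq> mor C A B \<and> F \<subseteq> U \<and> null A B \<in> U \<and> (\<forall>f\<in>U. \<forall>g\<in>U. f \<boxplus> g \<in> U) \<and>
        (\<forall>f\<in>U. \<forall>b\<in>mor C B B. b \<bullet> f \<in> U) \<longrightarrow> mor C A B \<subseteq> U)"
    and cluster_tilting: "cluster_tilting_object C T"

lemma injective_opp: "injective (opp C) P \<longleftrightarrow> projective C P"
proof -
  have "(\<forall>A B D x y \<delta>. etriangle C (D, B, A, y, x, \<delta>) \<longrightarrow> R A B x y) \<longleftrightarrow>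
    (\<forall>D B A y x \<delta>. etriangle C (D, B, A, y, x, \<delta>) \<longrightarrow> R A B x y)" for R by blast
  note R = this[of "\<lambda>A B x y. \<forall>f\<in>mor C P A. \<exists>g\<in>mor C P B. x \<bullet>\<^bsub>C\<^esub> g = f"]
  show ?thesis unfolding injective_def projective_def etriangle_opp opp_simps by (rule conj_cong[OF refl R])
qed

lemma projective_opp: "projective (opp C) P \<longleftrightarrow> injective C P"
proof -
  have "(\<forall>A B D x y \<delta>. etriangle C (D, B, A, y, x, \<delta>) \<longrightarrow> R D B x y) \<longleftrightarrow>
    (\<forall>D B A y x \<delta>. etriangle C (D, B, A, y, x, \<delta>) \<longrightarrow> R D B x y)" for R by blast
  note R = this[of "\<lambda>D B x y. \<forall>f\<in>mor C D P. \<exists>g\<in>mor C B P. g \<bullet>\<^bsub>C\<^esub> y = f"]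
  show ?thesis unfolding injective_def projective_def etriangle_opp opp_simps by (rule conj_cong[OF refl R])
qed

lemma add_closure_opp: "add_closure (opp C) M = add_closure C M"
  unfolding add_closure_def is_direct_sum_opp ..

context extriangulated_category
begin

lemma ext_vanish_orth: "ext_vanish C X Y \<longleftrightarrow> (\<forall>M\<in>X. \<forall>N\<in>Y. orth M N)"
  unfolding ext_vanish_def orth_def ..

lemma projective_orth:
  assumes "projective C P" "W \<in> Obj C" shows "orth P W"
proof (rule orthI)
  have P: "P \<in> Obj C" using assms(1) unfolding projective_def by blast
  fix \<epsilon> assume e: "\<epsilon> \<in> ext C P W"
  obtain B x y where t: "etriangle C (W, B, P, x, y, \<epsilon>)" using realize_exists[OF P assms(2) e] by blast
  have BO: "B \<in> Obj C" using etriangleD[OF t] by blast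
  obtain g where g: "g \<in> mor C P B" "y \<bullet> g = Ident C P"
    using assms(1) t ident_mor[OF P] unfolding projective_def by blast
  have "pull C W (y \<bullet> g) \<epsilon> = \<zero>\<^bsub>Ext C P W\<^esub>" using pull_factor_zero[OF t, of g] morD[OF g(1) P BO] by simp
  then show "\<epsilon> = \<zero>\<^bsub>Ext C P W\<^esub>" unfolding g(2) using emap_ident[OF P assms(2) e] by simp
qed (use assms in \<open>simp_all add: projective_def\<close>)

lemma projective_if_orth:
  assumes "P \<in> Obj C" "\<And>W. W \<in> Obj C \<Longrightarrow> orth P W" shows "projective C P"
  unfolding projective_def
proof (intro conjI allI impI ballI)
  fix A B D x y \<delta> f assume t: "etriangle C (A, B, D, x, y, \<delta>)" and f: "f \<in> mor C P D"
  note tt = etriangleD[OF t]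
  note fa = morD[OF f assms(1) tt(3)]
  have "factors_right y P" by (rule factors_right_from_orth[OF t assms(2)[OF tt(1)]])
  then obtain g where "arrow g" "Dom C g = P" "Cod C g = B" "y \<bullet> g = f"
    using fa tt(9,10) unfolding factors_right_def by metis
  then show "\<exists>g\<in>mor C P B. y \<bullet> g = f" by (intro bexI[of _ g]) (auto intro: arrow_mor)
qed (rule assms(1))

lemma injective_orth:
  assumes "injective C Q" "W \<in> Obj C" shows "orth W Q"
proof -
  interpret o: extriangulated_category "opp C" by (rule extriangulated_opp)
  show ?thesis using o.projective_orth[of Q W] assms by (simp add: projective_opp orth_opp)
qed

end

context cluster_setting
begin

lemma krull_schmidt_opp: "krull_schmidt_category (opp C)"
proof -
  interpret o: additive_category "opp C" by (rule additive_opp) unfold_locales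
  show ?thesis by unfold_locales (simp add: krull_schmidt)
qed

lemma cluster_setting_opp: "cluster_setting (opp C) T"
proof -
  interpret o: extriangulated_category "opp C" by (rule extriangulated_opp)
  interpret ok: krull_schmidt_category "opp C" by (rule krull_schmidt_opp)
  have plus: "o.plus f g = f \<boxplus> g" for f g unfolding plus_def o.plus_def by simp
  show ?thesis
  proof (intro cluster_setting.intro cluster_setting_axioms.intro)
    show "extriangulated_category (opp C)" "krull_schmidt_category (opp C)" by unfold_locales
    fix A B assume "o.orth A B" "A \<in> Obj (opp C)" "B \<in> Obj (opp C)"
    then show "o.orth B A" unfolding orth_opp opp_simps using orth_sym by blast
  next
    show "enough_projectives (opp C)"
      using enough_inj unfolding enough_projectives_def enough_injectives_def projective_opp etriangle_opp opp_simps
      by meson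
    show "enough_injectives (opp C)"
      using enough_proj unfolding enough_projectives_def enough_injectives_def injective_opp etriangle_opp opp_simps
      by meson
  next
    fix A B assume "A \<in> Obj (opp C)" "B \<in> Obj (opp C)"
    then have AB: "A \<in> Obj C" "B \<in> Obj C" by simp_all
    show "\<exists>F. finite F \<and> F \<subseteq> mor (opp C) A B \<and>
      (\<forall>U. U \<subseteq> mor (opp C) A B \<and> F \<subseteq> U \<and> \<zero>\<^bsub>Hom (opp C) A B\<^esub> \<in> U \<and> (\<forall>f\<in>U. \<forall>g\<in>U. o.plus f g \<in> U) \<and>
        (\<forall>f\<in>U. \<forall>a\<in>mor (opp C) A A. f \<bullet>\<^bsub>opp C\<^esub> a \<in> U) \<longrightarrow> mor (opp C) A B \<subseteq> U)"
      using hom_finite_left[OF AB(2,1)] unfolding opp_simps plus .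
    show "\<exists>F. finite F \<and> F \<subseteq> mor (opp C) A B \<and>
      (\<forall>U. U \<subseteq> mor (opp C) A B \<and> F \<subseteq> U \<and> \<zero>\<^bsub>Hom (opp C) A B\<^esub> \<in> U \<and> (\<forall>f\<in>U. \<forall>g\<in>U. o.plus f g \<in> U) \<and>
        (\<forall>f\<in>U. \<forall>b\<in>mor (opp C) B B. b \<bullet>\<^bsub>opp C\<^esub> f \<in> U) \<longrightarrow> mor (opp C) A B \<subseteq> U)"
      using hom_finite_right[OF AB(2,1)] unfolding opp_simps plus .
  next
    have ff: "functorially_finite (opp C) R \<longleftrightarrow> functorially_finite C R" for R
      unfolding functorially_finite_def left_approximation_def right_approximation_def opp_simps by blast
    have ev: "ext_vanish (opp C) X Y \<longleftrightarrow> ext_vanish C Y X" for X Y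
      unfolding ext_vanish_def opp_simps by blast
    show "cluster_tilting_object (opp C) T"
      using cluster_tilting unfolding cluster_tilting_object_def cluster_tilting_subcategory_def
        ff ev add_closure_opp subcategory_opp opp_simps by blast
  qed
qed

text \<open>Both notions amount to vanishing of Ext on one side, and \<open>orth_sym\<close>
  exchanges the sides. So every \<open>I\<close> that contains the projectives contains the
  injectives.\<close>

lemma injective_projective: assumes "injective C Q" shows "projective C Q"
proof (rule projective_if_orth)
  show Q: "Q \<in> Obj C" using assms unfolding injective_def by blast
  show "orth Q W" if "W \<in> Obj C" for W by (rule orth_sym[OF injective_orth[OF assms that] that Q])
qed

section \<open>Approximations by hulls of finitely many objects\<close>

lemma left_approximation_exists:
  assumes "finite S" "S \<subseteq> Obj C" "M \<in> Obj C"
  shows "\<exists>a. arrow a \<and> Dom C a = M \<and> Cod C a \<in> add_hull S \<and> (\<forall>W\<in>add_hull S. factors_left a W)"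
proof -
  have "\<forall>s\<in>S. \<exists>F. finite F \<and> F \<subseteq> mor C M s \<and>
      (\<forall>U. U \<subseteq> mor C M s \<and> F \<subseteq> U \<and> null M s \<in> U \<and> (\<forall>f\<in>U. \<forall>g\<in>U. f \<boxplus> g \<in> U) \<and>
        (\<forall>f\<in>U. \<forall>b\<in>mor C s s. b \<bullet> f \<in> U) \<longrightarrow> mor C M s \<subseteq> U)"
    by (rule ballI, rule hom_finite_left[OF assms(3)]) (use assms(2) in blast)
  from bchoice[OF this] obtain F where F: "\<forall>s\<in>S. finite (F s) \<and> F s \<subseteq> mor C M s \<and>
      (\<forall>U. U \<subseteq> mor C M s \<and> F s \<subseteq> U \<and> null M s \<in> U \<and> (\<forall>f\<in>U. \<forall>g\<in>U. f \<boxplus> g \<in> U) \<and>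
        (\<forall>f\<in>U. \<forall>b\<in>mor C s s. b \<bullet> f \<in> U) \<longrightarrow> mor C M s \<subseteq> U)" by blast
  have "\<exists>a. arrow a \<and> Dom C a = M \<and> Cod C a \<in> add_hull S \<and>
     (\<forall>f\<in>(\<Union>s\<in>S. F s). \<exists>g. arrow g \<and> Dom C g = Cod C a \<and> Cod C g = Cod C f \<and> g \<bullet> a = f)"
  proof (rule common_extension[OF _ assms(3) _ hull_subcategory])
    show "finite (\<Union>s\<in>S. F s)" using F assms(1) by blast
    fix f assume "f \<in> (\<Union>s\<in>S. F s)"
    then obtain s where s: "s \<in> S" "f \<in> mor C M s" using F by blast
    have sO: "s \<in> Obj C" using s assms(2) by blast
    have "s \<in> add_hull S" using hull_incl[OF assms(2)] s by blast
    then show "arrow f \<and> Dom C f = M \<and> Cod C f \<in> add_hull S" using morD[OF s(2) assms(3) sO] by simp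
  qed
  then obtain a where a: "arrow a" "Dom C a = M" "Cod C a \<in> add_hull S"
     and af: "\<And>f. f \<in> (\<Union>s\<in>S. F s) \<Longrightarrow> \<exists>g. arrow g \<and> Dom C g = Cod C a \<and> Cod C g = Cod C f \<and> g \<bullet> a = f" by blast
  have aO: "Cod C a \<in> Obj C" using a(1) by simp
  have fs: "factors_left a s" if s: "s \<in> S" for s
  proof -
    have sO: "s \<in> Obj C" using s assms(2) by blast
    \<comment> \<open>The maps \<open>M -> s\<close> that factor through \<open>a\<close>. They
      contain the generators \<open>F s\<close> and are closed under sums and endomorphisms of
      \<open>s\<close>, so they are all maps.\<close>
    define U where "U = {f \<in> mor C M s. \<exists>g\<in>mor C (Cod C a) s. g \<bullet> a = f}"
    have am: "a \<in> mor C M (Cod C a)" by (rule arrow_mor[OF a(1,2) refl])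
    have 1: "F s \<subseteq> U"
    proof
      fix f assume f: "f \<in> F s"
      then have fm: "f \<in> mor C M s" using F s by blast
      obtain g where g: "arrow g" "Dom C g = Cod C a" "Cod C g = Cod C f" "g \<bullet> a = f" using af f s by blast
      have "g \<in> mor C (Cod C a) s" by (rule arrow_mor[OF g(1,2)]) (use g(3) morD[OF fm assms(3) sO] in simp)
      then show "f \<in> U" unfolding U_def using fm g(4) by blast
    qed
    have 2: "null M s \<in> U"
    proof -
      have "null M s \<in> mor C M s" "null (Cod C a) s \<in> mor C (Cod C a) s" using assms(3) sO aO by (auto intro: arrow_mor)
      moreover have "null (Cod C a) s \<bullet> a = null M s" using comp_null(2)[OF a(1) sO refl] a(2) by simp
      ultimately show ?thesis unfolding U_def by blast
    qed
    have 3: "f \<boxplus> f' \<in> U" if f: "f \<in> U" "f' \<in> U" for f f'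
    proof -
      obtain g g' where g: "g \<in> mor C (Cod C a) s" "g \<bullet> a = f" "g' \<in> mor C (Cod C a) s" "g' \<bullet> a = f'"
        and fm: "f \<in> mor C M s" "f' \<in> mor C M s" using f unfolding U_def by blast
      note gg = morD[OF g(1) aO sO] morD[OF g(3) aO sO] morD[OF fm(1) assms(3) sO] morD[OF fm(2) assms(3) sO]
      have "g \<boxplus> g' \<in> mor C (Cod C a) s" "f \<boxplus> f' \<in> mor C M s" using gg by (auto intro!: arrow_mor)
      moreover have "(g \<boxplus> g') \<bullet> a = g \<bullet> a \<boxplus> g' \<bullet> a" by (rule comp_plus_left) (use gg(1-6) a(1) in simp_all)
      then have "(g \<boxplus> g') \<bullet> a = f \<boxplus> f'" unfolding g(2,4) .
      ultimately show ?thesis unfolding U_def by blast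
    qed
    have 4: "b \<bullet> f \<in> U" if f: "f \<in> U" and b: "b \<in> mor C s s" for f b
    proof -
      obtain g where g: "g \<in> mor C (Cod C a) s" "g \<bullet> a = f" and fm: "f \<in> mor C M s" using f unfolding U_def by blast
      note gg = morD[OF g(1) aO sO] morD[OF fm assms(3) sO] morD[OF b sO sO]
      have "b \<bullet> g \<in> mor C (Cod C a) s" "b \<bullet> f \<in> mor C M s" using gg by (auto intro!: arrow_mor)
      moreover have "(b \<bullet> g) \<bullet> a = b \<bullet> f" using comp_assoc'[of a g b] gg a g(2) by simp
      ultimately show ?thesis unfolding U_def by blast
    qed
    have U: "U \<subseteq> mor C M s" unfolding U_def by blast
    have "U \<subseteq> mor C M s \<and> F s \<subseteq> U \<and> null M s \<in> U \<and> (\<forall>f\<in>U. \<forall>g\<in>U. f \<boxplus> g \<in> U) \<and>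
        (\<forall>f\<in>U. \<forall>b\<in>mor C s s. b \<bullet> f \<in> U)" by (intro conjI ballI U 1 2 3 4)
    from spec[OF conjunct2[OF conjunct2[OF bspec[OF F s]]], of U, THEN mp, OF this]
    have "mor C M s \<subseteq> U" .
    show ?thesis
    proof (rule factors_leftI)
      fix f assume f: "arrow f" "Dom C f = Dom C a" "Cod C f = s"
      have "f \<in> mor C M s" by (rule arrow_mor[OF f(1) _ f(3)]) (use f(2) a(2) in simp)
      then obtain g where g: "g \<in> mor C (Cod C a) s" "g \<bullet> a = f" using \<open>mor C M s \<subseteq> U\<close> unfolding U_def by blast
      show "\<exists>g. arrow g \<and> Dom C g = Cod C a \<and> Cod C g = s \<and> g \<bullet> a = f"
        using morD[OF g(1) aO sO] g(2) by blast
    qed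
  qed
  have "add_hull S \<subseteq> {W \<in> Obj C. factors_left a W}"
    by (rule hull_least[OF factors_left_subcategory[OF a(1)]]) (use fs assms(2) in blast)
  then show ?thesis using a by blast
qed

abbreviation Inj :: "'o set" where "Inj \<equiv> {Q. injective C Q}"

lemma Inj_obj: "Inj \<subseteq> Obj C" unfolding injective_def by blast

text \<open>The injectives join the generators for two reasons: one of them provides the inflation
  to which the approximation is added, and the resulting middle term has to lie in the hull.\<close>

lemma inflation_approximation_exists:
  assumes "finite S" "S \<subseteq> Obj C" "M \<in> Obj C"
  shows "\<exists>N L x y \<delta>. N \<in> add_hull (S \<union> Inj) \<and> etriangle C (M, N, L, x, y, \<delta>) \<and> (\<forall>W\<in>add_hull (S \<union> Inj). factors_left x W)"
proof -
  have SI: "S \<union> Inj \<subseteq> Obj C" using assms(2) Inj_obj by blast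
  obtain Q D x y \<delta> where Q: "injective C Q" "etriangle C (M, Q, D, x, y, \<delta>)"
    using enough_inj assms(3) unfolding enough_injectives_def by blast
  note tt = etriangleD[OF Q(2)]
  obtain a where a: "arrow a" "Dom C a = M" "Cod C a \<in> add_hull S" "\<forall>W\<in>add_hull S. factors_left a W"
    using left_approximation_exists[OF assms] by blast
  obtain N E x' y' \<delta>' where N: "is_direct_sum C [Q, Cod C a] N" "etriangle C (M, N, E, x', y', \<delta>')"
    "\<forall>W. factors_left a W \<or> factors_left x W \<longrightarrow> factors_left x' W"
    using inflation_approximation[OF Q(2) a(1,2) refl] by blast
  have ax: "arrow x'" using etriangleD[OF N(2)] by blast
  have "Q \<in> add_hull (S \<union> Inj)" "Cod C a \<in> add_hull (S \<union> Inj)"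
    using hull_incl[OF SI] Q(1) hull_mono[OF _ SI, of S] a(3) by blast+
  then have NU: "N \<in> add_hull (S \<union> Inj)" using subcategory_sum2[OF hull_subcategory _ _ N(1)] by blast
  have inj: "factors_left x W" if iW: "injective C W" for W
  proof (rule factors_leftI)
    have WO: "W \<in> Obj C" using iW unfolding injective_def by blast
    fix f assume f: "arrow f" "Dom C f = Dom C x" "Cod C f = W"
    have "f \<in> mor C M W" by (rule arrow_mor[OF f(1) _ f(3)]) (use f(2) tt(6) in simp)
    then obtain g where g: "g \<in> mor C Q W" "g \<bullet> x = f" using iW Q(2) unfolding injective_def by blast
    show "\<exists>g. arrow g \<and> Dom C g = Cod C x \<and> Cod C g = W \<and> g \<bullet> x = f"
      by (intro exI[of _ g]) (simp add: morD[OF g(1) tt(2) WO] g(2) tt(7))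
  qed
  have "S \<union> Inj \<subseteq> {W \<in> Obj C. factors_left x' W}"
    using N(3) a(4) inj hull_incl[OF assms(2)] SI by blast
  then have "add_hull (S \<union> Inj) \<subseteq> {W \<in> Obj C. factors_left x' W}"
    by (rule hull_least[OF factors_left_subcategory[OF ax]])
  then show ?thesis using N(2) NU by blast
qed

lemma cone_of_approximation:
  assumes "etriangle C (M, N, L, x, y, \<delta>)" "\<And>W. W \<in> U \<Longrightarrow> factors_left x W" "\<And>W. W \<in> U \<Longrightarrow> orth N W" "U \<subseteq> Obj C" "W \<in> U"
  shows "orth L W"
  using orth_from_factors_left[OF assms(1) assms(2)[OF assms(5)] _ assms(3)[OF assms(5)]] assms(4,5) by blast

section \<open>The cluster tilting subcategory: resolutions and indecomposables\<close>

abbreviation "\<T> \<equiv> add_closure C T"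

lemma T_subcategory: "subcategory C \<T>"
  using cluster_tilting unfolding cluster_tilting_object_def cluster_tilting_subcategory_def by blast

lemma T_iff: "M \<in> Obj C \<Longrightarrow> M \<in> \<T> \<longleftrightarrow> (\<forall>W\<in>\<T>. orth M W)" "M \<in> Obj C \<Longrightarrow> M \<in> \<T> \<longleftrightarrow> (\<forall>W\<in>\<T>. orth W M)"
  using cluster_tilting unfolding cluster_tilting_object_def cluster_tilting_subcategory_def ext_vanish_orth by blast+

lemma T_obj: "M \<in> \<T> \<Longrightarrow> M \<in> Obj C" by (rule subcategory_obj[OF T_subcategory])

text \<open>A right approximation becomes a deflation after adding a projective, which lies in the
  cluster tilting subcategory. Its kernel is then right orthogonal to that subcategory, hence
  belongs to it.\<close>

lemma T_resolution:
  assumes "M \<in> Obj C" shows "\<exists>T0 T1. T0 \<in> \<T> \<and> T1 \<in> \<T> \<and> conflation T1 T0 M"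
proof -
  obtain N b where b: "right_approximation C \<T> N M b"
    using cluster_tilting assms unfolding cluster_tilting_object_def cluster_tilting_subcategory_def functorially_finite_def by blast
  have N: "N \<in> \<T>" "b \<in> mor C N M" using b unfolding right_approximation_def by blast+
  note ba = morD[OF N(2) T_obj[OF N(1)] assms]
  have fb: "factors_right b W" if W: "W \<in> \<T>" for W
    unfolding factors_right_def
  proof (intro allI impI, elim conjE)
    fix f assume f: "arrow f" "Dom C f = W" "Cod C f = Cod C b"
    have "f \<in> mor C W M" by (rule arrow_mor[OF f(1,2)]) (use f(3) ba in simp)
    then obtain g where g: "g \<in> mor C W N" "b \<bullet> g = f" using b W unfolding right_approximation_def by blast
    show "\<exists>g. arrow g \<and> Dom C g = W \<and> Cod C g = Dom C b \<and> b \<bullet> g = f"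
      by (intro exI[of _ g]) (simp add: morD[OF g(1) T_obj[OF W] T_obj[OF N(1)]] g(2) ba(2))
  qed
  obtain P D x y \<delta> where P: "projective C P" "etriangle C (D, P, M, x, y, \<delta>)"
    using enough_proj assms unfolding enough_projectives_def by blast
  have PO: "P \<in> Obj C" using P(1) unfolding projective_def by blast
  have PT: "P \<in> \<T>" using T_iff(1)[OF PO] projective_orth[OF P(1)] T_obj by blast
  obtain S E x' y' \<delta>' where S: "is_direct_sum C [P, N] S" "etriangle C (E, S, M, x', y', \<delta>')"
    "\<forall>W. factors_right b W \<or> factors_right y W \<longrightarrow> factors_right y' W"
    using deflation_approximation[OF P(2) ba] by blast
  have ST: "S \<in> \<T>" by (rule subcategory_sum2[OF T_subcategory PT N(1) S(1)])
  have "orth W E" if W: "W \<in> \<T>" for W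
    by (rule orth_from_factors_right[OF S(2)])
      (use S(3) fb[OF W] T_obj[OF W] ST W T_iff(1)[OF T_obj[OF W]] in blast)+
  then have "E \<in> \<T>" using T_iff(2)[of E] etriangleD(1)[OF S(2)] by blast
  then show ?thesis using ST conflationI[OF S(2)] by blast
qed

text \<open>Every indecomposable of \<open>add_closure C T\<close> is a summand of \<open>T\<close>;
  the length of \<open>Ts\<close> will be the bound in \<open>rigid_locals_bounded\<close>.\<close>

lemma T_locals: "\<exists>Ts. (\<forall>X\<in>set Ts. local X \<and> X \<in> \<T>) \<and> (\<forall>X. local X \<and> X \<in> \<T> \<longrightarrow> (\<exists>Y\<in>set Ts. isomorphic X Y))"
proof -
  have TO: "T \<in> Obj C" using cluster_tilting unfolding cluster_tilting_object_def by blast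
  obtain Z where Z: "is_zero_object C Z" using zero_exists by blast
  have "is_direct_sum C (replicate 1 T) T" using direct_sum_single[OF TO] by simp
  then have TT: "T \<in> \<T>" unfolding add_closure_def using direct_sum_zero[OF Z TO] by blast
  obtain Ts where Ts: "is_direct_sum C Ts T" "\<And>Y. Y \<in> set Ts \<Longrightarrow> local Y" using local_decomposition[OF TO] by blast
  have in_T: "set Ts \<subseteq> \<T>" by (rule subcategory_summands[OF T_subcategory TT Ts(1)])
  have TsO: "set Ts \<subseteq> Obj C" using direct_sum_obj[OF Ts(1)] by blast
  have Th: "T \<in> add_hull (set Ts)" by (rule subcategory_sum[OF hull_subcategory hull_incl[OF TsO] Ts(1)])
  have "\<exists>Y\<in>set Ts. isomorphic X Y" if X: "local X" "X \<in> \<T>" for X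
  proof (rule hull_local_iso[OF X(1) _ Ts(2)])
    obtain n Y S where S: "is_direct_sum C (replicate n T) S" "is_direct_sum C [X, Y] S"
      using X(2) unfolding add_closure_def by blast
    have "S \<in> add_hull (set Ts)" by (rule subcategory_sum[OF hull_subcategory _ S(1)]) (use Th in auto)
    then show "X \<in> add_hull (set Ts)" by (rule subcategory_summand(1)[OF hull_subcategory _ S(2)])
  qed
  then show ?thesis using Ts(2) in_T by blast
qed

lemma direct_sum_cong_left:
  assumes "is_direct_sum C [X, B] S" "isomorphic X Y" shows "is_direct_sum C [Y, B] S"
proof -
  have O: "X \<in> Obj C" "Y \<in> Obj C" "B \<in> Obj C" using direct_sum_obj[OF assms(1)] assms(2) unfolding isomorphic_def by auto
  have "is_direct_sum C [Y] X" by (rule direct_sum_cong[OF direct_sum_single[OF O(2)] isomorphic_sym[OF assms(2)]])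
  then have "is_direct_sum C ([Y] @ [B]) S" using direct_sum_append direct_sum_single[OF O(3)] assms(1) by blast
  then show ?thesis by simp
qed

definition rigid_locals :: "'o set \<Rightarrow> bool" where
  "rigid_locals S \<longleftrightarrow> finite S \<and> (\<forall>s\<in>S. local s) \<and> (\<forall>s\<in>S. \<forall>t\<in>S. s \<noteq> t \<longrightarrow> \<not> isomorphic s t) \<and>
     (\<forall>s\<in>S. \<forall>t\<in>S. orth s t)"

text \<open>The map sending a cluster tilting summand \<open>M\<close> to the class \<open>[N] - [L]\<close> of a left
  approximation triangle \<open>M \<rightarrow> N \<rightarrow> L\<close> inverts the index map \<open>s \<mapsto> [T0] - [T1]\<close> on rigid objects,
  so the latter is injective on classes in the split Grothendieck group.\<close>

theorem rigid_locals_bounded: "\<exists>n. \<forall>S. rigid_locals S \<longrightarrow> card S \<le> n"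
proof -
  obtain Ts where Ts: "\<And>X. X \<in> set Ts \<Longrightarrow> local X \<and> X \<in> \<T>" "\<And>X. local X \<Longrightarrow> X \<in> \<T> \<Longrightarrow> \<exists>Y\<in>set Ts. isomorphic X Y"
    using T_locals by blast
  have "card S \<le> length Ts" if S: "rigid_locals S" for S
  proof -
    have fin: "finite S" and loc: "\<And>s. s \<in> S \<Longrightarrow> local s"
      and niso: "\<And>s t. \<lbrakk>s \<in> S; t \<in> S; s \<noteq> t\<rbrakk> \<Longrightarrow> \<not> isomorphic s t"
      and rig: "\<And>s t. \<lbrakk>s \<in> S; t \<in> S\<rbrakk> \<Longrightarrow> orth s t" using S unfolding rigid_locals_def by blast+
    have SO: "S \<subseteq> Obj C" using loc local_obj by blast
    \<comment> \<open>\<open>G\<close> is rigid like \<open>S\<close>, because injectives are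
      orthogonal to everything on both sides, and it admits approximations that are
      inflations.\<close>
    define G where "G = add_hull (S \<union> Inj)"
    have SI: "S \<union> Inj \<subseteq> Obj C" using SO Inj_obj by blast
    have Gs: "subcategory C G" unfolding G_def by (rule hull_subcategory)
    have GO: "G \<subseteq> Obj C" using subcategory_obj[OF Gs] by blast
    have SG: "S \<subseteq> G" using hull_incl[OF SI] unfolding G_def by blast
    have oSI: "orth s t" if "s \<in> S \<union> Inj" "t \<in> S \<union> Inj" for s t
      using that rig injective_orth projective_orth[OF injective_projective] SI by blast
    have "G \<subseteq> {M \<in> Obj C. \<forall>W\<in>S \<union> Inj. orth M W}" unfolding G_def
      by (rule hull_least[OF orth_left_subcategory[OF SI]]) (use oSI SI in blast)
    then have oG1: "orth M W" if "M \<in> G" "W \<in> S \<union> Inj" for M W using that by blast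
    have "G \<subseteq> {M \<in> Obj C. \<forall>W\<in>G. orth W M}"
    proof -
      have "add_hull (S \<union> Inj) \<subseteq> {M \<in> Obj C. \<forall>W\<in>G. orth W M}"
        by (rule hull_least[OF orth_right_subcategory[OF GO]]) (use oG1 SI in blast)
      then show ?thesis unfolding G_def .
    qed
    then have oG: "orth M W" if "M \<in> G" "W \<in> G" for M W using that by blast
    define good where "good M N L \<longleftrightarrow> conflation M N L \<and> N \<in> G \<and> (\<forall>W\<in>G. orth L W)" for M N L
    have good_ex: "\<exists>N L. good M N L" if MO: "M \<in> Obj C" for M
    proof -
      obtain N L x y \<delta> where N: "N \<in> G" "etriangle C (M, N, L, x, y, \<delta>)" "\<forall>W\<in>G. factors_left x W"
        using inflation_approximation_exists[OF fin SO MO] unfolding G_def by blast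
      have "orth L W" if "W \<in> G" for W
        by (rule cone_of_approximation[OF N(2), of G]) (use N oG GO that in blast)+
      then show ?thesis unfolding good_def using N(1) conflationI[OF N(2)] by blast
    qed
    have good_sum: "good SM SN SL" if "good M N L" "good M' N' L'"
      "is_direct_sum C [M, M'] SM" "is_direct_sum C [N, N'] SN" "is_direct_sum C [L, L'] SL" for M N L M' N' L' SM SN SL
    proof -
      have "conflation SM SN SL" using conflation_sum[OF _ _ that(3-5)] that(1,2) unfolding good_def by blast
      moreover have "SN \<in> G" by (rule subcategory_sum2[OF Gs _ _ that(4)]) (use that(1,2) good_def in blast)+
      moreover have "orth SL W" if "W \<in> G" for W
        by (rule orth_sum_left[OF \<open>is_direct_sum C [L, L'] SL\<close>])
          (use \<open>good M N L\<close> \<open>good M' N' L'\<close> that GO good_def in blast)+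
      ultimately show ?thesis unfolding good_def by blast
    qed
    have "\<forall>i. \<exists>N L. i < length Ts \<longrightarrow> good (Ts ! i) N L"
      using good_ex Ts(1) local_obj nth_mem by blast
    then obtain N0 L0 where NL: "\<And>i. i < length Ts \<Longrightarrow> good (Ts ! i) (N0 i) (L0 i)" by metis
    \<comment> \<open>Coefficient of \<open>s\<close> in the class [N] - [L] of the chosen triangle
      that starts at the \<open>i\<close>-th cluster tilting indecomposable.\<close>
    define w where "w s i = real (multiplicity s (N0 i)) - real (multiplicity s (L0 i))" for s i
    \<comment> \<open>The class of some good triangle for \<open>M\<close> is a combination of the
      classes for \<open>Ts\<close> with coefficients independent of \<open>s\<close>. These are
      multiplicities, but real coefficients suffice for the rank argument.\<close>
    define P where "P M \<longleftrightarrow> (\<exists>N L c. good M N L \<and>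
      (\<forall>s\<in>S. real (multiplicity s N) - real (multiplicity s L) = (\<Sum>i<length Ts. c i * w s i)))" for M
    have P_list: "P M" if "is_direct_sum C Xs M" "\<forall>X\<in>set Xs. \<exists>Y\<in>set Ts. isomorphic X Y" for Xs M
      using that
    proof (induction Xs arbitrary: M)
      case Nil
      then have Z: "is_zero_object C M" by (simp add: is_direct_sum_Nil)
      have MO: "M \<in> Obj C" using Z unfolding is_zero_object_def by blast
      have "good M M M" unfolding good_def
        using conflation_zero_left[OF Z MO] subcategory_zero[OF Gs Z] orth_zero_left[OF Z] GO by blast
      moreover have "real (multiplicity s M) - real (multiplicity s M) = (\<Sum>i<length Ts. 0 * w s i)" for s by simp
      ultimately show ?case unfolding P_def by (intro exI[of _ M] exI[of _ "\<lambda>_. 0"] conjI ballI)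
    next
      case (Cons X Xs)
      obtain M' where M': "is_direct_sum C Xs M'" "is_direct_sum C [X, M'] M"
        using Cons.prems(1) by (rule direct_sum_ConsE)
      obtain Y where Y: "Y \<in> set Ts" "isomorphic X Y" using Cons.prems(2) by auto
      obtain k where k: "k < length Ts" "Ts ! k = Y" using Y(1) by (auto simp: in_set_conv_nth)
      have M: "is_direct_sum C [Ts ! k, M'] M" using direct_sum_cong_left[OF M'(2) Y(2)] k(2) by simp
      have "P M'" using Cons.IH[OF M'(1)] Cons.prems(2) by simp
      then obtain N L c where NLc: "good M' N L"
        "\<forall>s\<in>S. real (multiplicity s N) - real (multiplicity s L) = (\<Sum>i<length Ts. c i * w s i)"
        unfolding P_def by blast
      have O: "N0 k \<in> Obj C" "L0 k \<in> Obj C" "N \<in> Obj C" "L \<in> Obj C"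
        using NL[OF k(1)] NLc(1) conflation_obj unfolding good_def by blast+
      obtain SN where SN: "is_direct_sum C [N0 k, N] SN" using two_sum_exists[OF O(1,3)] by blast
      obtain SL where SL: "is_direct_sum C [L0 k, L] SL" using two_sum_exists[OF O(2,4)] by blast
      have g: "good M SN SL" by (rule good_sum[OF NL[OF k(1)] NLc(1) M SN SL])
      have "real (multiplicity s SN) - real (multiplicity s SL) = (\<Sum>i<length Ts. (if i = k then c i + 1 else c i) * w s i)"
        if s: "s \<in> S" for s
      proof -
        have "real (multiplicity s SN) - real (multiplicity s SL) = w s k + (\<Sum>i<length Ts. c i * w s i)"
          using multiplicity_sum[OF loc[OF s] SN] multiplicity_sum[OF loc[OF s] SL] NLc(2) s by (simp add: w_def)
        also have "w s k = (\<Sum>i<length Ts. if i = k then w s i else 0)" using k(1) by (simp add: sum.delta)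
        also have "\<dots> + (\<Sum>i<length Ts. c i * w s i) = (\<Sum>i<length Ts. (if i = k then c i + 1 else c i) * w s i)"
          unfolding sum.distrib[symmetric] by (rule sum.cong) (auto simp: algebra_simps)
        finally show ?thesis .
      qed
      then show ?case unfolding P_def using g by (intro exI[of _ SN] exI[of _ SL] exI[of _ "\<lambda>i. if i = k then c i + 1 else c i"]) blast
    qed
    have P: "P M" if M: "M \<in> \<T>" for M
    proof -
      obtain Xs where Xs: "is_direct_sum C Xs M" "\<And>Y. Y \<in> set Xs \<Longrightarrow> local Y" using local_decomposition[OF T_obj[OF M]] by blast
      have "set Xs \<subseteq> \<T>" by (rule subcategory_summands[OF T_subcategory M Xs(1)])
      then show ?thesis using P_list[OF Xs(1)] Xs(2) Ts(2) by blast
    qed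
    have main: "\<exists>c. \<forall>t\<in>S. (if t = s then 1 else 0) = (\<Sum>i<length Ts. c i * w t i)" if s: "s \<in> S" for s
    proof -
      have sO: "s \<in> Obj C" using s SO by blast
      obtain T0 T1 where T: "T0 \<in> \<T>" "T1 \<in> \<T>" "conflation T1 T0 s" using T_resolution[OF sO] by blast
      obtain N1 L1 c1 where 1: "good T1 N1 L1" "\<forall>t\<in>S. real (multiplicity t N1) - real (multiplicity t L1) = (\<Sum>i<length Ts. c1 i * w t i)"
        using P[OF T(2)] unfolding P_def by blast
      obtain N2 L2 c2 where 2: "good T0 N2 L2" "\<forall>t\<in>S. real (multiplicity t N2) - real (multiplicity t L2) = (\<Sum>i<length Ts. c2 i * w t i)"
        using P[OF T(1)] unfolding P_def by blast
      have c1: "conflation T1 N1 L1" "N1 \<in> G" "\<forall>W\<in>G. orth L1 W" and c2: "conflation T0 N2 L2" "N2 \<in> G" "\<forall>W\<in>G. orth L2 W"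
        using 1(1) 2(1) unfolding good_def by blast+
      have sG: "s \<in> G" using s SG by blast
      \<comment> \<open>Pushing the resolution of \<open>s\<close> out along \<open>T1 -> N1\<close>
        splits off \<open>s\<close> by rigidity of \<open>G\<close>. So \<open>E\<close> is the sum
        of \<open>N1\<close> and \<open>s\<close>, and \<open>T0 -> E -> L1\<close> is a second good
        triangle at \<open>T0\<close>; Schanuel compares it with the one through
        \<open>N2\<close>.\<close>
      obtain E where E: "conflation T0 E L1" "is_direct_sum C [N1, s] E"
        using pushout_conflation[OF T(3) c1(1)] oG[OF sG c1(2)] by blast
      have EG: "E \<in> G" by (rule subcategory_sum2[OF Gs c1(2) sG E(2)])
      obtain F where F: "is_direct_sum C [N2, L1] F" "is_direct_sum C [E, L2] F"
        using schanuel[OF E(1) c2(1)] c1(3) c2(2,3) EG by blast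
      have "(if t = s then 1 else 0) = (\<Sum>i<length Ts. (c2 i - c1 i) * w t i)" if t: "t \<in> S" for t
      proof -
        have m: "multiplicity t N2 + multiplicity t L1 = multiplicity t N1 + multiplicity t s + multiplicity t L2"
          using multiplicity_sum[OF loc[OF t] F(1)] multiplicity_sum[OF loc[OF t] F(2)] multiplicity_sum[OF loc[OF t] E(2)] by simp
        have "multiplicity t s = (if t = s then 1 else 0)"
          using multiplicity_local[OF loc[OF t] loc[OF s]] niso[OF t s] isomorphic_refl[OF sO] by auto
        then have "(if t = s then 1 else 0) = (real (multiplicity t N2) - real (multiplicity t L2)) - (real (multiplicity t N1) - real (multiplicity t L1))"
          using m by (auto simp: algebra_simps split: if_splits)
        also have "\<dots> = (\<Sum>i<length Ts. c2 i * w t i) - (\<Sum>i<length Ts. c1 i * w t i)" using 1(2) 2(2) t by simp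
        also have "\<dots> = (\<Sum>i<length Ts. (c2 i - c1 i) * w t i)" by (simp add: sum_subtractf left_diff_distrib)
        finally show ?thesis .
      qed
      then show ?thesis by (intro exI[of _ "\<lambda>i. c2 i - c1 i"] ballI)
    qed
    then have "\<forall>s\<in>S. \<exists>c. \<forall>t\<in>S. (if t = s then 1 else 0) = (\<Sum>i<length Ts. c i * w t i)" by blast
    from bchoice[OF this] obtain c where c: "\<forall>s\<in>S. \<forall>t\<in>S. (if t = s then 1 else 0) = (\<Sum>i<length Ts. c s i * w t i)" by blast
    obtain e where e: "bij_betw e {..<card S} S" using ex_bij_betw_nat_finite[OF fin] by (auto simp: atLeast0LessThan)
    show "card S \<le> length Ts"
    \<comment> \<open>The identity on \<open>S\<close> factors as index followed by class, through a
      real space of dimension \<open>length Ts\<close>.\<close>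
    proof (rule real_matrix_card_le[where \<beta> = "\<lambda>m. c (e m)" and \<alpha> = "\<lambda>n m. w (e m) n"])
      fix m m' assume m: "m < card S" "m' < card S"
      have m12: "e m \<in> S" "e m' \<in> S" using e m bij_betwE by blast+
      have eq: "e m' = e m \<longleftrightarrow> m = m'" using e m unfolding bij_betw_def inj_on_def by auto
      have "(if e m' = e m then 1 else 0) = (\<Sum>n<length Ts. c (e m) n * w (e m') n)"
        by (rule bspec[OF bspec[OF c m12(1)] m12(2)])
      then show "(\<Sum>n<length Ts. c (e m) n * w (e m') n) = (if m = m' then 1 else 0)" unfolding eq by (rule sym)
    qed
  qed
  then show ?thesis by blast
qed

text \<open>Each entry is new relative to its predecessors and to \<open>B\<close>. Chains are
  counted rather than indecomposables, because a cosyzygy of a local object may pick up summands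
  from \<open>I\<close> and need not be local; in the later uses \<open>B\<close> absorbs
  these.\<close>

definition chain :: "'o set \<Rightarrow> 'o list \<Rightarrow> bool" where
  "chain B Ms \<longleftrightarrow> (\<forall>k<length Ms. Ms ! k \<notin> add_hull (set (take k Ms) \<union> B))"

definition rigid_list :: "'o list \<Rightarrow> bool" where
  "rigid_list Ms \<longleftrightarrow> set Ms \<subseteq> Obj C \<and> (\<forall>M\<in>set Ms. \<forall>N\<in>set Ms. orth M N)"

text \<open>Each entry has a local retract outside the hull of its predecessors and
  \<open>B\<close>. These retracts are pairwise non-isomorphic and mutually orthogonal, so
  \<open>rigid_locals_bounded\<close> applies, uniformly in \<open>B\<close>.\<close>

lemma chain_bounded: "\<exists>n. \<forall>B Ms. B \<subseteq> Obj C \<and> rigid_list Ms \<and> chain B Ms \<longrightarrow> length Ms \<le> n"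
proof -
  obtain n where n: "\<And>S. rigid_locals S \<Longrightarrow> card S \<le> n" using rigid_locals_bounded by blast
  have "length Ms \<le> n" if B: "B \<subseteq> Obj C" and r: "rigid_list Ms" and c: "chain B Ms" for B Ms
  proof -
    have MO: "set Ms \<subseteq> Obj C" using r unfolding rigid_list_def by blast
    have tO: "set (take k Ms) \<union> B \<subseteq> Obj C" for k using B MO set_take_subset by fastforce
    have "\<exists>l. local l \<and> retract l (Ms ! k) \<and> l \<notin> add_hull (set (take k Ms) \<union> B)" if k: "k < length Ms" for k
    proof (rule ccontr)
      assume "\<not> ?thesis"
      then have "Ms ! k \<in> add_hull (set (take k Ms) \<union> B)"
        using subcategory_if_locals[OF hull_subcategory, of "Ms ! k"] nth_mem[OF k] MO by blast
      then show False using c k unfolding chain_def by blast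
    qed
    then obtain l where l: "\<And>k. k < length Ms \<Longrightarrow> local (l k) \<and> retract (l k) (Ms ! k) \<and> l k \<notin> add_hull (set (take k Ms) \<union> B)"
      by metis
    have lt: "\<not> isomorphic (l i) (l k)" if "i < k" "k < length Ms" for i k
    proof
      assume iso: "isomorphic (l i) (l k)"
      have il: "i < length Ms" using that by simp
      have "Ms ! i \<in> set (take k Ms)" using that il by (auto simp: in_set_conv_nth)
      then have "Ms ! i \<in> add_hull (set (take k Ms) \<union> B)" using hull_incl[OF tO] by blast
      then have "l i \<in> add_hull (set (take k Ms) \<union> B)" using subcategory_retract[OF hull_subcategory] l[OF il] by blast
      then have "l k \<in> add_hull (set (take k Ms) \<union> B)" using subcategory_iso[OF hull_subcategory] iso by blast
      then show False using l[OF that(2)] by blast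
    qed
    have ne: "\<not> isomorphic (l i) (l k)" if "i \<noteq> k" "i < length Ms" "k < length Ms" for i k
      using that lt[of i k] lt[of k i] isomorphic_sym by (meson linorder_neqE_nat)
    have inj: "inj_on l {..<length Ms}"
    proof (rule inj_onI)
      fix i k assume a: "i \<in> {..<length Ms}" "k \<in> {..<length Ms}" "l i = l k"
      show "i = k"
      proof (rule ccontr)
        assume "i \<noteq> k"
        then have "\<not> isomorphic (l i) (l k)" using ne[of i k] a(1,2) by simp
        moreover have "isomorphic (l i) (l k)" unfolding a(3) using isomorphic_refl local_obj l[of k] a(2) by simp
        ultimately show False by blast
      qed
    qed
    have "card (l ` {..<length Ms}) \<le> n"
    proof (rule n, unfold rigid_locals_def, intro conjI)
      show "\<forall>s\<in>l ` {..<length Ms}. local s" using l by blast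
      show "\<forall>s\<in>l ` {..<length Ms}. \<forall>t\<in>l ` {..<length Ms}. s \<noteq> t \<longrightarrow> \<not> isomorphic s t"
      proof (intro ballI impI, elim imageE)
        fix s t i k assume a: "s \<noteq> t" "s = l i" "i \<in> {..<length Ms}" "t = l k" "k \<in> {..<length Ms}"
        then have "i \<noteq> k" by blast
        then show "\<not> isomorphic s t" unfolding a(2,4) by (rule ne) (use a(3,5) in simp_all)
      qed
      show "\<forall>s\<in>l ` {..<length Ms}. \<forall>t\<in>l ` {..<length Ms}. orth s t"
      proof (intro ballI, elim imageE)
        fix s t i k assume a: "s = l i" "i \<in> {..<length Ms}" "t = l k" "k \<in> {..<length Ms}"
        have m: "Ms ! i \<in> set Ms" "Ms ! k \<in> set Ms" using a by auto
        then have o: "orth (Ms ! i) (Ms ! k)" using r unfolding rigid_list_def by blast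
        have rt: "retract (l i) (Ms ! i)" "retract (l k) (Ms ! k)" using l a by auto
        have O: "Ms ! i \<in> Obj C" "Ms ! k \<in> Obj C" "l i \<in> Obj C" "l k \<in> Obj C" using m MO retract_obj rt by blast+
        have "orth (l i) (Ms ! k)" by (rule orth_retract_left[OF rt(1) o O(2)])
        then have "orth (Ms ! k) (l i)" using orth_sym O by blast
        then have "orth (l k) (l i)" using orth_retract_left[OF rt(2)] O by blast
        then show "orth s t" using orth_sym O a by blast
      qed
    qed simp
    then show ?thesis using card_image[OF inj] by simp
  qed
  then show ?thesis by blast
qed

lemma maximal_chain:
  assumes "U \<subseteq> Obj C" "B \<subseteq> Obj C"
  shows "\<exists>Ms. set Ms \<subseteq> U \<and> rigid_list Ms \<and> chain B Ms \<and>
    (\<forall>Ms'. set Ms' \<subseteq> U \<and> rigid_list Ms' \<and> chain B Ms' \<longrightarrow> length Ms' \<le> length Ms)"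
proof -
  define P where "P Ms \<longleftrightarrow> set Ms \<subseteq> U \<and> rigid_list Ms \<and> chain B Ms" for Ms
  obtain n where n: "\<forall>B Ms. B \<subseteq> Obj C \<and> rigid_list Ms \<and> chain B Ms \<longrightarrow> length Ms \<le> n" using chain_bounded ..
  have "P []" unfolding P_def rigid_list_def chain_def by simp
  moreover have "length Ms \<le> n" if "P Ms" for Ms using n assms(2) that unfolding P_def by blast
  then have "\<forall>Ms. P Ms \<longrightarrow> length Ms < Suc n" by (auto simp: less_Suc_eq_le)
  ultimately have "\<exists>Ms. P Ms \<and> (\<forall>Ms'. P Ms' \<longrightarrow> length Ms' \<le> length Ms)" by (rule ex_has_greatest_nat)
  then show ?thesis unfolding P_def by blast
qed

lemma chain_snoc:
  "chain B (Ms @ [M]) \<longleftrightarrow> chain B Ms \<and> M \<notin> add_hull (set Ms \<union> B)"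
  unfolding chain_def by (auto simp: nth_append less_Suc_eq)

text \<open>A chain in \<open>U\<close> of maximal length generates \<open>U\<close>, since any
  object outside its hull would prolong it. This is the source of approximations by a rigid
  \<open>I\<close>.\<close>

lemma rigid_finitely_generated:
  assumes "subcategory C U" "\<And>M N. \<lbrakk>M \<in> U; N \<in> U\<rbrakk> \<Longrightarrow> orth M N"
  shows "\<exists>S. finite S \<and> S \<subseteq> Obj C \<and> U = add_hull S"
proof -
  have UO: "U \<subseteq> Obj C" using subcategory_obj[OF assms(1)] by blast
  obtain Ms where Ms: "set Ms \<subseteq> U" "rigid_list Ms" "chain {} Ms"
    "\<And>Ms'. \<lbrakk>set Ms' \<subseteq> U; rigid_list Ms'; chain {} Ms'\<rbrakk> \<Longrightarrow> length Ms' \<le> length Ms"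
    using maximal_chain[OF UO, of "{}"] by blast
  have "M \<in> add_hull (set Ms)" if M: "M \<in> U" for M
  proof (rule ccontr)
    assume n: "M \<notin> add_hull (set Ms)"
    have "chain {} (Ms @ [M])" using Ms(3) n by (simp add: chain_snoc)
    moreover have "set (Ms @ [M]) \<subseteq> U" using Ms(1) M by simp
    moreover from this have "rigid_list (Ms @ [M])" unfolding rigid_list_def using assms(2) UO by blast
    ultimately have "length (Ms @ [M]) \<le> length Ms" using Ms(4) by blast
    then show False by simp
  qed
  moreover have "add_hull (set Ms) \<subseteq> U" by (rule hull_least[OF assms(1) Ms(1)])
  ultimately have "U = add_hull (set Ms)" by blast
  then show ?thesis using Ms(1) UO by blast
qed

end


section \<open>Syzygies relative to a rigid subcategory\<close>

locale rigid_setting = cluster_setting C T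
  for C :: "('o, 'm, 'k, 'e) extri" (structure) and T :: 'o +
  fixes I :: "'o set"
  assumes I_subcategory: "subcategory C I"
    and I_rigid: "\<lbrakk>M \<in> I; N \<in> I\<rbrakk> \<Longrightarrow> orth M N"
    and projective_I: "projective C P \<Longrightarrow> P \<in> I"
begin

lemma I_obj: "N \<in> I \<Longrightarrow> N \<in> Obj C" by (rule subcategory_obj[OF I_subcategory])

lemma injective_I: "injective C Q \<Longrightarrow> Q \<in> I" using projective_I injective_projective by blast

lemma rigid_setting_opp: "rigid_setting (opp C) T I"
proof -
  interpret o: cluster_setting "opp C" T by (rule cluster_setting_opp)
  show ?thesis
  proof (intro rigid_setting.intro rigid_setting_axioms.intro)
    show "cluster_setting (opp C) T" by (rule cluster_setting_opp)
    show "subcategory (opp C) I" using I_subcategory by simp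
    show "o.orth M N" if "M \<in> I" "N \<in> I" for M N using I_rigid[OF that(2,1)] by (simp add: orth_opp)
    show "P \<in> I" if "projective (opp C) P" for P using injective_I that by (simp add: projective_opp)
  qed
qed

definition Perp :: "'o set" where "Perp = {M \<in> Obj C. \<forall>N\<in>I. orth M N}"

lemma Perp_subcategory: "subcategory C Perp"
  unfolding Perp_def by (rule orth_left_subcategory) (use I_obj in blast)

lemma Perp_obj: "M \<in> Perp \<Longrightarrow> M \<in> Obj C" unfolding Perp_def by blast

lemma Perp_orth: "\<lbrakk>M \<in> Perp; N \<in> I\<rbrakk> \<Longrightarrow> orth M N" "\<lbrakk>M \<in> Perp; N \<in> I\<rbrakk> \<Longrightarrow> orth N M"
  unfolding Perp_def using orth_sym I_obj by blast+

lemma Perp_opp: "rigid_setting.Perp (opp C) I = Perp"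
proof -
  interpret o: rigid_setting "opp C" T I by (rule rigid_setting_opp)
  show ?thesis unfolding Perp_def o.Perp_def using orth_sym I_obj by (auto simp: orth_opp)
qed

lemma I_Perp: "I \<subseteq> Perp" unfolding Perp_def using I_rigid I_obj by blast

lemma Perp_extension: "\<lbrakk>conflation A B D; A \<in> Perp; D \<in> Perp\<rbrakk> \<Longrightarrow> B \<in> Perp"
  unfolding Perp_def using orth_middle_left conflation_obj I_obj by blast

text \<open>\<open>I\<close> is the hull of a finite \<open>S\<close>, and adding the injectives to
  \<open>S\<close> does not lead out of \<open>I\<close>. So the approximation has its middle term
  in \<open>I\<close>, and rigidity makes the cone left orthogonal to \<open>I\<close>.\<close>

lemma I_inflation:
  assumes "M \<in> Obj C" shows "\<exists>N L. N \<in> I \<and> L \<in> Perp \<and> conflation M N L"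
proof -
  obtain S where S: "finite S" "S \<subseteq> Obj C" "I = add_hull S"
    using rigid_finitely_generated[OF I_subcategory I_rigid] by blast
  obtain N L x y \<delta> where N: "N \<in> add_hull (S \<union> Inj)" "etriangle C (M, N, L, x, y, \<delta>)" "\<forall>W\<in>add_hull (S \<union> Inj). factors_left x W"
    using inflation_approximation_exists[OF S(1,2) assms] by blast
  have SI: "S \<union> Inj \<subseteq> Obj C" using S(2) Inj_obj by blast
  have "S \<subseteq> I" unfolding S(3) by (rule hull_incl[OF S(2)])
  then have "S \<union> Inj \<subseteq> I" using injective_I by blast
  then have NI: "N \<in> I" using hull_least[OF I_subcategory] N(1) by blast
  have "I \<subseteq> add_hull (S \<union> Inj)" unfolding S(3) by (rule hull_mono[OF _ SI]) blast
  then have "orth L W" if "W \<in> I" for W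
    by (intro cone_of_approximation[OF N(2), of I]) (use N(3) I_rigid[OF NI] I_obj that in blast)+
  then have "L \<in> Perp" unfolding Perp_def using etriangleD(3)[OF N(2)] by blast
  then show ?thesis using NI conflationI[OF N(2)] by blast
qed

lemma I_deflation:
  assumes "M \<in> Obj C" shows "\<exists>K N. N \<in> I \<and> K \<in> Perp \<and> conflation K N M"
proof -
  interpret o: rigid_setting "opp C" T I by (rule rigid_setting_opp)
  show ?thesis using o.I_inflation[of M] assms by (auto simp: Perp_opp conflation_opp)
qed

section \<open>Maps through \<open>I\<close>, syzygies and cosyzygies\<close>

definition thru :: "'m \<Rightarrow> bool" where
  "thru f \<longleftrightarrow> (\<exists>N u v. N \<in> I \<and> arrow u \<and> Dom C u = Dom C f \<and> Cod C u = N \<and> arrow v \<and> Dom C v = N \<and> Cod C v = Cod C f \<and> f = v \<bullet> u)"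

definition no_maps :: "'o \<Rightarrow> 'o \<Rightarrow> bool" where
  "no_maps A B \<longleftrightarrow> (\<forall>f. arrow f \<and> Dom C f = A \<and> Cod C f = B \<longrightarrow> thru f)"

lemma thruI: "\<lbrakk>arrow u; arrow v; Cod C u = Dom C v; Dom C v \<in> I\<rbrakk> \<Longrightarrow> thru (v \<bullet> u)"
  unfolding thru_def by (intro exI[of _ "Dom C v"] exI[of _ u] exI[of _ v]) simp

lemma thruE:
  assumes "thru f" obtains u v where "arrow u" "arrow v" "Dom C u = Dom C f" "Cod C u = Dom C v" "Cod C v = Cod C f" "Dom C v \<in> I" "f = v \<bullet> u"
  using assms unfolding thru_def by metis

lemma no_mapsD: "\<lbrakk>no_maps A B; arrow f; Dom C f = A; Cod C f = B\<rbrakk> \<Longrightarrow> thru f"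
  unfolding no_maps_def by blast

lemma thru_arrow: "thru f \<Longrightarrow> arrow f"
  by (erule thruE) simp

lemma thru_comp_left:
  assumes "thru f" "arrow g" "Dom C g = Cod C f" shows "thru (g \<bullet> f)"
proof -
  obtain u v where u: "arrow u" "arrow v" "Dom C u = Dom C f" "Cod C u = Dom C v" "Cod C v = Cod C f" "Dom C v \<in> I" "f = v \<bullet> u"
    using assms(1) by (rule thruE)
  have "g \<bullet> f = (g \<bullet> v) \<bullet> u" unfolding u(7) using u(1,2,4,5) assms(2,3) by simp
  then show ?thesis using thruI[of u "g \<bullet> v"] u(1,2,4,5,6) assms(2,3) by simp
qed

lemma thru_comp_right:
  assumes "thru f" "arrow g" "Cod C g = Dom C f" shows "thru (f \<bullet> g)"
proof -
  obtain u v where u: "arrow u" "arrow v" "Dom C u = Dom C f" "Cod C u = Dom C v" "Cod C v = Cod C f" "Dom C v \<in> I" "f = v \<bullet> u"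
    using assms(1) by (rule thruE)
  have "f \<bullet> g = v \<bullet> (u \<bullet> g)" unfolding u(7) using u(1-4) assms(2,3) by simp
  then show ?thesis using thruI[of "u \<bullet> g" v] u(1-4,6) assms(2,3) by simp
qed

lemma thru_plus:
  assumes "thru f" "thru g" "Dom C f = Dom C g" "Cod C f = Cod C g" shows "thru (f \<boxplus> g)"
proof -
  obtain u v where u: "arrow u" "arrow v" "Dom C u = Dom C f" "Cod C u = Dom C v" "Cod C v = Cod C f" "Dom C v \<in> I" "f = v \<bullet> u"
    using assms(1) by (rule thruE)
  obtain u' v' where u': "arrow u'" "arrow v'" "Dom C u' = Dom C g" "Cod C u' = Dom C v'" "Cod C v' = Cod C g" "Dom C v' \<in> I" "g = v' \<bullet> u'"
    using assms(2) by (rule thruE)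
  obtain S i j p q where b: "biprod (Dom C v) (Dom C v') S i j p q"
    using two_sum_exists[OF arrow_obj(1)[OF u(2)] arrow_obj(1)[OF u'(2)]] by (auto simp: is_direct_sum_two)
  note bb = b[unfolded biprod_def]
  have e: "p \<bullet> i = Ident C (Dom C v)" "q \<bullet> j = Ident C (Dom C v')" "q \<bullet> i = null (Dom C v) (Dom C v')" "p \<bullet> j = null (Dom C v') (Dom C v)"
    using bb by auto
  have SI: "S \<in> I" using subcategory_sum2[OF I_subcategory u(6) u'(6)] b is_direct_sum_two by blast
  have d: "Dom C u' = Dom C u" "Cod C v' = Cod C v" using u(3,5) u'(3,5) assms(3,4) by simp_all
  have "(v \<bullet> p \<boxplus> v' \<bullet> q) \<bullet> (i \<bullet> u \<boxplus> j \<bullet> u') = v \<bullet> u \<boxplus> v' \<bullet> u'"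
    using bb u(1,2,4) u'(1,2,4) d by (simp add: e[THEN reassoc])
  moreover have "thru ((v \<bullet> p \<boxplus> v' \<bullet> q) \<bullet> (i \<bullet> u \<boxplus> j \<bullet> u'))"
    by (rule thruI) (use bb u(1,2,4) u'(1,2,4) d SI in simp_all)
  ultimately show ?thesis unfolding u(7) u'(7) by simp
qed

lemma no_self_maps_I:
  assumes "no_maps A A" "A \<in> Obj C" shows "A \<in> I"
proof -
  have "thru (Ident C A)" by (rule no_mapsD[OF assms(1)]) (use assms(2) in simp_all)
  then obtain u v where u: "arrow u" "arrow v" "Dom C u = Dom C (Ident C A)" "Cod C u = Dom C v" "Cod C v = Cod C (Ident C A)" "Dom C v \<in> I" "Ident C A = v \<bullet> u"
    by (rule thruE)
  have "retract A (Dom C v)" by (rule retractI[of v u]) (use u(7)[symmetric] u(1-5) assms(2) in simp_all)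
  then show ?thesis by (rule subcategory_retract[OF I_subcategory u(6)])
qed

text \<open>\<open>B\<close> is a shift of \<open>A\<close> in the quotient. As an object of
  \<open>C\<close> it is determined only up to summands from \<open>I\<close>, so a relation is more
  convenient than a chosen function.\<close>

definition syz :: "'o \<Rightarrow> 'o \<Rightarrow> bool" where
  "syz A B \<longleftrightarrow> A \<in> Perp \<and> B \<in> Perp \<and> (\<exists>N\<in>I. conflation A N B)"

lemma syz_Perp: "syz A B \<Longrightarrow> A \<in> Perp" "syz A B \<Longrightarrow> B \<in> Perp" unfolding syz_def by blast+

lemma syzE: assumes "syz A B" obtains N where "N \<in> I" "conflation A N B" using assms unfolding syz_def by blast

lemma cosyzygy_exists: "M \<in> Perp \<Longrightarrow> \<exists>L. syz M L"
  using I_inflation[OF Perp_obj] unfolding syz_def by blast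

lemma syzygy_exists: "M \<in> Perp \<Longrightarrow> \<exists>K. syz K M"
  using I_deflation[OF Perp_obj] unfolding syz_def by blast

lemma syz_opp: "rigid_setting.syz (opp C) I A B \<longleftrightarrow> syz B A"
proof -
  interpret o: rigid_setting "opp C" T I by (rule rigid_setting_opp)
  show ?thesis unfolding syz_def o.syz_def Perp_opp conflation_opp by blast
qed

lemma thru_opp: "rigid_setting.thru (opp C) I f \<longleftrightarrow> thru f"
proof -
  interpret o: rigid_setting "opp C" T I by (rule rigid_setting_opp)
  show ?thesis
  proof
    assume "o.thru f"
    then obtain u v where u: "o.arrow u" "o.arrow v" "Dom (opp C) u = Dom (opp C) f" "Cod (opp C) u = Dom (opp C) v"
      "Cod (opp C) v = Cod (opp C) f" "Dom (opp C) v \<in> I" "f = v \<bullet>\<^bsub>opp C\<^esub> u" by (rule o.thruE)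
    then show "thru f" using thruI[of v u] by (simp add: arrow_opp)
  next
    assume "thru f"
    then obtain u v where u: "arrow u" "arrow v" "Dom C u = Dom C f" "Cod C u = Dom C v" "Cod C v = Cod C f" "Dom C v \<in> I" "f = v \<bullet> u" by (rule thruE)
    then show "o.thru f" using o.thruI[of v u] by (simp add: arrow_opp)
  qed
qed

lemma no_maps_opp: "rigid_setting.no_maps (opp C) I A B \<longleftrightarrow> no_maps B A"
proof -
  interpret o: rigid_setting "opp C" T I by (rule rigid_setting_opp)
  show ?thesis unfolding no_maps_def o.no_maps_def thru_opp arrow_opp opp_simps by blast
qed

text \<open>For \<open>A -> N -> B\<close> with Ext(W, N) = 0, the group Ext(W, A) is Hom(W, B)
  modulo the maps that lift to \<open>N\<close>. These are exactly the maps through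
  \<open>I\<close>, because a map from an object of \<open>I\<close> to \<open>B\<close> lifts to
  \<open>N\<close> by Ext(I, A) = 0.\<close>

lemma orth_iff_no_maps:
  assumes "syz A B" "W \<in> Perp" shows "orth W A \<longleftrightarrow> no_maps W B"
proof -
  obtain N where N: "N \<in> I" "conflation A N B" using assms(1) by (rule syzE)
  obtain x y \<delta> where t: "etriangle C (A, N, B, x, y, \<delta>)" using N(2) unfolding conflation_def by blast
  note tt = etriangleD[OF t]
  have AP: "A \<in> Perp" "B \<in> Perp" using syz_Perp[OF assms(1)] .
  show ?thesis
  proof
    assume o: "orth W A"
    show "no_maps W B"
      unfolding no_maps_def
    proof (intro allI impI, elim conjE)
      fix f assume f: "arrow f" "Dom C f = W" "Cod C f = B"
      have "Cod C f = Cod C y" using f(3) tt(10) by simp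
      then obtain g where g: "arrow g" "Dom C g = W" "Cod C g = Dom C y" "y \<bullet> g = f"
        using factors_right_from_orth[OF t o] f(1,2) unfolding factors_right_def by blast
      have "thru (y \<bullet> g)" by (rule thruI) (use g(1,3) tt N(1) in simp_all)
      then show "thru f" using g(4) by simp
    qed
  next
    assume n: "no_maps W B"
    show "orth W A"
    proof (rule orthI)
      fix \<epsilon> assume e: "\<epsilon> \<in> ext C W A"
      have WO: "W \<in> Obj C" using Perp_obj[OF assms(2)] .
      have "push C W x \<epsilon> = \<zero>\<^bsub>Ext C W N\<^esub>"
        using orthD[OF Perp_orth(1)[OF assms(2) N(1)]] push_closed[of W x \<epsilon>] tt e WO by simp
      then obtain f where f: "arrow f" "Dom C f = W" "Cod C f = B" "\<epsilon> = pull C A f \<delta>"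
        using ext_from_hom[OF t WO e] by blast
      obtain u v where u: "arrow u" "arrow v" "Dom C u = Dom C f" "Cod C u = Dom C v" "Cod C v = Cod C f" "Dom C v \<in> I" "f = v \<bullet> u"
        using no_mapsD[OF n f(1-3)] by (rule thruE)
      have "factors_right y (Dom C v)" by (rule factors_right_from_orth[OF t Perp_orth(2)[OF AP(1) u(6)]])
      moreover have "Cod C v = Cod C y" using u(5) f(3) tt(10) by simp
      ultimately obtain v' where v': "arrow v'" "Dom C v' = Dom C v" "Cod C v' = Dom C y" "y \<bullet> v' = v"
        using u(2) unfolding factors_right_def by blast
      have "f = (y \<bullet> v') \<bullet> u" unfolding v'(4) by (rule u(7))
      also have "\<dots> = y \<bullet> (v' \<bullet> u)" by (rule comp_assoc') (use u(1,4) v'(1-3) tt in simp_all)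
      finally have f': "f = y \<bullet> (v' \<bullet> u)" .
      have "pull C A (y \<bullet> (v' \<bullet> u)) \<delta> = \<zero>\<^bsub>Ext C (Dom C (v' \<bullet> u)) A\<^esub>"
        by (rule pull_factor_zero[OF t]) (use u(1,4) v'(1-3) tt in simp_all)
      moreover have "Dom C (v' \<bullet> u) = W" using u(1,3,4) v'(1-3) f(2) by simp
      ultimately show "\<epsilon> = \<zero>\<^bsub>Ext C W A\<^esub>" unfolding f(4) f'[symmetric] by simp
    qed (use Perp_obj AP assms(2) in blast)+
  qed
qed

lemma orth_iff_no_maps_op:
  assumes "syz A B" "W \<in> Perp" shows "orth B W \<longleftrightarrow> no_maps A W"
proof -
  interpret o: rigid_setting "opp C" T I by (rule rigid_setting_opp)
  show ?thesis using o.orth_iff_no_maps[of B A W] assms by (simp add: syz_opp Perp_opp orth_opp no_maps_opp)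
qed

text \<open>By Schanuel's argument two cosyzygies become equal after adding objects of
  \<open>I\<close>.\<close>

lemma cosyzygy_unique:
  assumes "subcategory C U" "I \<subseteq> U" "syz A B" "syz A B'" "B \<in> U" shows "B' \<in> U"
proof -
  obtain N where N: "N \<in> I" "conflation A N B" using assms(3) by (rule syzE)
  obtain N' where N': "N' \<in> I" "conflation A N' B'" using assms(4) by (rule syzE)
  obtain E where E: "is_direct_sum C [N', B] E" "is_direct_sum C [N, B'] E"
    using schanuel[OF N(2) N'(2) Perp_orth(1)[OF syz_Perp(2)[OF assms(3)] N'(1)] Perp_orth(1)[OF syz_Perp(2)[OF assms(4)] N(1)]] by blast
  have "E \<in> U" by (rule subcategory_sum2[OF assms(1) _ assms(5) E(1)]) (use N' assms(2) in blast)
  then show ?thesis by (rule subcategory_summand(2)[OF assms(1) _ E(2)])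
qed

lemma syzygy_unique:
  assumes "subcategory C U" "I \<subseteq> U" "syz A B" "syz A' B" "A \<in> U" shows "A' \<in> U"
proof -
  interpret o: rigid_setting "opp C" T I by (rule rigid_setting_opp)
  show ?thesis using o.cosyzygy_unique[of U B A A'] assms by (simp add: syz_opp)
qed

lemma syz_sum:
  assumes "syz A B" "syz A' B'" "is_direct_sum C [A, A'] S" "is_direct_sum C [B, B'] S'" shows "syz S S'"
proof -
  obtain N where N: "N \<in> I" "conflation A N B" using assms(1) by (rule syzE)
  obtain N' where N': "N' \<in> I" "conflation A' N' B'" using assms(2) by (rule syzE)
  obtain F where F: "is_direct_sum C [N, N'] F" using two_sum_exists[OF I_obj[OF N(1)] I_obj[OF N'(1)]] by blast
  have "S \<in> Perp" "S' \<in> Perp"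
    by (rule subcategory_sum2[OF Perp_subcategory syz_Perp(1)[OF assms(1)] syz_Perp(1)[OF assms(2)] assms(3)],
        rule subcategory_sum2[OF Perp_subcategory syz_Perp(2)[OF assms(1)] syz_Perp(2)[OF assms(2)] assms(4)])
  then show ?thesis unfolding syz_def
    using conflation_sum[OF N(2) N'(2) assms(3) F assms(4)] subcategory_sum2[OF I_subcategory N(1) N'(1) F] by blast
qed

lemma orth_cosyzygies:
  assumes "syz A B" "syz A' B'" "orth A A'" shows "orth B B'"
proof -
  obtain N where N: "N \<in> I" "conflation A N B" using assms(1) by (rule syzE)
  obtain N' where N': "N' \<in> I" "conflation A' N' B'" using assms(2) by (rule syzE)
  show ?thesis by (rule orth_cones[OF N(2) N'(2) assms(3) Perp_orth(2)[OF syz_Perp(2)[OF assms(2)] N(1)]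
        Perp_orth(1)[OF syz_Perp(2)[OF assms(1)] N'(1)]])
qed

text \<open>Adding the trivial conflation on a zero object turns a change of the third term along an
  isomorphism into another choice of direct sum.\<close>

lemma syz_iso_right:
  assumes "syz A B" "isomorphic B B'" shows "syz A B'"
proof -
  obtain N where N: "N \<in> I" "conflation A N B" using assms(1) by (rule syzE)
  obtain Z where Z: "is_zero_object C Z" using zero_exists by blast
  have ZO: "Z \<in> Obj C" using Z unfolding is_zero_object_def by blast
  note O = conflation_obj[OF N(2)]
  have "conflation A N B'"
    by (rule conflation_sum[OF N(2) conflation_zero_left[OF Z ZO] direct_sum_zero[OF Z O(1)] direct_sum_zero[OF Z O(2)]
          direct_sum_cong[OF direct_sum_zero[OF Z O(3)] assms(2)]])
  then show ?thesis unfolding syz_def using N(1) syz_Perp[OF assms(1)] subcategory_iso[OF Perp_subcategory _ assms(2)] by blast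
qed

definition cosyzygies :: "'o set \<Rightarrow> 'o set" where
  "cosyzygies U = {B. \<exists>A\<in>U. syz A B}"

text \<open>These sets are exactly the subcategories of the quotient, see
  \<open>subcategory_Q\<close>; \<open>I\<close> is its zero subcategory.\<close>

definition admissible :: "'o set \<Rightarrow> bool" where
  "admissible U \<longleftrightarrow> subcategory C U \<and> I \<subseteq> U \<and> U \<subseteq> Perp"

lemma cosyzygies_syz: "\<lbrakk>admissible U; B \<in> cosyzygies U; syz A B\<rbrakk> \<Longrightarrow> A \<in> U"
  unfolding cosyzygies_def admissible_def using syzygy_unique by blast

lemma I_cosyzygies: assumes "admissible U" shows "I \<subseteq> cosyzygies U"
proof
  fix N assume N: "N \<in> I"
  obtain A where A: "syz A N" using syzygy_exists I_Perp N by blast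
  obtain M where M: "M \<in> I" "conflation A M N" using A by (rule syzE)
  have "is_direct_sum C [A, N] M" by (rule orth_split[OF M(2) Perp_orth(2)[OF syz_Perp(1)[OF A] N]])
  then have "A \<in> I" using subcategory_summand(1)[OF I_subcategory M(1)] by blast
  then show "N \<in> cosyzygies U" unfolding cosyzygies_def using A assms admissible_def by blast
qed

lemma cosyzygies_admissible:
  assumes "admissible U" shows "admissible (cosyzygies U)"
proof -
  have U: "subcategory C U" "I \<subseteq> U" "U \<subseteq> Perp" using assms unfolding admissible_def by blast+
  have cP: "cosyzygies U \<subseteq> Perp" unfolding cosyzygies_def using syz_Perp(2) by blast
  have sum: "S \<in> cosyzygies U" if h: "A \<in> cosyzygies U" "B \<in> cosyzygies U" "is_direct_sum C [A, B] S" for A B S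
  proof -
    obtain A0 B0 where AB: "A0 \<in> U" "syz A0 A" "B0 \<in> U" "syz B0 B" using h(1,2) unfolding cosyzygies_def by blast
    obtain S0 where S0: "is_direct_sum C [A0, B0] S0"
      using two_sum_exists[OF Perp_obj[OF syz_Perp(1)[OF AB(2)]] Perp_obj[OF syz_Perp(1)[OF AB(4)]]] by blast
    have "S0 \<in> U" by (rule subcategory_sum2[OF U(1) AB(1,3) S0])
    then show ?thesis unfolding cosyzygies_def using syz_sum[OF AB(2,4) S0 h(3)] by blast
  qed
  have iso: "S' \<in> cosyzygies U" if "S \<in> cosyzygies U" "isomorphic S S'" for S S'
    using that syz_iso_right unfolding cosyzygies_def by blast
  have summand: "A \<in> cosyzygies U" if h: "S \<in> cosyzygies U" "is_direct_sum C [A, B] S" for A B S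
  proof -
    have SP: "S \<in> Perp" using h(1) cP by blast
    have AB: "A \<in> Perp" "B \<in> Perp" using subcategory_summand[OF Perp_subcategory SP h(2)] .
    obtain A0 where A0: "syz A0 A" using syzygy_exists[OF AB(1)] by blast
    obtain B0 where B0: "syz B0 B" using syzygy_exists[OF AB(2)] by blast
    obtain S0 where S0: "is_direct_sum C [A0, B0] S0"
      using two_sum_exists[OF Perp_obj[OF syz_Perp(1)[OF A0]] Perp_obj[OF syz_Perp(1)[OF B0]]] by blast
    have "S0 \<in> U" by (rule cosyzygies_syz[OF assms h(1) syz_sum[OF A0 B0 S0 h(2)]])
    then have "A0 \<in> U" by (rule subcategory_summand(1)[OF U(1) _ S0])
    then show ?thesis unfolding cosyzygies_def using A0 by blast
  qed
  have Z: "Z \<in> cosyzygies U" if "is_zero_object C Z" for Z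
    using I_cosyzygies[OF assms] subcategory_zero[OF I_subcategory that] by blast
  have "subcategory C (cosyzygies U)"
    unfolding subcategory_def
  proof (intro conjI allI impI)
    show "cosyzygies U \<subseteq> Obj C" using cP Perp_obj by blast
    fix X Y f assume a: "X \<in> cosyzygies U \<and> Y \<in> Obj C \<and> is_iso C X Y f"
    then have "isomorphic X Y" using cP Perp_obj unfolding isomorphic_def by blast
    then show "Y \<in> cosyzygies U" using iso a by blast
  next
    fix Xs S assume "set Xs \<subseteq> cosyzygies U \<and> is_direct_sum C Xs S"
    then have "set Xs \<subseteq> cosyzygies U" "is_direct_sum C Xs S" by auto
    then show "S \<in> cosyzygies U"
    proof (induction Xs arbitrary: S)
      case Nil then show ?case using Z by (simp add: is_direct_sum_Nil)
    next
      case (Cons X Xs)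
      obtain S' where S': "is_direct_sum C Xs S'" "is_direct_sum C [X, S'] S"
        using Cons.prems(2) by (rule direct_sum_ConsE)
      have "X \<in> cosyzygies U" "S' \<in> cosyzygies U" using Cons.IH[OF _ S'(1)] Cons.prems(1) by auto
      then show ?case by (rule sum[OF _ _ S'(2)])
    qed
  next
    fix X Y S assume "S \<in> cosyzygies U \<and> is_direct_sum C [X, Y] S"
    then show "X \<in> cosyzygies U" using summand by blast
  qed
  then show ?thesis unfolding admissible_def using I_cosyzygies[OF assms] cP by blast
qed

definition extension_closed :: "'o set \<Rightarrow> bool" where
  "extension_closed U \<longleftrightarrow> (\<forall>A B D. conflation A B D \<and> A \<in> U \<and> D \<in> U \<longrightarrow> B \<in> U)"

text \<open>A horseshoe argument: pulling \<open>B -> D\<close> back to the resolution of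
  \<open>D\<close> and composing deflations produces a conflation \<open>F -> S -> B\<close>, where
  \<open>S\<close> is the sum of \<open>N\<close> and \<open>N'\<close> and \<open>F\<close> is an
  extension of \<open>D0\<close> by \<open>A0\<close>.\<close>

lemma cosyzygies_extension_closed:
  assumes "admissible U" "extension_closed U" shows "extension_closed (cosyzygies U)"
  unfolding extension_closed_def
proof (intro allI impI, elim conjE)
  fix A B D assume c: "conflation A B D" and AD: "A \<in> cosyzygies U" "D \<in> cosyzygies U"
  obtain A0 D0 where s: "A0 \<in> U" "syz A0 A" "D0 \<in> U" "syz D0 D" using AD unfolding cosyzygies_def by blast
  obtain N where N: "N \<in> I" "conflation A0 N A" using s(2) by (rule syzE)
  obtain N' where N': "N' \<in> I" "conflation D0 N' D" using s(4) by (rule syzE)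
  have P: "A \<in> Perp" "D \<in> Perp" "A0 \<in> Perp" "D0 \<in> Perp" using syz_Perp s(2,4) by blast+
  obtain E where E: "conflation D0 E B" "is_direct_sum C [A, N'] E"
    using pullback_conflation[OF c N'(2)] Perp_orth(2)[OF P(1) N'(1)] by blast
  obtain Z where Z: "is_zero_object C Z" using zero_exists by blast
  obtain S where S: "is_direct_sum C [N, N'] S" using two_sum_exists[OF I_obj[OF N(1)] I_obj[OF N'(1)]] by blast
  have "conflation A0 S E"
    by (rule conflation_sum[OF N(2) conflation_zero_left[OF Z I_obj[OF N'(1)]] direct_sum_zero[OF Z Perp_obj[OF P(3)]] S E(2)])
  then obtain F where F: "conflation F S B" "conflation A0 F D0" using compose_deflations[OF E(1)] by blast
  have "F \<in> U" using assms(2) F(2) s(1,3) unfolding extension_closed_def by blast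
  moreover have "S \<in> I" by (rule subcategory_sum2[OF I_subcategory N(1) N'(1) S])
  moreover have "B \<in> Perp" by (rule Perp_extension[OF c P(1,2)])
  moreover have "F \<in> Perp" by (rule Perp_extension[OF F(2) P(3,4)])
  ultimately show "B \<in> cosyzygies U" unfolding cosyzygies_def syz_def using F(1) by blast
qed

definition cosyz :: "'o \<Rightarrow> 'o" where "cosyz A = (SOME B. syz A B)"

lemma cosyz: "A \<in> Perp \<Longrightarrow> syz A (cosyz A)"
  unfolding cosyz_def using cosyzygy_exists by (rule someI_ex)

text \<open>If a cosyzygy were generated by the earlier ones and \<open>I\<close>, it would be a
  cosyzygy of the hull of the earlier originals. Uniqueness of syzygies would then put the original
  entry into that hull.\<close>

lemma chain_cosyz:
  assumes "set Ms \<subseteq> Perp" "chain I Ms" shows "chain I (map cosyz Ms)"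
  unfolding chain_def
proof (intro allI impI notI)
  fix k assume k: "k < length (map cosyz Ms)" and h: "map cosyz Ms ! k \<in> add_hull (set (take k (map cosyz Ms)) \<union> I)"
  define U where "U = add_hull (set (take k Ms) \<union> I)"
  have tP: "set (take k Ms) \<union> I \<subseteq> Perp" using assms(1) set_take_subset I_Perp by fastforce
  have tO: "set (take k Ms) \<union> I \<subseteq> Obj C" using tP Perp_obj by blast
  have inU: "set (take k Ms) \<union> I \<subseteq> U" unfolding U_def by (rule hull_incl[OF tO])
  have U: "admissible U" unfolding admissible_def
    using hull_subcategory[of "set (take k Ms) \<union> I"] hull_least[OF Perp_subcategory tP] inU unfolding U_def by blast
  have "cosyz M \<in> cosyzygies U" if "M \<in> set (take k Ms)" for M
    unfolding cosyzygies_def using cosyz[of M] that inU tP by blast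
  then have "set (take k (map cosyz Ms)) \<union> I \<subseteq> cosyzygies U"
    using I_cosyzygies[OF U] by (auto simp: take_map)
  then have "add_hull (set (take k (map cosyz Ms)) \<union> I) \<subseteq> cosyzygies U"
    using hull_least cosyzygies_admissible[OF U] unfolding admissible_def by blast
  then have c: "cosyz (Ms ! k) \<in> cosyzygies U" using h k by auto
  have "Ms ! k \<in> Perp" using assms(1) k nth_mem by fastforce
  then have "Ms ! k \<in> U" using cosyzygies_syz[OF U c cosyz] by blast
  then show False using assms(2) k unfolding chain_def U_def by simp
qed

lemma rigid_list_cosyz:
  assumes "set Ms \<subseteq> Perp" "rigid_list Ms" shows "rigid_list (map cosyz Ms)"
  unfolding rigid_list_def
proof (intro conjI ballI)
  have s: "syz M (cosyz M)" if "M \<in> set Ms" for M using cosyz assms(1) that by blast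
  show "set (map cosyz Ms) \<subseteq> Obj C" using s syz_Perp(2) Perp_obj by auto
  fix M N assume "M \<in> set (map cosyz Ms)" "N \<in> set (map cosyz Ms)"
  then obtain M' N' where "M' \<in> set Ms" "M = cosyz M'" "N' \<in> set Ms" "N = cosyz N'" by auto
  moreover from this have "orth M' N'" using assms(2) unfolding rigid_list_def by blast
  ultimately show "orth M N" using orth_cosyzygies[OF s s] by blast
qed

end

section \<open>Cotorsion pairs with a given core\<close>

locale cotorsion_core = rigid_setting C T I
  for C :: "('o, 'm, 'k, 'e) extri" (structure) and T :: 'o and I :: "'o set" +
  fixes X Y :: "'o set"
  assumes X_subcategory: "subcategory C X" and Y_subcategory: "subcategory C Y"
    and XY: "\<lbrakk>A \<in> X; B \<in> Y\<rbrakk> \<Longrightarrow> orth A B"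
    and core: "X \<inter> Y = I"
    and right_truncation: "M \<in> Obj C \<Longrightarrow> \<exists>A\<in>Y. \<exists>B\<in>X. conflation A B M"
    and left_truncation: "M \<in> Obj C \<Longrightarrow> \<exists>A\<in>Y. \<exists>B\<in>X. conflation M A B"
begin

lemma X_obj: "A \<in> X \<Longrightarrow> A \<in> Obj C" by (rule subcategory_obj[OF X_subcategory])
lemma Y_obj: "A \<in> Y \<Longrightarrow> A \<in> Obj C" by (rule subcategory_obj[OF Y_subcategory])

lemma YX: "\<lbrakk>A \<in> X; B \<in> Y\<rbrakk> \<Longrightarrow> orth B A" using XY orth_sym X_obj Y_obj by blast

lemma I_X: "I \<subseteq> X" and I_Y: "I \<subseteq> Y" using core by blast+

lemma X_Perp: "X \<subseteq> Perp" unfolding Perp_def using XY I_Y X_obj by blast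
lemma Y_Perp: "Y \<subseteq> Perp" unfolding Perp_def using YX I_X Y_obj by blast

lemma cotorsion_core_opp: "cotorsion_core (opp C) T I Y X"
proof -
  interpret o: rigid_setting "opp C" T I by (rule rigid_setting_opp)
  show ?thesis
  proof (intro cotorsion_core.intro cotorsion_core_axioms.intro)
    show "rigid_setting (opp C) T I" by (rule rigid_setting_opp)
    show "subcategory (opp C) X" "subcategory (opp C) Y" using X_subcategory Y_subcategory by simp_all
    show "Y \<inter> X = I" using core by blast
    show "o.orth A B" if "A \<in> Y" "B \<in> X" for A B using XY[OF that(2,1)] by (simp add: orth_opp)
    show "\<exists>A\<in>X. \<exists>B\<in>Y. o.conflation A B M" if "M \<in> Obj (opp C)" for M
      using left_truncation[of M] that unfolding conflation_opp opp_simps by blast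
    show "\<exists>A\<in>X. \<exists>B\<in>Y. o.conflation M A B" if "M \<in> Obj (opp C)" for M
      using right_truncation[of M] that unfolding conflation_opp opp_simps by blast
  qed
qed

text \<open>The truncation triangle of \<open>M\<close> splits, so \<open>M\<close> is a summand of
  its term in \<open>X\<close>.\<close>

lemma X_if_orth:
  assumes "M \<in> Obj C" "\<And>B. B \<in> Y \<Longrightarrow> orth M B" shows "M \<in> X"
proof -
  obtain A B where AB: "A \<in> Y" "B \<in> X" "conflation A B M" using right_truncation[OF assms(1)] by blast
  have "is_direct_sum C [A, M] B" by (rule orth_split[OF AB(3) assms(2)[OF AB(1)]])
  then show ?thesis by (rule subcategory_summand(2)[OF X_subcategory AB(2)])
qed

lemma Y_if_orth:
  assumes "M \<in> Obj C" "\<And>A. A \<in> X \<Longrightarrow> orth A M" shows "M \<in> Y"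
proof -
  interpret o: cotorsion_core "opp C" T I Y X by (rule cotorsion_core_opp)
  show ?thesis using o.X_if_orth[of M] assms by (simp add: orth_opp)
qed

lemma X_extension: "extension_closed X"
  unfolding extension_closed_def
proof (intro allI impI, elim conjE)
  fix A B D assume a: "conflation A B D" "A \<in> X" "D \<in> X"
  show "B \<in> X"
  proof (rule X_if_orth[OF conflation_obj(2)[OF a(1)]])
    show "orth B W" if W: "W \<in> Y" for W
      by (rule orth_middle_left[OF a(1) Y_obj[OF W] XY[OF a(2) W] XY[OF a(3) W]])
  qed
qed

lemma X_admissible: "admissible X"
  unfolding admissible_def using X_subcategory I_X X_Perp by blast

text \<open>In the left truncation \<open>A -> N -> B'\<close> the middle term lies in
  \<open>Y\<close>, and in \<open>X\<close> as an extension of objects of \<open>X\<close>. So it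
  lies in the core and \<open>B'\<close> is a cosyzygy of \<open>A\<close>.\<close>

lemma cosyzygy_X:
  assumes "A \<in> X" "syz A B" shows "B \<in> X"
proof -
  obtain N B' where N: "N \<in> Y" "B' \<in> X" "conflation A N B'" using left_truncation[OF X_obj[OF assms(1)]] by blast
  have "N \<in> X" using X_extension N(2,3) assms(1) unfolding extension_closed_def by blast
  then have "N \<in> I" using N(1) core by blast
  then have "syz A B'" unfolding syz_def using N(2,3) assms(1) X_Perp by blast
  then show ?thesis by (rule cosyzygy_unique[OF X_subcategory I_X _ assms(2) N(2)])
qed

lemma syzygy_Y:
  assumes "B \<in> Y" "syz A B" shows "A \<in> Y"
proof -
  interpret o: cotorsion_core "opp C" T I Y X by (rule cotorsion_core_opp)
  show ?thesis using o.cosyzygy_X[of B A] assms by (simp add: syz_opp)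
qed

lemma no_maps_X_Y:
  assumes "A \<in> X" "B \<in> Y" shows "no_maps A B"
proof -
  obtain B0 where B0: "syz B0 B" using syzygy_exists assms(2) Y_Perp by blast
  have "orth A B0" by (rule XY[OF assms(1) syzygy_Y[OF assms(2) B0]])
  then show ?thesis using orth_iff_no_maps[OF B0] assms(1) X_Perp by blast
qed

text \<open>The k-fold shift of \<open>X\<close> in the quotient, a descending sequence of
  subcategories of \<open>X\<close>.\<close>

primrec level :: "nat \<Rightarrow> 'o set" where
  "level 0 = X"
| "level (Suc k) = cosyzygies (level k)"

lemma level_admissible: "admissible (level k)"
  by (induction k) (simp_all add: X_admissible cosyzygies_admissible)

lemma level_extension_closed: "extension_closed (level k)"
  by (induction k) (simp_all add: X_extension cosyzygies_extension_closed level_admissible)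

lemma level_decreasing: "level (Suc k) \<subseteq> level k"
proof (induction k)
  case 0 show ?case using cosyzygy_X by (auto simp: cosyzygies_def)
next
  case (Suc k)
  then have "cosyzygies (level (Suc k)) \<subseteq> cosyzygies (level k)" unfolding cosyzygies_def by blast
  then show ?case by simp
qed

lemma level_X: "level k \<subseteq> X"
  by (induction k) (use level_decreasing in auto)

lemma level_Perp: "level k \<subseteq> Perp" using level_admissible[of k] unfolding admissible_def by blast
lemma level_subcategory: "subcategory C (level k)" using level_admissible[of k] unfolding admissible_def by blast
lemma I_level: "I \<subseteq> level k" using level_admissible[of k] unfolding admissible_def by blast

text \<open>Cosyzygies preserve length, rigidity and the chain property. So a longest chain can be
  moved into any level while its length stays maximal among the chains in all of
  \<open>X\<close>.\<close>

lemma shifted_maximal_chain: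
  "\<exists>Ms. set Ms \<subseteq> level k \<and> rigid_list Ms \<and> chain I Ms \<and>
    (\<forall>Ms'. set Ms' \<subseteq> X \<and> rigid_list Ms' \<and> chain I Ms' \<longrightarrow> length Ms' \<le> length Ms)"
proof (induction k)
  case 0
  show ?case using maximal_chain[of X I] X_obj I_obj by auto
next
  case (Suc k)
  then obtain Ms where Ms: "set Ms \<subseteq> level k" "rigid_list Ms" "chain I Ms"
    "\<forall>Ms'. set Ms' \<subseteq> X \<and> rigid_list Ms' \<and> chain I Ms' \<longrightarrow> length Ms' \<le> length Ms" by blast
  have P: "set Ms \<subseteq> Perp" using Ms(1) level_Perp by blast
  have "set (map cosyz Ms) \<subseteq> level (Suc k)"
    using Ms(1) P cosyz by (auto simp: cosyzygies_def)
  then show ?case using rigid_list_cosyz[OF P Ms(2)] chain_cosyz[OF P Ms(3)] Ms(4)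
    by (intro exI[of _ "map cosyz Ms"]) simp
qed

text \<open>A maximal rigid chain stays maximal after shifting, because rigid chains have bounded
  length. Hence every rigid object of \<open>X\<close> is resolved by arbitrarily high shifts of \<open>X\<close>.\<close>

lemma rigid_level:
  assumes P: "P \<in> X" "orth P P" shows "P \<in> level k"
proof -
  \<comment> \<open>One level higher than the goal: the cone \<open>L\<close> below will lie in
    \<open>level (Suc k)\<close>, and its syzygy \<open>L0\<close> is needed in
    \<open>level k\<close>.\<close>
  obtain Ms where Ms: "set Ms \<subseteq> level (Suc k)" "rigid_list Ms" "chain I Ms"
    "\<And>Ms'. \<lbrakk>set Ms' \<subseteq> X; rigid_list Ms'; chain I Ms'\<rbrakk> \<Longrightarrow> length Ms' \<le> length Ms"
    using shifted_maximal_chain[of "Suc k"] by blast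
  have MsX: "set Ms \<subseteq> X" using Ms(1) level_X by blast
  have MsP: "set Ms \<subseteq> Perp" using MsX X_Perp by blast
  obtain S where S: "finite S" "S \<subseteq> Obj C" "I = add_hull S"
    using rigid_finitely_generated[OF I_subcategory I_rigid] by blast
  have SI: "S \<subseteq> I" unfolding S(3) by (rule hull_incl[OF S(2)])
  define S' where "S' = set Ms \<union> S"
  have S': "finite S'" "S' \<subseteq> Obj C" using S(1,2) MsX X_obj unfolding S'_def by auto
  \<comment> \<open>\<open>G\<close> has finitely many generators besides the injectives, as the
    approximation lemma requires; it contains \<open>I\<close> and lies in the hull of
    \<open>Ms\<close> and \<open>I\<close>.\<close>
  define G where "G = add_hull (S' \<union> Inj)"
  have gen: "S' \<union> Inj \<subseteq> Obj C" using S'(2) Inj_obj by blast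
  have IG: "I \<subseteq> G" unfolding G_def by (subst S(3), rule hull_mono[OF _ gen]) (auto simp: S'_def)
  have MsG: "set Ms \<subseteq> G" using hull_incl[OF gen] unfolding G_def S'_def by blast
  have MIO: "set Ms \<union> I \<subseteq> Obj C" using MsX X_obj I_obj by blast
  have "S' \<union> Inj \<subseteq> add_hull (set Ms \<union> I)" using hull_incl[OF MIO] SI injective_I unfolding S'_def by blast
  then have G_sub: "G \<subseteq> add_hull (set Ms \<union> I)" unfolding G_def by (rule hull_least[OF hull_subcategory])
  have hull_level: "add_hull (set Ms \<union> I) \<subseteq> level (Suc k)"
    by (rule hull_least[OF level_subcategory]) (use Ms(1) I_level in blast)
  have GX: "G \<subseteq> X" using G_sub hull_level level_X by blast
  have o1: "orth M N" if "M \<in> set Ms \<union> I" "N \<in> set Ms \<union> I" for M N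
    using that Ms(2) Perp_orth MsP I_rigid unfolding rigid_list_def by blast
  have "add_hull (set Ms \<union> I) \<subseteq> {M \<in> Obj C. \<forall>W\<in>set Ms \<union> I. orth M W}"
    by (rule hull_least[OF orth_left_subcategory[OF MIO]]) (use o1 MIO in blast)
  then have o2: "orth M N" if "M \<in> G" "N \<in> set Ms \<union> I" for M N using that G_sub by blast
  have GO: "G \<subseteq> Obj C" using GX X_obj by blast
  have "add_hull (set Ms \<union> I) \<subseteq> {M \<in> Obj C. \<forall>W\<in>G. orth W M}"
    by (rule hull_least[OF orth_right_subcategory[OF GO]]) (use o2 MIO in blast)
  then have oG: "orth M N" if "M \<in> G" "N \<in> G" for M N using that G_sub by blast
  obtain Q L x y \<delta> where Q: "Q \<in> G" "etriangle C (P, Q, L, x, y, \<delta>)" "\<forall>W\<in>G. factors_left x W"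
    using inflation_approximation_exists[OF S' X_obj[OF P(1)]] unfolding G_def by blast
  have c: "conflation P Q L" by (rule conflationI[OF Q(2)])
  have LO: "L \<in> Obj C" by (rule conflation_obj(3)[OF c])
  have LG: "orth L W" if "W \<in> G" for W
    by (rule cone_of_approximation[OF Q(2), of G]) (use Q(3) oG[OF Q(1)] GO that in blast)+
  have GL: "orth W L" if "W \<in> G" for W using orth_sym[OF LG[OF that] LO] GO that by blast
  have LL: "orth L L" by (rule orth_cones[OF c c P(2) GL[OF Q(1)] LG[OF Q(1)]])
  have LP: "L \<in> Perp" unfolding Perp_def using LG IG LO by blast
  obtain P' where P': "syz P P'" using cosyzygy_exists P(1) X_Perp by blast
  obtain N where N: "N \<in> I" "conflation P N P'" using P' by (rule syzE)
  \<comment> \<open>The pushout splits into \<open>N\<close> and \<open>L\<close> and is also an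
    extension of \<open>P'\<close> by \<open>Q\<close>, both in \<open>X\<close>. This shows that
    \<open>L\<close> lies in \<open>X\<close>, so maximality of \<open>Ms\<close> can be applied to
    it.\<close>
  obtain E where E: "conflation Q E P'" "is_direct_sum C [N, L] E"
    using pushout_conflation[OF c N(2)] Perp_orth(1)[OF LP N(1)] by blast
  have "E \<in> X" using X_extension E(1) GX Q(1) cosyzygy_X[OF P(1) P'] unfolding extension_closed_def by blast
  then have LX: "L \<in> X" by (rule subcategory_summand(2)[OF X_subcategory _ E(2)])
  have "L \<in> add_hull (set Ms \<union> I)"
  proof (rule ccontr)
    assume n: "L \<notin> add_hull (set Ms \<union> I)"
    have "chain I (Ms @ [L])" using Ms(3) n by (simp add: chain_snoc)
    moreover have "set (Ms @ [L]) \<subseteq> X" using MsX LX by simp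
    moreover have "rigid_list (Ms @ [L])"
      unfolding rigid_list_def
    proof (intro conjI ballI)
      show "set (Ms @ [L]) \<subseteq> Obj C" using MsX X_obj LO by auto
      fix M N assume "M \<in> set (Ms @ [L])" "N \<in> set (Ms @ [L])"
      then have "M \<in> set Ms \<or> M = L" "N \<in> set Ms \<or> N = L" by auto
      then show "orth M N" using o1 LG GL LL MsG by blast
    qed
    ultimately have "length (Ms @ [L]) \<le> length Ms" using Ms(4) by blast
    then show False by simp
  qed
  then have "L \<in> cosyzygies (level k)" using hull_level by auto
  then obtain L0 where L0: "L0 \<in> level k" "syz L0 L" unfolding cosyzygies_def by blast
  obtain N' where N': "N' \<in> I" "conflation L0 N' L" using L0(2) by (rule syzE)
  have PP: "P \<in> Perp" using P(1) X_Perp by blast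
  \<comment> \<open>The pullback splits into \<open>P\<close> and \<open>N'\<close> and is also an
    extension of \<open>Q\<close> by \<open>L0\<close>, both in \<open>level k\<close>. So
    \<open>P\<close> is a summand of an object of \<open>level k\<close>.\<close>
  obtain F where F: "conflation L0 F Q" "is_direct_sum C [P, N'] F"
    using pullback_conflation[OF c N'(2)] Perp_orth(2)[OF PP N'(1)] by blast
  have "Q \<in> level k" using Q(1) G_sub hull_level level_decreasing by blast
  then have "F \<in> level k" using level_extension_closed[of k] F(1) L0(1) unfolding extension_closed_def by blast
  then show ?thesis by (rule subcategory_summand(1)[OF level_subcategory _ F(2)])
qed

text \<open>A two-term resolution of \<open>A\<close> by cluster tilting objects, truncated by the cotorsion pair.\<close>

lemma rigid_resolution:
  assumes A: "A \<in> X"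
  shows "\<exists>Y1 X1 Y0 X0 F E. X1 \<in> X \<and> orth X1 X1 \<and> X0 \<in> X \<and> orth X0 X0 \<and> Y1 \<in> Y \<and> Y0 \<in> Y \<and>
    is_direct_sum C [Y1, A] F \<and> is_direct_sum C [Y0, X1] E \<and> conflation F E X0"
proof -
  obtain T0 T1 where T: "T0 \<in> \<T>" "T1 \<in> \<T>" "conflation T1 T0 A" using T_resolution[OF X_obj[OF A]] by blast
  obtain Y1 X1 where 1: "Y1 \<in> Y" "X1 \<in> X" "conflation T1 Y1 X1" using left_truncation[OF T_obj[OF T(2)]] by blast
  obtain Y0 X0 where 0: "Y0 \<in> Y" "X0 \<in> X" "conflation T0 Y0 X0" using left_truncation[OF T_obj[OF T(1)]] by blast
  have TT: "orth M N" if "M \<in> \<T>" "N \<in> \<T>" for M N using T_iff(1)[OF T_obj] that by blast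
  \<comment> \<open>Rigidity passes from the cluster tilting objects \<open>T1\<close> and
    \<open>T0\<close> to the cones of their truncations, because \<open>X\<close> and
    \<open>Y\<close> are orthogonal on both sides.\<close>
  have r: "orth X1 X1" "orth X0 X0"
    by (rule orth_cones[OF 1(3) 1(3) TT[OF T(2) T(2)] YX[OF 1(2,1)] XY[OF 1(2,1)]],
        rule orth_cones[OF 0(3) 0(3) TT[OF T(1) T(1)] YX[OF 0(2,1)] XY[OF 0(2,1)]])
  obtain F where F: "conflation T0 F X1" "is_direct_sum C [Y1, A] F"
    using pushout_conflation[OF T(3) 1(3)] XY[OF A 1(1)] by blast
  obtain E where E: "conflation F E X0" "is_direct_sum C [Y0, X1] E"
    using pushout_conflation[OF F(1) 0(3)] XY[OF 1(2) 0(1)] by blast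
  show ?thesis using r 0(1,2) 1(1,2) F(2) E by blast
qed

text \<open>If all rigid objects of \<open>X\<close> were in \<open>I\<close>, the resolution of
  \<open>A\<close> would split: \<open>F\<close> would be a summand of \<open>E\<close>, and
  \<open>E\<close> would lie in \<open>Y\<close>. Then \<open>A\<close> would lie in both
  \<open>X\<close> and \<open>Y\<close>, that is, in \<open>I\<close>.\<close>

lemma rigid_outside_I:
  assumes "A \<in> X" "A \<notin> I" shows "\<exists>P\<in>X. P \<notin> I \<and> orth P P"
proof (rule ccontr)
  assume n: "\<not> ?thesis"
  obtain Y1 X1 Y0 X0 F E where r: "X1 \<in> X" "orth X1 X1" "X0 \<in> X" "orth X0 X0" "Y1 \<in> Y" "Y0 \<in> Y"
    "is_direct_sum C [Y1, A] F" "is_direct_sum C [Y0, X1] E" "conflation F E X0" using rigid_resolution[OF assms(1)] by blast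
  have I: "X1 \<in> I" "X0 \<in> I" using n r(1-4) by blast+
  have "F \<in> Perp" by (rule subcategory_sum2[OF Perp_subcategory _ _ r(7)]) (use r(5) assms(1) X_Perp Y_Perp in blast)+
  then have "is_direct_sum C [F, X0] E" using orth_split[OF r(9)] Perp_orth(2) I(2) by blast
  moreover have "E \<in> Y" by (rule subcategory_sum2[OF Y_subcategory r(6) _ r(8)]) (use I(1) I_Y in blast)
  ultimately have "F \<in> Y" using subcategory_summand(1)[OF Y_subcategory] by blast
  then have "A \<in> Y" by (rule subcategory_summand(2)[OF Y_subcategory _ r(7)])
  then show False using assms core by blast
qed

text \<open>Maps from \<open>Y\<close> into a cosyzygy of an object of \<open>X\<close> factor through \<open>I\<close>, and rigid objects of
  \<open>X\<close> are iterated cosyzygies; \<open>rigid_resolution\<close> reduces arbitrary objects of \<open>X\<close> to rigid ones.\<close>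

lemma no_maps_Y_X:
  assumes W: "W \<in> Y" and A: "A \<in> X" shows "no_maps W A"
  unfolding no_maps_def
proof (intro allI impI, elim conjE)
  fix f assume f: "arrow f" "Dom C f = W" "Cod C f = A"
  have WP: "W \<in> Perp" using W Y_Perp by blast
  obtain Y1 X1 Y0 X0 F E where r: "X1 \<in> X" "orth X1 X1" "X0 \<in> X" "orth X0 X0" "Y1 \<in> Y" "Y0 \<in> Y"
    "is_direct_sum C [Y1, A] F" "is_direct_sum C [Y0, X1] E" "conflation F E X0" using rigid_resolution[OF A] by blast
  have level1: "no_maps W B" if B: "B \<in> level 1" for B
  proof -
    obtain B0 where B0: "B0 \<in> X" "syz B0 B" using B by (auto simp: cosyzygies_def)
    show ?thesis using orth_iff_no_maps[OF B0(2) WP] YX[OF B0(1) W] by blast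
  qed
  have n1: "no_maps W X1" by (rule level1[OF rigid_level[OF r(1,2)]])
  \<comment> \<open>Two levels are needed for \<open>X0\<close>: its syzygy \<open>C0\<close> must
    itself be a cosyzygy of an object of \<open>X\<close> for \<open>level1\<close> to apply to
    it.\<close>
  have "X0 \<in> level (Suc 1)" by (rule rigid_level[OF r(3,4)])
  then obtain C0 where C0: "C0 \<in> level 1" "syz C0 X0" unfolding level.simps cosyzygies_def by auto
  have n0: "no_maps W C0" by (rule level1[OF C0(1)])
  have C0P: "C0 \<in> Perp" using C0(1) level_Perp by blast
  obtain N where N: "N \<in> I" "conflation C0 N X0" using C0(2) by (rule syzE)
  have FP: "F \<in> Perp" by (rule subcategory_sum2[OF Perp_subcategory _ _ r(7)]) (use r(5) A X_Perp Y_Perp in blast)+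
  \<comment> \<open>The pullback rewrites \<open>F\<close>, enlarged by \<open>N\<close>, as an
    extension of \<open>E\<close> by \<open>C0\<close>. So \<open>A\<close> is a retract of
    \<open>G\<close>, whose two ends are accessible to maps from \<open>W\<close>.\<close>
  obtain G where G: "conflation C0 G E" "is_direct_sum C [F, N] G"
    using pullback_conflation[OF r(9) N(2)] Perp_orth(2)[OF FP N(1)] by blast
  obtain a e \<eta> where t: "etriangle C (C0, G, E, a, e, \<eta>)" using G(1) unfolding conflation_def by blast
  note tt = etriangleD[OF t]
  have "retract A G" by (rule retract_trans[OF direct_sum_retract(2)[OF r(7)] direct_sum_retract(1)[OF G(2)]])
  then obtain j s where j: "arrow j" "Dom C j = A" "Cod C j = G" "arrow s" "Dom C s = G" "Cod C s = A" "s \<bullet> j = Ident C A"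
    by (rule retractE)
  obtain i0 j1 p0 q1 where b: "biprod Y0 X1 E i0 j1 p0 q1" using r(8) by (auto simp: is_direct_sum_two)
  note bb = b[unfolded biprod_def]
  \<comment> \<open>The image of \<open>f\<close> in \<open>E\<close>, the sum of \<open>Y0\<close>
    and \<open>X1\<close>. Its component in \<open>X1\<close> is covered by \<open>n1\<close>; its
    component in \<open>Y0\<close> passes through a map from \<open>A\<close> in \<open>X\<close> to
    \<open>Y0\<close> in \<open>Y\<close>.\<close>
  define h where "h = e \<bullet> (j \<bullet> f)"
  have h: "arrow h" "Dom C h = W" "Cod C h = E" using f j tt by (simp_all add: h_def)
  have "thru (q1 \<bullet> h)" by (rule no_mapsD[OF n1]) (use h bb in simp_all)
  then have th1: "thru (j1 \<bullet> (q1 \<bullet> h))" by (rule thru_comp_left) (use h bb in simp_all)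
  have "thru (p0 \<bullet> (e \<bullet> j))" by (rule no_mapsD[OF no_maps_X_Y[OF A r(6)]]) (use j tt bb in simp_all)
  then have "thru ((p0 \<bullet> (e \<bullet> j)) \<bullet> f)" by (rule thru_comp_right) (use f j tt bb in simp_all)
  then have "thru (p0 \<bullet> h)" using f j tt bb by (simp add: h_def)
  then have th0: "thru (i0 \<bullet> (p0 \<bullet> h))" by (rule thru_comp_left) (use h bb in simp_all)
  have "h = (i0 \<bullet> p0 \<boxplus> j1 \<bullet> q1) \<bullet> h" using bb h by simp
  also have "\<dots> = i0 \<bullet> (p0 \<bullet> h) \<boxplus> j1 \<bullet> (q1 \<bullet> h)" using comp_plus_left[of "i0 \<bullet> p0" "j1 \<bullet> q1" h] bb h by simp
  finally have hh: "i0 \<bullet> (p0 \<bullet> h) \<boxplus> j1 \<bullet> (q1 \<bullet> h) = h" by (rule sym)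
  have "thru (i0 \<bullet> (p0 \<bullet> h) \<boxplus> j1 \<bullet> (q1 \<bullet> h))" by (rule thru_plus[OF th0 th1]) (use bb h in simp_all)
  then have "thru h" unfolding hh .
  then obtain u v where u: "arrow u" "arrow v" "Dom C u = Dom C h" "Cod C u = Dom C v" "Cod C v = Cod C h" "Dom C v \<in> I" "h = v \<bullet> u"
    by (rule thruE)
  have "factors_right e (Dom C v)" by (rule factors_right_from_orth[OF t Perp_orth(2)[OF C0P u(6)]])
  moreover have "Cod C v = Cod C e" using u(5) h(3) tt(10) by simp
  ultimately obtain v' where v': "arrow v'" "Dom C v' = Dom C v" "Cod C v' = Dom C e" "e \<bullet> v' = v"
    using u(2) unfolding factors_right_def by blast
  have ty: "arrow (v' \<bullet> u)" "Dom C (v' \<bullet> u) = W" "Cod C (v' \<bullet> u) = G" using u(1,3,4) v'(1-3) h(2) tt(9) by simp_all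
  have tyj: "arrow (j \<bullet> f)" "Dom C (j \<bullet> f) = W" "Cod C (j \<bullet> f) = G" using f j by simp_all
  have "e \<bullet> (v' \<bullet> u) = (e \<bullet> v') \<bullet> u" by (rule comp_assoc'[symmetric]) (use u(1,4) v'(1-3) tt in simp_all)
  also have "\<dots> = e \<bullet> (j \<bullet> f)" unfolding v'(4) u(7)[symmetric] h_def ..
  finally have ee: "e \<bullet> (v' \<bullet> u) = e \<bullet> (j \<bullet> f)" .
  \<comment> \<open>\<open>v' \<bullet> u\<close> goes through \<open>I\<close> and agrees with
    \<open>j \<bullet> f\<close> after \<open>e\<close>. Their difference \<open>k\<close> therefore
    comes from a map \<open>W -> C0\<close>, and \<open>n0\<close> applies.\<close>
  define k where "k = j \<bullet> f \<boxplus> neg (v' \<bullet> u)"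
  have k: "arrow k" "Dom C k = W" "Cod C k = G" unfolding k_def using ty tyj by simp_all
  have "e \<bullet> k = e \<bullet> (j \<bullet> f) \<boxplus> e \<bullet> neg (v' \<bullet> u)" unfolding k_def by (rule comp_plus_right) (use ty tyj tt in simp_all)
  also have "e \<bullet> neg (v' \<bullet> u) = neg (e \<bullet> (v' \<bullet> u))" by (rule comp_neg(1)) (use ty tt in simp_all)
  also have "\<dots> = neg (e \<bullet> (j \<bullet> f))" unfolding ee ..
  also have "e \<bullet> (j \<bullet> f) \<boxplus> neg (e \<bullet> (j \<bullet> f)) = null W E" using plus_neg(1)[of "e \<bullet> (j \<bullet> f)"] tyj tt by simp
  finally have "e \<bullet> k = null (Dom C k) E" using k(2) by simp
  then obtain g where g: "arrow g" "Dom C g = Dom C k" "Cod C g = C0" "a \<bullet> g = k" using kernel_factor[OF t k(1,3)] by blast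
  have "thru g" by (rule no_mapsD[OF n0 g(1) _ g(3)]) (use g(2) k(2) in simp)
  then have "thru (a \<bullet> g)" by (rule thru_comp_left) (use g(3) tt in simp_all)
  then have "thru k" unfolding g(4) .
  moreover have "thru (v' \<bullet> u)" by (rule thruI) (use u(1,4,6) v'(1,2) in simp_all)
  ultimately have "thru (k \<boxplus> v' \<bullet> u)" by (rule thru_plus) (use k ty in simp_all)
  moreover have "k \<boxplus> v' \<bullet> u = j \<bullet> f"
    unfolding k_def using plus_assoc[of "j \<bullet> f" "neg (v' \<bullet> u)" "v' \<bullet> u"] ty tyj by simp
  ultimately have "thru (j \<bullet> f)" by simp
  then have "thru (s \<bullet> (j \<bullet> f))" by (rule thru_comp_left) (use j(4,5) tyj(3) in simp_all)
  then show "thru f" using reassoc[OF j(7), of f] j f by simp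
qed

text \<open>Vanishing of maps from \<open>Y\<close> to \<open>B\<close> modulo \<open>I\<close> says
  that Ext(Y, A) is zero for the syzygy \<open>A\<close>; the symmetry of \<open>orth\<close> brings
  this into the form needed for \<open>X_if_orth\<close>.\<close>

lemma syzygy_X:
  assumes "B \<in> X" "syz A B" shows "A \<in> X"
proof (rule X_if_orth)
  show O: "A \<in> Obj C" by (rule Perp_obj[OF syz_Perp(1)[OF assms(2)]])
  show "orth A W" if "W \<in> Y" for W
    using orth_iff_no_maps[OF assms(2)] no_maps_Y_X[OF that assms(1)] that Y_Perp orth_sym[OF _ Y_obj[OF that] O] by blast
qed

lemma cosyzygy_Y:
  assumes "A \<in> Y" "syz A B" shows "B \<in> Y"
proof (rule Y_if_orth)
  show O: "B \<in> Obj C" by (rule Perp_obj[OF syz_Perp(2)[OF assms(2)]])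
  show "orth W B" if "W \<in> X" for W
    using orth_iff_no_maps_op[OF assms(2)] no_maps_Y_X[OF assms(1) that] that X_Perp orth_sym[OF _ O X_obj[OF that]] by blast
qed

text \<open>The first map of the truncation \<open>Y' -> X' -> M\<close> factors through
  \<open>I\<close>, so the triangle splits modulo \<open>I\<close>: adding \<open>Q\<close> to
  \<open>M\<close> gives the sum of \<open>X'\<close> and the cosyzygy \<open>B\<close> of
  \<open>Y'\<close>. A local \<open>M\<close> is a retract of one of them.\<close>

lemma local_X_or_Y:
  assumes l: "local M" "M \<in> Perp" shows "M \<in> X \<or> M \<in> Y"
proof -
  obtain Y' X' where YX': "Y' \<in> Y" "X' \<in> X" "conflation Y' X' M" using right_truncation[OF Perp_obj[OF l(2)]] by blast
  obtain x y \<delta> where t: "etriangle C (Y', X', M, x, y, \<delta>)" using YX'(3) unfolding conflation_def by blast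
  obtain B where B: "syz Y' B" using cosyzygy_exists YX'(1) Y_Perp by blast
  have BY: "B \<in> Y" by (rule cosyzygy_Y[OF YX'(1) B])
  obtain Q where Q: "Q \<in> I" "conflation Y' Q B" using B by (rule syzE)
  obtain a b \<eta> where t': "etriangle C (Y', Q, B, a, b, \<eta>)" using Q(2) unfolding conflation_def by blast
  note tt = etriangleD[OF t] and tt' = etriangleD[OF t']
  obtain E d e \<zeta> d' e' \<zeta>' where E: "etriangle C (Q, E, M, d, e, \<zeta>)" "etriangle C (X', E, B, d', e', \<zeta>')"
    "push C B x \<eta> = \<zero>\<^bsub>Ext C B X'\<^esub> \<longrightarrow> \<zeta>' = \<zero>\<^bsub>Ext C B X'\<^esub>"
    using homotopy_pushout[OF t t'] by blast
  have "thru x" by (rule no_mapsD[OF no_maps_Y_X[OF YX'(1,2)] tt(5-7)])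
  then obtain u v where u: "arrow u" "arrow v" "Dom C u = Dom C x" "Cod C u = Dom C v" "Cod C v = Cod C x" "Dom C v \<in> I" "x = v \<bullet> u"
    by (rule thruE)
  have fl: "factors_left a (Dom C v)" by (rule factors_left_from_orth[OF t' Perp_orth(1)[OF syz_Perp(2)[OF B] u(6)]])
  have "Dom C u = Dom C a" using u(3) tt(6) tt'(6) by simp
  then obtain u' where u': "arrow u'" "Dom C u' = Cod C a" "Cod C u' = Dom C v" "u' \<bullet> a = u"
    using factors_leftE[OF fl u(1) _ u(4)] by blast
  have "x = v \<bullet> (u' \<bullet> a)" unfolding u'(4) by (rule u(7))
  also have "\<dots> = (v \<bullet> u') \<bullet> a" by (rule comp_assoc'[symmetric]) (use u(2) u'(1-3) tt' in simp_all)
  finally have xa: "x = (v \<bullet> u') \<bullet> a" .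
  have "push C B ((v \<bullet> u') \<bullet> a) \<eta> = \<zero>\<^bsub>Ext C B (Cod C (v \<bullet> u'))\<^esub>"
    by (rule push_factor_zero[OF t']) (use u(2) u'(1-3) tt' in simp_all)
  moreover have "Cod C (v \<bullet> u') = X'" using u(2,5) u'(1,3) tt(7) by simp
  ultimately have "push C B x \<eta> = \<zero>\<^bsub>Ext C B X'\<^esub>" unfolding xa[symmetric] by simp
  then have "is_direct_sum C [X', B] E" using E(2,3) zero_etriangle_sum by blast
  moreover have "is_direct_sum C [Q, M] E" by (rule orth_split[OF conflationI[OF E(1)] Perp_orth(1)[OF l(2) Q(1)]])
  ultimately have "retract M X' \<or> retract M B" using local_retract_sum[OF l(1)] direct_sum_retract(2) by blast
  then show ?thesis
    using subcategory_retract[OF X_subcategory YX'(2)] subcategory_retract[OF Y_subcategory BY] by blast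
qed

end

section \<open>Splittings of \<open>Perp\<close> and their extension to cotorsion pairs\<close>

context rigid_setting
begin

text \<open>Equivalent to being a cotorsion pair with core \<open>I\<close>, but formulated inside
  \<open>Perp\<close>, without truncations, and symmetric in \<open>X\<close> and \<open>Y\<close>
  up to \<open>orth_sym\<close>.\<close>

definition splitting :: "'o set \<Rightarrow> 'o set \<Rightarrow> bool" where
  "splitting X Y \<longleftrightarrow> admissible X \<and> admissible Y \<and> X \<inter> Y = I \<and> (\<forall>A\<in>X. \<forall>B\<in>Y. orth A B) \<and>
     (\<forall>M. local M \<and> M \<in> Perp \<longrightarrow> M \<in> X \<or> M \<in> Y) \<and>
     (\<forall>A B. syz A B \<longrightarrow> (A \<in> X \<longleftrightarrow> B \<in> X) \<and> (A \<in> Y \<longleftrightarrow> B \<in> Y))"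

lemma splitting_sym: assumes s: "splitting X Y" shows "splitting Y X"
proof -
  have XY: "X \<subseteq> Obj C" "Y \<subseteq> Obj C" "\<And>A B. A \<in> X \<Longrightarrow> B \<in> Y \<Longrightarrow> orth A B"
    using s Perp_obj unfolding splitting_def admissible_def by blast+
  have "\<forall>B\<in>Y. \<forall>A\<in>X. orth B A"
    by (intro ballI orth_sym[OF XY(3)]) (use XY(1,2) in blast)+
  moreover have "\<forall>M. local M \<and> M \<in> Perp \<longrightarrow> M \<in> Y \<or> M \<in> X"
    "\<forall>A B. syz A B \<longrightarrow> (A \<in> Y \<longleftrightarrow> B \<in> Y) \<and> (A \<in> X \<longleftrightarrow> B \<in> X)"
    using s unfolding splitting_def by blast+
  moreover have "admissible Y" "admissible X" "Y \<inter> X = I"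
    using s unfolding splitting_def by (simp_all add: Int_commute)
  ultimately show ?thesis unfolding splitting_def by simp
qed

lemma splitting_opp: "rigid_setting.splitting (opp C) I X Y \<longleftrightarrow> splitting Y X"
proof -
  interpret o: rigid_setting "opp C" T I by (rule rigid_setting_opp)
  have l: "o.local M \<longleftrightarrow> local M" for M unfolding local_def o.local_def by simp
  have a: "o.admissible U \<longleftrightarrow> admissible U" for U unfolding admissible_def o.admissible_def Perp_opp by simp
  show ?thesis unfolding splitting_def o.splitting_def a l Perp_opp orth_opp syz_opp by blast
qed

text \<open>Local summands are truncated one at a time: one in \<open>X\<close> by the trivial
  conflation, one in \<open>Y\<close> by its syzygy \<open>K -> N -> L\<close>, with
  \<open>K\<close> in \<open>Y\<close> and \<open>N\<close> in \<open>I\<close>.\<close>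

lemma splitting_Perp_truncation:
  assumes s: "splitting X Y" and M: "M \<in> Perp" shows "\<exists>A\<in>Y. \<exists>B\<in>X. conflation A B M"
proof -
  have X: "subcategory C X" "I \<subseteq> X" "X \<subseteq> Perp" and Y: "subcategory C Y" "I \<subseteq> Y" "Y \<subseteq> Perp"
    using s unfolding splitting_def admissible_def by blast+
  have step: "\<exists>A\<in>Y. \<exists>B\<in>X. conflation A B M" if "is_direct_sum C Ms M" "\<forall>L\<in>set Ms. local L \<and> L \<in> Perp" for Ms M
    using that
  proof (induction Ms arbitrary: M)
    case Nil
    then have Z: "is_zero_object C M" by (simp add: is_direct_sum_Nil)
    have "M \<in> Obj C" using Z unfolding is_zero_object_def by blast
    then show ?case using conflation_zero_left[OF Z] subcategory_zero[OF X(1) Z] subcategory_zero[OF Y(1) Z] by blast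
  next
    case (Cons L Ms)
    obtain M' where M': "is_direct_sum C Ms M'" "is_direct_sum C [L, M'] M"
      using Cons.prems(1) by (rule direct_sum_ConsE)
    have L: "local L" "L \<in> Perp" using Cons.prems(2) by auto
    obtain A B where AB: "A \<in> Y" "B \<in> X" "conflation A B M'" using Cons.IH[OF M'(1)] Cons.prems(2) by auto
    have "\<exists>A\<in>Y. \<exists>B\<in>X. conflation A B L"
    proof (cases "L \<in> X")
      case True
      obtain Z where Z: "is_zero_object C Z" using zero_exists by blast
      show ?thesis using conflation_zero_left[OF Z Perp_obj[OF L(2)]] True subcategory_zero[OF Y(1) Z] by blast
    next
      case False
      then have LY: "L \<in> Y" using L s unfolding splitting_def by blast
      obtain K where K: "syz K L" using syzygy_exists[OF L(2)] by blast
      obtain N where N: "N \<in> I" "conflation K N L" using K by (rule syzE)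
      have "K \<in> Y" using K LY s unfolding splitting_def by blast
      then show ?thesis using N X(2) by blast
    qed
    then obtain A' B' where AB': "A' \<in> Y" "B' \<in> X" "conflation A' B' L" by blast
    obtain SA where SA: "is_direct_sum C [A', A] SA" using two_sum_exists conflation_obj(1)[OF AB(3)] conflation_obj(1)[OF AB'(3)] by blast
    obtain SB where SB: "is_direct_sum C [B', B] SB" using two_sum_exists conflation_obj(2)[OF AB(3)] conflation_obj(2)[OF AB'(3)] by blast
    have "conflation SA SB M" by (rule conflation_sum[OF AB'(3) AB(3) SA SB M'(2)])
    then show ?case using subcategory_sum2[OF Y(1) AB'(1) AB(1) SA] subcategory_sum2[OF X(1) AB'(2) AB(2) SB] by blast
  qed
  obtain Ms where Ms: "is_direct_sum C Ms M" "\<And>L. L \<in> set Ms \<Longrightarrow> local L" using local_decomposition[OF Perp_obj[OF M]] by blast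
  have "set Ms \<subseteq> Perp" by (rule subcategory_summands[OF Perp_subcategory M Ms(1)])
  then show ?thesis using step[OF Ms(1)] Ms(2) by blast
qed

text \<open>A local retract \<open>L\<close> of \<open>Z\<close> outside \<open>Y\<close> would lie
  in \<open>X\<close>, and so would its cosyzygy \<open>B\<close>. Orthogonality of \<open>B\<close>
  to \<open>Z\<close> passes to \<open>L\<close>, so \<open>L -> N -> B\<close> splits and
  \<open>L\<close> lies in \<open>I\<close>, a contradiction.\<close>

lemma splitting_orth_Y:
  assumes s: "splitting X Y" and Z: "Z \<in> Perp" "\<And>A. A \<in> X \<Longrightarrow> orth A Z" shows "Z \<in> Y"
proof (rule subcategory_if_locals)
  have X: "subcategory C X" "I \<subseteq> X" "X \<subseteq> Perp" and Y: "subcategory C Y" "I \<subseteq> Y" "Y \<subseteq> Perp"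
    using s unfolding splitting_def admissible_def by blast+
  show "subcategory C Y" by (rule Y(1))
  show "Z \<in> Obj C" by (rule Perp_obj[OF Z(1)])
  fix L assume L: "local L" "retract L Z"
  have LP: "L \<in> Perp" by (rule subcategory_retract[OF Perp_subcategory Z(1) L(2)])
  show "L \<in> Y"
  proof (rule ccontr)
    assume n: "L \<notin> Y"
    then have LX: "L \<in> X" using L(1) LP s unfolding splitting_def by blast
    obtain B where B: "syz L B" using cosyzygy_exists[OF LP] by blast
    have BX: "B \<in> X" using B LX s unfolding splitting_def by blast
    have "orth Z B" using orth_sym[OF Z(2)[OF BX]] Perp_obj syz_Perp(2)[OF B] Z(1) by blast
    then have "orth L B" using orth_retract_left[OF L(2)] Perp_obj syz_Perp(2)[OF B] by blast
    then have o: "orth B L" using orth_sym Perp_obj LP syz_Perp(2)[OF B] by blast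
    obtain N where N: "N \<in> I" "conflation L N B" using B by (rule syzE)
    have "L \<in> I" by (rule subcategory_summand(1)[OF I_subcategory N(1) orth_split[OF N(2) o]])
    then show False using n Y(2) by blast
  qed
qed

lemma splitting_right_truncation:
  assumes s: "splitting X Y" and M: "M \<in> Obj C" shows "\<exists>A\<in>Y. \<exists>B\<in>X. conflation A B M"
proof -
  have X: "subcategory C X" "I \<subseteq> X" "X \<subseteq> Perp" and Y: "subcategory C Y" "I \<subseteq> Y" "Y \<subseteq> Perp"
    and XY: "\<And>A B. A \<in> X \<Longrightarrow> B \<in> Y \<Longrightarrow> orth A B"
    using s unfolding splitting_def admissible_def by blast+
  obtain K N where K: "N \<in> I" "K \<in> Perp" "conflation K N M" using I_deflation[OF M] by blast
  obtain N' K' where K': "N' \<in> I" "K' \<in> Perp" "conflation K N' K'" using I_inflation[OF Perp_obj[OF K(2)]] by blast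
  \<comment> \<open>\<open>M\<close> is replaced by an object \<open>E\<close> of
    \<open>Perp\<close> at the cost of a kernel \<open>N'\<close> in \<open>I\<close>. Truncating
    \<open>E\<close> and composing the two deflations changes the kernel only by an extension by
    \<open>N'\<close>.\<close>
  obtain E where E: "conflation N' E M" "conflation N E K'" using pushout_conflation[OF K(3) K'(3)] by blast
  have EP: "E \<in> Perp" by (rule Perp_extension[OF E(2) _ K'(2)]) (use K(1) I_Perp in blast)
  obtain A B where AB: "A \<in> Y" "B \<in> X" "conflation A B E" using splitting_Perp_truncation[OF s EP] by blast
  obtain F where F: "conflation F B M" "conflation A F N'" using compose_deflations[OF E(1) AB(3)] by blast
  have "F \<in> Y"
  proof (rule splitting_orth_Y[OF s])
    show "F \<in> Perp" by (rule Perp_extension[OF F(2)]) (use AB(1) Y(3) K'(1) I_Perp in blast)+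
    show "orth W F" if "W \<in> X" for W
      by (rule orth_middle_right[OF F(2) _ XY[OF that AB(1)]]) (use that X(3) Perp_obj Perp_orth(1) K'(1) in blast)+
  qed
  then show ?thesis using F(1) AB(2) by blast
qed

lemma splitting_left_truncation:
  assumes s: "splitting X Y" and M: "M \<in> Obj C" shows "\<exists>A\<in>Y. \<exists>B\<in>X. conflation M A B"
proof -
  interpret o: rigid_setting "opp C" T I by (rule rigid_setting_opp)
  have "o.splitting Y X" unfolding splitting_opp by (rule s)
  from o.splitting_right_truncation[OF this, of M] M show ?thesis unfolding conflation_opp opp_simps by blast
qed

lemma splitting_cotorsion_core:
  assumes s: "splitting X Y" shows "cotorsion_core C T I X Y"
proof (intro cotorsion_core.intro cotorsion_core_axioms.intro)
  show "rigid_setting C T I" by unfold_locales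
  show "subcategory C X" "subcategory C Y" "X \<inter> Y = I" using s unfolding splitting_def admissible_def by blast+
  show "orth A B" if "A \<in> X" "B \<in> Y" for A B using s that unfolding splitting_def by blast
qed (rule splitting_right_truncation[OF s] splitting_left_truncation[OF s]; assumption)+

lemma cotorsion_core_splitting:
  assumes "cotorsion_core C T I X Y" shows "splitting X Y"
proof -
  interpret c: cotorsion_core C T I X Y by (rule assms)
  interpret co: cotorsion_core "opp C" T I Y X by (rule c.cotorsion_core_opp)
  have "admissible Y" unfolding admissible_def using c.Y_subcategory c.I_Y c.Y_Perp by blast
  then show ?thesis unfolding splitting_def
    using c.X_admissible c.core c.XY c.local_X_or_Y c.cosyzygy_X c.syzygy_X c.cosyzygy_Y c.syzygy_Y by blast
qed

end


section \<open>The quotient category\<close>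

context rigid_setting
begin

abbreviation "Q \<equiv> perp_quot_tri C I"
abbreviation "cls \<equiv> quot_mor C I"

lemma left_perp_Perp: "left_perp C I = Perp"
  unfolding left_perp_def Perp_def ext_vanish_orth by auto

lemma Q_simps:
  "Obj Q = Perp" "Hom Q = quot_hom C I" "Ident Q A = cls (Ident C A)"
  "Dom Q F = Dom C (SOME f. f \<in> F)" "Cod Q F = Cod C (SOME f. f \<in> F)"
  "G \<bullet>\<^bsub>Q\<^esub> F = (\<Union>g\<in>G. \<Union>f\<in>F. cls (g \<bullet> f))" "Shift Q = shift_obj C I" "Triangles Q = quot_triangles C I"
  by (simp_all add: perp_quot_tri_def cat.defs tri_cat.defs quot_cat_def left_perp_Perp)

lemma is_iso_Q: "is_iso (perp_quot C I) A B \<alpha> \<longleftrightarrow> is_iso Q A B \<alpha>"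
  by (simp add: is_iso_def perp_quot_tri_def cat.defs tri_cat.defs quot_cat_def)

lemma thru_ident: "M \<in> Obj C \<Longrightarrow> thru (Ident C M) \<longleftrightarrow> M \<in> I"
proof
  assume M: "M \<in> Obj C" and t: "thru (Ident C M)"
  have "no_maps M M" unfolding no_maps_def
  proof (intro allI impI, elim conjE)
    fix f assume f: "arrow f" "Dom C f = M" "Cod C f = M"
    have "thru (f \<bullet> Ident C M)" by (rule thru_comp_left[OF t f(1)]) (use f M in simp)
    then show "thru f" using f by simp
  qed
  then show "M \<in> I" by (rule no_self_maps_I[OF _ M])
next
  assume M: "M \<in> Obj C" and I: "M \<in> I"
  have "thru (Ident C M \<bullet> Ident C M)" by (rule thruI) (use M I in simp_all)
  then show "thru (Ident C M)" using M by simp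
qed

lemma thru_null: assumes "A \<in> Obj C" "B \<in> Obj C" shows "thru (null A B)"
proof -
  obtain Z where Z: "is_zero_object C Z" using zero_exists by blast
  have ZI: "Z \<in> I" by (rule subcategory_zero[OF I_subcategory Z])
  note ZO = I_obj[OF ZI]
  have "thru (null Z B \<bullet> null A Z)" by (rule thruI) (use assms ZO ZI in simp_all)
  then show ?thesis using assms ZO by simp
qed

lemma thru_neg: assumes "thru f" shows "thru (neg f)"
proof -
  note f = thru_arrow[OF assms]
  have "thru (f \<bullet> neg (Ident C (Dom C f)))" by (rule thru_comp_right[OF assms]) (use f in simp_all)
  then show ?thesis using f by simp
qed

lemma factoring_thru:
  assumes "A \<in> Obj C" "B \<in> Obj C" shows "factoring C I A B = {f. thru f \<and> Dom C f = A \<and> Cod C f = B}"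
proof (intro equalityI subsetI)
  fix f assume "f \<in> factoring C I A B"
  then obtain N u v where f: "N \<in> I" "u \<in> mor C A N" "v \<in> mor C N B" "f = v \<bullet> u" unfolding factoring_def by blast
  note uu = morD[OF f(2) assms(1) I_obj[OF f(1)]] and vv = morD[OF f(3) I_obj[OF f(1)] assms(2)]
  show "f \<in> {f. thru f \<and> Dom C f = A \<and> Cod C f = B}" unfolding f(4) using thruI[of u v] uu vv f(1) by simp
next
  fix f assume "f \<in> {f. thru f \<and> Dom C f = A \<and> Cod C f = B}"
  then have th: "thru f" and d: "Dom C f = A" "Cod C f = B" by blast+
  obtain u v where u: "arrow u" "arrow v" "Dom C u = Dom C f" "Cod C u = Dom C v" "Cod C v = Cod C f" "Dom C v \<in> I" "f = v \<bullet> u"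
    using th by (rule thruE)
  have "u \<in> mor C A (Dom C v)" by (rule arrow_mor) (use u d in simp_all)
  moreover have "v \<in> mor C (Dom C v) B" by (rule arrow_mor) (use u d in simp_all)
  moreover have "f \<in> mor C A B" by (rule arrow_mor[OF thru_arrow[OF th] d])
  ultimately show "f \<in> factoring C I A B" unfolding factoring_def using u(6,7) by blast
qed

lemma factoring_subgroup:
  assumes O: "A \<in> Obj C" "B \<in> Obj C" shows "abelian_subgroup (factoring C I A B) (Hom C A B)"
proof (rule abelian_subgroupI3)
  show g: "abelian_group (Hom C A B)" by (rule hom_group[OF O])
  interpret abelian_group "Hom C A B" by (rule g)
  note F = factoring_thru[OF O]
  have "subgroup (factoring C I A B) (add_monoid (Hom C A B))"
  proof (rule subgroup.intro)
    show "factoring C I A B \<subseteq> carrier (add_monoid (Hom C A B))" unfolding factoring_def by auto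
    show "\<one>\<^bsub>add_monoid (Hom C A B)\<^esub> \<in> factoring C I A B" unfolding F using thru_null[OF O] O by simp
    fix f assume f: "f \<in> factoring C I A B"
    then have ff: "thru f" "Dom C f = A" "Cod C f = B" unfolding F by blast+
    have "inv\<^bsub>add_monoid (Hom C A B)\<^esub> f = neg f" unfolding neg_def a_inv_def ff(2,3) ..
    then show "inv\<^bsub>add_monoid (Hom C A B)\<^esub> f \<in> factoring C I A B"
      unfolding F using thru_neg[OF ff(1)] thru_arrow[OF ff(1)] ff(2,3) by simp
    fix g assume g: "g \<in> factoring C I A B"
    then have gg: "thru g" "Dom C g = A" "Cod C g = B" unfolding F by blast+
    have "f \<otimes>\<^bsub>add_monoid (Hom C A B)\<^esub> g = f \<boxplus> g" using plus_fold[OF ff(2,3)] by simp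
    moreover have "thru (f \<boxplus> g)" by (rule thru_plus[OF ff(1) gg(1)]) (use ff gg in simp_all)
    ultimately show "f \<otimes>\<^bsub>add_monoid (Hom C A B)\<^esub> g \<in> factoring C I A B"
      unfolding F using ff(2,3) gg(2,3) thru_arrow[OF ff(1)] thru_arrow[OF gg(1)] by simp
  qed
  then show "additive_subgroup (factoring C I A B) (Hom C A B)" by (rule additive_subgroupI)
qed

lemma cls_iff:
  assumes f: "arrow f"
  shows "g \<in> cls f \<longleftrightarrow> arrow g \<and> Dom C g = Dom C f \<and> Cod C g = Cod C f \<and> thru (g \<boxplus> neg f)"
proof -
  have e: "g \<in> cls f \<longleftrightarrow> (\<exists>h. thru h \<and> Dom C h = Dom C f \<and> Cod C h = Cod C f \<and> g = h \<boxplus> f)"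
    unfolding quot_mor_def a_r_coset_def' using factoring_thru[of "Dom C f" "Cod C f"] f by (auto simp: plus_fold)
  show ?thesis
  proof
    assume "g \<in> cls f"
    then obtain h where h: "thru h" "Dom C h = Dom C f" "Cod C h = Cod C f" "g = h \<boxplus> f" using e by blast
    note ha = thru_arrow[OF h(1)]
    have "(h \<boxplus> f) \<boxplus> neg f = h \<boxplus> (f \<boxplus> neg f)" by (rule plus_assoc) (use h(2,3) ha f in simp_all)
    then have "g \<boxplus> neg f = h" unfolding h(4) using h(2,3) ha f by simp
    then show "arrow g \<and> Dom C g = Dom C f \<and> Cod C g = Cod C f \<and> thru (g \<boxplus> neg f)"
      using h(1-3) ha f unfolding h(4) by simp
  next
    assume g: "arrow g \<and> Dom C g = Dom C f \<and> Cod C g = Cod C f \<and> thru (g \<boxplus> neg f)"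
    have "(g \<boxplus> neg f) \<boxplus> f = g" using plus_assoc[of g "neg f" f] g f by simp
    then show "g \<in> cls f" unfolding e using g f by (intro exI[of _ "g \<boxplus> neg f"]) simp
  qed
qed

lemma cls_self: "arrow f \<Longrightarrow> f \<in> cls f"
  unfolding cls_iff using thru_null by simp

lemma cls_eqI:
  assumes "arrow f" "arrow g" "Dom C f = Dom C g" "Cod C f = Cod C g" "thru (f \<boxplus> neg g)" shows "cls f = cls g"
proof -
  have O: "Dom C g \<in> Obj C" "Cod C g \<in> Obj C" using assms(2) by simp_all
  interpret H: abelian_subgroup "factoring C I (Dom C g) (Cod C g)" "Hom C (Dom C g) (Cod C g)" by (rule factoring_subgroup[OF O])
  have "f \<in> cls g" using cls_iff[OF assms(2)] assms by blast
  then have "f \<in> factoring C I (Dom C g) (Cod C g) +>\<^bsub>Hom C (Dom C g) (Cod C g)\<^esub> g" unfolding quot_mor_def .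
  from H.a_repr_independence[OF this _ H.a_subgroup] show ?thesis
    unfolding quot_mor_def assms(3,4) using arrow_mor[OF assms(2)] by simp
qed

lemma cls_eq_iff:
  assumes "arrow f" "arrow g"
  shows "cls f = cls g \<longleftrightarrow> Dom C f = Dom C g \<and> Cod C f = Cod C g \<and> thru (f \<boxplus> neg g)"
  using cls_eqI[OF assms] cls_iff[OF assms(2), of f] cls_self[OF assms(1)] by blast

lemma mor_Q:
  assumes "A \<in> Perp" "B \<in> Perp"
  shows "F \<in> mor Q A B \<longleftrightarrow> (\<exists>f. arrow f \<and> Dom C f = A \<and> Cod C f = B \<and> F = cls f)"
proof -
  note O = Perp_obj[OF assms(1)] Perp_obj[OF assms(2)]
  have "F \<in> mor Q A B \<longleftrightarrow> (\<exists>f\<in>mor C A B. F = factoring C I A B +>\<^bsub>Hom C A B\<^esub> f)"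
    unfolding Q_simps quot_hom_def A_RCOSETS_def' by auto
  also have "\<dots> \<longleftrightarrow> (\<exists>f. arrow f \<and> Dom C f = A \<and> Cod C f = B \<and> F = cls f)"
    unfolding Bex_def mor_iff[OF O] quot_mor_def by auto
  finally show ?thesis .
qed

lemma mor_QE:
  assumes "F \<in> mor Q A B" "A \<in> Perp" "B \<in> Perp"
  obtains f where "arrow f" "Dom C f = A" "Cod C f = B" "F = cls f"
  using assms mor_Q by blast

lemma Q_dom_cod: assumes "arrow f" shows "Dom Q (cls f) = Dom C f" "Cod Q (cls f) = Cod C f"
proof -
  have "(SOME g. g \<in> cls f) \<in> cls f" by (rule someI[of "\<lambda>g. g \<in> cls f", OF cls_self[OF assms]])
  then show "Dom Q (cls f) = Dom C f" "Cod Q (cls f) = Cod C f" unfolding Q_simps cls_iff[OF assms] by blast+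
qed

lemma plus_telescope:
  assumes "arrow f" "arrow g" "arrow h" "Dom C f = Dom C g" "Cod C f = Cod C g" "Dom C g = Dom C h" "Cod C g = Cod C h"
  shows "(f \<boxplus> neg g) \<boxplus> (g \<boxplus> neg h) = f \<boxplus> neg h"
proof -
  have "neg g \<boxplus> (g \<boxplus> neg h) = (neg g \<boxplus> g) \<boxplus> neg h" using assms by (intro plus_assoc[symmetric]) simp_all
  also have "\<dots> = neg h" using assms by simp
  finally have e: "neg g \<boxplus> (g \<boxplus> neg h) = neg h" .
  have "(f \<boxplus> neg g) \<boxplus> (g \<boxplus> neg h) = f \<boxplus> (neg g \<boxplus> (g \<boxplus> neg h))" using assms by (intro plus_assoc) simp_all
  then show ?thesis unfolding e .
qed

lemma Q_comp:
  assumes fg: "arrow f" "arrow g" "Cod C f = Dom C g" shows "cls g \<bullet>\<^bsub>Q\<^esub> cls f = cls (g \<bullet> f)"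
proof -
  have eq: "cls (g' \<bullet> f') = cls (g \<bullet> f)" if g0: "g' \<in> cls g" and f0: "f' \<in> cls f" for g' f'
  proof -
    have g': "arrow g'" "Dom C g' = Dom C g" "Cod C g' = Cod C g" "thru (g' \<boxplus> neg g)" using g0 cls_iff[OF fg(2)] by blast+
    have f': "arrow f'" "Dom C f' = Dom C f" "Cod C f' = Cod C f" "thru (f' \<boxplus> neg f)" using f0 cls_iff[OF fg(1)] by blast+
    \<comment> \<open>The difference of the two composites is a map after \<open>f' - f\<close> plus
      \<open>g' - g\<close> after a map; both terms go through \<open>I\<close>.\<close>
    have 1: "thru (g' \<bullet> (f' \<boxplus> neg f))" by (rule thru_comp_left[OF f'(4) g'(1)]) (use g'(2) f' fg in simp)
    have 2: "thru ((g' \<boxplus> neg g) \<bullet> f)" by (rule thru_comp_right[OF g'(4) fg(1)]) (use g' f' fg in simp)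
    have 3: "g' \<bullet> (f' \<boxplus> neg f) = g' \<bullet> f' \<boxplus> neg (g' \<bullet> f)" using g'(1-3) f'(1-3) fg by simp
    have 4: "(g' \<boxplus> neg g) \<bullet> f = g' \<bullet> f \<boxplus> neg (g \<bullet> f)" using g'(1-3) f'(1-3) fg by simp
    have "thru (g' \<bullet> (f' \<boxplus> neg f) \<boxplus> (g' \<boxplus> neg g) \<bullet> f)"
      by (rule thru_plus[OF 1 2]) (use g'(1-3) f'(1-3) fg in simp_all)
    then have "thru (g' \<bullet> f' \<boxplus> neg (g \<bullet> f))"
      unfolding 3 4 using plus_telescope[of "g' \<bullet> f'" "g' \<bullet> f" "g \<bullet> f"] g'(1-3) f'(1-3) fg by simp
    then show ?thesis by (intro cls_eqI) (use g'(1-3) f'(1-3) fg in simp_all)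
  qed
  show ?thesis unfolding Q_simps(6)
  proof (intro equalityI UN_least)
    show "cls (g' \<bullet> f') \<subseteq> cls (g \<bullet> f)" if "g' \<in> cls g" "f' \<in> cls f" for g' f' unfolding eq[OF that] by (rule subset_refl)
    show "cls (g \<bullet> f) \<subseteq> (\<Union>g'\<in>cls g. \<Union>f'\<in>cls f. cls (g' \<bullet> f'))"
      using cls_self[OF fg(1)] cls_self[OF fg(2)] by blast
  qed
qed

lemma Q_add:
  assumes "arrow f" "arrow g" "Dom C f = A" "Cod C f = B" "Dom C g = A" "Cod C g = B"
  shows "cls f \<oplus>\<^bsub>Hom Q A B\<^esub> cls g = cls (f \<boxplus> g)"
proof -
  have O: "A \<in> Obj C" "B \<in> Obj C" using assms by auto
  interpret H: abelian_subgroup "factoring C I A B" "Hom C A B" by (rule factoring_subgroup[OF O])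
  have d: "Dom C (f \<boxplus> g) = A" "Cod C (f \<boxplus> g) = B" using assms by simp_all
  show ?thesis unfolding quot_mor_def assms(3-6) d Q_simps quot_hom_def
    using H.a_rcos_sum[OF arrow_mor[OF assms(1,3,4)] arrow_mor[OF assms(2,5,6)]] plus_fold[OF assms(3,4)] by simp
qed

lemma Q_null: assumes "A \<in> Obj C" "B \<in> Obj C" shows "\<zero>\<^bsub>Hom Q A B\<^esub> = cls (null A B)"
proof -
  interpret H: abelian_subgroup "factoring C I A B" "Hom C A B" by (rule factoring_subgroup[OF assms])
  have "null A B \<in> factoring C I A B" using factoring_thru[OF assms] thru_null[OF assms] assms by simp
  then have "factoring C I A B +>\<^bsub>Hom C A B\<^esub> null A B = factoring C I A B"
    by (intro H.a_coset_join2) (simp_all add: H.a_subgroup)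
  then show ?thesis unfolding quot_mor_def Q_simps quot_hom_def using assms by simp
qed

text \<open>An additive monoid carries a record extension and the factor group does not; the group
  axioms see only the three base fields.\<close>

lemma comm_group_more:
  "comm_group \<lparr>carrier = S, mult = m, one = e\<rparr> \<Longrightarrow> comm_group \<lparr>carrier = S, mult = m, one = e, \<dots> = x\<rparr>"
  unfolding comm_group_def comm_monoid_def comm_monoid_axioms_def monoid_def group_def group_axioms_def Units_def
    partial_object.simps monoid.simps .

lemma Q_group: assumes P: "A \<in> Perp" "B \<in> Perp" shows "abelian_group (Hom Q A B)"
proof -
  interpret H: abelian_subgroup "factoring C I A B" "Hom C A B" by (rule factoring_subgroup[OF Perp_obj[OF P(1)] Perp_obj[OF P(2)]])
  have "comm_group (add_monoid (Hom Q A B))"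
    using H.a_factorgroup_is_comm_group comm_group_more unfolding A_FactGroup_def' Q_simps quot_hom_def by simp
  then show ?thesis unfolding abelian_group_def abelian_group_axioms_def abelian_monoid_def comm_group_def by blast
qed

lemma Q_preadditive: "preadditive_category Q"
proof (rule preadditive_category.intro)
  note O = Perp_obj
  fix A B assume "A \<in> Obj Q" "B \<in> Obj Q"
  then have P: "A \<in> Perp" "B \<in> Perp" by (simp_all add: Q_simps(1))
  show "abelian_group (Hom Q A B)" by (rule Q_group[OF P])
  fix F assume F: "F \<in> mor Q A B"
  obtain f where f: "arrow f" "Dom C f = A" "Cod C f = B" "F = cls f" using F P by (rule mor_QE)
  show "Dom Q F = A \<and> Cod Q F = B" unfolding f(4) using f(1-3) by (simp add: Q_dom_cod)
  show "F \<bullet>\<^bsub>Q\<^esub> Ident Q A = F \<and> Ident Q B \<bullet>\<^bsub>Q\<^esub> F = F"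
    unfolding f(4) Q_simps(3) using f(1-3) P O by (simp add: Q_comp)
  fix D assume "D \<in> Obj Q"
  then have D: "D \<in> Perp" by (simp add: Q_simps(1))
  show "G \<bullet>\<^bsub>Q\<^esub> F \<in> mor Q A D" if G: "G \<in> mor Q B D" for G
  proof -
    obtain g where g: "arrow g" "Dom C g = B" "Cod C g = D" "G = cls g" using G P(2) D by (rule mor_QE)
    show ?thesis unfolding mor_Q[OF P(1) D] g(4) f(4) by (intro exI[of _ "g \<bullet> f"]) (use f(1-3) g(1-3) Q_comp in simp)
  qed
  show "G \<bullet>\<^bsub>Q\<^esub> (F \<oplus>\<^bsub>Hom Q A B\<^esub> F') = G \<bullet>\<^bsub>Q\<^esub> F \<oplus>\<^bsub>Hom Q A D\<^esub> G \<bullet>\<^bsub>Q\<^esub> F'"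
    if F': "F' \<in> mor Q A B" and G: "G \<in> mor Q B D" for F' G
  proof -
    obtain f' where f': "arrow f'" "Dom C f' = A" "Cod C f' = B" "F' = cls f'" using F' P by (rule mor_QE)
    obtain g where g: "arrow g" "Dom C g = B" "Cod C g = D" "G = cls g" using G P(2) D by (rule mor_QE)
    show ?thesis unfolding f(4) f'(4) g(4) using f(1-3) f'(1-3) g(1-3) by (simp add: Q_comp Q_add)
  qed
  show "(G \<oplus>\<^bsub>Hom Q B D\<^esub> G') \<bullet>\<^bsub>Q\<^esub> F = G \<bullet>\<^bsub>Q\<^esub> F \<oplus>\<^bsub>Hom Q A D\<^esub> G' \<bullet>\<^bsub>Q\<^esub> F"
    if G: "G \<in> mor Q B D" and G': "G' \<in> mor Q B D" for G G'
  proof -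
    obtain g where g: "arrow g" "Dom C g = B" "Cod C g = D" "G = cls g" using G P(2) D by (rule mor_QE)
    obtain g' where g': "arrow g'" "Dom C g' = B" "Cod C g' = D" "G' = cls g'" using G' P(2) D by (rule mor_QE)
    show ?thesis unfolding f(4) g(4) g'(4) using f(1-3) g'(1-3) g(1-3) by (simp add: Q_comp Q_add)
  qed
  fix E G H assume "E \<in> Obj Q" and G: "G \<in> mor Q B D" and H: "H \<in> mor Q D E"
  then have E: "E \<in> Perp" by (simp add: Q_simps(1))
  obtain g where g: "arrow g" "Dom C g = B" "Cod C g = D" "G = cls g" using G P(2) D by (rule mor_QE)
  obtain h where h: "arrow h" "Dom C h = D" "Cod C h = E" "H = cls h" using H D E by (rule mor_QE)
  show "H \<bullet>\<^bsub>Q\<^esub> (G \<bullet>\<^bsub>Q\<^esub> F) = (H \<bullet>\<^bsub>Q\<^esub> G) \<bullet>\<^bsub>Q\<^esub> F"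
    unfolding f(4) g(4) h(4) using f(1-3) g(1-3) h(1-3) by (simp add: Q_comp)
next
  fix A assume "A \<in> Obj Q"
  then have P: "A \<in> Perp" by (simp add: Q_simps(1))
  show "Ident Q A \<in> mor Q A A" unfolding mor_Q[OF P P] Q_simps(3)
    by (intro exI[of _ "Ident C A"]) (use Perp_obj[OF P] in simp)
qed

interpretation q: preadditive_category Q by (rule Q_preadditive)

lemma q_arrow:
  assumes "arrow f" "Dom C f \<in> Perp" "Cod C f \<in> Perp" shows "q.arrow (cls f)"
  unfolding q.arrow_def Q_dom_cod[OF assms(1)] mor_Q[OF assms(2,3)] using assms by (auto simp: Q_simps(1))

lemma q_arrowE:
  assumes "q.arrow F" obtains f where "arrow f" "Dom C f = Dom Q F" "Cod C f = Cod Q F" "F = cls f"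
proof -
  have "F \<in> mor Q (Dom Q F) (Cod Q F)" "Dom Q F \<in> Perp" "Cod Q F \<in> Perp" using assms unfolding q.arrow_def Q_simps(1) by blast+
  then have "\<exists>f. arrow f \<and> Dom C f = Dom Q F \<and> Cod C f = Cod Q F \<and> F = cls f" using mor_Q by blast
  then show ?thesis using that by blast
qed

lemma biprod_quot:
  assumes b: "biprod A B S i j p r" and P: "A \<in> Perp" "B \<in> Perp" "S \<in> Perp"
  shows "q.biprod A B S (cls i) (cls j) (cls p) (cls r)"
proof -
  note bb = b[unfolded biprod_def]
  have pl: "q.plus (cls (i \<bullet> p)) (cls (j \<bullet> r)) = cls (i \<bullet> p \<boxplus> j \<bullet> r)"
    unfolding q.plus_def using bb by (intro Q_add) (simp_all add: Q_dom_cod)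
  show ?thesis unfolding q.biprod_def
    using bb P by (simp add: Q_dom_cod q_arrow Q_comp Q_null pl Q_simps(1,3))
qed

lemma zero_object_Q: "is_zero_object Q M \<longleftrightarrow> M \<in> I"
proof
  assume "is_zero_object Q M"
  then have M: "M \<in> Perp" "cls (Ident C M) = \<zero>\<^bsub>Hom Q M M\<^esub>" unfolding is_zero_object_def Q_simps(1,3) by blast+
  note O = Perp_obj[OF M(1)]
  have "thru (Ident C M \<boxplus> neg (null M M))"
    using M(2) cls_eq_iff[of "Ident C M" "null M M"] O unfolding Q_null[OF O O] by simp
  then show "M \<in> I" using thru_ident[OF O] O by simp
next
  assume M: "M \<in> I"
  note O = I_obj[OF M]
  have "cls (Ident C M) = cls (null M M)" by (rule cls_eqI) (use thru_ident[OF O] M O in simp_all)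
  then show "is_zero_object Q M" unfolding is_zero_object_def Q_simps(1,3) using Q_null[OF O O] M I_Perp by auto
qed

lemma mor_Q_zero:
  assumes P: "A \<in> Perp" "B \<in> Perp" shows "mor Q A B = {\<zero>\<^bsub>Hom Q A B\<^esub>} \<longleftrightarrow> no_maps A B"
proof -
  note O = Perp_obj[OF P(1)] Perp_obj[OF P(2)]
  have e: "cls f = cls (null A B) \<longleftrightarrow> thru f" if "arrow f" "Dom C f = A" "Cod C f = B" for f
    using cls_eq_iff[of f "null A B"] that O by simp
  have z: "cls (null A B) \<in> mor Q A B" unfolding mor_Q[OF P] using O by (intro exI[of _ "null A B"]) simp
  show ?thesis unfolding Q_null[OF O]
  proof
    assume m: "mor Q A B = {cls (null A B)}"
    show "no_maps A B" unfolding no_maps_def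
    proof (intro allI impI, elim conjE)
      fix f assume f: "arrow f" "Dom C f = A" "Cod C f = B"
      have "cls f \<in> mor Q A B" unfolding mor_Q[OF P] using f by blast
      then show "thru f" unfolding m using e[OF f] by blast
    qed
  next
    assume n: "no_maps A B"
    have "F = cls (null A B)" if F: "F \<in> mor Q A B" for F
    proof -
      obtain f where f: "arrow f" "Dom C f = A" "Cod C f = B" "F = cls f" using F P by (rule mor_QE)
      show ?thesis unfolding f(4) e[OF f(1-3)] by (rule no_mapsD[OF n f(1-3)])
    qed
    then show "mor Q A B = {cls (null A B)}" using z by blast
  qed
qed

lemma direct_sum_Q: "\<lbrakk>is_direct_sum C Xs S; S \<in> Perp\<rbrakk> \<Longrightarrow> is_direct_sum Q Xs S"
proof (induction Xs arbitrary: S)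
  case Nil
  then have "S \<in> I" using subcategory_zero[OF I_subcategory] by (simp add: is_direct_sum_Nil)
  then show ?case unfolding q.is_direct_sum_Nil zero_object_Q .
next
  case (Cons X Xs)
  obtain S' where S': "is_direct_sum C Xs S'" "is_direct_sum C [X, S'] S" using Cons.prems(1) by (rule direct_sum_ConsE)
  have P: "X \<in> Perp" "S' \<in> Perp" using subcategory_summand[OF Perp_subcategory Cons.prems(2) S'(2)] .
  obtain i j p r where b: "biprod X S' S i j p r" using S'(2) unfolding is_direct_sum_two by blast
  have "is_direct_sum Q [X, S'] S" unfolding q.is_direct_sum_two using biprod_quot[OF b P Cons.prems(2)] by blast
  then show ?case by (rule q.direct_sum_ConsI[OF Cons.IH[OF S'(1) P(2)]])
qed

lemma Q_additive: "additive_category Q"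
proof (intro additive_category.intro additive_category_axioms.intro Q_preadditive)
  fix Xs assume "set Xs \<subseteq> Obj Q"
  then have X: "set Xs \<subseteq> Perp" unfolding Q_simps(1) .
  then obtain S where S: "is_direct_sum C Xs S" using direct_sums[of Xs] Perp_obj by blast
  have "S \<in> Perp" by (rule subcategory_sum[OF Perp_subcategory X S])
  then show "\<exists>S. is_direct_sum Q Xs S" using direct_sum_Q[OF S] by blast
qed

interpretation q: additive_category Q by (rule Q_additive)

text \<open>A retraction modulo \<open>I\<close> satisfies
  \<open>g \<bullet> f = 1 - v \<bullet> u\<close> with \<open>v \<bullet> u\<close> through some
  object of \<open>I\<close>. Hence \<open>X\<close> is an honest retract in \<open>C\<close> of the
  sum of \<open>S\<close> and that object.\<close>

lemma retract_Q:
  assumes r: "q.retract X S" and U: "admissible U" "S \<in> U" shows "X \<in> U"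
proof -
  have UU: "subcategory C U" "I \<subseteq> U" "U \<subseteq> Perp" using U(1) unfolding admissible_def by blast+
  obtain F G where FG: "q.arrow F" "Dom Q F = X" "Cod Q F = S" "q.arrow G" "Dom Q G = S" "Cod Q G = X" "G \<bullet>\<^bsub>Q\<^esub> F = Ident Q X"
    using r by (rule q.retractE)
  obtain f where f0: "arrow f" "Dom C f = Dom Q F" "Cod C f = Cod Q F" "F = cls f" using FG(1) by (rule q_arrowE)
  obtain g where g0: "arrow g" "Dom C g = Dom Q G" "Cod C g = Cod Q G" "G = cls g" using FG(4) by (rule q_arrowE)
  have f: "arrow f" "Dom C f = X" "Cod C f = S" and g: "arrow g" "Dom C g = S" "Cod C g = X"
    using f0(1-3) g0(1-3) FG by simp_all
  have O: "X \<in> Obj C" "S \<in> Obj C" using f by auto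
  have "cls (Ident C X) = cls (g \<bullet> f)"
    using FG(7) Q_comp[OF f(1) g(1)] f(3) g(2) unfolding f0(4) g0(4) Q_simps(3) by simp
  then have "thru (Ident C X \<boxplus> neg (g \<bullet> f))" using cls_eq_iff[of "Ident C X" "g \<bullet> f"] f g O by simp
  then obtain u v where u: "arrow u" "arrow v" "Dom C u = Dom C (Ident C X \<boxplus> neg (g \<bullet> f))" "Cod C u = Dom C v"
    "Cod C v = Cod C (Ident C X \<boxplus> neg (g \<bullet> f))" "Dom C v \<in> I" "Ident C X \<boxplus> neg (g \<bullet> f) = v \<bullet> u"
    by (rule thruE)
  have d: "Dom C u = X" "Cod C v = X" using u(3,5) f g O by simp_all
  obtain E i j p r where b: "biprod S (Dom C v) E i j p r"
    using two_sum_exists[OF O(2) I_obj[OF u(6)]] unfolding is_direct_sum_two by blast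
  note bb = b[unfolded biprod_def]
  have e: "p \<bullet> i = Ident C S" "r \<bullet> j = Ident C (Dom C v)" "r \<bullet> i = null S (Dom C v)" "p \<bullet> j = null (Dom C v) S"
    using bb by auto
  have "(g \<bullet> p \<boxplus> v \<bullet> r) \<bullet> (i \<bullet> f \<boxplus> j \<bullet> u) = g \<bullet> f \<boxplus> v \<bullet> u"
    using bb u(1,2,4) d f g O by (simp add: e[THEN reassoc])
  also have "\<dots> = v \<bullet> u \<boxplus> g \<bullet> f" by (rule plus_comm) (use u(1,2,4) d f g in simp_all)
  also have "\<dots> = Ident C X"
    unfolding u(7)[symmetric] using plus_assoc[of "Ident C X" "neg (g \<bullet> f)" "g \<bullet> f"] f g O by simp
  finally have "retract X E" by (rule retractI) (use bb u(1,2,4) d f g in simp_all)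
  moreover have "E \<in> U"
    by (rule subcategory_sum2[OF UU(1) U(2)]) (use u(6) UU(2) b is_direct_sum_two in blast)+
  ultimately show ?thesis using subcategory_retract[OF UU(1)] by blast
qed

lemma iso_Q:
  assumes "is_iso Q X Y \<alpha>" "X \<in> Perp" "Y \<in> Perp" "admissible U" shows "X \<in> U \<longleftrightarrow> Y \<in> U"
proof -
  have "q.isomorphic X Y" unfolding q.isomorphic_def using assms by (auto simp: Q_simps(1))
  then show ?thesis using q.isomorphic_retract q.isomorphic_sym retract_Q assms(4) by blast
qed

text \<open>A subcategory of the quotient contains the zero objects, which are the objects of
  \<open>I\<close>. Conversely, a retract or sum formed in the quotient differs from one in
  \<open>C\<close> only by objects of \<open>I\<close>.\<close>

lemma subcategory_Q: "subcategory Q U \<longleftrightarrow> admissible U"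
proof
  assume s: "subcategory Q U"
  have UP: "U \<subseteq> Perp" using s unfolding subcategory_def Q_simps(1) by blast
  have "I \<subseteq> U" using q.subcategory_zero[OF s] zero_object_Q by blast
  moreover have "subcategory C U"
    unfolding subcategory_def
  proof (intro conjI allI impI)
    show "U \<subseteq> Obj C" using UP Perp_obj by blast
  next
    fix X Y f assume a: "X \<in> U \<and> Y \<in> Obj C \<and> is_iso C X Y f"
    have XO: "X \<in> Obj C" using a UP Perp_obj by blast
    have iso: "isomorphic X Y" unfolding isomorphic_def using a XO by blast
    have P: "X \<in> Perp" "Y \<in> Perp" using a UP subcategory_iso[OF Perp_subcategory _ iso] by blast+
    obtain g where g: "arrow f" "Dom C f = X" "Cod C f = Y" "arrow g" "Dom C g = Y" "Cod C g = X" "g \<bullet> f = Ident C X" "f \<bullet> g = Ident C Y"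
      using a is_iso_iff[OF XO, of Y f] by blast
    have "q.isomorphic X Y"
      by (rule q.isomorphicI[of "cls g" "cls f"]) (use g P in \<open>simp_all add: Q_comp Q_simps(3) Q_dom_cod q_arrow\<close>)
    then show "Y \<in> U" using q.subcategory_iso[OF s] a by blast
  next
    fix Xs S assume a: "set Xs \<subseteq> U \<and> is_direct_sum C Xs S"
    have "S \<in> Perp" using subcategory_sum[OF Perp_subcategory] a UP by blast
    then show "S \<in> U" using q.subcategory_sum[OF s] direct_sum_Q a by blast
  next
    fix X Y S assume a: "S \<in> U \<and> is_direct_sum C [X, Y] S"
    then have "is_direct_sum Q [X, Y] S" using direct_sum_Q UP by blast
    then show "X \<in> U" using q.subcategory_summand(1)[OF s] a by blast
  qed
  ultimately show "admissible U" unfolding admissible_def using UP by blast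
next
  assume U: "admissible U"
  then have UU: "subcategory C U" "I \<subseteq> U" "U \<subseteq> Perp" unfolding admissible_def by blast+
  show "subcategory Q U"
  proof (rule q.subcategoryI)
    show "U \<subseteq> Obj Q" using UU(3) unfolding Q_simps(1) .
    show "X \<in> U" if "q.retract X S" "S \<in> U" for X S by (rule retract_Q[OF that(1) U that(2)])
    show "Z \<in> U" if "is_zero_object Q Z" for Z using that UU(2) unfolding zero_object_Q by blast
    fix A B S assume a: "A \<in> U" "B \<in> U" "is_direct_sum Q [A, B] S"
    obtain S' where S': "is_direct_sum C [A, B] S'" using two_sum_exists Perp_obj UU(3) a(1,2) by blast
    have S'U: "S' \<in> U" by (rule subcategory_sum2[OF UU(1) a(1,2) S'])
    then have "is_direct_sum Q [A, B] S'" using direct_sum_Q[OF S'] UU(3) by blast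
    then have "q.isomorphic S S'" using q.direct_sum_unique[OF a(3)] by blast
    then show "S \<in> U" by (rule retract_Q[OF q.isomorphic_retract U S'U])
  qed
qed

lemma sum_Q_in_admissible:
  "\<lbrakk>admissible U; set Xs \<subseteq> U; is_direct_sum Q Xs S\<rbrakk> \<Longrightarrow> S \<in> U"
  using q.subcategory_sum subcategory_Q by blast

lemma direct_sum_Nil_Q: "is_direct_sum Q [] M \<longleftrightarrow> M \<in> I"
  unfolding q.is_direct_sum_Nil zero_object_Q ..

lemma is_direct_sum_full_sub:
  assumes "U \<subseteq> Perp"
  shows "is_direct_sum (full_sub Q U) Xs S \<longleftrightarrow> set Xs \<subseteq> U \<and> S \<in> U \<and> is_direct_sum Q Xs S"
  using assms unfolding is_direct_sum_def direct_sum_diagram_def by (auto simp: Q_simps(1))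

section \<open>Shift and triangles of the quotient\<close>

lemma shift_triangle_exists: assumes A: "A \<in> Perp" shows "\<exists>t. is_shift_triangle C I A t"
proof -
  obtain N L where N: "N \<in> I" "L \<in> Perp" "conflation A N L" using I_inflation[OF Perp_obj[OF A]] by blast
  obtain x y \<delta> where t: "etriangle C (A, N, L, x, y, \<delta>)" using N(3) unfolding conflation_def by blast
  note tt = etriangleD[OF t]
  have "left_approximation C I A N x"
    unfolding left_approximation_def
  proof (intro conjI ballI)
    show "N \<in> I" by (rule N(1))
    show "x \<in> mor C A N" by (rule arrow_mor[OF tt(5-7)])
    fix W u assume W: "W \<in> I" and u: "u \<in> mor C A W"
    note uu = morD[OF u tt(1) I_obj[OF W]]
    have "Dom C u = Dom C x" using uu(2) tt(6) by simp
    then obtain g where g: "arrow g" "Dom C g = Cod C x" "Cod C g = W" "g \<bullet> x = u"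
      using factors_leftE[OF factors_left_from_orth[OF t Perp_orth(1)[OF N(2) W]] uu(1) _ uu(3)] by blast
    have "g \<in> mor C N W" by (rule arrow_mor) (use g tt(7) in simp_all)
    then show "\<exists>v\<in>mor C N W. v \<bullet> x = u" using g(4) by blast
  qed
  moreover have "right_approximation C I N L y"
    unfolding right_approximation_def
  proof (intro conjI ballI)
    show "N \<in> I" by (rule N(1))
    show "y \<in> mor C N L" by (rule arrow_mor[OF tt(8-10)])
    fix W u assume W: "W \<in> I" and u: "u \<in> mor C W L"
    note uu = morD[OF u I_obj[OF W] tt(3)]
    have "Cod C u = Cod C y" using uu(3) tt(10) by simp
    then obtain g where g: "arrow g" "Dom C g = W" "Cod C g = Dom C y" "y \<bullet> g = u"
      using factors_right_from_orth[OF t Perp_orth(2)[OF A W]] uu(1,2) unfolding factors_right_def by blast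
    have "g \<in> mor C W N" by (rule arrow_mor) (use g tt(9) in simp_all)
    then show "\<exists>v\<in>mor C W N. y \<bullet> v = u" using g(4) by blast
  qed
  ultimately have "is_shift_triangle C I A (A, N, L, x, y, \<delta>)" using t by simp
  then show ?thesis by blast
qed

text \<open>The chosen shift triangle only speaks of approximations. That its cone lies in
  \<open>Perp\<close> follows from the left approximation and the rigidity of
  \<open>I\<close>.\<close>

lemma syz_shift: assumes A: "A \<in> Perp" shows "syz A (shift_obj C I A)"
proof -
  obtain A' N L x y \<delta> where e: "shift_triangle C I A = (A', N, L, x, y, \<delta>)" by (cases "shift_triangle C I A") blast
  have "is_shift_triangle C I A (shift_triangle C I A)"
    unfolding shift_triangle_def by (rule someI_ex[OF shift_triangle_exists[OF A]])
  then have s: "A' = A" "etriangle C (A', N, L, x, y, \<delta>)" "left_approximation C I A' N x" unfolding e is_shift_triangle.simps by blast+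
  note t = s(2)[unfolded s(1)] and a = s(3)[unfolded s(1) left_approximation_def]
  note tt = etriangleD[OF t]
  have NI: "N \<in> I" using a by blast
  have fl: "factors_left x W" if W: "W \<in> I" for W
  proof (rule factors_leftI)
    fix f assume f: "arrow f" "Dom C f = Dom C x" "Cod C f = W"
    have "f \<in> mor C A W" by (rule arrow_mor) (use f tt(6) in simp_all)
    then obtain v where v: "v \<in> mor C N W" "v \<bullet> x = f" using a W by blast
    note vv = morD[OF v(1) tt(2) I_obj[OF W]]
    show "\<exists>g. arrow g \<and> Dom C g = Cod C x \<and> Cod C g = W \<and> g \<bullet> x = f"
      using vv v(2) tt(7) by (intro exI[of _ v]) simp
  qed
  have "orth L W" if W: "W \<in> I" for W
    by (rule cone_of_approximation[OF t, of I]) (use fl I_rigid[OF NI] I_obj W in blast)+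
  then have "L \<in> Perp" unfolding Perp_def using tt(3) by blast
  then have "syz A L" unfolding syz_def using A NI conflationI[OF t] by blast
  then show ?thesis unfolding shift_obj_def e by simp
qed

text \<open>Stability under the shift in both directions, expressed by \<open>syz\<close> and
  therefore independent of the chosen shift triangles.\<close>

definition stable :: "'o set \<Rightarrow> bool" where
  "stable U \<longleftrightarrow> admissible U \<and> (\<forall>A B. syz A B \<longrightarrow> (A \<in> U \<longleftrightarrow> B \<in> U))"

lemma stable_if_triangulated: assumes t: "triangulated_subcategory Q U" shows "stable U"
proof -
  have a: "admissible U" using t unfolding triangulated_subcategory_def subcategory_Q by blast
  then have U: "subcategory C U" "I \<subseteq> U" unfolding admissible_def by blast+
  have sh: "shift_obj C I A \<in> U \<longleftrightarrow> A \<in> U" if "A \<in> Perp" for A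
    using t that unfolding triangulated_subcategory_def Q_simps by blast
  have "A \<in> U \<longleftrightarrow> B \<in> U" if s: "syz A B" for A B
  proof -
    note A = syz_Perp(1)[OF s]
    show ?thesis using cosyzygy_unique[OF U s syz_shift[OF A]] cosyzygy_unique[OF U syz_shift[OF A] s] sh[OF A] by blast
  qed
  then show ?thesis unfolding stable_def using a by blast
qed

text \<open>All three clauses reduce to closure under extensions by rotating the conflation: a
  pushout along \<open>A -> N -> A'\<close> or a pullback along \<open>D' -> N -> D\<close> makes
  the missing term a summand of an extension of known terms.\<close>

lemma stable_triangle:
  assumes W: "stable W" "extension_closed W" and t: "(X, Y, Z, u, v, w) \<in> quot_triangles C I"
  shows "(X \<in> W \<and> Y \<in> W \<longrightarrow> Z \<in> W) \<and> (Y \<in> W \<and> Z \<in> W \<longrightarrow> X \<in> W) \<and> (X \<in> W \<and> Z \<in> W \<longrightarrow> Y \<in> W)"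
proof -
  have WW: "admissible W" "subcategory C W" "I \<subseteq> W" using W(1) unfolding stable_def admissible_def by blast+
  have stb: "A \<in> W \<longleftrightarrow> B \<in> W" if "syz A B" for A B using W(1) that unfolding stable_def by blast
  have P: "X \<in> Perp" "Y \<in> Perp" "Z \<in> Perp" using t unfolding quot_triangles_def left_perp_Perp by blast+
  obtain A B D f g h \<alpha> \<beta> \<gamma> where s: "(A, B, D, f, g, h) \<in> standard_triangles C I"
    and iso: "is_iso Q X A \<alpha>" "is_iso Q Y B \<beta>" "is_iso Q Z D \<gamma>"
    using t unfolding quot_triangles_def is_iso_Q by blast
  have "\<exists>f g \<delta>. A \<in> Perp \<and> B \<in> Perp \<and> D \<in> Perp \<and> etriangle C (A, B, D, f, g, \<delta>)"
    using s unfolding standard_triangles_def left_perp_Perp by blast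
  then have c: "A \<in> Perp" "B \<in> Perp" "D \<in> Perp" "conflation A B D" unfolding conflation_def by blast+
  have e: "X \<in> W \<longleftrightarrow> A \<in> W" "Y \<in> W \<longleftrightarrow> B \<in> W" "Z \<in> W \<longleftrightarrow> D \<in> W"
    using iso_Q[OF iso(1) P(1) c(1) WW(1)] iso_Q[OF iso(2) P(2) c(2) WW(1)] iso_Q[OF iso(3) P(3) c(3) WW(1)] by blast+
  have ext: "M \<in> W" if "conflation L M N" "L \<in> W" "N \<in> W" for L M N
    using W(2) that unfolding extension_closed_def by blast
  have 1: "D \<in> W" if a: "A \<in> W" "B \<in> W"
  proof -
    obtain A' where A': "syz A A'" using cosyzygy_exists[OF c(1)] by blast
    obtain N where N: "N \<in> I" "conflation A N A'" using A' by (rule syzE)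
    obtain E where E: "conflation B E A'" "orth D N \<longrightarrow> is_direct_sum C [N, D] E"
      using pushout_conflation[OF c(4) N(2)] by blast
    have "E \<in> W" by (rule ext[OF E(1) a(2)]) (use stb[OF A'] a(1) in blast)
    then show ?thesis using subcategory_summand(2)[OF WW(2)] E(2) Perp_orth(1)[OF c(3) N(1)] by blast
  qed
  have 2: "A \<in> W" if a: "B \<in> W" "D \<in> W"
  proof -
    obtain D' where D': "syz D' D" using syzygy_exists[OF c(3)] by blast
    obtain N where N: "N \<in> I" "conflation D' N D" using D' by (rule syzE)
    obtain E where E: "conflation D' E B" "orth N A \<longrightarrow> is_direct_sum C [A, N] E"
      using pullback_conflation[OF c(4) N(2)] by blast
    have "E \<in> W" by (rule ext[OF E(1) _ a(1)]) (use stb[OF D'] a(2) in blast)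
    then show ?thesis using subcategory_summand(1)[OF WW(2)] E(2) Perp_orth(2)[OF c(1) N(1)] by blast
  qed
  show ?thesis unfolding e using 1 2 ext[OF c(4)] by blast
qed

end


section \<open>Consequences of the 2-Calabi-Yau property\<close>

context two_calabi_yau
begin

text \<open>The duality embeds Ext(B, A) into the dual of Ext(A, B). The dual of the zero space has
  a single element, the extensional zero functional.\<close>

lemma ext_symmetric:
  assumes o: "orth A B" and O: "A \<in> Obj C" "B \<in> Obj C" shows "orth B A"
proof -
  obtain \<Phi> where \<Phi>: "bij_betw (\<Phi> B A) (ext C B A) (carrier (dual_space K (Ext C A B)))"
    using duality O by blast
  let ?z = "\<zero>\<^bsub>Ext C A B\<^esub>"
  have E: "ext C A B = {?z}" using o unfolding orth_def .
  interpret E: abelian_group "Ext C A B" by (rule ext_group[OF O])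
  interpret V: vectorspace K "Ext C A B" by (rule ext_vectorspace[OF O])
  have val: "f = (\<lambda>x\<in>{?z}. \<zero>\<^bsub>K\<^esub>)" if f: "f \<in> carrier (dual_space K (Ext C A B))" for f
  proof (rule extensionalityI[of _ "{?z}"])
    have m: "f \<in> LinearCombinations.module_hom K (Ext C A B) (field_as_module K)" and e: "f \<in> extensional {?z}"
      using f unfolding dual_space_def E by auto
    show "f \<in> extensional {?z}" by (rule e)
    have c: "f ?z \<in> carrier K" using module_hom_closed[OF m] unfolding field_as_module_def by auto
    have "\<zero>\<^bsub>K\<^esub> \<odot>\<^bsub>Ext C A B\<^esub> ?z = ?z" using V.smult_closed[of "\<zero>\<^bsub>K\<^esub>" ?z] unfolding E by simp
    moreover have "f (\<zero>\<^bsub>K\<^esub> \<odot>\<^bsub>Ext C A B\<^esub> ?z) = \<zero>\<^bsub>K\<^esub> \<otimes>\<^bsub>K\<^esub> f ?z"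
      using module_hom_smult[OF m, of "\<zero>\<^bsub>K\<^esub>" ?z] unfolding field_as_module_def by simp
    ultimately have "f ?z = \<zero>\<^bsub>K\<^esub>" using c by simp
    then show "f x = (\<lambda>x\<in>{?z}. \<zero>\<^bsub>K\<^esub>) x" if "x \<in> {?z}" for x using that by simp
  qed simp
  show ?thesis
  proof (rule orthI[OF O(2,1)])
    fix \<delta> assume d: "\<delta> \<in> ext C B A"
    have z: "\<zero>\<^bsub>Ext C B A\<^esub> \<in> ext C B A" using abelian_group.a_group[OF ext_group[OF O(2,1)]] ext_zero_closed O by blast
    have "\<Phi> B A \<delta> = \<Phi> B A \<zero>\<^bsub>Ext C B A\<^esub>" using val \<Phi> d z unfolding bij_betw_def by (metis imageI)
    then show "\<delta> = \<zero>\<^bsub>Ext C B A\<^esub>" using \<Phi> d z unfolding bij_betw_def inj_on_def by blast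
  qed
qed

lemma hom_finitely_generated:
  assumes O: "A \<in> Obj C" "B \<in> Obj C"
  shows "\<exists>F. finite F \<and> F \<subseteq> mor C A B \<and> (\<forall>U. U \<subseteq> mor C A B \<and> F \<subseteq> U \<and> null A B \<in> U \<and>
    (\<forall>f\<in>U. \<forall>g\<in>U. f \<boxplus> g \<in> U) \<and> (\<forall>f\<in>U. \<forall>r\<in>carrier K. r \<odot>\<^bsub>Hom C A B\<^esub> f \<in> U) \<longrightarrow> mor C A B \<subseteq> U)"
proof -
  interpret V: vectorspace K "Hom C A B" by (rule hom_vectorspace[OF O])
  obtain F where F: "finite F" "F \<subseteq> mor C A B" "V.span F = mor C A B"
    using hom_fin_dim[OF O] unfolding V.fin_dim_def by blast
  have gen: "mor C A B \<subseteq> U" if U: "U \<subseteq> mor C A B" "F \<subseteq> U" "null A B \<in> U" "\<And>f g. f \<in> U \<Longrightarrow> g \<in> U \<Longrightarrow> f \<boxplus> g \<in> U"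
      "\<And>f r. f \<in> U \<Longrightarrow> r \<in> carrier K \<Longrightarrow> r \<odot>\<^bsub>Hom C A B\<^esub> f \<in> U" for U
  proof -
    have "LinearCombinations.submodule K U (Hom C A B)"
    proof (rule LinearCombinations.submodule.intro)
      show "Module.module K (Hom C A B)" by (rule V.module_axioms)
      show "f \<oplus>\<^bsub>Hom C A B\<^esub> g \<in> U" if fg: "f \<in> U" "g \<in> U" for f g
      proof -
        have "f \<in> mor C A B" using U(1) fg(1) by blast
        note ff = morD[OF this O]
        show ?thesis using U(4)[OF fg] unfolding plus_fold[OF ff(2,3)] .
      qed
    qed (use U in auto)
    then show ?thesis using V.span_is_subset[OF U(2)] unfolding F(3) by blast
  qed
  show ?thesis
  proof (intro exI[of _ F] conjI F(1,2) allI impI, elim conjE)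
    fix U assume U: "U \<subseteq> mor C A B" "F \<subseteq> U" "null A B \<in> U" "\<forall>f\<in>U. \<forall>g\<in>U. f \<boxplus> g \<in> U"
      "\<forall>f\<in>U. \<forall>r\<in>carrier K. r \<odot>\<^bsub>Hom C A B\<^esub> f \<in> U"
    show "mor C A B \<subseteq> U" by (rule gen[OF U(1-3)]) (simp_all only: U(4,5)[rule_format])
  qed
qed

text \<open>Scalars act through endomorphisms, namely multiples of the identity. So a set closed
  under composition with endomorphisms is closed under scalars, and a spanning set also generates
  over the endomorphisms.\<close>

lemma smult_factors:
  assumes O: "A \<in> Obj C" "B \<in> Obj C" and f: "f \<in> mor C A B" and r: "r \<in> carrier K"
  shows "\<exists>a\<in>mor C A A. r \<odot>\<^bsub>Hom C A B\<^esub> f = f \<bullet>\<^bsub>C\<^esub> a" "\<exists>b\<in>mor C B B. r \<odot>\<^bsub>Hom C A B\<^esub> f = b \<bullet>\<^bsub>C\<^esub> f"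
proof -
  interpret VA: vectorspace K "Hom C A A" by (rule hom_vectorspace[OF O(1) O(1)])
  interpret VB: vectorspace K "Hom C B B" by (rule hom_vectorspace[OF O(2) O(2)])
  have "f \<bullet>\<^bsub>C\<^esub> (r \<odot>\<^bsub>Hom C A A\<^esub> Ident C A) = r \<odot>\<^bsub>Hom C A B\<^esub> f"
    using comp_smult[OF O(1) O(1) O(2) r ident_mor[OF O(1)] f] comp_ident[OF O f] by simp
  then show "\<exists>a\<in>mor C A A. r \<odot>\<^bsub>Hom C A B\<^esub> f = f \<bullet>\<^bsub>C\<^esub> a"
    using VA.smult_closed[OF r ident_mor[OF O(1)]] by (intro bexI[of _ "r \<odot>\<^bsub>Hom C A A\<^esub> Ident C A"]) simp_all
  have "(r \<odot>\<^bsub>Hom C B B\<^esub> Ident C B) \<bullet>\<^bsub>C\<^esub> f = r \<odot>\<^bsub>Hom C A B\<^esub> f"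
    using comp_smult[OF O(1) O(2) O(2) r f ident_mor[OF O(2)]] comp_ident[OF O f] by simp
  then show "\<exists>b\<in>mor C B B. r \<odot>\<^bsub>Hom C A B\<^esub> f = b \<bullet>\<^bsub>C\<^esub> f"
    using VB.smult_closed[OF r ident_mor[OF O(2)]] by (intro bexI[of _ "r \<odot>\<^bsub>Hom C B B\<^esub> Ident C B"]) simp_all
qed

lemma cluster_settingI:
  assumes "krull_schmidt_category C" "enough_projectives C" "enough_injectives C" "cluster_tilting_object C T"
  shows "cluster_setting C T"
proof (intro cluster_setting.intro cluster_setting_axioms.intro)
  show "extriangulated_category C" by unfold_locales
  show "krull_schmidt_category C" "enough_projectives C" "enough_injectives C" "cluster_tilting_object C T" by (fact assms)+
  show "orth B A" if "orth A B" "A \<in> Obj C" "B \<in> Obj C" for A B by (rule ext_symmetric[OF that])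
  fix A B assume O: "A \<in> Obj C" "B \<in> Obj C"
  obtain F where F: "finite F" "F \<subseteq> mor C A B" and G0: "\<forall>U. U \<subseteq> mor C A B \<and> F \<subseteq> U \<and> null A B \<in> U \<and>
    (\<forall>f\<in>U. \<forall>g\<in>U. f \<boxplus> g \<in> U) \<and> (\<forall>f\<in>U. \<forall>r\<in>carrier K. r \<odot>\<^bsub>Hom C A B\<^esub> f \<in> U) \<longrightarrow> mor C A B \<subseteq> U"
    using hom_finitely_generated[OF O] by (elim exE conjE) (rule that)
  have G: "mor C A B \<subseteq> U" if "U \<subseteq> mor C A B" "F \<subseteq> U" "null A B \<in> U" "\<forall>f\<in>U. \<forall>g\<in>U. f \<boxplus> g \<in> U"
      "\<forall>f\<in>U. \<forall>r\<in>carrier K. r \<odot>\<^bsub>Hom C A B\<^esub> f \<in> U" for U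
    by (rule G0[rule_format]) (intro conjI that)
  show "\<exists>F. finite F \<and> F \<subseteq> mor C A B \<and> (\<forall>U. U \<subseteq> mor C A B \<and> F \<subseteq> U \<and> null A B \<in> U \<and>
    (\<forall>f\<in>U. \<forall>g\<in>U. f \<boxplus> g \<in> U) \<and> (\<forall>f\<in>U. \<forall>a\<in>mor C A A. f \<bullet>\<^bsub>C\<^esub> a \<in> U) \<longrightarrow> mor C A B \<subseteq> U)"
  proof (intro exI[of _ F] conjI F allI impI, elim conjE)
    fix U assume U: "U \<subseteq> mor C A B" "F \<subseteq> U" "null A B \<in> U" "\<forall>f\<in>U. \<forall>g\<in>U. f \<boxplus> g \<in> U" "\<forall>f\<in>U. \<forall>a\<in>mor C A A. f \<bullet>\<^bsub>C\<^esub> a \<in> U"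
    show "mor C A B \<subseteq> U"
    proof (rule G[OF U(1-4)], intro ballI)
      fix f r assume f: "f \<in> U" and r: "r \<in> carrier K"
      obtain a where "a \<in> mor C A A" "r \<odot>\<^bsub>Hom C A B\<^esub> f = f \<bullet>\<^bsub>C\<^esub> a" using smult_factors(1)[OF O subsetD[OF U(1) f] r] by blast
      then show "r \<odot>\<^bsub>Hom C A B\<^esub> f \<in> U" using U(5) f by simp
    qed
  qed
  show "\<exists>F. finite F \<and> F \<subseteq> mor C A B \<and> (\<forall>U. U \<subseteq> mor C A B \<and> F \<subseteq> U \<and> null A B \<in> U \<and>
    (\<forall>f\<in>U. \<forall>g\<in>U. f \<boxplus> g \<in> U) \<and> (\<forall>f\<in>U. \<forall>b\<in>mor C B B. b \<bullet>\<^bsub>C\<^esub> f \<in> U) \<longrightarrow> mor C A B \<subseteq> U)"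
  proof (intro exI[of _ F] conjI F allI impI, elim conjE)
    fix U assume U: "U \<subseteq> mor C A B" "F \<subseteq> U" "null A B \<in> U" "\<forall>f\<in>U. \<forall>g\<in>U. f \<boxplus> g \<in> U" "\<forall>f\<in>U. \<forall>b\<in>mor C B B. b \<bullet>\<^bsub>C\<^esub> f \<in> U"
    show "mor C A B \<subseteq> U"
    proof (rule G[OF U(1-4)], intro ballI)
      fix f r assume f: "f \<in> U" and r: "r \<in> carrier K"
      obtain b where "b \<in> mor C B B" "r \<odot>\<^bsub>Hom C A B\<^esub> f = b \<bullet>\<^bsub>C\<^esub> f" using smult_factors(2)[OF O subsetD[OF U(1) f] r] by blast
      then show "r \<odot>\<^bsub>Hom C A B\<^esub> f \<in> U" using U(5) f by simp
    qed
  qed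
qed

end


section \<open>Decompositions of the quotient and cotorsion pairs\<close>

context rigid_setting
begin

lemma cotorsion_pair_with_core_iff: "cotorsion_pair_with_core C I X Y \<longleftrightarrow> splitting X Y"
proof -
  have r: "rigid_setting C T I" by unfold_locales
  have "cotorsion_pair_with_core C I X Y \<longleftrightarrow> cotorsion_core C T I X Y"
    unfolding cotorsion_pair_with_core_def cotorsion_pair_def ext_vanish_orth conflation_def[symmetric]
      cotorsion_core_def cotorsion_core_axioms_def
    using r by blast
  then show ?thesis using splitting_cotorsion_core cotorsion_core_splitting by blast
qed

lemma stable_admissible: "stable U \<Longrightarrow> subcategory C U" "stable U \<Longrightarrow> I \<subseteq> U" "stable U \<Longrightarrow> U \<subseteq> Perp" "stable U \<Longrightarrow> admissible U"
  unfolding stable_def admissible_def by blast+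

lemma stable_syz: "\<lbrakk>stable U; syz A B\<rbrakk> \<Longrightarrow> A \<in> U \<longleftrightarrow> B \<in> U"
  unfolding stable_def by blast

lemma add_hull_opp: "preadditive_category.add_hull (opp C) S = add_hull S"
proof -
  interpret o: rigid_setting "opp C" T I by (rule rigid_setting_opp)
  show ?thesis unfolding add_hull_def o.add_hull_def by simp
qed

lemma admissible_opp: "rigid_setting.admissible (opp C) I U \<longleftrightarrow> admissible U"
proof -
  interpret o: rigid_setting "opp C" T I by (rule rigid_setting_opp)
  show ?thesis unfolding admissible_def o.admissible_def Perp_opp by simp
qed

lemma stable_opp: "rigid_setting.stable (opp C) I U \<longleftrightarrow> stable U"
proof -
  interpret o: rigid_setting "opp C" T I by (rule rigid_setting_opp)
  show ?thesis unfolding stable_def o.stable_def admissible_opp syz_opp by blast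
qed

lemma stable_Int:
  assumes "stable U" "stable V" shows "stable (U \<inter> V)"
proof -
  note U = stable_admissible[OF assms(1)] and V = stable_admissible[OF assms(2)]
  have "subcategory C (U \<inter> V)"
  proof (rule subcategoryI)
    show "U \<inter> V \<subseteq> Obj C" using U(3) Perp_obj by blast
    show "X \<in> U \<inter> V" if "retract X S" "S \<in> U \<inter> V" for X S
      using subcategory_retract[OF U(1) _ that(1)] subcategory_retract[OF V(1) _ that(1)] that(2) by blast
    show "Z \<in> U \<inter> V" if "is_zero_object C Z" for Z
      using subcategory_zero[OF U(1) that] subcategory_zero[OF V(1) that] by blast
    show "S \<in> U \<inter> V" if "A \<in> U \<inter> V" "B \<in> U \<inter> V" "is_direct_sum C [A, B] S" for A B S
      using subcategory_sum2[OF U(1) _ _ that(3)] subcategory_sum2[OF V(1) _ _ that(3)] that(1,2) by blast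
  qed
  then show ?thesis
    unfolding stable_def admissible_def using U(2,3) V(2) stable_syz[OF assms(1)] stable_syz[OF assms(2)] by blast
qed

text \<open>The counterpart in \<open>C\<close> of the sum of the \<open>A j\<close> in the
  quotient. \<open>I\<close> is added because it is the zero subcategory there, which matters when
  \<open>L\<close> is empty.\<close>

definition part :: "('j \<Rightarrow> 'o set) \<Rightarrow> 'j set \<Rightarrow> 'o set" where
  "part A L = add_hull (\<Union>(A ` L) \<union> I)"

lemma part_generators_Perp: "\<forall>j\<in>L. stable (A j) \<Longrightarrow> \<Union>(A ` L) \<union> I \<subseteq> Perp"
  using stable_admissible(3) I_Perp by blast

lemma part_admissible:
  assumes "\<forall>j\<in>L. stable (A j)"
  shows "admissible (part A L)" "\<Union>(A ` L) \<union> I \<subseteq> part A L"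
proof -
  have P: "\<Union>(A ` L) \<union> I \<subseteq> Perp" by (rule part_generators_Perp[OF assms])
  then have O: "\<Union>(A ` L) \<union> I \<subseteq> Obj C" using Perp_obj by blast
  show i: "\<Union>(A ` L) \<union> I \<subseteq> part A L" unfolding part_def by (rule hull_incl[OF O])
  have "part A L \<subseteq> Perp" unfolding part_def by (rule hull_least[OF Perp_subcategory P])
  then show "admissible (part A L)" unfolding admissible_def using i hull_subcategory unfolding part_def by blast
qed

lemma part_least:
  assumes "admissible U" "\<And>j. j \<in> L \<Longrightarrow> A j \<subseteq> U" shows "part A L \<subseteq> U"
proof -
  have "subcategory C U" "\<Union>(A ` L) \<union> I \<subseteq> U" using assms unfolding admissible_def by blast+
  then show ?thesis unfolding part_def by (rule hull_least)
qed

text \<open>The cosyzygies of \<open>part A L\<close> again form an admissible set containing every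
  \<open>A j\<close>, hence all of \<open>part A L\<close>; no decomposition of objects is
  needed.\<close>

lemma part_syzygy:
  assumes s: "\<forall>j\<in>L. stable (A j)" and XY: "syz X Y" "Y \<in> part A L" shows "X \<in> part A L"
proof (rule cosyzygies_syz[OF part_admissible(1)[OF s] _ XY(1)])
  have "part A L \<subseteq> cosyzygies (part A L)"
  proof (rule part_least[OF cosyzygies_admissible[OF part_admissible(1)[OF s]]])
    fix j assume j: "j \<in> L"
    show "A j \<subseteq> cosyzygies (part A L)"
    proof
      fix B assume B: "B \<in> A j"
      then obtain M where M: "syz M B" using syzygy_exists stable_admissible(3)[OF bspec[OF s j]] by blast
      have "M \<in> A j" using stable_syz[OF bspec[OF s j] M] B by blast
      then have "M \<in> part A L" using part_admissible(2)[OF s] j by blast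
      then show "B \<in> cosyzygies (part A L)" unfolding cosyzygies_def using M by blast
    qed
  qed
  then show "Y \<in> cosyzygies (part A L)" using XY(2) by blast
qed

lemma part_stable:
  assumes s: "\<forall>j\<in>L. stable (A j)" shows "stable (part A L)"
proof -
  interpret o: rigid_setting "opp C" T I by (rule rigid_setting_opp)
  have p: "o.part A L = part A L" unfolding part_def o.part_def add_hull_opp ..
  have "Y \<in> part A L" if "syz X Y" "X \<in> part A L" for X Y
    using o.part_syzygy[of L A Y X] s that unfolding p stable_opp syz_opp by blast
  then show ?thesis
    unfolding stable_def using part_admissible(1)[OF s] part_syzygy[OF s] by (intro conjI allI impI iffI)
qed

lemma part_local:
  assumes s: "\<forall>j\<in>L. stable (A j)" and M: "local M" "M \<in> part A L"
  shows "M \<in> I \<or> (\<exists>j\<in>L. M \<in> A j)"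
proof -
  have "\<exists>U\<in>insert I (A ` L). M \<in> U"
  proof (rule hull_local_Union[OF M(1) M(2)[unfolded part_def]])
    fix x assume "x \<in> \<Union>(A ` L) \<union> I"
    then show "\<exists>U\<in>insert I (A ` L). subcategory C U \<and> x \<in> U"
      using I_subcategory stable_admissible(1)[OF bspec[OF s]] by auto
  qed
  then show ?thesis by blast
qed

lemma sum_of_subcategories_part:
  assumes s: "\<forall>j\<in>L. stable (A j)" shows "sum_of_subcategories Q L A = part A L"
proof
  note a = part_admissible[OF s]
  show "sum_of_subcategories Q L A \<subseteq> part A L"
  proof
    fix M assume "M \<in> sum_of_subcategories Q L A"
    then obtain Xs where X: "set Xs \<subseteq> (\<Union>j\<in>L. A j)" "is_direct_sum Q Xs M" unfolding sum_of_subcategories_def by blast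
    have "set Xs \<subseteq> part A L" using X(1) a(2) by blast
    then show "M \<in> part A L" by (rule sum_Q_in_admissible[OF a(1) _ X(2)])
  qed
  show "part A L \<subseteq> sum_of_subcategories Q L A"
  proof
    fix M assume M: "M \<in> part A L"
    have MP: "M \<in> Perp" and sub: "subcategory C (part A L)" using a(1) M unfolding admissible_def by blast+
    obtain Ms where Ms: "is_direct_sum C Ms M" "\<And>N. N \<in> set Ms \<Longrightarrow> local N" using local_decomposition[OF Perp_obj[OF MP]] by blast
    have l: "N \<in> I \<or> (\<exists>j\<in>L. N \<in> A j)" if "N \<in> set Ms" for N
      using part_local[OF s Ms(2)[OF that]] subcategory_summands[OF sub M Ms(1)] that by blast
    have "\<exists>Xs. set Xs \<subseteq> (\<Union>j\<in>L. A j) \<and> is_direct_sum Q Xs M"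
    \<comment> \<open>For empty \<open>L\<close> there is no \<open>A j\<close> to hold the summands
      from \<open>I\<close>, so \<open>M\<close> is presented as an empty sum, a zero object of the
      quotient.\<close>
    proof (cases "L = {}")
      case True
      then have "set Ms \<subseteq> I" using l by blast
      then have "M \<in> I" by (rule subcategory_sum[OF I_subcategory _ Ms(1)])
      then show ?thesis using direct_sum_Nil_Q by (intro exI[of _ "[]"]) simp
    next
      case False
      then have "set Ms \<subseteq> (\<Union>j\<in>L. A j)" using l stable_admissible(2)[OF bspec[OF s]] by blast
      then show ?thesis using direct_sum_Q[OF Ms(1) MP] by blast
    qed
    then show "M \<in> sum_of_subcategories Q L A" unfolding sum_of_subcategories_def Q_simps(1) using MP by blast
  qed
qed

lemma splittingD:
  assumes "splitting X Y"
  shows "stable X" "stable Y" "X \<inter> Y = I" "\<And>A B. A \<in> X \<Longrightarrow> B \<in> Y \<Longrightarrow> orth A B"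
    "\<And>M. local M \<Longrightarrow> M \<in> Perp \<Longrightarrow> M \<in> X \<or> M \<in> Y" "extension_closed X"
proof -
  show "stable X" "stable Y" "X \<inter> Y = I" "\<And>A B. A \<in> X \<Longrightarrow> B \<in> Y \<Longrightarrow> orth A B"
    "\<And>M. local M \<Longrightarrow> M \<in> Perp \<Longrightarrow> M \<in> X \<or> M \<in> Y"
    using assms unfolding splitting_def stable_def by blast+
  show "extension_closed X" by (rule cotorsion_core.X_extension[OF splitting_cotorsion_core[OF assms]])
qed

lemma nonzero_full_sub:
  assumes "W \<subseteq> Perp" shows "nonzero_category (full_sub Q W) \<longleftrightarrow> \<not> W \<subseteq> I"
proof -
  have "is_zero_object (full_sub Q W) M \<longleftrightarrow> M \<in> I" if "M \<in> W" for M
    using zero_object_Q[of M] that assms unfolding is_zero_object_def by (auto simp: Q_simps(1))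
  then show ?thesis unfolding nonzero_category_def by auto
qed

lemma triangulated_full_sub:
  assumes U: "stable U" and X: "stable X" "extension_closed X"
  shows "triangulated_subcategory (full_sub Q U) (U \<inter> X)"
proof -
  have W: "stable (U \<inter> X)" by (rule stable_Int[OF U X(1)])
  note WW = stable_admissible[OF W] and UP = stable_admissible(3)[OF U]
  have sQ: "subcategory Q (U \<inter> X)" using subcategory_Q WW(4) by blast
  have "subcategory (full_sub Q U) (U \<inter> X)"
    unfolding subcategory_def is_direct_sum_full_sub[OF UP]
  proof (intro conjI allI impI)
    show "U \<inter> X \<subseteq> Obj (full_sub Q U)" by simp
  next
    fix M N f assume a: "M \<in> U \<inter> X \<and> N \<in> Obj (full_sub Q U) \<and> is_iso (full_sub Q U) M N f"
    then have "is_iso Q M N f" unfolding is_iso_def by simp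
    then show "N \<in> U \<inter> X" using iso_Q[of M N f, OF _ _ _ WW(4)] a UP by auto
  next
    fix Xs S assume "set Xs \<subseteq> U \<inter> X \<and> set Xs \<subseteq> U \<and> S \<in> U \<and> is_direct_sum Q Xs S"
    then show "S \<in> U \<inter> X" using sum_Q_in_admissible[OF WW(4)] by blast
  next
    fix M N S assume "S \<in> U \<inter> X \<and> set [M, N] \<subseteq> U \<and> S \<in> U \<and> is_direct_sum Q [M, N] S"
    then have "S \<in> U \<inter> X" "is_direct_sum Q [M, N] S" by blast+
    then show "M \<in> U \<inter> X" using sQ unfolding subcategory_def by blast
  qed
  moreover have "Shift (full_sub Q U) M \<in> U \<inter> X \<longleftrightarrow> M \<in> U \<inter> X" if "M \<in> Obj (full_sub Q U)" for M
  proof -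
    have "M \<in> Perp" using that UP by auto
    then show ?thesis using stable_syz[OF W syz_shift] by (simp add: Q_simps(7))
  qed
  moreover have "(M \<in> U \<inter> X \<and> N \<in> U \<inter> X \<longrightarrow> L \<in> U \<inter> X) \<and> (N \<in> U \<inter> X \<and> L \<in> U \<inter> X \<longrightarrow> M \<in> U \<inter> X) \<and>
      (M \<in> U \<inter> X \<and> L \<in> U \<inter> X \<longrightarrow> N \<in> U \<inter> X)"
    if "M \<in> Obj (full_sub Q U)" "N \<in> Obj (full_sub Q U)" "L \<in> Obj (full_sub Q U)"
      "(M, N, L, u, v, w) \<in> Triangles (full_sub Q U)" for M N L u v w
  proof -
    have t: "(M, N, L, u, v, w) \<in> quot_triangles C I" using that(4) by (simp add: Q_simps(8))
    have "M \<in> U" "N \<in> U" "L \<in> U" using that(1-3) by simp_all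
    then show ?thesis using stable_triangle[OF X t] by blast
  qed
  ultimately show ?thesis unfolding triangulated_subcategory_def by blast
qed

text \<open>The intersections of \<open>U\<close> with \<open>X\<close> and \<open>Y\<close>
  decompose \<open>U\<close>, since maps vanish modulo \<open>I\<close> in both directions. By
  indecomposability one intersection lies in \<open>I\<close>, and then all local objects of
  \<open>U\<close> lie in the other half.\<close>

lemma indecomposable_splitting:
  assumes U: "stable U" and ind: "indecomposable_triangulated (full_sub Q U)" and s: "splitting X Y"
  shows "U \<subseteq> X \<or> U \<subseteq> Y"
proof -
  note XX = splittingD[OF s] and YY = splittingD[OF splitting_sym[OF s]]
  note UU = stable_admissible[OF U]
  interpret c: cotorsion_core C T I X Y by (rule splitting_cotorsion_core[OF s])
  define D where "D b = (if b then U \<inter> X else U \<inter> Y)" for b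
  have DU: "D b \<subseteq> U" for b unfolding D_def by auto
  have "decomposition (full_sub Q U) UNIV D"
    unfolding decomposition_def
  proof (intro conjI ballI impI)
    show "triangulated_subcategory (full_sub Q U) (D b)" for b
      unfolding D_def using triangulated_full_sub[OF U XX(1,6)] triangulated_full_sub[OF U YY(1,6)] by simp
  next
    fix a b M N assume ab: "a \<noteq> b" "M \<in> D a" "N \<in> D b"
    have "no_maps M N"
      using ab c.no_maps_X_Y c.no_maps_Y_X unfolding D_def by (cases a; cases b) auto
    moreover have "M \<in> Perp" "N \<in> Perp" using ab(2,3) DU UU(3) by blast+
    ultimately have "mor Q M N = {\<zero>\<^bsub>Hom Q M N\<^esub>}" using mor_Q_zero by blast
    then show "mor (full_sub Q U) M N = {\<zero>\<^bsub>Hom (full_sub Q U) M N\<^esub>}" by simp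
  next
    have "\<exists>Xs. set Xs \<subseteq> (\<Union>b. D b) \<and> is_direct_sum (full_sub Q U) Xs M" if M: "M \<in> U" for M
    proof -
      have MP: "M \<in> Perp" using M UU(3) by blast
      obtain Ms where Ms: "is_direct_sum C Ms M" "\<And>N. N \<in> set Ms \<Longrightarrow> local N" using local_decomposition[OF Perp_obj[OF MP]] by blast
      have MU: "set Ms \<subseteq> U" by (rule subcategory_summands[OF UU(1) M Ms(1)])
      have "N \<in> D True \<or> N \<in> D False" if "N \<in> set Ms" for N
        using XX(5)[OF Ms(2)[OF that]] MU UU(3) that unfolding D_def by auto
      then have "set Ms \<subseteq> (\<Union>b. D b)" by blast
      then show ?thesis using direct_sum_Q[OF Ms(1) MP] MU M unfolding is_direct_sum_full_sub[OF UU(3)] by blast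
    qed
    then show "sum_of_subcategories (full_sub Q U) UNIV D = Obj (full_sub Q U)"
      unfolding sum_of_subcategories_def by auto
  qed
  then obtain b where b: "\<not> nonzero_category (full_sub (full_sub Q U) (D b))"
    using ind unfolding indecomposable_triangulated_def by blast
  have e: "full_sub (full_sub Q U) (D b) = full_sub Q (D b)" by simp
  have DP: "D b \<subseteq> Perp" using DU UU(3) by blast
  have DI: "D b \<subseteq> I" using b unfolding e nonzero_full_sub[OF DP] by blast
  \<comment> \<open>The value \<open>True\<close> stands for the intersection with \<open>X\<close>;
    if that one is contained in \<open>I\<close>, then \<open>U\<close> is contained in
    \<open>Y\<close>, and vice versa.\<close>
  have "U \<subseteq> (if b then Y else X)"
  proof
    fix M assume M: "M \<in> U"
    have sub: "subcategory C (if b then Y else X)" using c.X_subcategory c.Y_subcategory by simp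
    show "M \<in> (if b then Y else X)"
    proof (rule subcategory_if_locals[OF sub])
      show "M \<in> Obj C" using M UU(3) Perp_obj by blast
      fix L assume L: "local L" "retract L M"
      have LU: "L \<in> U" by (rule subcategory_retract[OF UU(1) M L(2)])
      then have "L \<in> X \<or> L \<in> Y" using XX(5)[OF L(1)] UU(3) by blast
      then show "L \<in> (if b then Y else X)" using DI LU c.I_X c.I_Y unfolding D_def by (cases b) auto
    qed
  qed
  then show ?thesis by (cases b) simp_all
qed

end

text \<open>What a complete decomposition says after translation to \<open>C\<close>: the quotient
  and its triangles no longer occur, and indecomposability survives as its effect on
  splittings.\<close>

locale stable_family = rigid_setting C T I
  for C :: "('o, 'm, 'k, 'e) extri" (structure) and T :: 'o and I :: "'o set" +
  fixes J :: "'j set" and A :: "'j \<Rightarrow> 'o set"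
  assumes stable_A: "j \<in> J \<Longrightarrow> stable (A j)"
    and no_maps_A: "\<lbrakk>i \<in> J; j \<in> J; i \<noteq> j; X \<in> A i; Y \<in> A j\<rbrakk> \<Longrightarrow> no_maps X Y"
    and part_J: "part A J = Perp"
    and A_nonzero: "j \<in> J \<Longrightarrow> \<not> A j \<subseteq> I"
    and A_indecomposable: "\<lbrakk>splitting U V; j \<in> J\<rbrakk> \<Longrightarrow> A j \<subseteq> U \<or> A j \<subseteq> V"
begin

lemma stable_sub: "L \<subseteq> J \<Longrightarrow> \<forall>j\<in>L. stable (A j)" using stable_A by blast

lemma A_part: assumes "L \<subseteq> J" "j \<in> L" shows "A j \<subseteq> part A L"
  using part_admissible(2)[OF stable_sub[OF assms(1)]] assms(2) by blast

lemma part_mono: assumes "L \<subseteq> L'" "L' \<subseteq> J" shows "part A L \<subseteq> part A L'"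
  by (rule part_least[OF part_admissible(1)[OF stable_sub[OF assms(2)]]]) (use A_part assms in blast)

text \<open>For \<open>B\<close> in \<open>A k\<close> with \<open>k \<noteq> i\<close> the cosyzygy
  of \<open>B\<close> stays in \<open>A k\<close>, so the absence of maps from \<open>A i\<close> to
  it is Ext-vanishing from \<open>A i\<close> to \<open>B\<close>. The two hulls are then treated
  one after the other.\<close>

lemma orth_parts:
  assumes L: "L \<subseteq> J" and XY: "X \<in> part A L" "Y \<in> part A (J - L)" shows "orth X Y"
proof -
  have st: "\<forall>j\<in>J - L. stable (A j)" using stable_A by blast
  have 1: "part A (J - L) \<subseteq> {B \<in> Obj C. \<forall>X\<in>A i. orth X B}" if i: "i \<in> L" for i
    unfolding part_def
  proof (rule hull_least)
    have iJ: "i \<in> J" using i L by blast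
    note P = stable_admissible(3)[OF stable_A[OF iJ]]
    show "subcategory C {B \<in> Obj C. \<forall>X\<in>A i. orth X B}" by (rule orth_right_subcategory) (use P Perp_obj in blast)
    show "\<Union>(A ` (J - L)) \<union> I \<subseteq> {B \<in> Obj C. \<forall>X\<in>A i. orth X B}"
    proof
      fix B assume B: "B \<in> \<Union>(A ` (J - L)) \<union> I"
      have BP: "B \<in> Perp" using B part_generators_Perp[OF st] by blast
      have "orth X B" if X: "X \<in> A i" for X
      proof (cases "B \<in> I")
        case True
        then show ?thesis using Perp_orth(1) P X by blast
      next
        case False
        then obtain k where k: "k \<in> J" "k \<noteq> i" "B \<in> A k" using B i by blast
        obtain B' where B': "syz B B'" using cosyzygy_exists[OF BP] by blast
        have "B' \<in> A k" using stable_syz[OF stable_A[OF k(1)] B'] k(3) by blast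
        then have "no_maps X B'" using no_maps_A[OF iJ k(1) _ X] k(2) by blast
        then show ?thesis using orth_iff_no_maps[OF B'] P X by blast
      qed
      then show "B \<in> {B \<in> Obj C. \<forall>X\<in>A i. orth X B}" using Perp_obj[OF BP] by blast
    qed
  qed
  have JP: "part A (J - L) \<subseteq> Perp" by (rule stable_admissible(3)[OF part_stable[OF st]])
  have "part A L \<subseteq> {M \<in> Obj C. \<forall>B\<in>part A (J - L). orth M B}"
    unfolding part_def[of A L]
  proof (rule hull_least)
    show "subcategory C {M \<in> Obj C. \<forall>B\<in>part A (J - L). orth M B}" by (rule orth_left_subcategory) (use JP Perp_obj in blast)
    show "\<Union>(A ` L) \<union> I \<subseteq> {M \<in> Obj C. \<forall>B\<in>part A (J - L). orth M B}"
    proof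
      fix M assume M: "M \<in> \<Union>(A ` L) \<union> I"
      have MO: "M \<in> Obj C" using M part_generators_Perp[OF stable_sub[OF L]] Perp_obj by blast
      have "orth M B" if B: "B \<in> part A (J - L)" for B
        using M 1 B Perp_orth(2)[OF subsetD[OF JP B]] by blast
      then show "M \<in> {M \<in> Obj C. \<forall>B\<in>part A (J - L). orth M B}" using MO by blast
    qed
  qed
  then show ?thesis using XY by blast
qed

lemma splitting_part: assumes L: "L \<subseteq> J" shows "splitting (part A L) (part A (J - L))"
proof -
  have s1: "stable (part A L)" by (rule part_stable[OF stable_sub[OF L]])
  have s2: "stable (part A (J - L))" by (rule part_stable) (use stable_A in blast)
  have int: "part A L \<inter> part A (J - L) \<subseteq> I"
  proof
    fix M assume M: "M \<in> part A L \<inter> part A (J - L)"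
    \<comment> \<open>An object of both parts is orthogonal to its own cosyzygy, so
      \<open>M -> N -> B\<close> splits.\<close>
    obtain B where B: "syz M B" using cosyzygy_exists stable_admissible(3)[OF s1] M by blast
    obtain N where N: "N \<in> I" "conflation M N B" using B by (rule syzE)
    have "B \<in> part A L" using stable_syz[OF s1 B] M by blast
    then have "orth B M" using orth_parts[OF L] M by blast
    from subcategory_summand(1)[OF I_subcategory N(1) orth_split[OF N(2) this]] show "M \<in> I" .
  qed
  have loc: "M \<in> part A L \<or> M \<in> part A (J - L)" if M: "local M" "M \<in> Perp" for M
  proof -
    have "M \<in> I \<or> (\<exists>j\<in>J. M \<in> A j)" using part_local[OF stable_sub[OF subset_refl] M(1)] M(2) part_J by blast
    then show ?thesis
    proof
      assume "M \<in> I"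
      then show ?thesis using stable_admissible(2)[OF s1] by blast
    next
      assume "\<exists>j\<in>J. M \<in> A j"
      then obtain j where j: "j \<in> J" "M \<in> A j" by blast
      show ?thesis using A_part[OF L, of j] A_part[of "J - L" j] j by blast
    qed
  qed
  have "part A L \<inter> part A (J - L) = I" using int stable_admissible(2)[OF s1] stable_admissible(2)[OF s2] by blast
  moreover have "\<forall>X\<in>part A L. \<forall>Y\<in>part A (J - L). orth X Y" using orth_parts[OF L] by blast
  moreover have "\<forall>M. local M \<and> M \<in> Perp \<longrightarrow> M \<in> part A L \<or> M \<in> part A (J - L)" using loc by blast
  moreover have "\<forall>X Y. syz X Y \<longrightarrow> (X \<in> part A L \<longleftrightarrow> Y \<in> part A L) \<and> (X \<in> part A (J - L) \<longleftrightarrow> Y \<in> part A (J - L))"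
    using stable_syz[OF s1] stable_syz[OF s2] by blast
  ultimately show ?thesis unfolding splitting_def using stable_admissible(4)[OF s1] stable_admissible(4)[OF s2] by simp
qed

text \<open>If \<open>j\<close> is in \<open>L\<close> but not in \<open>L'\<close>, equality of the
  parts would put \<open>A j\<close> into both halves of the splitting given by \<open>L'\<close>,
  hence into \<open>I\<close>.\<close>

lemma part_inj: "inj_on (part A) (Pow J)"
proof -
  have "L \<subseteq> L'" if L: "L \<subseteq> J" and L': "L' \<subseteq> J" and e: "part A L = part A L'" for L L'
  proof
    fix j assume j: "j \<in> L"
    show "j \<in> L'"
    proof (rule ccontr)
      assume n: "j \<notin> L'"
      have "A j \<subseteq> part A L'" using A_part[OF L j] e by simp
      moreover have "A j \<subseteq> part A (J - L')" by (rule A_part) (use j n L in blast)+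
      ultimately have "A j \<subseteq> I" using splittingD(3)[OF splitting_part[OF L']] by blast
      then show False using A_nonzero j L by blast
    qed
  qed
  then show ?thesis unfolding inj_on_def by blast
qed

text \<open>Every \<open>A j\<close> lies in \<open>X\<close> or in \<open>Y\<close>, so the
  splitting given by these \<open>A j\<close> is contained in \<open>(X, Y)\<close> componentwise.
  Nested splittings agree, because local objects are distributed between the halves and the halves
  meet in \<open>I\<close>.\<close>

lemma splitting_is_part:
  assumes s: "splitting X Y"
  shows "X = part A {j \<in> J. A j \<subseteq> X}" "Y = part A (J - {j \<in> J. A j \<subseteq> X})"
proof -
  define L where "L = {j \<in> J. A j \<subseteq> X}"
  have L: "L \<subseteq> J" unfolding L_def by blast
  note XX = splittingD[OF s] and PP = splittingD[OF splitting_part[OF L]]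
  have A_Y: "A j \<subseteq> Y" if "j \<in> J - L" for j using A_indecomposable[OF s, of j] that unfolding L_def by blast
  have le: "part A L \<subseteq> X" "part A (J - L) \<subseteq> Y"
    by (rule part_least[OF stable_admissible(4)[OF XX(1)]], use L_def in blast,
        rule part_least[OF stable_admissible(4)[OF XX(2)] A_Y])
  have ge: "U \<subseteq> V" if st: "stable U" "stable V" "stable V'" and i: "V' \<inter> U \<subseteq> I" "\<And>M. local M \<Longrightarrow> M \<in> Perp \<Longrightarrow> M \<in> V \<or> M \<in> V'" for U V V'
  proof
    note UU = stable_admissible[OF st(1)] and VV = stable_admissible[OF st(2)]
    fix M assume M: "M \<in> U"
    show "M \<in> V"
    proof (rule subcategory_if_locals[OF VV(1)])
      show "M \<in> Obj C" using M UU(3) Perp_obj by blast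
      fix N assume N: "local N" "retract N M"
      have NU: "N \<in> U" by (rule subcategory_retract[OF UU(1) M N(2)])
      then show "N \<in> V" using i(2)[OF N(1)] i(1) UU(3) VV(2) by blast
    qed
  qed
  have "X \<subseteq> part A L" by (rule ge[OF XX(1) PP(1,2) _ PP(5)]) (use le(2) XX(3) in blast)
  moreover have "Y \<subseteq> part A (J - L)"
    by (rule ge[OF XX(2) PP(2,1)]) (use le(1) XX(3) PP(5) in blast)+
  ultimately show "X = part A {j \<in> J. A j \<subseteq> X}" "Y = part A (J - {j \<in> J. A j \<subseteq> X})" using le unfolding L_def by blast+
qed

lemma splittings: "{(X, Y). splitting X Y} = (\<lambda>L. (part A L, part A (J - L))) ` Pow J"
proof (intro equalityI subsetI)
  fix p assume "p \<in> {(X, Y). splitting X Y}"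
  then obtain X Y where p: "p = (X, Y)" "splitting X Y" by blast
  show "p \<in> (\<lambda>L. (part A L, part A (J - L))) ` Pow J"
    by (rule image_eqI[of _ _ "{j \<in> J. A j \<subseteq> X}"]) (use p(1) splitting_is_part[OF p(2)] in auto)
qed (use splitting_part in auto)

text \<open>\<open>part A {j}\<close> is one half of a splitting, thus of a cotorsion pair with core
  \<open>I\<close>, and \<open>rigid_outside_I\<close> applies to it.\<close>

lemma rigid_in_part: assumes j: "j \<in> J" shows "\<exists>P\<in>part A {j}. P \<notin> I \<and> orth P P"
proof -
  have L: "{j} \<subseteq> J" using j by blast
  obtain M where M: "M \<in> A j" "M \<notin> I" using A_nonzero[OF j] by blast
  have "M \<in> part A {j}" using A_part[OF L] M(1) by blast
  then show ?thesis by (rule cotorsion_core.rigid_outside_I[OF splitting_cotorsion_core[OF splitting_part[OF L]] _ M(2)])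
qed

lemma finite_J: "finite J"
proof (rule ccontr)
  assume inf: "infinite J"
  obtain n where n: "\<And>B Ms. B \<subseteq> Obj C \<Longrightarrow> rigid_list Ms \<Longrightarrow> chain B Ms \<Longrightarrow> length Ms \<le> n" using chain_bounded by blast
  obtain S where S: "finite S" "card S = Suc n" "S \<subseteq> J" using infinite_arbitrarily_large[OF inf] by blast
  obtain js where js: "set js = S" "distinct js" using finite_distinct_list[OF S(1)] by blast
  have len: "length js = Suc n" using distinct_card[OF js(2)] js(1) S(2) by simp
  obtain p where p: "\<And>j. j \<in> J \<Longrightarrow> p j \<in> part A {j}" "\<And>j. j \<in> J \<Longrightarrow> p j \<notin> I" "\<And>j. j \<in> J \<Longrightarrow> orth (p j) (p j)"
    using bchoice[of J "\<lambda>j P. P \<in> part A {j} \<and> P \<notin> I \<and> orth P P"] rigid_in_part by blast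
  have other: "p j \<in> part A (J - {i})" if "j \<in> J" "j \<noteq> i" for i j
    using part_mono[of "{j}" "J - {i}"] p(1)[OF that(1)] that by blast
  have pO: "p j \<in> Obj C" if "j \<in> J" for j
  proof -
    have "stable (part A {j})" by (rule part_stable) (use stable_A that in blast)
    then show ?thesis using stable_admissible(3) p(1)[OF that] Perp_obj by blast
  qed
  have "orth (p i) (p j)" if "i \<in> J" "j \<in> J" for i j
  proof (cases "i = j")
    case True
    then show ?thesis using p(3) that by simp
  next
    case False
    have "{i} \<subseteq> J" using that by blast
    then show ?thesis using orth_parts[OF _ p(1)[OF that(1)] other[OF that(2)]] False by blast
  qed
  then have "rigid_list (map p js)" unfolding rigid_list_def using pO js(1) S(3) by auto
  moreover have "chain I (map p js)"
    unfolding chain_def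
  proof (intro allI impI)
    fix k assume "k < length (map p js)"
    then have k: "k < length js" by simp
    define j where "j = js ! k"
    have j: "j \<in> J" unfolding j_def using nth_mem[OF k] js(1) S(3) by blast
    \<comment> \<open>All predecessors of \<open>p j\<close> and \<open>I\<close> lie in the
      complementary part, which meets \<open>part A {j}\<close> only in \<open>I\<close>; so
      \<open>p j\<close> is new and the \<open>p j\<close> form a chain.\<close>
    have st: "stable (part A (J - {j}))" by (rule part_stable) (use stable_A in blast)
    have "i \<in> J \<and> i \<noteq> j" if i: "i \<in> set (take k js)" for i
    proof -
      obtain m where m: "m < k" "js ! m = i" using i k by (auto simp: in_set_conv_nth)
      have "js ! m \<noteq> js ! k" using nth_eq_iff_index_eq[OF js(2), of m k] m(1) k by simp
      moreover have "i \<in> set js" by (rule in_set_takeD[OF i])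
      ultimately show ?thesis using m(2) js(1) S(3) unfolding j_def by blast
    qed
    then have "set (take k (map p js)) \<subseteq> part A (J - {j})" using other by (auto simp: take_map)
    then have "set (take k (map p js)) \<union> I \<subseteq> part A (J - {j})" using stable_admissible(2)[OF st] by blast
    then have h: "add_hull (set (take k (map p js)) \<union> I) \<subseteq> part A (J - {j})" by (rule hull_least[OF stable_admissible(1)[OF st]])
    have "{j} \<subseteq> J" using j by blast
    note i = splittingD(3)[OF splitting_part[OF this]]
    have "p j \<notin> part A (J - {j})" using p(1,2)[OF j] i by blast
    then have "p j \<notin> add_hull (set (take k (map p js)) \<union> I)" using h by blast
    then show "map p js ! k \<notin> add_hull (set (take k (map p js)) \<union> I)" using k unfolding j_def by simp
  qed
  moreover have "I \<subseteq> Obj C" using I_obj by blast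
  ultimately have "length (map p js) \<le> n" using n by blast
  then show False using len by simp
qed

end

lemma (in rigid_setting) stable_familyI:
  assumes "complete_decomposition (perp_quot_tri C I) J A" shows "stable_family C T I J A"
proof (intro stable_family.intro stable_family_axioms.intro)
  show "rigid_setting C T I" by unfold_locales
  have d: "\<And>j. j \<in> J \<Longrightarrow> triangulated_subcategory Q (A j)"
    "\<And>i j X Y. i \<in> J \<Longrightarrow> j \<in> J \<Longrightarrow> i \<noteq> j \<Longrightarrow> X \<in> A i \<Longrightarrow> Y \<in> A j \<Longrightarrow> mor Q X Y = {\<zero>\<^bsub>Hom Q X Y\<^esub>}"
    "sum_of_subcategories Q J A = Obj Q"
    "\<And>j. j \<in> J \<Longrightarrow> indecomposable_triangulated (full_sub Q (A j))"
    using assms unfolding complete_decomposition_def decomposition_def by simp_all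
  show st: "stable (A j)" if "j \<in> J" for j by (rule stable_if_triangulated[OF d(1)[OF that]])
  show "no_maps X Y" if "i \<in> J" "j \<in> J" "i \<noteq> j" "X \<in> A i" "Y \<in> A j" for i j X Y
    using d(2)[OF that] mor_Q_zero stable_admissible(3)[OF st[OF that(1)]] stable_admissible(3)[OF st[OF that(2)]] that(4,5) by blast
  show "part A J = Perp" using d(3) sum_of_subcategories_part[of J A] st unfolding Q_simps(1) by simp
  show "\<not> A j \<subseteq> I" if "j \<in> J" for j
    using d(4)[OF that] nonzero_full_sub[OF stable_admissible(3)[OF st[OF that]]] unfolding indecomposable_triangulated_def by blast
  show "A j \<subseteq> X \<or> A j \<subseteq> Y" if "splitting X Y" "j \<in> J" for X Y j
    by (rule indecomposable_splitting[OF st[OF that(2)] d(4)[OF that(2)] that(1)])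
qed

theorem theorem4p3:
  fixes K :: "'k ring"
    and C :: "('o, 'm, 'k, 'e) extri"
    and T :: 'o
    and I :: "'o set"
    and J :: "'j set"
    and A :: "'j \<Rightarrow> 'o set"
  assumes "krull_schmidt_category C"
    and "extriangulated_category C"
    and "two_calabi_yau K C"
    and "enough_projectives C"
    and "enough_injectives C"
    and "cluster_tilting_object C T"
    and "rigid_subcategory C I"
    and "{P. projective C P} \<subseteq> I"
    and "complete_decomposition (perp_quot_tri C I) J A"
  shows "{(X, Y). cotorsion_pair_with_core C I X Y} =
           (\<lambda>L. (quot_preimage C I (sum_of_subcategories (perp_quot_tri C I) L A),
                 quot_preimage C I (sum_of_subcategories (perp_quot_tri C I) (J - L) A))) ` Pow J
       \<and> finite J
       \<and> card {(X, Y). cotorsion_pair_with_core C I X Y} = 2 ^ card J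
       \<and> (\<forall>X Y. cotorsion_pair_with_core C I X Y \<longleftrightarrow> cotorsion_pair_with_core C I Y X)"
proof -
  interpret cy: two_calabi_yau K C by (rule assms(3))
  interpret s: cluster_setting C T by (rule cy.cluster_settingI[OF assms(1,4-6)])
  interpret rigid_setting C T I
  proof (intro rigid_setting.intro rigid_setting_axioms.intro)
    show "cluster_setting C T" by (rule s.cluster_setting_axioms)
    show "subcategory C I" using assms(7) unfolding rigid_subcategory_def by blast
    show "cy.orth M N" if "M \<in> I" "N \<in> I" for M N
      using assms(7) that unfolding rigid_subcategory_def cy.ext_vanish_orth by blast
    show "P \<in> I" if "projective C P" for P using assms(8) that by blast
  qed
  interpret f: stable_family C T I J A by (rule stable_familyI[OF assms(9)])
  have q: "quot_preimage C I (sum_of_subcategories (perp_quot_tri C I) L A) = part A L" if "L \<subseteq> J" for L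
  proof -
    have "stable (part A L)" by (rule part_stable[OF f.stable_sub[OF that]])
    then show ?thesis
      unfolding quot_preimage_def left_perp_Perp sum_of_subcategories_part[OF f.stable_sub[OF that]]
      using stable_admissible(3) by blast
  qed
  have q2: "(quot_preimage C I (sum_of_subcategories (perp_quot_tri C I) L A),
      quot_preimage C I (sum_of_subcategories (perp_quot_tri C I) (J - L) A)) = (part A L, part A (J - L))" if "L \<in> Pow J" for L
    using q[of L] q[of "J - L"] that by simp
  have e: "{(X, Y). cotorsion_pair_with_core C I X Y} = (\<lambda>L. (part A L, part A (J - L))) ` Pow J"
    unfolding cotorsion_pair_with_core_iff by (rule f.splittings)
  have "inj_on (\<lambda>L. (part A L, part A (J - L))) (Pow J)" using f.part_inj unfolding inj_on_def by simp
  then have "card {(X, Y). cotorsion_pair_with_core C I X Y} = card (Pow J)" unfolding e by (rule card_image)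
  moreover have "(\<lambda>L. (part A L, part A (J - L))) ` Pow J =
           (\<lambda>L. (quot_preimage C I (sum_of_subcategories (perp_quot_tri C I) L A),
                 quot_preimage C I (sum_of_subcategories (perp_quot_tri C I) (J - L) A))) ` Pow J"
    by (rule image_cong[OF refl q2[symmetric]])
  ultimately show ?thesis
    using e f.finite_J card_Pow[OF f.finite_J] cotorsion_pair_with_core_iff splitting_sym by auto
qed

end
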